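(* Let $\Omega\subset\mathbb{R}^3$ be a bounded open set with smooth boundary, and assume $H=H(\kappa)$ satisfies $\frac{\ln\kappa}{\kappa}\ll H\ll\kappa$ as $\kappa\to\infty$. Then the ground state energy satisfies $$C_0(\kappa,H)\le|\Omega|\,\kappa H\ln\sqrt{\frac{\kappa}{H}}\,\big(1+o(1)\big)\quad\text{as }\kappa\to\infty.$$ Furthermore, there exists $\kappa_0$ such that if $\kappa\ge\kappa_0$ and $(\psi,\mathbf A)$ is a minimizer of $\mathcal E^{3D}_{\kappa,H}$, then $$\|\operatorname{curl}(\mathbf A-\mathbf F)\|_{L^2(\mathbb{R}^3)}\le\frac{2|\Omega|}{\sqrt{\kappa H}}\sqrt{\ln\sqrt{\frac{\kappa}{H}}}.$$
   Context: Notation: $a(\kappa)\ll b(\kappa)$ means $a(\kappa)/b(\kappa)\to0$ as $\kappa\to\infty$. Let $\beta=(0,0,1)$, $\mathbf F(x)=(-x_2/2,x_1/2,0)$. Let $\dot H^1(\mathbb{R}^3)$ be the closure of $C_c^\infty(\mathbb{R}^3)$ under $u\mapsto\|\nabla u\|_{L^2(\mathbb{R}^3)}$ and $\dot H^1_{\mathrm{div},\mathbf F}(\mathbb{R}^3)=\{\mathbf A:\ \operatorname{div}\mathbf A=0,\ \mathbf A-\mathbf F\in\dot H^1(\mathbb{R}^3)\}$. For $\kappa,H>0$, $\psi\in H^1(\Omega;\mathbb{C})$, $\mathbf A\in\dot H^1_{\mathrm{div},\mathbf F}(\mathbb{R}^3)$, $$\mathcal E^{3D}_{\kappa,H}(\psi,\mathbf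 A)=\int_\Omega\Big(|(\nabla-i\kappa H\mathbf A)\psi|^2+\frac{\kappa^2}{2}(1-|\psi|^2)^2\Big)dx+\kappa^2H^2\int_{\mathbb{R}^3}|\operatorname{curl}\mathbf A-\beta|^2dx,$$ $C_0(\kappa,H)$ is its infimum over $H^1(\Omega;\mathbb{C})\times\dot H^1_{\mathrm{div},\mathbf F}(\mathbb{R}^3)$, and a minimizer is a pair attaining this infimum. *)

theory Defs
  imports "HOL-Analysis.Analysis" "HOL-Library.Landau_Symbols"
begin

type_synonym R3 = "real^3"

definition partial :: "3 \<Rightarrow> (R3 \<Rightarrow> real) \<Rightarrow> R3 \<Rightarrow> real" where
  "partial j f x = frechet_derivative f (at x) (axis j 1)"

fun Ck_on :: "nat \<Rightarrow> R3 set \<Rightarrow> (R3 \<Rightarrow> real) \<Rightarrow> bool" where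
  "Ck_on 0 U f = continuous_on U f"
| "Ck_on (Suc n) U f = ((\<forall>x\<in>U. f differentiable (at x)) \<and> continuous_on U f
                        \<and> (\<forall>j. Ck_on n U (partial j f)))"

definition smooth_on :: "R3 set \<Rightarrow> (R3 \<Rightarrow> real) \<Rightarrow> bool" where
  "smooth_on U f \<longleftrightarrow> (\<forall>n. Ck_on n U f)"

definition smooth_boundary :: "R3 set \<Rightarrow> bool" where
  "smooth_boundary \<Omega> \<longleftrightarrow>
     (\<forall>p\<in>frontier \<Omega>. \<exists>r>0. \<exists>\<rho>. smooth_on (ball p r) \<rho>
        \<and> (\<forall>x\<in>ball p r. \<exists>j. partial j \<rho> x \<noteq> 0)
        \<and> \<Omega> \<inter> ball p r = {x\<in>ball p r. \<rho> x < 0})"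

definition test_fun :: "R3 set \<Rightarrow> (R3 \<Rightarrow> real) \<Rightarrow> bool" where
  "test_fun U \<phi> \<longleftrightarrow> smooth_on UNIV \<phi> \<and> compact (closure {x. \<phi> x \<noteq> 0})
                     \<and> closure {x. \<phi> x \<noteq> 0} \<subseteq> U"

definition loc_int :: "R3 set \<Rightarrow> (R3 \<Rightarrow> 'a::{banach,second_countable_topology}) \<Rightarrow> bool" where
  "loc_int U u \<longleftrightarrow> (\<forall>K. compact K \<and> K \<subseteq> U \<longrightarrow> set_integrable lborel K u)"

definition weak_partial :: "R3 set \<Rightarrow> 3 \<Rightarrow> (R3 \<Rightarrow> 'a::{banach,second_countable_topology})
      \<Rightarrow> (R3 \<Rightarrow> 'a) \<Rightarrow> bool" where
  "weak_partial U j u g \<longleftrightarrow> loc_int U u \<and> loc_int U g \<and>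
     (\<forall>\<phi>. test_fun U \<phi> \<longrightarrow>
        (LINT x:U|lborel. partial j \<phi> x *\<^sub>R u x) = - (LINT x:U|lborel. \<phi> x *\<^sub>R g x))"

definition wpartial :: "R3 set \<Rightarrow> 3 \<Rightarrow> (R3 \<Rightarrow> 'a::{banach,second_countable_topology})
      \<Rightarrow> R3 \<Rightarrow> 'a" where
  "wpartial U j u = (SOME g. weak_partial U j u g)"

definition L2 :: "R3 set \<Rightarrow> (R3 \<Rightarrow> 'a::{banach,second_countable_topology}) \<Rightarrow> bool" where
  "L2 U f \<longleftrightarrow> set_borel_measurable lborel U f \<and> set_integrable lborel U (\<lambda>x. (norm (f x))\<^sup>2)"

definition H1 :: "R3 set \<Rightarrow> (R3 \<Rightarrow> complex) \<Rightarrow> bool" where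
  "H1 \<Omega> \<psi> \<longleftrightarrow> L2 \<Omega> \<psi> \<and> (\<forall>j. \<exists>g. weak_partial \<Omega> j \<psi> g \<and> L2 \<Omega> g)"

text \<open>Homogeneous Sobolev space: functions with L^2 weak gradient that are limits of
  test functions in the gradient L^2-seminorm (and in L^1_loc, identifying the limit).\<close>
definition Hdot1 :: "(R3 \<Rightarrow> real) \<Rightarrow> bool" where
  "Hdot1 u \<longleftrightarrow> (\<forall>j. \<exists>g. weak_partial UNIV j u g \<and> L2 UNIV g) \<and>
     (\<exists>\<phi>::nat \<Rightarrow> R3 \<Rightarrow> real. (\<forall>n. test_fun UNIV (\<phi> n)) \<and>
        (\<forall>j. (\<lambda>n. LINT x|lborel. (partial j (\<phi> n) x - wpartial UNIV j u x)\<^sup>2) \<longlonglongrightarrow> 0) \<and>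
        (\<forall>r. (\<lambda>n. LINT x:ball 0 r|lborel. \<bar>\<phi> n x - u x\<bar>) \<longlonglongrightarrow> 0))"

definition Fmag :: "R3 \<Rightarrow> R3" where
  "Fmag x = vector [- (x$2) / 2, (x$1) / 2, 0]"

definition beta :: R3 where
  "beta = vector [0, 0, 1]"

definition weak_div_free :: "(R3 \<Rightarrow> R3) \<Rightarrow> bool" where
  "weak_div_free A \<longleftrightarrow> (\<forall>\<phi>. test_fun UNIV \<phi> \<longrightarrow>
      (LINT x|lborel. (\<Sum>j\<in>UNIV. A x $ j * partial j \<phi> x)) = 0)"

definition HdotF :: "(R3 \<Rightarrow> R3) \<Rightarrow> bool" where
  "HdotF A \<longleftrightarrow> weak_div_free A \<and> (\<forall>i. Hdot1 (\<lambda>x. (A x - Fmag x) $ i))"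

definition wcurl :: "(R3 \<Rightarrow> R3) \<Rightarrow> R3 \<Rightarrow> R3" where
  "wcurl A x = (let d = (\<lambda>j i. wpartial UNIV j (\<lambda>y. A y $ i) x) in
     vector [d 2 3 - d 3 2, d 3 1 - d 1 3, d 1 2 - d 2 1])"

definition GL_energy :: "R3 set \<Rightarrow> real \<Rightarrow> real \<Rightarrow> (R3 \<Rightarrow> complex) \<Rightarrow> (R3 \<Rightarrow> R3) \<Rightarrow> ennreal" where
  "GL_energy \<Omega> \<kappa> H \<psi> A =
     (\<integral>\<^sup>+x. indicator \<Omega> x * ennreal
        ((\<Sum>j\<in>UNIV. (cmod (wpartial \<Omega> j \<psi> x - \<i> * complex_of_real (\<kappa> * H * A x $ j) * \<psi> x))\<^sup>2)
         + \<kappa>\<^sup>2 / 2 * (1 - (cmod (\<psi> x))\<^sup>2)\<^sup>2) \<partial>lborel)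
   + ennreal (\<kappa>\<^sup>2 * H\<^sup>2) * (\<integral>\<^sup>+x. ennreal ((norm (wcurl A x - beta))\<^sup>2) \<partial>lborel)"

definition GL_C0 :: "R3 set \<Rightarrow> real \<Rightarrow> real \<Rightarrow> ennreal" where
  "GL_C0 \<Omega> \<kappa> H = (INF p \<in> {(\<psi>, A). H1 \<Omega> \<psi> \<and> HdotF A}. GL_energy \<Omega> \<kappa> H (fst p) (snd p))"

definition GL_minimizer :: "R3 set \<Rightarrow> real \<Rightarrow> real \<Rightarrow> (R3 \<Rightarrow> complex) \<Rightarrow> (R3 \<Rightarrow> R3) \<Rightarrow> bool" where
  "GL_minimizer \<Omega> \<kappa> H \<psi> A \<longleftrightarrow> H1 \<Omega> \<psi> \<and> HdotF A \<and> GL_energy \<Omega> \<kappa> H \<psi> A = GL_C0 \<Omega> \<kappa> H"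

end

(* The trial states are vortex lattices lat(f + alpha, h + beta) with one zero of size
   sqrt (H / kappa) per unit cell of (f, h). Such a function has nearly unit modulus away from its
   zeros and its gradient is that of a phase with connection form 2 pi f dh, up to an error whose
   square has the cell average 2 pi ln (sqrt (kappa / H)) + O(1). Averaging over the translations
   alpha, beta gives a lattice that is as good as this average.

   With 2 pi f dh gauge equivalent to kappa H F this yields the upper bound. For a minimizer (psi, A),
   put a = A - F and let v be a product of three lattices with connection forms close to
   - kappa H a_j dx_j. The configuration (psi v, F), with psi truncated, gauges a away. It saves the
   magnetic energy M = kappa^2 H^2 |curl a|^2. By the upper bound |grad a| = |curl a| is small, so few
   vortices are needed and the lattices cost only o(kappa H ln (sqrt (kappa / H))). Hence M is
   o(kappa H ln (sqrt (kappa / H))) as well, which beats the factor 4 |Omega|^2 even when |Omega| < 1/4. *)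
theory Submission imports Defs
begin

section \<open>Continuity of translations in the mean\<close>

text \<open>A form a_j dx_j need not be exact, so no phase factor removes it; but f dh is, up to the
  factor 2 pi, the connection form of a lattice in the coordinates (f, h). Only the product of the
  coefficients in f = - c \<phi>_j and h = c' x_j is prescribed. If |grad a|^2 integrates to at most
  |\<Omega>| s^2, then c' = s c makes the costs c^2 |grad \<phi>_j|^2 and c'^2 |\<Omega>| both of
  order \<kappa> H s. With L = ln (sqrt (\<kappa> / H)) the upper bound allows s^2 = (L + 110) /
  (\<kappa> H), and the lower bound on H sends s to 0. The nonmagnetic energy E of the minimizer may
  itself be of order \<kappa> H L, so it has to cancel in the comparison. Young's inequality with
  weight \<eta> leaves \<eta> E; the weight \<eta> = |\<Omega>| makes this about |\<Omega>|^2
  \<kappa> H L, safely below 4 |\<Omega>|^2 \<kappa> H L. The truncation stands in for a pointwise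
  bound on the minimizer, whose modulus multiplies every error term of the covariant gradient.
  Difference quotients give the calculus rules at this regularity: the truncation is only C^1 and
  psi only weakly differentiable.\<close>

lemma integrable_shift:
  fixes f :: "'a::euclidean_space \<Rightarrow> 'b::{banach,second_countable_topology}"
  shows "integrable lborel (\<lambda>x. f (x + h)) \<longleftrightarrow> integrable lborel f"
proof -
  have 1: "integrable lborel (\<lambda>x. g (x + k))" if "integrable lborel g" for g :: "'a \<Rightarrow> 'b" and k
  proof -
    have "integrable (distr lborel borel ((+) k)) g"
      using that by (simp add: lborel_distr_plus)
    then show ?thesis
      by (subst (asm) integrable_distr_eq) (use that in \<open>auto simp: add.commute\<close>)
  qed
  from 1[of f h] 1[of "\<lambda>x. f (x + h)" "-h"] show ?thesis by (auto simp: add.assoc)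
qed

lemma integral_shift:
  fixes f :: "'a::euclidean_space \<Rightarrow> 'b::{banach,second_countable_topology}"
  shows "(LINT x|lborel. f (x + h)) = (LINT x|lborel. f x)"
proof (cases "integrable lborel f")
  case True
  have "(LINT x|lborel. f x) = (LINT x|distr lborel borel ((+) h). f x)"
    by (simp add: lborel_distr_plus)
  also have "\<dots> = (LINT x|lborel. f (x + h))"
    by (subst integral_distr) (use True in \<open>auto simp: add.commute\<close>)
  finally show ?thesis ..
next
  case False
  then show ?thesis using integrable_shift[of f h] by (simp add: not_integrable_integral_eq)
qed

lemma nn_integral_shift:
  fixes f :: "'a::euclidean_space \<Rightarrow> ennreal"
  assumes [measurable]: "f \<in> borel_measurable borel"
  shows "(\<integral>\<^sup>+x. f (x + h) \<partial>lborel) = (\<integral>\<^sup>+x. f x \<partial>lborel)"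
proof -
  have "(\<integral>\<^sup>+x. f x \<partial>lborel) = (\<integral>\<^sup>+x. f x \<partial>distr lborel borel ((+) h))"
    by (simp add: lborel_distr_plus)
  also have "\<dots> = (\<integral>\<^sup>+x. f (x + h) \<partial>lborel)"
    by (subst nn_integral_distr) (auto simp: add.commute)
  finally show ?thesis ..
qed

text \<open>Sandwich A between a compact K and an open W with W - K of small measure. For h so short
  that translates of K stay in W, membership in A can differ between x and x + h only if one of
  these points lies in W - K.\<close>

lemma L1_translation_continuous_indicator:
  fixes A :: "'a::euclidean_space set"
  assumes A: "A \<in> sets lborel" "emeasure lborel A < \<infinity>" and e: "e > 0"
  shows "\<exists>d>0. \<forall>h. norm h < d \<longrightarrow> (LINT x|lborel. \<bar>indicator A (x + h) - indicator A x :: real\<bar>) < e"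
proof -
  have lA: "A \<in> lmeasurable"
    using A by (auto simp: fmeasurable_def)
  obtain W where W: "open W" "A \<subseteq> W" "W - A \<in> lmeasurable" "emeasure lebesgue (W - A) < ennreal (e/4)"
    using sets_lebesgue_outer_open[of A "e/4"] lA e by (auto simp: fmeasurableD)
  have W4: "measure lebesgue (W - A) < e/4"
    using W e by (simp add: emeasure_eq_measure2 ennreal_less_iff)
  \<comment> \<open>Inner regularity is available for finite measures, so it is applied to Lebesgue
    measure restricted to A.\<close>
  define N where "N = density lborel (indicator A :: 'a \<Rightarrow> ennreal)"
  have Ab [measurable]: "A \<in> sets borel" using A by simp
  have N: "emeasure N B = emeasure lborel (A \<inter> B)" if "B \<in> sets borel" for B
    using that unfolding N_def by (subst emeasure_density) (auto simp: indicator_inter_arith[symmetric])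
  have sN: "sets N = sets borel" "space N = UNIV" by (auto simp: N_def)
  have fN: "emeasure N (space N) \<noteq> \<infinity>" using N[of UNIV] A by (simp add: sN)
  have NA: "emeasure N A = (SUP K \<in> {K. K \<subseteq> A \<and> compact K}. emeasure N K)"
    by (rule inner_regular[OF sN(1) fN Ab])
  have "\<exists>K\<in>{K. K \<subseteq> A \<and> compact K}. (SUP K \<in> {K. K \<subseteq> A \<and> compact K}. emeasure N K) < emeasure N K + ennreal (e/4)"
  proof (rule SUP_approx_ennreal)
    show "(SUP K \<in> {K. K \<subseteq> A \<and> compact K}. emeasure N K) \<noteq> \<infinity>"
      unfolding NA[symmetric] using N[of A] A by simp
  qed (use e in auto)
  then obtain K where K: "K \<subseteq> A" "compact K" and K1: "emeasure N A < emeasure N K + ennreal (e/4)"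
    using NA by auto
  have Kb [measurable]: "K \<in> sets borel" using K by (auto intro: borel_compact)
  have Kl: "K \<in> lmeasurable" using K by (auto intro: lmeasurable_compact)
  have "emeasure lborel A < emeasure lborel K + ennreal (e/4)"
    using K1 N[of A] N[of K] K(1) by (simp add: Int_absorb1)
  then have "emeasure lebesgue A < emeasure lebesgue K + ennreal (e/4)"
    by simp
  then have mAK: "measure lebesgue A < measure lebesgue K + e/4"
    using lA Kl e by (simp add: emeasure_eq_measure2 ennreal_plus[symmetric] ennreal_less_iff del: ennreal_plus)
  have K4: "A - K \<in> lmeasurable" "measure lebesgue (A - K) < e/4"
    using mAK lA Kl K(1) by (auto simp: measurable_measure_Diff fmeasurableD)
  define D where "D = W - K"
  have Dm: "D \<in> sets borel" unfolding D_def using W K by (auto intro: borel_open borel_compact)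
  have "D = (W - A) \<union> (A - K)" using W K by (auto simp: D_def)
  then have Dl: "D \<in> lmeasurable" "measure lebesgue D < e/2"
    using W W4 K4 measure_Un_le[of "W - A" lebesgue "A - K"] by (auto simp: fmeasurableD)
  have Di: "integrable lborel (indicator D :: 'a \<Rightarrow> real)"
    using Dl Dm by (simp add: integrable_indicator_iff fmeasurable_def)
  have Dv: "(LINT x|lborel. indicator D x) < e/2"
    using Dl Dm by simp
  obtain d where d: "d > 0" "(\<Union>x\<in>K. ball x d) \<subseteq> W"
    using compact_subset_open_imp_ball_epsilon_subset[OF K(2) W(1)] K(1) W(2) by blast
  show ?thesis
  proof (intro exI[of _ d] conjI allI impI)
    fix h :: 'a assume h: "norm h < d"
    have pt: "\<bar>indicator A (x + h) - indicator A x :: real\<bar> \<le> indicator D (x + h) + indicator D x" for x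
    proof -
      have "x \<in> W" if "x + h \<in> K"
        by (rule subsetD[OF d(2)], rule UN_I[OF that]) (use h in \<open>simp add: dist_norm\<close>)
      moreover have "x + h \<in> W" if "x \<in> K"
        by (rule subsetD[OF d(2)], rule UN_I[OF that]) (use h in \<open>simp add: dist_norm\<close>)
      ultimately show ?thesis using W K unfolding D_def by (auto split: split_indicator)
    qed
    have "(LINT x|lborel. \<bar>indicator A (x + h) - indicator A x :: real\<bar>)
        \<le> (LINT x|lborel. indicator D (x + h) + (indicator D x::real))"
    proof (rule integral_mono)
      show "integrable lborel (\<lambda>x. indicator D (x + h) + (indicator D x::real))"
        using Di integrable_shift[of "indicator D :: _ \<Rightarrow> real" h] by auto
      have "integrable lborel (indicator A :: 'a \<Rightarrow> real)" using A by (simp add: integrable_indicator_iff)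
      then show "integrable lborel (\<lambda>x. \<bar>indicator A (x + h) - indicator A x :: real\<bar>)"
        using integrable_shift[of "indicator A :: _ \<Rightarrow> real" h] by auto
    qed (rule pt)
    also have "\<dots> = 2 * (LINT x|lborel. indicator D x)"
      using Di integrable_shift[of "indicator D :: _ \<Rightarrow> real" h] integral_shift[of "indicator D :: _ \<Rightarrow> real" h] by simp
    also have "\<dots> < e" using Dv by simp
    finally show "(LINT x|lborel. \<bar>indicator A (x + h) - indicator A x :: real\<bar>) < e" .
  qed (use d in auto)
qed

text \<open>Simple functions reduce to indicators. In the limit step translation preserves the L1
  norm, so the approximation error counts twice and a three-epsilon argument finishes.\<close>

lemma L1_translation_continuous:
  fixes f :: "'a::euclidean_space \<Rightarrow> 'b::{banach,second_countable_topology}"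
  assumes "integrable lborel f" "e > 0"
  shows "\<exists>d>0. \<forall>h. norm h < d \<longrightarrow> (LINT x|lborel. norm (f (x + h) - f x)) < e"
  using assms
proof (induction f arbitrary: e rule: integrable_induct)
  case (base A c)
  obtain d where d: "d > 0" "\<And>h. norm h < d \<Longrightarrow> 
      (LINT x|lborel. \<bar>indicator A (x + h) - indicator A x :: real\<bar>) < e / (norm c + 1)"
    using L1_translation_continuous_indicator[OF base(1), of "e / (norm c + 1)"] base
    by (auto simp: add_nonneg_pos)
  show ?case
  proof (intro exI[of _ d] conjI allI impI)
    fix h :: 'a assume "norm h < d"
    have "(LINT x|lborel. norm (indicator A (x + h) *\<^sub>R c - indicator A x *\<^sub>R c))
       = (LINT x|lborel. \<bar>indicator A (x + h) - indicator A x :: real\<bar> * norm c)"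
      by (simp add: scaleR_diff_left[symmetric])
    also have "\<dots> = (LINT x|lborel. \<bar>indicator A (x + h) - indicator A x :: real\<bar>) * norm c" by simp
    also have "\<dots> \<le> e / (norm c + 1) * norm c"
      using d(2)[OF \<open>norm h < d\<close>] by (intro mult_right_mono) auto
    also have "\<dots> = e * (norm c / (norm c + 1))" by simp
    also have "\<dots> < e * 1" using base(3)
      by (intro mult_strict_left_mono) (auto simp: divide_less_eq_1 add_nonneg_pos)
    also have "\<dots> = e" by simp
    finally have "(LINT x|lborel. norm (indicator A (x + h) *\<^sub>R c - indicator A x *\<^sub>R c)) < e" .
    then show "(LINT x|lborel. norm (indicator A (x + h) *\<^sub>R c - indicator A x *\<^sub>R c)) < e" .
  qed (rule d)
next
  case (add f g)
  obtain d1 where d1: "d1 > 0" "\<And>h. norm h < d1 \<Longrightarrow> (LINT x|lborel. norm (f (x + h) - f x)) < e/2"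
    using add.IH(1)[of "e/2"] add.prems by auto
  obtain d2 where d2: "d2 > 0" "\<And>h. norm h < d2 \<Longrightarrow> (LINT x|lborel. norm (g (x + h) - g x)) < e/2"
    using add.IH(2)[of "e/2"] add.prems by auto
  show ?case
  proof (intro exI[of _ "min d1 d2"] conjI allI impI)
    fix h :: 'a assume h: "norm h < min d1 d2"
    have i: "integrable lborel (\<lambda>x. f (x + h) - f x)" "integrable lborel (\<lambda>x. g (x + h) - g x)"
      using add.hyps integrable_shift[of f h] integrable_shift[of g h] by auto
    have "(LINT x|lborel. norm (f (x + h) + g (x + h) - (f x + g x)))
        \<le> (LINT x|lborel. norm (f (x + h) - f x) + norm (g (x + h) - g x))"
    proof (rule integral_mono)
      show "integrable lborel (\<lambda>x. norm (f (x + h) + g (x + h) - (f x + g x)))"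
        using Bochner_Integration.integrable_add[OF i] by (intro integrable_norm) (simp add: algebra_simps)
    qed (use i in \<open>auto intro: norm_diff_triangle_ineq\<close>)
    also have "\<dots> = (LINT x|lborel. norm (f (x + h) - f x)) + (LINT x|lborel. norm (g (x + h) - g x))"
      using i by (intro Bochner_Integration.integral_add) auto
    also have "\<dots> < e" using d1(2)[of h] d2(2)[of h] h by simp
    finally show "(LINT x|lborel. norm (f (x + h) + g (x + h) - (f x + g x))) < e" .
  qed (use d1 d2 in auto)
next
  case (lim f s)
  have si: "integrable lborel (s i)" for i using lim by auto
  have "(\<lambda>i. LINT x|lborel. norm (s i x - f x)) \<longlonglongrightarrow> (LINT (x::'a)|lborel. norm (0::'b))"
  proof (rule integral_dominated_convergence[where f="\<lambda>x. norm (0::'b)" and w="\<lambda>x. 3 * norm (f x)"])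
    show "AE x in lborel. (\<lambda>i. norm (s i x - f x)) \<longlonglongrightarrow> norm (0::'b)"
      using lim.hyps by (intro AE_I2 tendsto_norm) (simp add: LIM_zero_iff)
    show "AE x in lborel. norm (norm (s i x - f x)) \<le> 3 * norm (f x)" for i
    proof (intro AE_I2)
      fix x :: 'a
      have "norm (s i x - f x) \<le> norm (s i x) + norm (f x)" by (rule norm_triangle_ineq4)
      then show "norm (norm (s i x - f x)) \<le> 3 * norm (f x)" using lim.hyps(3)[of x i] by simp
    qed
  qed (use lim.hyps si in auto)
  then have "\<forall>\<^sub>F i in sequentially. (LINT x|lborel. norm (s i x - f x)) < e/3"
    using lim.prems by (intro order_tendstoD(2)[where y=0]) auto
  then obtain i where i: "(LINT x|lborel. norm (s i x - f x)) < e/3"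
    by (auto simp: eventually_sequentially)
  obtain d where d: "d > 0" "\<And>h. norm h < d \<Longrightarrow> (LINT x|lborel. norm (s i (x + h) - s i x)) < e/3"
    using lim.IH[of "e/3" i] lim.prems by auto
  have fi: "integrable lborel f" using lim by auto
  show ?case
  proof (intro exI[of _ d] conjI allI impI)
    fix h :: 'a assume h: "norm h < d"
    have i1: "integrable lborel (\<lambda>x. norm (s i x - f x))" "integrable lborel (\<lambda>x. norm (s i (x + h) - s i x))"
      "integrable lborel (\<lambda>x. f (x + h) - f x)"
      using fi si integrable_shift[of f h] integrable_shift[of "s i" h] by auto
    have i2: "integrable lborel (\<lambda>x. norm (s i (x + h) - f (x + h)))"
      using integrable_shift[of "\<lambda>x. norm (s i x - f x)" h] i1 by auto
    have pt: "norm (f (x + h) - f x) \<le> norm (s i (x + h) - f (x + h)) + norm (s i (x + h) - s i x) + norm (s i x - f x)" for x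
    proof -
      have "f (x + h) - f x = - (s i (x + h) - f (x + h)) + (s i (x + h) - s i x) + (s i x - f x)" by simp
      then show ?thesis by (metis norm_triangle_le norm_minus_cancel norm_triangle_ineq add_mono order_refl)
    qed
    have "(LINT x|lborel. norm (f (x + h) - f x)) \<le> 
      (LINT x|lborel. norm (s i (x + h) - f (x + h)) + norm (s i (x + h) - s i x) + norm (s i x - f x))"
      by (rule integral_mono) (use i1 i2 pt in auto)
    also have "\<dots> = (LINT x|lborel. norm (s i x - f x)) + (LINT x|lborel. norm (s i (x + h) - s i x)) + (LINT x|lborel. norm (s i x - f x))"
      using i1 i2 integral_shift[of "\<lambda>x. norm (s i x - f x)" h] by simp
    also have "\<dots> < e" using i d(2)[OF h] by simp
    finally show "(LINT x|lborel. norm (f (x + h) - f x)) < e" .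
  qed (rule d)
qed

section \<open>Test functions\<close>

lemma partial_eq: "(f has_derivative f') (at x) \<Longrightarrow> partial j f x = f' (axis j 1)"
  unfolding partial_def using frechet_derivative_at[of f f' x] by simp

lemma Ck_on_antimono: "Ck_on n UNIV f \<Longrightarrow> m \<le> n \<Longrightarrow> Ck_on m UNIV f"
proof (induction n arbitrary: m f)
  case (Suc n)
  then show ?case by (cases m) (auto simp: Ck_on.simps)
qed auto

lemma Ck_on_add:
  "Ck_on n UNIV f \<Longrightarrow> Ck_on n UNIV g \<Longrightarrow> Ck_on n UNIV (\<lambda>x. f x + g x)"
proof (induction n arbitrary: f g)
  case (Suc n)
  then have d: "(f has_derivative frechet_derivative f (at x)) (at x)" "(g has_derivative frechet_derivative g (at x)) (at x)" for x
    using frechet_derivative_works by (metis Ck_on.simps(2) UNIV_I)+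
  have "partial j (\<lambda>x. f x + g x) = (\<lambda>x. partial j f x + partial j g x)" for j
    using partial_eq[OF has_derivative_add[OF d]] by (auto simp: partial_def)
  then show ?case using Suc by (auto intro!: continuous_intros)
qed (auto intro!: continuous_intros)

lemma Ck_on_mult:
  "Ck_on n UNIV f \<Longrightarrow> Ck_on n UNIV g \<Longrightarrow> Ck_on n UNIV (\<lambda>x. f x * g x)"
proof (induction n arbitrary: f g)
  case (Suc n)
  then have d: "(f has_derivative frechet_derivative f (at x)) (at x)" "(g has_derivative frechet_derivative g (at x)) (at x)" for x
    using frechet_derivative_works by (metis Ck_on.simps(2) UNIV_I)+
  have p: "partial j (\<lambda>x. f x * g x) = (\<lambda>x. f x * partial j g x + partial j f x * g x)" for j
    using partial_eq[OF has_derivative_mult[OF d]] by (auto simp: partial_def)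
  \<comment> \<open>The product rule leaves one factor undifferentiated, so the induction hypothesis
    is also applied to f and g at the lower order n.\<close>
  have f: "Ck_on n UNIV f" "Ck_on n UNIV g"
    using Suc.prems Ck_on_antimono[of "Suc n"] by (meson le_SucI order_refl)+
  show ?case unfolding Ck_on.simps(2) p
    using Suc f by (auto intro!: continuous_intros Ck_on_add)
qed (auto intro!: continuous_intros)

lemma Ck_on_const: "Ck_on n UNIV (\<lambda>x. c)"
proof (induction n arbitrary: c)
  case (Suc n)
  have "partial j (\<lambda>x. c) = (\<lambda>x. 0)" for j by (auto simp: partial_def)
  then show ?case using Suc by auto
qed auto

lemma Ck_on_linear: "bounded_linear l \<Longrightarrow> Ck_on n UNIV l"
proof (cases n)
  case (Suc m)
  assume l: "bounded_linear l"
  have "partial j l = (\<lambda>x. l (axis j 1))" for j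
    by (rule ext, rule partial_eq) (use l in \<open>rule bounded_linear_imp_has_derivative\<close>)
  then show ?thesis using l Suc
    by (auto simp: Ck_on_const bounded_linear_imp_differentiable linear_continuous_on)
qed (auto simp: linear_continuous_on)

lemma Ck_on_affine:
  "Ck_on n UNIV f \<Longrightarrow> Ck_on n UNIV (\<lambda>x. f (c + s *\<^sub>R x))"
proof (induction n arbitrary: f)
  case (Suc n)
  have d: "((\<lambda>x. f (c + s *\<^sub>R x)) has_derivative (\<lambda>h. frechet_derivative f (at (c + s *\<^sub>R x)) (s *\<^sub>R h))) (at x)" for x
  proof -
    have "(f has_derivative frechet_derivative f (at (c + s *\<^sub>R x))) (at (c + s *\<^sub>R x))"
      using Suc.prems by (auto simp: frechet_derivative_works)
    then show ?thesis
      by (rule has_derivative_compose[rotated]) (auto intro!: derivative_eq_intros)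
  qed
  have p: "partial j (\<lambda>x. f (c + s *\<^sub>R x)) = (\<lambda>x. s * partial j f (c + s *\<^sub>R x))" for j
  proof
    fix x
    have "bounded_linear (frechet_derivative f (at (c + s *\<^sub>R x)))"
      using Suc.prems by (auto simp: frechet_derivative_works dest: has_derivative_bounded_linear)
    then show "partial j (\<lambda>x. f (c + s *\<^sub>R x)) x = s * partial j f (c + s *\<^sub>R x)"
      using partial_eq[OF d] by (simp add: partial_def linear_simps)
  qed
  show ?case unfolding Ck_on.simps(2) p
  proof (intro conjI ballI allI)
    show "(\<lambda>x. f (c + s *\<^sub>R x)) differentiable at x" for x using d by (auto simp: differentiable_def)
    have "continuous_on UNIV f" using Suc.prems by auto
    then show "continuous_on UNIV (\<lambda>x. f (c + s *\<^sub>R x))"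
      by (rule continuous_on_compose2) (auto intro!: continuous_intros)
    show "Ck_on n UNIV (\<lambda>x. s * partial j f (c + s *\<^sub>R x))" for j
      using Suc by (auto intro!: Ck_on_mult Ck_on_const)
  qed
next
  case 0
  then have "continuous_on UNIV f" by auto
  then have "continuous_on UNIV (\<lambda>x. f (c + s *\<^sub>R x))"
    by (rule continuous_on_compose2) (auto intro!: continuous_intros)
  then show ?case by auto
qed

lemma partial_affine:
  assumes "f differentiable at (c + s *\<^sub>R x)"
  shows "partial j (\<lambda>x. f (c + s *\<^sub>R x)) x = s * partial j f (c + s *\<^sub>R x)"
proof -
  have 1: "(f has_derivative frechet_derivative f (at (c + s *\<^sub>R x))) (at (c + s *\<^sub>R x))"
    using assms by (auto simp: frechet_derivative_works)
  then have "((\<lambda>x. f (c + s *\<^sub>R x)) has_derivative (\<lambda>h. frechet_derivative f (at (c + s *\<^sub>R x)) (s *\<^sub>R h))) (at x)"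
    by (rule has_derivative_compose[rotated]) (auto intro!: derivative_eq_intros)
  from partial_eq[OF this] show ?thesis using has_derivative_bounded_linear[OF 1]
    by (simp add: partial_def linear_simps)
qed

text \<open>The power in the denominator closes the family under differentiation: the derivative of
  index k combines the indices k + 2 and k + 1. Index 0 is the standard flat function exp
  (-1/t).\<close>

definition flat_exp :: "nat \<Rightarrow> real \<Rightarrow> real" where
  "flat_exp k t = (if t > 0 then exp (- (1 / t)) / t ^ k else 0)"

text \<open>A single term of the exponential series at 1/t, that of index k + 2, already outweighs
  t^k with t^2 to spare. The spare square is what yields the derivative 0 at t = 0.\<close>

lemma flat_exp_le: "\<bar>flat_exp k t\<bar> \<le> fact (k + 2) * t\<^sup>2"
proof (cases "t > 0")
  case True
  define F :: real where "F = fact (k + 2)"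
  have F: "F > 0" by (simp add: F_def)
  have "(\<lambda>n. (1/t) ^ n /\<^sub>R fact n) sums exp (1/t)" by (rule exp_converges)
  then have "(1/t) ^ (k + 2) /\<^sub>R fact (k + 2) \<le> exp (1/t)"
    using True sum_le_suminf[of "\<lambda>n. (1/t) ^ n /\<^sub>R fact n" "{k+2}"]
    by (auto simp: sums_iff simp del: fact_Suc power_Suc add_2_eq_Suc')
  then have "1 / (F * t ^ (k + 2)) \<le> exp (1/t)"
    unfolding F_def[symmetric] by (simp only: power_one_over scaleR_conv_of_real) (simp add: field_simps)
  then have "1 \<le> exp (1/t) * (F * t ^ (k+2))"
    using True F by (subst (asm) pos_divide_le_eq) auto
  then have "exp (- (1/t)) * 1 \<le> exp (- (1/t)) * (exp (1/t) * (F * t ^ (k+2)))"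
    by (intro mult_left_mono) auto
  also have "\<dots> = F * t ^ (k+2)" by (simp add: exp_minus)
  finally have "exp (- (1/t)) / t^k \<le> F * t ^ (k + 2) / t ^ k"
    using True by (intro divide_right_mono) auto
  also have "\<dots> = F * t\<^sup>2" using True by (simp add: power_add power2_eq_square)
  finally have "exp (- (1/t)) / t^k \<le> fact (k+2) * t^2" by (simp only: F_def)
  then show ?thesis using True by (simp add: flat_exp_def)
qed (auto simp: flat_exp_def)

lemma flat_exp_has_derivative:
  "(flat_exp k has_real_derivative (flat_exp (k + 2) t - k * flat_exp (k + 1) t)) (at t)"
proof -
  consider "t > 0" | "t < 0" | "t = 0" by linarith
  then show ?thesis
  proof cases
    case 1
    have "((\<lambda>t. exp (- (1 / t)) / t ^ k) has_real_derivative (flat_exp (k + 2) t - k * flat_exp (k + 1) t)) (at t)"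
      using 1 by (auto intro!: derivative_eq_intros simp: flat_exp_def)
        (cases k; simp add: field_simps power2_eq_square)
    then show ?thesis
      by (rule has_field_derivative_transform_within_open[where S="{0<..}"]) (use 1 in \<open>auto simp: flat_exp_def\<close>)
  next
    case 2
    have "((\<lambda>t. 0) has_real_derivative (flat_exp (k + 2) t - k * flat_exp (k + 1) t)) (at t)"
      using 2 by (auto simp: flat_exp_def)
    then show ?thesis
      by (rule has_field_derivative_transform_within_open[where S="{..<0}"]) (use 2 in \<open>auto simp: flat_exp_def\<close>)
  next
    case 3
    have "((\<lambda>h. flat_exp k h / h) \<longlongrightarrow> 0) (at 0)"
    proof (rule Lim_null_comparison)
      show "\<forall>\<^sub>F h in at 0. norm (flat_exp k h / h) \<le> fact (k + 2) * \<bar>h\<bar>"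
      proof (rule always_eventually, rule allI)
        fix h :: real
        show "norm (flat_exp k h / h) \<le> fact (k + 2) * \<bar>h\<bar>"
        proof (cases "h = 0")
          case False
          have "\<bar>flat_exp k h\<bar> / \<bar>h\<bar> \<le> (fact (k + 2) * \<bar>h\<bar>\<^sup>2) / \<bar>h\<bar>"
            using flat_exp_le[of k h] by (intro divide_right_mono) auto
          also have "\<dots> = fact (k + 2) * \<bar>h\<bar>"
            using False by (simp only: power2_eq_square times_divide_eq_right[symmetric]) simp
          finally show ?thesis by simp
        qed auto
      qed
    qed (auto intro!: tendsto_eq_intros)
    then show ?thesis using 3 by (simp add: DERIV_def flat_exp_def)
  qed
qed

text \<open>Differentiation raises the index, so the induction on n must treat all k at
  once.\<close>

lemma Ck_on_flat_exp_comp: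
  assumes w: "\<And>n. Ck_on n UNIV w"
  shows "Ck_on n UNIV (\<lambda>x. flat_exp k (w x))"
proof (induction n arbitrary: k)
  case 0
  have "continuous_on UNIV w" using w[of 0] by auto
  moreover have "continuous_on UNIV (flat_exp k)"
    by (meson DERIV_isCont continuous_at_imp_continuous_on flat_exp_has_derivative)
  ultimately show ?case by (auto intro: continuous_on_compose2)
next
  case (Suc n)
  have dw: "(w has_derivative frechet_derivative w (at x)) (at x)" for x
    using w[of 1] by (auto simp: frechet_derivative_works)
  have d: "((\<lambda>x. flat_exp k (w x)) has_derivative 
      (\<lambda>h. frechet_derivative w (at x) h * (flat_exp (k + 2) (w x) - k * flat_exp (k + 1) (w x)))) (at x)" for x
    using has_derivative_compose[OF dw flat_exp_has_derivative[unfolded has_field_derivative_def]]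
    by (simp add: mult.commute)
  have p: "partial j (\<lambda>x. flat_exp k (w x)) = (\<lambda>x. partial j w x * (flat_exp (k + 2) (w x) + (- real k) * flat_exp (k + 1) (w x)))" for j
    by (rule ext) (subst partial_eq[OF d], simp add: partial_def)
  have "Ck_on n UNIV (partial j w)" for j using w[of "Suc n"] by auto
  then have "Ck_on n UNIV (partial j (\<lambda>x. flat_exp k (w x)))" for j
    unfolding p by (intro Ck_on_mult Ck_on_add Ck_on_const Suc)
  moreover have "(\<lambda>x. flat_exp k (w x)) differentiable at x" for x using d by (auto simp: differentiable_def)
  ultimately show ?case
    by (auto intro!: continuous_at_imp_continuous_on differentiable_imp_continuous_within)
qed

lemma test_funI:
  assumes "smooth_on UNIV \<phi>" "compact K" "K \<subseteq> U" "\<And>x. x \<notin> K \<Longrightarrow> \<phi> x = 0"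
  shows "test_fun U \<phi>"
proof -
  have "closure {x. \<phi> x \<noteq> 0} \<subseteq> K"
    using assms by (intro closure_minimal) (auto intro: compact_imp_closed)
  moreover from this have "compact (closure {x. \<phi> x \<noteq> 0})"
    using assms(2) by (metis closed_closure compact_Int_closed inf.absorb2)
  ultimately show ?thesis using assms unfolding test_fun_def by auto
qed

lemma test_fun_support:
  assumes "test_fun U \<phi>"
  obtains K where "compact K" "K \<subseteq> U" "\<And>x. x \<notin> K \<Longrightarrow> \<phi> x = 0"
proof (rule that)
  show "\<phi> x = 0" if "x \<notin> closure {x. \<phi> x \<noteq> 0}" for x
    using that closure_subset[of "{x. \<phi> x \<noteq> 0}"] by auto
qed (use assms in \<open>auto simp: test_fun_def\<close>)

lemma test_fun_mono: "test_fun U \<phi> \<Longrightarrow> U \<subseteq> W \<Longrightarrow> test_fun W \<phi>"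
  unfolding test_fun_def by (meson order_trans)

lemma smooth_on_affine: "smooth_on UNIV \<phi> \<Longrightarrow> smooth_on UNIV (\<lambda>x. \<phi> (c + s *\<^sub>R x))"
  unfolding smooth_on_def by (intro allI Ck_on_affine) simp

text \<open>The function exp (-1/w) with w = (r/2)^2 - |x|^2 vanishes outside the ball of radius
  r/2, which leaves room for a compact support inside \<open>ball 0 r\<close>. It is then divided by
  its integral.\<close>

lemma bump_exists:
  assumes "r > 0"
  obtains \<rho> where "test_fun (ball 0 r) \<rho>" "\<And>x. \<rho> x \<ge> 0" "integrable lborel \<rho>" "(LINT x|lborel. \<rho> x) = 1"
proof -
  define w :: "R3 \<Rightarrow> real" where "w x = r\<^sup>2/4 - (norm x)\<^sup>2" for x
  define \<rho> where "\<rho> x = flat_exp 0 (w x)" for x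
  have weq: "w = (\<lambda>x. r\<^sup>2/4 + (-1) * ((x$1) * (x$1) + ((x$2)*(x$2) + (x$3)*(x$3))))"
    by (rule ext) (simp add: w_def power2_norm_eq_inner inner_vec_def sum_3)
  have Cw: "Ck_on n UNIV w" for n
    unfolding weq by (intro Ck_on_add Ck_on_mult Ck_on_const Ck_on_linear bounded_linear_vec_nth)
  have sm: "smooth_on UNIV \<rho>"
    unfolding smooth_on_def \<rho>_def using Ck_on_flat_exp_comp[OF Cw] by auto
  have z: "\<rho> x = 0" if "x \<notin> cball 0 (r/2)" for x
  proof -
    have "(r/2)\<^sup>2 \<le> (norm x)\<^sup>2" using that assms by (intro power_mono) auto
    then show ?thesis by (simp add: \<rho>_def flat_exp_def w_def power_divide)
  qed
  have nn: "\<rho> x \<ge> 0" for x by (simp add: \<rho>_def flat_exp_def)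
  have cont: "continuous_on UNIV \<rho>" using sm unfolding smooth_on_def by (metis Ck_on.simps(1))
  have "set_integrable lborel (cball 0 (r/2)) \<rho>"
    unfolding set_integrable_def by (rule borel_integrable_compact) (auto intro: continuous_on_subset[OF cont])
  moreover have "(\<lambda>x. indicator (cball 0 (r/2)) x *\<^sub>R \<rho> x) = \<rho>"
    by (intro ext) (use z in \<open>auto simp: indicator_def\<close>)
  ultimately have int: "integrable lborel \<rho>" unfolding set_integrable_def by (simp only:)
  \<comment> \<open>The value on the sphere |x| = r/4, hence a lower bound on the ball of radius
    r/4; it shows that the integral is positive.\<close>
  define e where "e = flat_exp 0 (r\<^sup>2/4 - r\<^sup>2/16)"
  have e: "e > 0" using assms by (simp add: e_def flat_exp_def field_simps)
  have "e * measure lborel (ball (0::R3) (r/4)) = (LINT x|lborel. e * indicator (ball (0::R3) (r/4)) x)"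
    by simp
  also have "\<dots> \<le> (LINT x|lborel. \<rho> x)"
  proof (rule integral_mono[OF _ int])
    show "integrable lborel (\<lambda>x. e * indicator (ball (0::R3) (r/4)) x)"
      by (intro integrable_mult_right integrable_real_indicator emeasure_lborel_ball_finite) auto
    fix x :: R3
    show "e * indicator (ball 0 (r/4)) x \<le> \<rho> x"
    proof (cases "x \<in> ball 0 (r/4)")
      case True
      then have "(norm x)\<^sup>2 \<le> (r/4)\<^sup>2" by (intro power_mono) auto
      then have 1: "w x \<ge> r\<^sup>2/4 - r\<^sup>2/16" by (simp add: w_def power_divide)
      have 2: "r\<^sup>2/4 - r\<^sup>2/16 > 0" using assms by (simp add: field_simps)
      have wp: "w x > 0" using 1 2 by linarith
      have "- (1/(r\<^sup>2/4 - r\<^sup>2/16)) \<le> - (1 / w x)"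
        using 1 2 wp by (intro le_imp_neg_le divide_left_mono mult_pos_pos) linarith+
      then show ?thesis using True 2 wp by (simp add: e_def \<rho>_def flat_exp_def del: minus_divide_left)
    qed (use nn in auto)
  qed
  finally have "(LINT x|lborel. \<rho> x) > 0"
    using e content_ball_pos[of "r/4" "0::R3"] assms by (smt (verit) mult_pos_pos measure_completion borel_open divide_pos_pos open_ball sets_lborel)
  define I where "I = (LINT x|lborel. \<rho> x)"
  show ?thesis
  proof
    have "smooth_on UNIV (\<lambda>x. (1/I) * \<rho> x)"
      using sm unfolding smooth_on_def by (auto intro!: Ck_on_mult Ck_on_const simp del: times_divide_eq_left)
    then show "test_fun (ball 0 r) (\<lambda>x. (1/I) * \<rho> x)"
      by (rule test_funI[where K="cball 0 (r/2)"]) (use z assms in auto)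
    show "(LINT x|lborel. (1/I) * \<rho> x) = 1"
      using \<open>(LINT x|lborel. \<rho> x) > 0\<close> by (simp add: I_def)
    show "integrable lborel (\<lambda>x. (1/I) * \<rho> x)" using int by auto
    show "(1/I) * \<rho> x \<ge> 0" for x using \<open>(LINT x|lborel. \<rho> x) > 0\<close> nn by (simp add: I_def)
  qed
qed

lemma test_fun_continuous: "test_fun U \<phi> \<Longrightarrow> continuous_on UNIV \<phi>"
  unfolding test_fun_def smooth_on_def by (metis Ck_on.simps(1))

lemma test_fun_differentiable: "test_fun U \<phi> \<Longrightarrow> \<phi> differentiable at x"
  unfolding test_fun_def smooth_on_def by (metis Ck_on.simps(2) UNIV_I)

lemma test_fun_partial_continuous: "test_fun U \<phi> \<Longrightarrow> continuous_on UNIV (partial j \<phi>)"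
  unfolding test_fun_def smooth_on_def by (metis Ck_on.simps)

lemma test_fun_partial_zero:
  assumes "compact K" "\<And>x. x \<notin> K \<Longrightarrow> \<phi> x = 0" "x \<notin> K"
  shows "partial j \<phi> x = 0"
proof -
  have "((\<lambda>x. 0) has_derivative (\<lambda>h. 0)) (at x)" by auto
  then have "(\<phi> has_derivative (\<lambda>h. 0)) (at x)"
    by (rule has_derivative_transform_within_open[where s="-K"])
      (use assms in \<open>auto simp: compact_imp_closed open_Compl\<close>)
  from partial_eq[OF this] show ?thesis .
qed

lemma test_fun_bounded_partial:
  assumes "test_fun U \<phi>"
  obtains B where "\<And>x. \<bar>partial j \<phi> x\<bar> \<le> B" "B \<ge> 0"
proof -
  obtain K where K: "compact K" "\<And>x. x \<notin> K \<Longrightarrow> \<phi> x = 0" using test_fun_support[OF assms] by metis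
  have "compact (partial j \<phi> ` K)"
    using test_fun_partial_continuous[OF assms] K by (intro compact_continuous_image) (auto intro: continuous_on_subset)
  from compact_imp_bounded[OF this] obtain B where B: "\<And>x. x \<in> K \<Longrightarrow> \<bar>partial j \<phi> x\<bar> \<le> B"
    unfolding bounded_iff by auto
  show ?thesis
  proof (rule that[of "max B 0"])
    show "\<bar>partial j \<phi> x\<bar> \<le> max B 0" for x
      using B[of x] test_fun_partial_zero[OF K] by (cases "x \<in> K") auto
  qed auto
qed

lemma test_fun_bounded:
  assumes "test_fun U \<phi>"
  obtains B where "\<And>x. \<bar>\<phi> x\<bar> \<le> B" "B \<ge> 0"
proof -
  obtain K where K: "compact K" "\<And>x. x \<notin> K \<Longrightarrow> \<phi> x = 0" using test_fun_support[OF assms] by metis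
  have "compact (\<phi> ` K)"
    using test_fun_continuous[OF assms] K by (intro compact_continuous_image) (auto intro: continuous_on_subset)
  from compact_imp_bounded[OF this] obtain B where B: "\<And>x. x \<in> K \<Longrightarrow> \<bar>\<phi> x\<bar> \<le> B"
    unfolding bounded_iff by auto
  show ?thesis
  proof (rule that[of "max B 0"])
    show "\<bar>\<phi> x\<bar> \<le> max B 0" for x using B[of x] K(2)[of x] by (cases "x \<in> K") auto
  qed auto
qed

lemma test_fun_zero: "test_fun U (\<lambda>x. 0)"
  by (rule test_funI[where K="{}"]) (auto simp: smooth_on_def Ck_on_const)

section \<open>The fundamental lemma of the calculus of variations\<close>

lemma set_lint_eq_lint:
  assumes "\<And>x. x \<notin> U \<Longrightarrow> c x = 0"
  shows "(LINT x:U|lborel. c x *\<^sub>R u x) = (LINT x|lborel. c x *\<^sub>R u x)"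
proof -
  have "(\<lambda>x. indicator U x *\<^sub>R c x *\<^sub>R u x) = (\<lambda>x. c x *\<^sub>R u x)"
    by (intro ext) (use assms in \<open>auto simp: indicator_def\<close>)
  then show ?thesis unfolding set_lebesgue_integral_def by simp
qed

lemma integrable_mult_bounded:
  fixes f :: "'a::euclidean_space \<Rightarrow> 'b::{banach,second_countable_topology}"
  assumes "integrable lborel f" "c \<in> borel_measurable borel" "\<And>x. \<bar>c x\<bar> \<le> B"
  shows "integrable lborel (\<lambda>x. c x *\<^sub>R f x)"
proof (rule Bochner_Integration.integrable_bound[where f="\<lambda>x. B * norm (f x)"])
  show "AE x in lborel. norm (c x *\<^sub>R f x) \<le> norm (B * norm (f x))"
  proof (intro AE_I2)
    fix x
    have "\<bar>c x\<bar> * norm (f x) \<le> B * norm (f x)" using assms(3)[of x] by (intro mult_right_mono) auto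
    then show "norm (c x *\<^sub>R f x) \<le> norm (B * norm (f x))" by simp
  qed
qed (use assms in auto)

lemma loc_int_mult_integrable:
  fixes u :: "R3 \<Rightarrow> 'b::{banach,second_countable_topology}"
  assumes "loc_int U u" "compact K" "K \<subseteq> U" "c \<in> borel_measurable borel" "\<And>x. \<bar>c x\<bar> \<le> B" "\<And>x. x \<notin> K \<Longrightarrow> c x = 0"
  shows "integrable lborel (\<lambda>x. c x *\<^sub>R u x)"
proof -
  have "integrable lborel (\<lambda>x. indicator K x *\<^sub>R u x)"
    using assms(1-3) unfolding loc_int_def set_integrable_def by blast
  then have "integrable lborel (\<lambda>x. c x *\<^sub>R (indicator K x *\<^sub>R u x))"
    by (rule integrable_mult_bounded[OF _ assms(4,5)])
  moreover have "(\<lambda>x. c x *\<^sub>R (indicator K x *\<^sub>R u x)) = (\<lambda>x. c x *\<^sub>R u x)"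
    by (intro ext) (use assms in \<open>auto simp: indicator_def\<close>)
  ultimately show ?thesis by simp
qed

lemma test_fun_mult_integrable:
  fixes u :: "R3 \<Rightarrow> 'b::{banach,second_countable_topology}"
  assumes "loc_int U u" "test_fun U \<phi>"
  shows "integrable lborel (\<lambda>x. \<phi> x *\<^sub>R u x)" "integrable lborel (\<lambda>x. partial j \<phi> x *\<^sub>R u x)"
proof -
  obtain K where K: "compact K" "K \<subseteq> U" "\<And>x. x \<notin> K \<Longrightarrow> \<phi> x = 0" using test_fun_support[OF assms(2)] by metis
  obtain B where B: "\<And>x. \<bar>\<phi> x\<bar> \<le> B" using test_fun_bounded[OF assms(2)] by metis
  obtain B' where B': "\<And>x. \<bar>partial j \<phi> x\<bar> \<le> B'" using test_fun_bounded_partial[OF assms(2)] by metis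
  show "integrable lborel (\<lambda>x. \<phi> x *\<^sub>R u x)"
    using assms K B test_fun_continuous by (intro loc_int_mult_integrable[where K=K and U=U and B=B]) (auto intro: borel_measurable_continuous_onI)
  show "integrable lborel (\<lambda>x. partial j \<phi> x *\<^sub>R u x)"
    using assms K B' test_fun_partial_continuous test_fun_partial_zero[of K \<phi>, OF K(1,3)]
    by (intro loc_int_mult_integrable[where K=K and U=U and B=B']) (auto intro: borel_measurable_continuous_onI)
qed

text \<open>Test functions and their derivatives vanish outside a compact subset of U. Integrals
  over all space are preferable, since translations and Fubini apply to them directly.\<close>

lemma weak_partial_iff:
  fixes u :: "R3 \<Rightarrow> 'b::{banach,second_countable_topology}"
  shows "weak_partial U j u g \<longleftrightarrow> loc_int U u \<and> loc_int U g \<and>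
    (\<forall>\<phi>. test_fun U \<phi> \<longrightarrow> (LINT x|lborel. partial j \<phi> x *\<^sub>R u x) = - (LINT x|lborel. \<phi> x *\<^sub>R g x))"
proof -
  have "(LINT x:U|lborel. partial j \<phi> x *\<^sub>R u x) = (LINT x|lborel. partial j \<phi> x *\<^sub>R u x)"
    "(LINT x:U|lborel. \<phi> x *\<^sub>R g x) = (LINT x|lborel. \<phi> x *\<^sub>R g x)" if t: "test_fun U \<phi>" for \<phi>
  proof -
    obtain K where K: "compact K" "K \<subseteq> U" "\<And>x. x \<notin> K \<Longrightarrow> \<phi> x = 0" using test_fun_support[OF t] by metis
    show "(LINT x:U|lborel. partial j \<phi> x *\<^sub>R u x) = (LINT x|lborel. partial j \<phi> x *\<^sub>R u x)"
      using test_fun_partial_zero[of K \<phi>, OF K(1,3)] K(2) by (intro set_lint_eq_lint) blast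
    show "(LINT x:U|lborel. \<phi> x *\<^sub>R g x) = (LINT x|lborel. \<phi> x *\<^sub>R g x)"
      using K by (intro set_lint_eq_lint) auto
  qed
  then show ?thesis unfolding weak_partial_def by auto
qed

lemma compact_Union_cball:
  fixes K :: "'a::euclidean_space set"
  assumes "compact K"
  shows "compact (\<Union>x\<in>K. cball x r)"
proof -
  have "(\<Union>x\<in>K. cball x r) = {x + y |x y. x \<in> K \<and> y \<in> cball 0 r}"
  proof (intro equalityI subsetI)
    fix z assume "z \<in> (\<Union>x\<in>K. cball x r)"
    then obtain x where "x \<in> K" "dist x z \<le> r" by auto
    then show "z \<in> {x + y |x y. x \<in> K \<and> y \<in> cball 0 r}"
      by (intro CollectI exI[of _ x] exI[of _ "z - x"]) (auto simp: dist_norm norm_minus_commute)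
  next
    fix z assume "z \<in> {x + y |x y. x \<in> K \<and> y \<in> cball 0 r}"
    then obtain x y where "z = x + y" "x \<in> K" "norm y \<le> r" by auto
    then show "z \<in> (\<Union>x\<in>K. cball x r)" by (intro UN_I[of x]) (auto simp: dist_norm)
  qed
  then show ?thesis using compact_sums[OF assms(1) compact_cball, of 0 r] by simp
qed

lemma compact_neighbourhood:
  fixes K :: "'a::euclidean_space set"
  assumes "compact K" "open U" "K \<subseteq> U"
  obtains r where "r > 0" "compact (\<Union>x\<in>K. cball x r)" "(\<Union>x\<in>K. cball x r) \<subseteq> U"
  using compact_subset_open_imp_cball_epsilon_subset[OF assms] compact_Union_cball[OF assms(1)] by metis

lemma loc_int_restrict:
  "loc_int U u \<Longrightarrow> compact K \<Longrightarrow> K \<subseteq> U \<Longrightarrow> integrable lborel (\<lambda>x. indicator K x *\<^sub>R u x)"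
  unfolding loc_int_def set_integrable_def by blast

text \<open>For x in K the mollification of f at x is a test integral and vanishes, so |f(x)| is at
  most the weighted mean of |f(x + z) - f(x)| over short z. Integrating over K and exchanging the
  integrals bounds the L1 norm on K by the modulus of continuity in the mean.\<close>

lemma fundamental_lemma_compact:
  fixes f :: "R3 \<Rightarrow> 'b::{banach,second_countable_topology}"
  assumes U: "open U" and f: "loc_int U f"
    and z: "\<And>\<phi>. test_fun U \<phi> \<Longrightarrow> (LINT x|lborel. \<phi> x *\<^sub>R f x) = 0"
    and K: "compact K" "K \<subseteq> U"
  shows "AE x in lborel. x \<in> K \<longrightarrow> f x = 0"
proof -
  obtain e where e: "e > 0" and K': "compact (\<Union>x\<in>K. cball x e)" "(\<Union>x\<in>K. cball x e) \<subseteq> U"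
    using compact_neighbourhood[OF K(1) U K(2)] by metis
  define K' where "K' = (\<Union>x\<in>K. cball x e)"
  \<comment> \<open>The cutoff makes f integrable on all space; shifts of length at most e do not
    leave K' when they start in K.\<close>
  define F where "F x = indicator K' x *\<^sub>R f x" for x
  have F: "integrable lborel F"
    unfolding F_def using loc_int_restrict[OF f] K' by (simp add: K'_def)
  have Fm [measurable]: "F \<in> borel_measurable borel" using F by (simp add: borel_measurable_integrable)
  have Km [measurable]: "K \<in> sets borel" using K by (auto intro: borel_compact)
  have small: "(\<integral>\<^sup>+x. indicator K x * ennreal (norm (F x)) \<partial>lborel) \<le> ennreal \<epsilon>" if "\<epsilon> > 0" for \<epsilon>
  proof -
    obtain d where d: "d > 0" "\<And>h. norm h < d \<Longrightarrow> (LINT x|lborel. norm (F (x + h) - F x)) < \<epsilon>"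
      using L1_translation_continuous[OF F \<open>\<epsilon> > 0\<close>] by blast
    define r where "r = min d e"
    have r: "r > 0" "r \<le> d" "r \<le> e" using d e by (auto simp: r_def)
    obtain \<rho> where \<rho>: "test_fun (ball 0 r) \<rho>" "\<And>x. \<rho> x \<ge> 0" "integrable lborel \<rho>" "(LINT x|lborel. \<rho> x) = 1"
      using bump_exists[OF r(1)] by metis
    obtain S where S: "compact S" "S \<subseteq> ball 0 r" "\<And>x. x \<notin> S \<Longrightarrow> \<rho> x = 0" using test_fun_support[OF \<rho>(1)] by metis
    have \<rho>m [measurable]: "\<rho> \<in> borel_measurable borel"
      using \<rho>(3) by (simp add: borel_measurable_integrable)
    obtain B where B: "\<And>x. \<bar>\<rho> x\<bar> \<le> B" using test_fun_bounded[OF \<rho>(1)] by metis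
    have pt: "ennreal (norm (F x)) \<le> (\<integral>\<^sup>+z. ennreal (\<rho> z) * ennreal (norm (F (x + z) - F x)) \<partial>lborel)" if x: "x \<in> K" for x
    proof -
      have tf: "test_fun U (\<lambda>y. \<rho> (- x + 1 *\<^sub>R y))"
      proof (rule test_funI[where K="(+) x ` S"])
        show "smooth_on UNIV (\<lambda>y. \<rho> (- x + 1 *\<^sub>R y))"
          using \<rho>(1) unfolding test_fun_def by (intro smooth_on_affine) auto
        show "compact ((+) x ` S)" using S(1) by (rule compact_translation)
        have "(+) x ` S \<subseteq> cball x e" using S(2) r by (auto simp: dist_norm)
        then show "(+) x ` S \<subseteq> U" using K'(2) x by auto
        show "\<rho> (- x + 1 *\<^sub>R y) = 0" if "y \<notin> (+) x ` S" for y
          using S(3)[of "y - x"] that by (auto simp: image_iff) (metis add.commute diff_add_cancel)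
      qed
      have i1: "integrable lborel (\<lambda>z. \<rho> z *\<^sub>R F (x + z))"
        using integrable_shift[of F x] F B by (intro integrable_mult_bounded[where B=B]) (auto simp: add.commute)
      have i2: "integrable lborel (\<lambda>z. \<rho> z *\<^sub>R F x)" using \<rho>(3) by auto
      have "(LINT z|lborel. \<rho> z *\<^sub>R F (x + z)) = (LINT y|lborel. \<rho> (y - x) *\<^sub>R F y)"
        using integral_shift[of "\<lambda>y. \<rho> (y - x) *\<^sub>R F y" x] by (simp add: add.commute)
      also have "\<dots> = (LINT y|lborel. \<rho> (- x + 1 *\<^sub>R y) *\<^sub>R f y)"
      proof (rule Bochner_Integration.integral_cong[OF refl])
        fix y
        have "\<rho> (y - x) = 0" if "y \<notin> K'"
        proof (rule S(3), rule notI)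
          assume "y - x \<in> S"
          then have "y \<in> cball x e" using S(2) r by (auto simp: dist_norm norm_minus_commute)
          then show False using that x by (auto simp: K'_def)
        qed
        then show "\<rho> (y - x) *\<^sub>R F y = \<rho> (- x + 1 *\<^sub>R y) *\<^sub>R f y" by (auto simp: F_def indicator_def)
      qed
      also have "\<dots> = 0" by (rule z[OF tf])
      finally have "(LINT z|lborel. \<rho> z *\<^sub>R (F (x + z) - F x)) = - F x"
        using i1 i2 \<rho>(4) \<rho>(3) by (simp add: scaleR_diff_right)
      moreover have i3: "integrable lborel (\<lambda>z. \<rho> z *\<^sub>R (F (x + z) - F x))"
        using i1 i2 by (simp add: scaleR_diff_right)
      ultimately have "ennreal (norm (F x)) \<le> (\<integral>\<^sup>+z. norm (\<rho> z *\<^sub>R (F (x + z) - F x)) \<partial>lborel)"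
        using integral_norm_bound_ennreal[OF i3] by simp
      also have "\<dots> = (\<integral>\<^sup>+z. ennreal (\<rho> z) * ennreal (norm (F (x + z) - F x)) \<partial>lborel)"
        using \<rho>(2) by (intro nn_integral_cong) (simp add: ennreal_mult)
      finally show ?thesis .
    qed
    have "(\<integral>\<^sup>+x. indicator K x * ennreal (norm (F x)) \<partial>lborel)
       \<le> (\<integral>\<^sup>+x. (\<integral>\<^sup>+z. ennreal (\<rho> z) * ennreal (norm (F (x + z) - F x)) \<partial>lborel) \<partial>lborel)"
      using pt by (intro nn_integral_mono) (auto simp: indicator_def)
    also have "\<dots> = (\<integral>\<^sup>+z. (\<integral>\<^sup>+x. ennreal (\<rho> z) * ennreal (norm (F (x + z) - F x)) \<partial>lborel) \<partial>lborel)"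
      by (rule lborel_pair.Fubini'[symmetric]) measurable
    also have "\<dots> = (\<integral>\<^sup>+z. ennreal (\<rho> z) * (\<integral>\<^sup>+x. ennreal (norm (F (x + z) - F x)) \<partial>lborel) \<partial>lborel)"
      by (intro nn_integral_cong nn_integral_cmult) measurable
    also have "\<dots> \<le> (\<integral>\<^sup>+z. ennreal (\<rho> z) * ennreal \<epsilon> \<partial>lborel)"
    proof (rule nn_integral_mono)
      fix z
      show "ennreal (\<rho> z) * (\<integral>\<^sup>+x. ennreal (norm (F (x + z) - F x)) \<partial>lborel) \<le> ennreal (\<rho> z) * ennreal \<epsilon>"
      proof (cases "z \<in> S")
        case True
        then have "norm z < d" using S(2) r by auto
        have "(\<integral>\<^sup>+x. ennreal (norm (F (x + z) - F x)) \<partial>lborel) = ennreal (LINT x|lborel. norm (F (x + z) - F x))"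
          using F integrable_shift[of F z] by (intro nn_integral_eq_integral) auto
        also have "\<dots> \<le> ennreal \<epsilon>" using d(2)[OF \<open>norm z < d\<close>] by (simp add: ennreal_leI)
        finally show ?thesis by (rule mult_left_mono) simp
      qed (use S in auto)
    qed
    also have "\<dots> = ennreal \<epsilon>"
      using \<rho> by (subst nn_integral_multc) (auto simp: nn_integral_eq_integral)
    finally show ?thesis .
  qed
  have "(\<integral>\<^sup>+x. indicator K x * ennreal (norm (F x)) \<partial>lborel) \<le> 0"
  proof (rule ennreal_le_epsilon)
    show "(\<integral>\<^sup>+x. indicator K x * ennreal (norm (F x)) \<partial>lborel) \<le> 0 + ennreal e" if "e > 0" for e
      using small[OF that] by simp
  qed
  then have "(\<integral>\<^sup>+x. indicator K x * ennreal (norm (F x)) \<partial>lborel) = 0" by simp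
  then have "AE x in lborel. indicator K x * ennreal (norm (F x)) = 0"
    by (subst (asm) nn_integral_0_iff_AE) auto
  then show ?thesis
  proof eventually_elim
    case (elim x)
    have "x \<in> K \<Longrightarrow> x \<in> K'" using e by (force simp: K'_def)
    then show ?case using elim by (auto simp: F_def)
  qed
qed

lemma AE_open_compact:
  fixes U :: "R3 set"
  assumes "open U" "\<And>K. compact K \<Longrightarrow> K \<subseteq> U \<Longrightarrow> AE x in lborel. x \<in> K \<longrightarrow> P x"
  shows "AE x in lborel. x \<in> U \<longrightarrow> P x"
proof -
  obtain C :: "nat \<Rightarrow> R3 set" where C: "\<And>n. compact (C n)" "\<And>n. C n \<subseteq> U" "\<Union>(range C) = U"
    using open_Union_compact_subsets[OF assms(1)] by metis
  have "AE x in lborel. \<forall>n. x \<in> C n \<longrightarrow> P x"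
    using assms(2) C by (subst AE_all_countable) auto
  then show ?thesis by eventually_elim (use C(3) in blast)
qed

lemma fundamental_lemma:
  fixes f :: "R3 \<Rightarrow> 'b::{banach,second_countable_topology}"
  assumes "open U" "loc_int U f" "\<And>\<phi>. test_fun U \<phi> \<Longrightarrow> (LINT x|lborel. \<phi> x *\<^sub>R f x) = 0"
  shows "AE x in lborel. x \<in> U \<longrightarrow> f x = 0"
  by (rule AE_open_compact[OF assms(1) fundamental_lemma_compact[OF assms]])

lemma loc_int_diff: "loc_int U f \<Longrightarrow> loc_int U g \<Longrightarrow> loc_int U (\<lambda>x. f x - g x)"
  unfolding loc_int_def by auto

lemma loc_int_add: "loc_int U f \<Longrightarrow> loc_int U g \<Longrightarrow> loc_int U (\<lambda>x. f x + g x)"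
  unfolding loc_int_def by auto

lemma weak_partial_unique:
  fixes u :: "R3 \<Rightarrow> 'b::{banach,second_countable_topology}"
  assumes U: "open U" and g: "weak_partial U j u g" "weak_partial U j u g'"
  shows "AE x in lborel. x \<in> U \<longrightarrow> g x = g' x"
proof -
  have l: "loc_int U g" "loc_int U g'" using g by (auto simp: weak_partial_def)
  have "AE x in lborel. x \<in> U \<longrightarrow> g x - g' x = 0"
  proof (rule fundamental_lemma[OF U loc_int_diff[OF l]])
    fix \<phi> assume t: "test_fun U \<phi>"
    show "(LINT x|lborel. \<phi> x *\<^sub>R (g x - g' x)) = 0"
      using g t test_fun_mult_integrable(1)[OF l(1) t] test_fun_mult_integrable(1)[OF l(2) t]
      by (simp add: weak_partial_iff scaleR_diff_right)
  qed
  then show ?thesis by auto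
qed

lemma wpartial_weak_partial:
  "weak_partial U j u g \<Longrightarrow> weak_partial U j u (wpartial U j u)"
  unfolding wpartial_def by (metis someI)

text \<open>\<open>wpartial\<close> selects an unspecified weak derivative, so equality almost
  everywhere with a concrete one is the form in which every later computation has access to
  it.\<close>

lemma wpartial_eq:
  fixes u :: "R3 \<Rightarrow> 'b::{banach,second_countable_topology}"
  assumes "open U" "weak_partial U j u g"
  shows "AE x in lborel. x \<in> U \<longrightarrow> wpartial U j u x = g x"
  using weak_partial_unique[OF assms(1) wpartial_weak_partial[OF assms(2)] assms(2)] .

section \<open>Weak derivatives and difference quotients\<close>

abbreviation ax :: "3 \<Rightarrow> R3" where "ax j \<equiv> axis j 1"

lemma line_derivative:
  assumes "\<phi> differentiable at (x + t *\<^sub>R ax j)"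
  shows "((\<lambda>t. \<phi> (x + t *\<^sub>R ax j)) has_real_derivative partial j \<phi> (x + t *\<^sub>R ax j)) (at t)"
proof -
  let ?D = "frechet_derivative \<phi> (at (x + t *\<^sub>R ax j))"
  have 1: "(\<phi> has_derivative ?D) (at (x + t *\<^sub>R ax j))"
    using assms by (simp add: frechet_derivative_works)
  have "((\<lambda>t. \<phi> (x + t *\<^sub>R ax j)) has_derivative (\<lambda>h. ?D (h *\<^sub>R ax j))) (at t)"
    by (rule has_derivative_compose[where f="\<lambda>t. x + t *\<^sub>R ax j", OF _ 1]) (auto intro!: derivative_eq_intros)
  moreover have "(\<lambda>h. ?D (h *\<^sub>R ax j)) = (*) (partial j \<phi> (x + t *\<^sub>R ax j))"
    using has_derivative_bounded_linear[OF 1] by (simp add: partial_def linear_simps fun_eq_iff mult.commute)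
  ultimately show ?thesis by (simp add: has_field_derivative_def)
qed

lemma test_fun_shift_bound:
  assumes "test_fun U \<phi>" "\<And>x. \<bar>partial j \<phi> x\<bar> \<le> B"
  shows "\<bar>\<phi> (x + h *\<^sub>R ax j) - \<phi> x\<bar> \<le> B * \<bar>h\<bar>"
proof -
  have "norm ((\<lambda>t. \<phi> (x + t *\<^sub>R ax j)) h - (\<lambda>t. \<phi> (x + t *\<^sub>R ax j)) 0) \<le> B * norm (h - 0)"
    by (rule field_differentiable_bound[of UNIV])
      (use assms(2) line_derivative[OF test_fun_differentiable[OF assms(1)]] in \<open>auto intro: has_field_derivative_at_within\<close>)
  then show ?thesis by simp
qed

lemma test_fun_shift:
  assumes t: "test_fun W \<phi>" and "\<And>x. x \<in> W \<Longrightarrow> x + c \<in> U"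
  shows "test_fun U (\<lambda>y. \<phi> (y - c))"
proof -
  obtain S where S: "compact S" "S \<subseteq> W" "\<And>x. x \<notin> S \<Longrightarrow> \<phi> x = 0" using test_fun_support[OF t] by metis
  have "test_fun U (\<lambda>y. \<phi> (- c + 1 *\<^sub>R y))"
  proof (rule test_funI[where K="(+) c ` S"])
    show "smooth_on UNIV (\<lambda>y. \<phi> (- c + 1 *\<^sub>R y))"
      using t unfolding test_fun_def by (intro smooth_on_affine) auto
    show "compact ((+) c ` S)" using S(1) by (rule compact_translation)
    show "(+) c ` S \<subseteq> U" using S(2) assms(2) by (auto simp: add.commute)
    show "\<phi> (- c + 1 *\<^sub>R y) = 0" if "y \<notin> (+) c ` S" for y
      using S(3)[of "y - c"] that by (auto simp: image_iff) (metis add.commute diff_add_cancel)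
  qed
  then show ?thesis by simp
qed

lemma partial_shift:
  "\<phi> differentiable at (y - c) \<Longrightarrow> partial j (\<lambda>y. \<phi> (y - c)) y = partial j \<phi> (y - c)"
  using partial_affine[of \<phi> "- c" 1 y j] by simp

lemma integrable_imp_loc_int: "integrable lborel f \<Longrightarrow> loc_int U f"
  unfolding loc_int_def set_integrable_def
  by (intro allI impI integrable_mult_indicator) (auto intro: borel_compact)

text \<open>The fundamental theorem of calculus along a segment, for almost every starting point.
  Tested against \<open>\<phi>\<close>, Fubini and translations move the segment integral onto
  \<open>\<phi>\<close>, where the classical theorem holds; the fundamental lemma then removes
  \<open>\<phi>\<close>. The cutoff to K' is invisible because segments starting in W stay in
  K'.\<close>

lemma weak_partial_line:
  fixes u :: "R3 \<Rightarrow> 'b::{banach,second_countable_topology}"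
  assumes wp: "weak_partial U j u g" and W: "open W"
    and K': "compact K'" "K' \<subseteq> U"
    and WK0: "\<forall>x\<in>W. \<forall>s\<in>{0..1}. x + (s * h) *\<^sub>R ax j \<in> K'"
  defines "F \<equiv> \<lambda>x. indicator K' x *\<^sub>R u x" and "G \<equiv> \<lambda>x. indicator K' x *\<^sub>R g x"
  shows "AE x in lborel. x \<in> W \<longrightarrow>
     F (x + h *\<^sub>R ax j) - F x = h *\<^sub>R (LINT s|lborel. indicator {0..1} s *\<^sub>R G (x + (s * h) *\<^sub>R ax j))"
    and "integrable lborel (\<lambda>x. LINT s|lborel. indicator {0..1} s *\<^sub>R G (x + (s * h) *\<^sub>R ax j))"
    and "AE x in lborel. integrable lborel (\<lambda>s::real. indicator {0..1} s *\<^sub>R G (x + (s * h) *\<^sub>R ax j))"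
proof -
  note WK = WK0[rule_format]
  have l: "loc_int U u" "loc_int U g" using wp by (auto simp: weak_partial_def)
  have F: "integrable lborel F" and G: "integrable lborel G"
    unfolding F_def G_def using loc_int_restrict[OF _ K'] l by auto
  have Fm [measurable]: "F \<in> borel_measurable borel" using F by (simp add: borel_measurable_integrable)
  have Gm [measurable]: "G \<in> borel_measurable borel" using G by (simp add: borel_measurable_integrable)
  define k where "k = (\<lambda>(s::real, x). indicator {0..1} s *\<^sub>R G (x + (s * h) *\<^sub>R ax j))"
  have km: "k \<in> borel_measurable (lborel \<Otimes>\<^sub>M lborel)" unfolding k_def by measurable
  have ki: "integrable (lborel \<Otimes>\<^sub>M lborel) k"
  proof (rule lborel_pair.Fubini_integrable[OF km])
    have "(\<lambda>s. LINT x|lborel. norm (k (s, x))) = (\<lambda>s. indicator {0..1} s *\<^sub>R (LINT x|lborel. norm (G x)))"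
      using integral_shift[of "\<lambda>x. norm (G x)"] by (auto simp: k_def fun_eq_iff indicator_def)
    then show "integrable lborel (\<lambda>s. LINT x|lborel. norm (k (s, x)))" by simp
    show "AE s in lborel. integrable lborel (\<lambda>x. k (s, x))"
      using integrable_shift[of G] G by (auto simp: k_def)
  qed
  let ?I = "\<lambda>x. LINT s|lborel. indicator {0..1} s *\<^sub>R G (x + (s * h) *\<^sub>R ax j)"
  show Ii: "integrable lborel ?I"
    using lborel_pair.integrable_snd[of "\<lambda>s x. k (s, x)"] ki by (simp add: k_def)
  show "AE x in lborel. integrable lborel (\<lambda>s::real. indicator {0..1} s *\<^sub>R G (x + (s * h) *\<^sub>R ax j))"
    using lborel_pair.AE_integrable_snd[of "\<lambda>s x. k (s, x)"] ki by (simp add: k_def)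
  have "AE x in lborel. x \<in> W \<longrightarrow> F (x + h *\<^sub>R ax j) - F x - h *\<^sub>R ?I x = 0"
  proof (rule fundamental_lemma[OF W])
    have Fh: "integrable lborel (\<lambda>x. F (x + h *\<^sub>R ax j))" using F integrable_shift[of F] by simp
    have fi: "integrable lborel (\<lambda>x. F (x + h *\<^sub>R ax j) - F x - h *\<^sub>R ?I x)"
      using F Fh Ii by auto
    show "loc_int W (\<lambda>x. F (x + h *\<^sub>R ax j) - F x - h *\<^sub>R ?I x)"
      by (rule integrable_imp_loc_int[OF fi])
    fix \<phi> assume t: "test_fun W \<phi>"
    obtain S where S: "compact S" "S \<subseteq> W" "\<And>x. x \<notin> S \<Longrightarrow> \<phi> x = 0" using test_fun_support[OF t] by metis
    obtain B where B: "\<And>x. \<bar>\<phi> x\<bar> \<le> B" using test_fun_bounded[OF t] by metis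
    obtain B' where B': "\<And>x. \<bar>partial j \<phi> x\<bar> \<le> B'" using test_fun_bounded_partial[OF t] by metis
    have pm [measurable]: "\<phi> \<in> borel_measurable borel" "partial j \<phi> \<in> borel_measurable borel"
      using test_fun_continuous[OF t] test_fun_partial_continuous[OF t] by (auto intro: borel_measurable_continuous_onI)
    note mb = integrable_mult_bounded[OF _ pm(1) B]
    have pz: "partial j \<phi> x = 0" if "x \<notin> S" for x using test_fun_partial_zero[of S \<phi>, OF S(1,3) that] by simp
    \<comment> \<open>The test function shifted by s h is still supported in K', hence in U, so it
      may be inserted into the definition of the weak derivative.\<close>
    have inner: "(LINT x|lborel. \<phi> x *\<^sub>R G (x + (s * h) *\<^sub>R ax j))
       = - (LINT x|lborel. partial j \<phi> (x - (s * h) *\<^sub>R ax j) *\<^sub>R F x)" if s: "s \<in> {0..1}" for s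
    proof -
      let ?c = "(s * h) *\<^sub>R ax j"
      have tc: "test_fun U (\<lambda>y. \<phi> (y - ?c))"
        using WK s K'(2) by (intro test_fun_shift[OF t]) auto
      have out: "\<phi> (y - ?c) = 0" "partial j \<phi> (y - ?c) = 0" if "y \<notin> K'" for y
      proof -
        have "y - ?c \<notin> S" using WK[of "y - ?c" s] S(2) s that by auto
        then show "\<phi> (y - ?c) = 0" "partial j \<phi> (y - ?c) = 0" using S(3) pz by auto
      qed
      have "(LINT x|lborel. \<phi> x *\<^sub>R G (x + ?c)) = (LINT x|lborel. \<phi> (x - ?c) *\<^sub>R G x)"
        using integral_shift[of "\<lambda>x. \<phi> (x - ?c) *\<^sub>R G x" ?c] by simp
      also have "\<dots> = (LINT x|lborel. \<phi> (x - ?c) *\<^sub>R g x)"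
        by (rule Bochner_Integration.integral_cong) (use out in \<open>auto simp: G_def indicator_def\<close>)
      also have "\<dots> = - (LINT x|lborel. partial j (\<lambda>y. \<phi> (y - ?c)) x *\<^sub>R u x)"
        using wp tc by (simp add: weak_partial_iff)
      also have "(LINT x|lborel. partial j (\<lambda>y. \<phi> (y - ?c)) x *\<^sub>R u x)
         = (LINT x|lborel. partial j \<phi> (x - ?c) *\<^sub>R F x)"
        by (rule Bochner_Integration.integral_cong)
          (use out partial_shift[OF test_fun_differentiable[OF t]] in \<open>auto simp: F_def indicator_def\<close>)
      finally show ?thesis .
    qed
    have k2: "integrable (lborel \<Otimes>\<^sub>M lborel) (\<lambda>(s, x). \<phi> x *\<^sub>R k (s, x))"
    proof (rule Bochner_Integration.integrable_bound[where f="\<lambda>z. B * norm (k z)"])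
      show "AE z in lborel \<Otimes>\<^sub>M lborel. norm (case z of (s, x) \<Rightarrow> \<phi> x *\<^sub>R k (s, x)) \<le> norm (B * norm (k z))"
      proof (rule AE_I2, clarify)
        fix s :: real and x :: R3
        have "\<bar>\<phi> x\<bar> * norm (k (s, x)) \<le> B * norm (k (s, x))" by (intro mult_right_mono B) auto
        also have "\<dots> \<le> \<bar>B\<bar> * norm (k (s, x))" by (intro mult_right_mono) auto
        finally show "norm (\<phi> x *\<^sub>R k (s, x)) \<le> norm (B * norm (k (s, x)))" by (simp add: abs_mult)
      qed
      show "(\<lambda>(s, x). \<phi> x *\<^sub>R k (s, x)) \<in> borel_measurable (lborel \<Otimes>\<^sub>M lborel)"
        using km by measurable
    qed (use ki in auto)
    define k3 where "k3 = (\<lambda>(s::real, x). indicator {0..1} s *\<^sub>R partial j \<phi> (x - (s * h) *\<^sub>R ax j) *\<^sub>R F x)"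
    have k3m: "k3 \<in> borel_measurable (lborel \<Otimes>\<^sub>M lborel)" unfolding k3_def by measurable
    have k3i: "integrable (lborel \<Otimes>\<^sub>M lborel) k3"
    proof (rule Bochner_Integration.integrable_bound[OF _ k3m])
      show "integrable (lborel \<Otimes>\<^sub>M lborel) (\<lambda>(s::real, x). (B' * indicator {0..1} s) * norm (F x))"
      proof (rule lborel_pair.Fubini_integrable)
        have "(\<lambda>s::real. LINT x|lborel. norm (case (s, x) of (s, x) \<Rightarrow> (B' * indicator {0..1} s) * norm (F x)))
            = (\<lambda>s. indicator {0..1} s *\<^sub>R (\<bar>B'\<bar> * (LINT x|lborel. norm (F x))))"
          by (auto simp: fun_eq_iff indicator_def abs_mult)
        then show "integrable lborel (\<lambda>s::real. LINT x|lborel. norm (case (s, x) of (s, x) \<Rightarrow> (B' * indicator {0..1} s) * norm (F x)))"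
          by simp
      qed (use F in auto)
      show "AE z in lborel \<Otimes>\<^sub>M lborel. norm (k3 z) \<le> norm (case z of (s::real, x) \<Rightarrow> B' * indicator {0..1} s * norm (F x))"
      proof (rule AE_I2, clarify)
        fix s :: real and x :: R3
        have "\<bar>partial j \<phi> (x - (s * h) *\<^sub>R ax j)\<bar> * norm (F x) \<le> B' * norm (F x)"
          by (intro mult_right_mono B') auto
        then show "norm (k3 (s, x)) \<le> norm (B' * indicator {0..1} s * norm (F x))"
          by (auto simp: k3_def indicator_def)
      qed
    qed
    have "(LINT x|lborel. \<phi> x *\<^sub>R ?I x) = (LINT x|lborel. LINT s|lborel. \<phi> x *\<^sub>R k (s, x))"
      by (simp add: k_def del: scaleR_scaleR)
    also have "\<dots> = (LINT s|lborel. LINT x|lborel. \<phi> x *\<^sub>R k (s, x))"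
      using lborel_pair.Fubini_integral[of "\<lambda>s x. \<phi> x *\<^sub>R k (s, x)"] k2 by simp
    also have "\<dots> = (LINT s|lborel. - (LINT x|lborel. k3 (s, x)))"
    proof (rule Bochner_Integration.integral_cong[OF refl])
      fix s :: real
      show "(LINT x|lborel. \<phi> x *\<^sub>R k (s, x)) = - (LINT x|lborel. k3 (s, x))"
        using inner[of s] by (cases "s \<in> {0..1}") (auto simp: k_def k3_def)
    qed
    also have "\<dots> = - (LINT x|lborel. LINT s|lborel. k3 (s, x))"
      using lborel_pair.Fubini_integral[of "\<lambda>s x. k3 (s, x)"] k3i by simp
    finally have 0: "(LINT x|lborel. \<phi> x *\<^sub>R ?I x) = - (LINT x|lborel. LINT s|lborel. k3 (s, x))" .
    have "(\<lambda>x. \<phi> x *\<^sub>R h *\<^sub>R ?I x) = (\<lambda>x. h *\<^sub>R (\<phi> x *\<^sub>R ?I x))"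
      by (simp add: fun_eq_iff mult.commute)
    then have 1: "(LINT x|lborel. \<phi> x *\<^sub>R h *\<^sub>R ?I x) = - (LINT x|lborel. h *\<^sub>R (LINT s|lborel. k3 (s, x)))"
      using 0 by (simp del: scaleR_scaleR)
    have ftc: "h *\<^sub>R (LINT s|lborel. k3 (s, x)) = (\<phi> x - \<phi> (x - h *\<^sub>R ax j)) *\<^sub>R F x" for x
    proof -
      have c: "continuous_on UNIV (\<lambda>s. h * partial j \<phi> (x - (s * h) *\<^sub>R ax j))"
        by (intro continuous_intros continuous_on_compose2[OF test_fun_partial_continuous[OF t]]) auto
      have d: "((\<lambda>s. - \<phi> (x - (s * h) *\<^sub>R ax j)) has_real_derivative h * partial j \<phi> (x - (s * h) *\<^sub>R ax j)) (at s)" for s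
      proof -
        have "((\<lambda>s. \<phi> (x + (- (s * h)) *\<^sub>R ax j)) has_real_derivative partial j \<phi> (x + (- (s * h)) *\<^sub>R ax j) * (- h)) (at s)"
          by (rule DERIV_chain2[OF line_derivative[OF test_fun_differentiable[OF t]]]) (auto intro!: derivative_eq_intros)
        from DERIV_minus[OF this] show ?thesis by (simp add: mult.commute)
      qed
      have "(LINT s|lborel. indicator {0..1} s *\<^sub>R (h * partial j \<phi> (x - (s * h) *\<^sub>R ax j))) = - \<phi> (x - (1 * h) *\<^sub>R ax j) - (- \<phi> (x - (0 * h) *\<^sub>R ax j))"
        by (rule integral_FTC_Icc) (use d c in \<open>auto simp: has_real_derivative_iff_has_vector_derivative[symmetric]
            intro: has_field_derivative_at_within continuous_on_subset\<close>)
      then have f: "h * (LINT s|lborel. indicator {0..1} s * partial j \<phi> (x - (s * h) *\<^sub>R ax j)) = \<phi> x - \<phi> (x - h *\<^sub>R ax j)"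
        by (simp add: mult.left_commute[of _ h])
      have "(LINT s|lborel. k3 (s, x)) = (LINT s|lborel. (indicator {0..1} s * partial j \<phi> (x - (s * h) *\<^sub>R ax j)) *\<^sub>R F x)"
        by (simp add: k3_def)
      also have "\<dots> = (LINT s|lborel. indicator {0..1} s * partial j \<phi> (x - (s * h) *\<^sub>R ax j)) *\<^sub>R F x"
      proof (rule integral_scaleR_left)
        have "continuous_on {0..1} (\<lambda>s. partial j \<phi> (x - (s * h) *\<^sub>R ax j))"
          by (intro continuous_on_compose2[OF test_fun_partial_continuous[OF t]] continuous_intros) auto
        from borel_integrable_compact[OF compact_Icc this]
        show "integrable lborel (\<lambda>s. indicator {0..1} s * partial j \<phi> (x - (s * h) *\<^sub>R ax j))" by simp
      qed
      finally show ?thesis using f by simp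
    qed
    have sB: "\<bar>\<phi> (x - h *\<^sub>R ax j)\<bar> \<le> B" for x by (rule B)
    have i1: "integrable lborel (\<lambda>x. \<phi> x *\<^sub>R F x)" "integrable lborel (\<lambda>x. \<phi> x *\<^sub>R F (x + h *\<^sub>R ax j))"
       "integrable lborel (\<lambda>x. \<phi> x *\<^sub>R h *\<^sub>R ?I x)" "integrable lborel (\<lambda>x. \<phi> (x - h *\<^sub>R ax j) *\<^sub>R F x)"
      using F Fh Ii by (auto simp del: scaleR_scaleR intro!: mb integrable_mult_bounded[OF _ _ sB])
    have "(LINT x|lborel. \<phi> x *\<^sub>R (F (x + h *\<^sub>R ax j) - F x - h *\<^sub>R ?I x)) =
       (LINT x|lborel. \<phi> x *\<^sub>R F (x + h *\<^sub>R ax j)) - (LINT x|lborel. \<phi> x *\<^sub>R F x) - (LINT x|lborel. \<phi> x *\<^sub>R h *\<^sub>R ?I x)"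
      using i1 by (simp add: scaleR_diff_right del: scaleR_scaleR)
    also have "(LINT x|lborel. \<phi> x *\<^sub>R F (x + h *\<^sub>R ax j)) = (LINT x|lborel. \<phi> (x - h *\<^sub>R ax j) *\<^sub>R F x)"
      using integral_shift[of "\<lambda>x. \<phi> (x - h *\<^sub>R ax j) *\<^sub>R F x" "h *\<^sub>R ax j"] by simp
    also have "(LINT x|lborel. \<phi> x *\<^sub>R h *\<^sub>R ?I x) = - (LINT x|lborel. \<phi> x *\<^sub>R F x - \<phi> (x - h *\<^sub>R ax j) *\<^sub>R F x)"
      unfolding 1 ftc by (simp add: scaleR_diff_left)
    also have "\<dots> = - ((LINT x|lborel. \<phi> x *\<^sub>R F x) - (LINT x|lborel. \<phi> (x - h *\<^sub>R ax j) *\<^sub>R F x))"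
      using i1 by simp
    finally show "(LINT x|lborel. \<phi> x *\<^sub>R (F (x + h *\<^sub>R ax j) - F x - h *\<^sub>R ?I x)) = 0" by simp
  qed
  then show "AE x in lborel. x \<in> W \<longrightarrow> F (x + h *\<^sub>R ax j) - F x = h *\<^sub>R ?I x"
    by eventually_elim simp
qed

text \<open>On open sets weak derivatives are the local \<open>L\<^sup>1\<close> limits of difference quotients along some sequence of
  step sizes. In this form the product and chain rules follow from their pointwise counterparts.\<close>

definition diff_quot :: "3 \<Rightarrow> (R3 \<Rightarrow> 'b::real_vector) \<Rightarrow> real \<Rightarrow> R3 \<Rightarrow> 'b" where
  "diff_quot j u h x = (1/h) *\<^sub>R (u (x + h *\<^sub>R ax j) - u x)"

definition diff_quot_conv :: "R3 set \<Rightarrow> 3 \<Rightarrow> (R3 \<Rightarrow> 'b::{banach,second_countable_topology}) \<Rightarrow> (R3 \<Rightarrow> 'b) \<Rightarrow> (nat \<Rightarrow> real) \<Rightarrow> bool" where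
  "diff_quot_conv K j u g h \<longleftrightarrow> (\<forall>n. h n > 0) \<and> h \<longlonglongrightarrow> 0 \<and>
    (\<forall>n. integrable lborel (\<lambda>x. indicator K x *\<^sub>R (diff_quot j u (h n) x - g x))) \<and>
    (\<lambda>n. LINT x|lborel. norm (indicator K x *\<^sub>R (diff_quot j u (h n) x - g x))) \<longlonglongrightarrow> 0"

text \<open>By the line formula the error is the mean over s in [0, 1] of g(x + s h e_j) - g(x).
  Each of these differences is small in L1 by continuity of translations, uniformly in s.\<close>

lemma weak_partial_diff_quot:
  fixes u :: "R3 \<Rightarrow> 'b::{banach,second_countable_topology}"
  assumes wp: "weak_partial U j u g" and U: "open U" and K: "compact K" "K \<subseteq> U" and e: "e > 0"
  shows "\<exists>d>0. \<forall>h. 0 < h \<and> h < d \<longrightarrow> integrable lborel (\<lambda>x. indicator K x *\<^sub>R (diff_quot j u h x - g x)) \<and>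
     (LINT x|lborel. norm (indicator K x *\<^sub>R (diff_quot j u h x - g x))) \<le> e"
proof -
  have l: "loc_int U u" "loc_int U g" using wp by (auto simp: weak_partial_def)
  obtain r where r: "r > 0" and K'0: "compact (\<Union>x\<in>K. cball x r)" "(\<Union>x\<in>K. cball x r) \<subseteq> U"
    using compact_neighbourhood[OF K(1) U K(2)] by metis
  define K' where "K' = (\<Union>x\<in>K. cball x r)"
  note K' = K'0[folded K'_def]
  define W where "W = (\<Union>x\<in>K. ball x (r/2))"
  define F where "F x = indicator K' x *\<^sub>R u x" for x
  define G where "G x = indicator K' x *\<^sub>R g x" for x
  have F: "integrable lborel F" and G: "integrable lborel G"
    unfolding F_def G_def using loc_int_restrict[OF _ K'] l by auto
  have Gm [measurable]: "G \<in> borel_measurable borel" using G by (simp add: borel_measurable_integrable)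
  have Km [measurable]: "K \<in> sets borel" using K by (auto intro: borel_compact)
  obtain d0 where d0: "d0 > 0" "\<And>h. norm h < d0 \<Longrightarrow> (LINT x|lborel. norm (G (x + h) - G x)) < e"
    using L1_translation_continuous[OF G e] by blast
  show ?thesis
  proof (intro exI[of _ "min d0 (r/2)"] conjI allI impI)
    show "min d0 (r/2) > 0" using d0 r by simp
    fix h assume h: "0 < h \<and> h < min d0 (r/2)"
    have WK: "x + (s * h) *\<^sub>R ax j \<in> K'" if "x \<in> W" "s \<in> {0..1}" for x s
    proof -
      obtain y where y: "y \<in> K" "dist y x < r/2" using \<open>x \<in> W\<close> by (auto simp: W_def)
      have "s * h \<le> 1 * h" using that h by (intro mult_right_mono) auto
      moreover have "norm ((s * h) *\<^sub>R ax j) = s * h" using that h by simp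
      ultimately have "norm ((s * h) *\<^sub>R ax j) \<le> r/2" using h by linarith
      then have "dist y (x + (s * h) *\<^sub>R ax j) \<le> r"
        using y(2) dist_triangle[of y "x + (s * h) *\<^sub>R ax j" x] by (simp add: dist_norm)
      then show ?thesis using y(1) by (auto simp: K'_def)
    qed
    have WO: "open W" by (auto simp: W_def)
    have KW: "K \<subseteq> W" using r by (auto simp: W_def)
    let ?I = "\<lambda>x. LINT s|lborel. indicator {0..1} s *\<^sub>R G (x + (s * h) *\<^sub>R ax j)"
    have WK0: "\<forall>x\<in>W. \<forall>s\<in>{0..1}. x + (s * h) *\<^sub>R ax j \<in> K'" using WK by blast
    note line = weak_partial_line[OF wp WO K' WK0, folded F_def G_def]
    have eq: "indicator K x *\<^sub>R (diff_quot j u h x - g x) = indicator K x *\<^sub>R ((1/h) *\<^sub>R (F (x + h *\<^sub>R ax j) - F x) - G x)" for x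
    proof (cases "x \<in> K")
      case True
      then have "x + h *\<^sub>R ax j \<in> K'" "x \<in> K'" using WK[of x 1] WK[of x 0] KW by auto
      then show ?thesis by (simp add: F_def G_def diff_quot_def)
    qed simp
    show int: "integrable lborel (\<lambda>x. indicator K x *\<^sub>R (diff_quot j u h x - g x))"
      unfolding eq using F G integrable_shift[of F] by (intro integrable_mult_indicator) auto
    have "ennreal (LINT x|lborel. norm (indicator K x *\<^sub>R (diff_quot j u h x - g x)))
      = (\<integral>\<^sup>+x. ennreal (norm (indicator K x *\<^sub>R (diff_quot j u h x - g x))) \<partial>lborel)"
      by (rule nn_integral_eq_integral[symmetric, OF integrable_norm[OF int]]) simp
    also have "\<dots> \<le> (\<integral>\<^sup>+x. (\<integral>\<^sup>+s. indicator {0..1} s * ennreal (norm (G (x + (s * h) *\<^sub>R ax j) - G x)) \<partial>lborel) \<partial>lborel)"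
    proof (rule nn_integral_mono_AE)
      show "AE x in lborel. ennreal (norm (indicator K x *\<^sub>R (diff_quot j u h x - g x)))
         \<le> (\<integral>\<^sup>+s. indicator {0..1} s * ennreal (norm (G (x + (s * h) *\<^sub>R ax j) - G x)) \<partial>lborel)"
        using line(1) line(3)
      proof eventually_elim
        case (elim x)
        show ?case
        proof (cases "x \<in> K")
          case True
          have i: "integrable lborel (\<lambda>s::real. indicator {0..1} s *\<^sub>R G x)" by simp
          have "indicator K x *\<^sub>R (diff_quot j u h x - g x) = ?I x - G x"
            using elim(1) KW True h unfolding eq by auto
          also have "G x = (LINT s|lborel. indicator {0..1::real} s *\<^sub>R G x)" by simp
          also have "?I x - \<dots> = (LINT s|lborel. indicator {0..1} s *\<^sub>R (G (x + (s * h) *\<^sub>R ax j) - G x))"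
            using elim(2) i by (simp add: scaleR_diff_right)
          finally have q: "indicator K x *\<^sub>R (diff_quot j u h x - g x) = \<dots>" .
          have "integrable lborel (\<lambda>s::real. indicator {0..1} s *\<^sub>R (G (x + (s * h) *\<^sub>R ax j) - G x))"
            using elim(2) i by (simp add: scaleR_diff_right)
          from integral_norm_bound_ennreal[OF this]
          show ?thesis unfolding q by (simp add: ennreal_mult ennreal_indicator)
        qed simp
      qed
    qed
    also have "\<dots> = (\<integral>\<^sup>+s. (\<integral>\<^sup>+x. indicator {0..1} s * ennreal (norm (G (x + (s * h) *\<^sub>R ax j) - G x)) \<partial>lborel) \<partial>lborel)"
      by (rule lborel_pair.Fubini'[symmetric]) measurable
    also have "\<dots> = (\<integral>\<^sup>+s. indicator {0..1} s * (\<integral>\<^sup>+x. ennreal (norm (G (x + (s * h) *\<^sub>R ax j) - G x)) \<partial>lborel) \<partial>lborel)"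
      by (intro nn_integral_cong nn_integral_cmult) measurable
    also have "\<dots> \<le> (\<integral>\<^sup>+s. indicator {0..1::real} s * ennreal e \<partial>lborel)"
    proof (rule nn_integral_mono)
      fix s :: real
      show "indicator {0..1} s * (\<integral>\<^sup>+x. ennreal (norm (G (x + (s * h) *\<^sub>R ax j) - G x)) \<partial>lborel) \<le> indicator {0..1} s * ennreal e"
      proof (cases "s \<in> {0..1}")
        case True
        have "s * h \<le> 1 * h" using True h by (intro mult_right_mono) auto
        moreover have "norm ((s * h) *\<^sub>R ax j) = s * h" using True h by simp
        ultimately have "norm ((s * h) *\<^sub>R ax j) < d0" using h by linarith
        have "(\<integral>\<^sup>+x. ennreal (norm (G (x + (s * h) *\<^sub>R ax j) - G x)) \<partial>lborel) = ennreal (LINT x|lborel. norm (G (x + (s * h) *\<^sub>R ax j) - G x))"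
          using G integrable_shift[of G] by (intro nn_integral_eq_integral) auto
        also have "\<dots> \<le> ennreal e" using d0(2)[OF \<open>norm ((s * h) *\<^sub>R ax j) < d0\<close>] by (simp add: ennreal_leI)
        finally show ?thesis by (rule mult_left_mono) simp
      qed auto
    qed
    also have "\<dots> = ennreal e" by (subst nn_integral_multc) auto
    finally show "(LINT x|lborel. norm (indicator K x *\<^sub>R (diff_quot j u h x - g x))) \<le> e" using e by simp
  qed
qed

lemma weak_partial_diff_quot_conv:
  fixes u :: "R3 \<Rightarrow> 'b::{banach,second_countable_topology}"
  assumes wp: "weak_partial U j u g" and U: "open U" and K: "compact K" "K \<subseteq> U"
  shows "\<exists>h. diff_quot_conv K j u g h"
proof -
  let ?i = "\<lambda>h. integrable lborel (\<lambda>x. indicator K x *\<^sub>R (diff_quot j u h x - g x))"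
  let ?n = "\<lambda>h. (LINT x|lborel. norm (indicator K x *\<^sub>R (diff_quot j u h x - g x)))"
  have "\<forall>n. \<exists>h. 0 < h \<and> h < inverse (real (Suc n)) \<and> ?i h \<and> ?n h \<le> inverse (real (Suc n))"
  proof
    fix n
    obtain d where d: "d > 0" "\<And>h. 0 < h \<Longrightarrow> h < d \<Longrightarrow> ?i h \<and> ?n h \<le> inverse (real (Suc n))"
      using weak_partial_diff_quot[OF assms, of "inverse (real (Suc n))"] by auto
    define h0 where "h0 = min d (inverse (real (Suc n))) / 2"
    have "inverse (real (Suc n)) > 0" by simp
    then have "0 < h0" "h0 < d" "h0 < inverse (real (Suc n))" using d(1) unfolding h0_def min_def by (auto split: if_splits)
    then show "\<exists>h. 0 < h \<and> h < inverse (real (Suc n)) \<and> ?i h \<and> ?n h \<le> inverse (real (Suc n))"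
      using d(2)[of h0] by blast
  qed
  from choice[OF this] obtain h where h: "\<And>n. 0 < h n \<and> h n < inverse (real (Suc n)) \<and> ?i (h n) \<and> ?n (h n) \<le> inverse (real (Suc n))"
    by (elim exE) blast
  have "h \<longlonglongrightarrow> 0"
    by (rule tendsto_sandwich[OF _ _ tendsto_const LIMSEQ_inverse_real_of_nat]) (use h in \<open>auto intro!: always_eventually less_imp_le\<close>)
  moreover have "(\<lambda>n. ?n (h n)) \<longlonglongrightarrow> 0"
    by (rule tendsto_sandwich[OF _ _ tendsto_const LIMSEQ_inverse_real_of_nat]) (use h in \<open>auto intro!: always_eventually simp del: of_nat_Suc\<close>)
  ultimately show ?thesis using h unfolding diff_quot_conv_def by blast
qed

text \<open>Discrete integration by parts: a translation moves the difference quotient from u to the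
  test function, where it converges boundedly to the classical derivative. A sequence of steps that
  depends on the compact set suffices, because only the support of one test function matters at a
  time.\<close>

lemma weak_partialI_diff_quot:
  fixes u :: "R3 \<Rightarrow> 'b::{banach,second_countable_topology}"
  assumes U: "open U" and l: "loc_int U u" "loc_int U g"
    and dq: "\<And>K. compact K \<Longrightarrow> K \<subseteq> U \<Longrightarrow> \<exists>h. diff_quot_conv K j u g h"
  shows "weak_partial U j u g"
  unfolding weak_partial_iff
proof (intro conjI allI impI l)
  fix \<phi> assume t: "test_fun U \<phi>"
  obtain S where S: "compact S" "S \<subseteq> U" "\<And>x. x \<notin> S \<Longrightarrow> \<phi> x = 0" using test_fun_support[OF t] by metis
  obtain B where B: "\<And>x. \<bar>\<phi> x\<bar> \<le> B" "B \<ge> 0" using test_fun_bounded[OF t] by metis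
  obtain B' where B': "\<And>x. \<bar>partial j \<phi> x\<bar> \<le> B'" "B' \<ge> 0" using test_fun_bounded_partial[OF t] by metis
  have pm [measurable]: "\<phi> \<in> borel_measurable borel" "partial j \<phi> \<in> borel_measurable borel"
    using test_fun_continuous[OF t] test_fun_partial_continuous[OF t] by (auto intro: borel_measurable_continuous_onI)
  have pz: "partial j \<phi> x = 0" if "x \<notin> S" for x using test_fun_partial_zero[of S \<phi>, OF S(1,3) that] by simp
  obtain h where h: "\<And>n. h n > 0" "h \<longlonglongrightarrow> 0"
    "\<And>n. integrable lborel (\<lambda>x. indicator S x *\<^sub>R (diff_quot j u (h n) x - g x))"
    "(\<lambda>n. LINT x|lborel. norm (indicator S x *\<^sub>R (diff_quot j u (h n) x - g x))) \<longlonglongrightarrow> 0"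
    using dq[OF S(1,2)] unfolding diff_quot_conv_def by blast
  obtain r where r: "r > 0" and K'0: "compact (\<Union>x\<in>S. cball x r)" "(\<Union>x\<in>S. cball x r) \<subseteq> U"
    using compact_neighbourhood[OF S(1) U S(2)] by metis
  define K' where "K' = (\<Union>x\<in>S. cball x r)"
  note K' = K'0[folded K'_def]
  have SK: "x \<in> K'" if "x \<in> S" for x using that r by (force simp: K'_def)
  define F where "F x = indicator K' x *\<^sub>R u x" for x
  have F: "integrable lborel F"
    unfolding F_def using loc_int_restrict[OF l(1) K'] by auto
  have Fm [measurable]: "F \<in> borel_measurable borel" using F by (simp add: borel_measurable_integrable)
  have FB: "\<bar>(\<phi> (x - h n *\<^sub>R ax j) - \<phi> x) / h n\<bar> \<le> B'" for n x
    using test_fun_shift_bound[OF t B'(1), of x "- h n"] h(1)[of n] by (simp add: divide_le_eq)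
  have pg: "integrable lborel (\<lambda>x. \<phi> x *\<^sub>R g x)" using test_fun_mult_integrable(1)[OF l(2) t] .
  have lim1: "(\<lambda>n. LINT x|lborel. \<phi> x *\<^sub>R (indicator S x *\<^sub>R (diff_quot j u (h n) x - g x))) \<longlonglongrightarrow> 0"
  proof (rule Lim_null_comparison)
    have "norm (LINT x|lborel. \<phi> x *\<^sub>R (indicator S x *\<^sub>R (diff_quot j u (h n) x - g x))) \<le>
       B * (LINT x|lborel. norm (indicator S x *\<^sub>R (diff_quot j u (h n) x - g x)))" (is "?l \<le> ?r") for n
    proof -
      have "?l \<le> (LINT x|lborel. norm (\<phi> x *\<^sub>R (indicator S x *\<^sub>R (diff_quot j u (h n) x - g x))))"
        by (rule integral_norm_bound)
      also have "\<dots> \<le> (LINT x|lborel. B * norm (indicator S x *\<^sub>R (diff_quot j u (h n) x - g x)))"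
      proof (rule integral_mono)
        show "norm (\<phi> x *\<^sub>R (indicator S x *\<^sub>R (diff_quot j u (h n) x - g x))) \<le> B * norm (indicator S x *\<^sub>R (diff_quot j u (h n) x - g x))" for x
          unfolding norm_scaleR[of "\<phi> x"] abs_mult abs_norm_cancel abs_abs by (intro mult_right_mono B) auto
      qed (rule integrable_norm[OF integrable_mult_bounded[OF h(3) pm(1) B(1)]] integrable_mult_right[OF integrable_norm[OF h(3)]])+
      also have "\<dots> = ?r" by (rule integral_mult_right_zero)
      finally show ?thesis .
    qed
    then show "\<forall>\<^sub>F n in sequentially. norm (LINT x|lborel. \<phi> x *\<^sub>R (indicator S x *\<^sub>R (diff_quot j u (h n) x - g x))) \<le>
       B * (LINT x|lborel. norm (indicator S x *\<^sub>R (diff_quot j u (h n) x - g x)))" by simp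
    show "(\<lambda>n. B * (LINT x|lborel. norm (indicator S x *\<^sub>R (diff_quot j u (h n) x - g x)))) \<longlonglongrightarrow> 0"
      using tendsto_mult_right_zero[OF h(4)] by simp
  qed
  have "\<forall>\<^sub>F n in sequentially. h n < r" using h(2) r by (rule order_tendstoD)
  then have eq: "\<forall>\<^sub>F n in sequentially. (LINT x|lborel. \<phi> x *\<^sub>R (indicator S x *\<^sub>R (diff_quot j u (h n) x - g x)))
     = (LINT x|lborel. ((\<phi> (x - h n *\<^sub>R ax j) - \<phi> x) / h n) *\<^sub>R F x) - (LINT x|lborel. \<phi> x *\<^sub>R g x)"
  proof eventually_elim
    case (elim n)
    have hn: "h n > 0" by (rule h(1))
    have Fh: "integrable lborel (\<lambda>x. F (x + h n *\<^sub>R ax j))" using F integrable_shift[of F] by simp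
    have i: "integrable lborel (\<lambda>x. \<phi> x *\<^sub>R F (x + h n *\<^sub>R ax j))" "integrable lborel (\<lambda>x. \<phi> x *\<^sub>R F x)"
      using F Fh by (auto intro!: integrable_mult_bounded[OF _ _ B(1)])
    have i3: "integrable lborel (\<lambda>x. \<phi> (x - h n *\<^sub>R ax j) *\<^sub>R F x)"
      using F B by (intro integrable_mult_bounded[where B=B]) auto
    have "(\<lambda>x. \<phi> x *\<^sub>R (indicator S x *\<^sub>R (diff_quot j u (h n) x - g x)))
       = (\<lambda>x. (1 / h n) *\<^sub>R (\<phi> x *\<^sub>R F (x + h n *\<^sub>R ax j) - \<phi> x *\<^sub>R F x) - \<phi> x *\<^sub>R g x)"
    proof
      fix x
      show "\<phi> x *\<^sub>R (indicator S x *\<^sub>R (diff_quot j u (h n) x - g x))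
       = (1 / h n) *\<^sub>R (\<phi> x *\<^sub>R F (x + h n *\<^sub>R ax j) - \<phi> x *\<^sub>R F x) - \<phi> x *\<^sub>R g x"
      proof (cases "x \<in> S")
        case True
        have "x + h n *\<^sub>R ax j \<in> cball x r" using elim hn by (simp add: dist_norm)
        then have "x + h n *\<^sub>R ax j \<in> K'" using True by (auto simp: K'_def)
        then show ?thesis using True SK[OF True] by (simp add: F_def diff_quot_def algebra_simps)
      next
        case False
        then show ?thesis using S(3)[OF False] by simp
      qed
    qed
    then have "(LINT x|lborel. \<phi> x *\<^sub>R (indicator S x *\<^sub>R (diff_quot j u (h n) x - g x)))
      = (LINT x|lborel. (1 / h n) *\<^sub>R (\<phi> x *\<^sub>R F (x + h n *\<^sub>R ax j) - \<phi> x *\<^sub>R F x) - \<phi> x *\<^sub>R g x)" by simp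
    also have "\<dots> = (1 / h n) *\<^sub>R ((LINT x|lborel. \<phi> x *\<^sub>R F (x + h n *\<^sub>R ax j)) - (LINT x|lborel. \<phi> x *\<^sub>R F x)) - (LINT x|lborel. \<phi> x *\<^sub>R g x)"
      using i pg by simp
    also have "(LINT x|lborel. \<phi> x *\<^sub>R F (x + h n *\<^sub>R ax j)) = (LINT x|lborel. \<phi> (x - h n *\<^sub>R ax j) *\<^sub>R F x)"
      using integral_shift[of "\<lambda>x. \<phi> (x - h n *\<^sub>R ax j) *\<^sub>R F x" "h n *\<^sub>R ax j"] by simp
    also have "(1 / h n) *\<^sub>R (\<dots> - (LINT x|lborel. \<phi> x *\<^sub>R F x)) = (LINT x|lborel. (1 / h n) *\<^sub>R (\<phi> (x - h n *\<^sub>R ax j) *\<^sub>R F x - \<phi> x *\<^sub>R F x))"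
      using i i3 by simp
    also have "\<dots> = (LINT x|lborel. ((\<phi> (x - h n *\<^sub>R ax j) - \<phi> x) / h n) *\<^sub>R F x)"
      by (rule Bochner_Integration.integral_cong) (auto simp: scaleR_diff_left[symmetric] divide_inverse mult.commute)
    finally show ?case .
  qed
  have lim2: "(\<lambda>n. LINT x|lborel. ((\<phi> (x - h n *\<^sub>R ax j) - \<phi> x) / h n) *\<^sub>R F x) \<longlonglongrightarrow> (LINT x|lborel. (- partial j \<phi> x) *\<^sub>R F x)"
  proof (rule integral_dominated_convergence[where w="\<lambda>x. B' * norm (F x)"])
    show "AE x in lborel. (\<lambda>n. ((\<phi> (x - h n *\<^sub>R ax j) - \<phi> x) / h n) *\<^sub>R F x) \<longlonglongrightarrow> (- partial j \<phi> x) *\<^sub>R F x"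
    proof (intro AE_I2 tendsto_scaleR tendsto_const)
      fix x
      have "((\<lambda>t. (\<phi> (x + t *\<^sub>R ax j) - \<phi> x) / t) \<longlongrightarrow> partial j \<phi> x) (at 0)"
        using line_derivative[OF test_fun_differentiable[OF t], where x=x and t=0 and j=j] by (simp add: DERIV_def)
      moreover have "filterlim (\<lambda>n. - h n) (at 0) sequentially"
        using tendsto_minus[OF h(2)] h(1) by (auto simp: filterlim_at less_imp_neq[symmetric])
      ultimately have "(\<lambda>n. (\<phi> (x + (- h n) *\<^sub>R ax j) - \<phi> x) / (- h n)) \<longlonglongrightarrow> partial j \<phi> x"
        by (rule filterlim_compose)
      from tendsto_minus[OF this] show "(\<lambda>n. (\<phi> (x - h n *\<^sub>R ax j) - \<phi> x) / h n) \<longlonglongrightarrow> - partial j \<phi> x"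
        by simp
    qed
    show "AE x in lborel. norm (((\<phi> (x - h n *\<^sub>R ax j) - \<phi> x) / h n) *\<^sub>R F x) \<le> B' * norm (F x)" for n
    proof (intro AE_I2)
      fix x
      show "norm (((\<phi> (x - h n *\<^sub>R ax j) - \<phi> x) / h n) *\<^sub>R F x) \<le> B' * norm (F x)"
        unfolding norm_scaleR by (intro mult_right_mono FB) auto
    qed
  qed (use F in auto)
  have "(LINT x|lborel. (- partial j \<phi> x) *\<^sub>R F x) = - (LINT x|lborel. partial j \<phi> x *\<^sub>R u x)"
  proof -
    have "(\<lambda>x. (- partial j \<phi> x) *\<^sub>R F x) = (\<lambda>x. - (partial j \<phi> x *\<^sub>R u x))"
      by (intro ext) (use pz SK in \<open>auto simp: F_def indicator_def\<close>)
    then show ?thesis by simp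
  qed
  with lim2 have "(\<lambda>n. (LINT x|lborel. ((\<phi> (x - h n *\<^sub>R ax j) - \<phi> x) / h n) *\<^sub>R F x) - (LINT x|lborel. \<phi> x *\<^sub>R g x))
     \<longlonglongrightarrow> - (LINT x|lborel. partial j \<phi> x *\<^sub>R u x) - (LINT x|lborel. \<phi> x *\<^sub>R g x)"
    by (intro tendsto_diff tendsto_const) simp
  then have "(\<lambda>n. LINT x|lborel. \<phi> x *\<^sub>R (indicator S x *\<^sub>R (diff_quot j u (h n) x - g x)))
     \<longlonglongrightarrow> - (LINT x|lborel. partial j \<phi> x *\<^sub>R u x) - (LINT x|lborel. \<phi> x *\<^sub>R g x)"
    by (subst tendsto_cong[OF eq])
  from LIMSEQ_unique[OF this lim1]
  show "(LINT x|lborel. partial j \<phi> x *\<^sub>R u x) = - (LINT x|lborel. \<phi> x *\<^sub>R g x)"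
    by (metis minus_minus right_minus_eq)
qed

section \<open>Calculus rules for weak derivatives: C^1 functions, products, compositions\<close>

lemma tendsto_zeroI_le:
  fixes f :: "'a \<Rightarrow> real"
  assumes "\<And>e. e > 0 \<Longrightarrow> \<forall>\<^sub>F n in F. f n \<le> e" "\<And>n. f n \<ge> 0"
  shows "(f \<longlongrightarrow> 0) F"
proof (rule tendstoI)
  fix e :: real assume "e > 0"
  from assms(1)[of "e/2"] this have "\<forall>\<^sub>F n in F. f n \<le> e/2" by simp
  then show "\<forall>\<^sub>F n in F. dist (f n) 0 < e"
  proof eventually_elim
    case (elim n)
    then show ?case using assms(2)[of n] \<open>e > 0\<close> by simp
  qed
qed

text \<open>One direction at a time and without total differentiability, which is all that a weak
  derivative in direction j requires. The derivative is asked for at t = 0 only, but the base point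
  is arbitrary, so every point of each line is covered.\<close>

definition C1_dir :: "3 \<Rightarrow> (R3 \<Rightarrow> 'b::real_normed_vector) \<Rightarrow> (R3 \<Rightarrow> 'b) \<Rightarrow> bool" where
  "C1_dir j u u' \<longleftrightarrow> continuous_on UNIV u \<and> continuous_on UNIV u' \<and>
     (\<forall>x. ((\<lambda>t. u (x + t *\<^sub>R ax j)) has_vector_derivative u' x) (at 0))"

lemma C1_dir_line:
  assumes "C1_dir j u u'"
  shows "((\<lambda>t. u (x + t *\<^sub>R ax j)) has_vector_derivative u' (x + t *\<^sub>R ax j)) (at t)"
proof -
  have 1: "((\<lambda>s. u (x + t *\<^sub>R ax j + s *\<^sub>R ax j)) has_vector_derivative u' (x + t *\<^sub>R ax j)) (at ((\<lambda>s. s - t) t))"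
    using assms unfolding C1_dir_def by auto
  have 2: "((\<lambda>s. s - t) has_vector_derivative 1) (at t)"
    by (auto intro!: derivative_eq_intros)
  from vector_diff_chain_at[OF 2 1] show ?thesis
    by (simp add: o_def algebra_simps scaleR_add_left[symmetric] del: scaleR_add_left)
qed

text \<open>Mean value inequality for u(x + t e_j) - t u'(x) on [0, h], together with the uniform
  continuity of u' on the closed 1-neighbourhood of K.\<close>

lemma C1_dir_uniform:
  assumes u: "C1_dir j u u'" and K: "compact K" and e: "e > 0"
  shows "\<exists>d>0. \<forall>h x. 0 < h \<and> h < d \<and> x \<in> K \<longrightarrow> norm (diff_quot j u h x - u' x) \<le> e \<and> norm (u (x + h *\<^sub>R ax j) - u x) \<le> e"
proof -
  define K' where "K' = (\<Union>x\<in>K. cball x 1)"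
  have K': "compact K'"
    unfolding K'_def by (rule compact_Union_cball[OF K])
  have uc: "uniformly_continuous_on K' u'" "uniformly_continuous_on K' u"
    using u K' unfolding C1_dir_def by (auto intro!: compact_uniformly_continuous intro: continuous_on_subset)
  obtain d1 where d1: "d1 > 0" "\<And>x y. x \<in> K' \<Longrightarrow> y \<in> K' \<Longrightarrow> dist y x < d1 \<Longrightarrow> dist (u' y) (u' x) < e"
    using uniformly_continuous_onE[OF uc(1) e] by metis
  obtain d2 where d2: "d2 > 0" "\<And>x y. x \<in> K' \<Longrightarrow> y \<in> K' \<Longrightarrow> dist y x < d2 \<Longrightarrow> dist (u y) (u x) < e"
    using uniformly_continuous_onE[OF uc(2) e] by metis
  show ?thesis
  proof (intro exI[of _ "min 1 (min d1 d2)"] conjI allI impI)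
    show "min 1 (min d1 d2) > 0" using d1 d2 by auto
    fix h :: real and x assume hx: "0 < h \<and> h < min 1 (min d1 d2) \<and> x \<in> K"
    have inK: "x + t *\<^sub>R ax j \<in> K'" "dist (x + t *\<^sub>R ax j) x = t" if "t \<in> {0..h}" for t
    proof -
      show "dist (x + t *\<^sub>R ax j) x = t" using that by (simp add: dist_norm)
      then have "x + t *\<^sub>R ax j \<in> cball x 1" using hx that by (simp add: dist_commute)
      then show "x + t *\<^sub>R ax j \<in> K'" using hx by (auto simp: K'_def)
    qed
    have xK: "x \<in> K'" using inK(1)[of 0] hx by auto
    show "norm (u (x + h *\<^sub>R ax j) - u x) \<le> e"
      using d2(2)[OF xK inK(1)[of h]] inK(2)[of h] hx by (auto simp: dist_norm)
    define w where "w t = u (x + t *\<^sub>R ax j) - t *\<^sub>R u' x" for t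
    have "norm (w h - w 0) \<le> e * norm (h - 0)"
    proof (rule differentiable_bound[where S="{0..h}" and f'="\<lambda>t s. s *\<^sub>R (u' (x + t *\<^sub>R ax j) - u' x)"])
      fix t assume t: "t \<in> {0..h}"
      have "(w has_vector_derivative (u' (x + t *\<^sub>R ax j) - u' x)) (at t)"
        unfolding w_def[abs_def]
        by (rule has_vector_derivative_diff[OF C1_dir_line[OF u]]) (auto intro!: derivative_eq_intros simp: has_vector_derivative_def)
      then show "(w has_derivative (\<lambda>s. s *\<^sub>R (u' (x + t *\<^sub>R ax j) - u' x))) (at t within {0..h})"
        unfolding has_vector_derivative_def by (rule has_derivative_at_withinI)
      have "norm (u' (x + t *\<^sub>R ax j) - u' x) \<le> e"
        using d1(2)[OF xK inK(1)[OF t]] inK(2)[OF t] hx t by (auto simp: dist_norm)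
      then show "onorm (\<lambda>s. s *\<^sub>R (u' (x + t *\<^sub>R ax j) - u' x)) \<le> e"
        using e by (intro onorm_bound) (simp_all add: mult.commute[of _ "\<bar>_\<bar>"] mult_left_mono)
    qed (use hx in auto)
    then have "norm (u (x + h *\<^sub>R ax j) - u x - h *\<^sub>R u' x) \<le> e * h"
      using hx by (simp add: w_def algebra_simps)
    moreover have "diff_quot j u h x - u' x = (1/h) *\<^sub>R (u (x + h *\<^sub>R ax j) - u x - h *\<^sub>R u' x)"
      using hx by (simp add: diff_quot_def scaleR_diff_right)
    ultimately show "norm (diff_quot j u h x - u' x) \<le> e"
      using hx by (simp add: divide_le_eq)
  qed
qed

lemma continuous_loc_int:
  fixes u :: "R3 \<Rightarrow> 'b::{banach,second_countable_topology}"
  shows "continuous_on UNIV u \<Longrightarrow> loc_int U u"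
  unfolding loc_int_def set_integrable_def
  by (intro allI impI borel_integrable_compact) (auto intro: continuous_on_subset)

lemma continuous_diff_quot:
  fixes u :: "R3 \<Rightarrow> 'b::real_normed_vector"
  assumes "continuous_on UNIV u" shows "continuous_on UNIV (diff_quot j u h)"
proof -
  have "continuous_on UNIV (\<lambda>x. u (x + h *\<^sub>R ax j))"
    by (rule continuous_on_compose2[OF assms]) (auto intro!: continuous_intros)
  then show ?thesis unfolding diff_quot_def[abs_def] using assms by (intro continuous_intros)
qed

text \<open>Uniform convergence of the difference quotients on a compact set is L1 convergence
  there, because the set has finite measure.\<close>

lemma C1_dir_weak_partial:
  fixes u :: "R3 \<Rightarrow> 'b::{banach,second_countable_topology}"
  assumes u: "C1_dir j u u'" and U: "open U"
  shows "weak_partial U j u u'"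
proof (rule weak_partialI_diff_quot[OF U])
  have c: "continuous_on UNIV u" "continuous_on UNIV u'" using u by (auto simp: C1_dir_def)
  show "loc_int U u" "loc_int U u'" using c by (auto intro: continuous_loc_int)
  fix K :: "R3 set" assume K: "compact K"
  have Kb: "K \<in> sets borel" using K by (rule borel_compact)
  let ?h = "\<lambda>n. inverse (real (Suc n))"
  have i: "integrable lborel (\<lambda>x. indicator K x *\<^sub>R (diff_quot j u (?h n) x - u' x))" for n
    by (rule borel_integrable_compact[OF K]) (intro continuous_intros continuous_on_subset[OF c(2)] continuous_on_subset[OF continuous_diff_quot[OF c(1)]] subset_UNIV)
  have iK: "integrable lborel (indicator K :: R3 \<Rightarrow> real)"
    using K Kb by (intro integrable_real_indicator emeasure_bounded_finite compact_imp_bounded) auto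
  have "diff_quot_conv K j u u' ?h"
    unfolding diff_quot_conv_def
  proof (intro conjI allI i LIMSEQ_inverse_real_of_nat tendsto_zeroI_le)
    fix e :: real assume e: "e > 0"
    define e' where "e' = e / (measure lborel K + 1)"
    have mp: "measure lborel K + 1 > 0" by (simp add: add_nonneg_pos)
    have e': "e' > 0" using e mp by (simp add: e'_def)
    obtain d where d: "d > 0" "\<And>h x. 0 < h \<and> h < d \<and> x \<in> K \<Longrightarrow> norm (diff_quot j u h x - u' x) \<le> e'"
      using C1_dir_uniform[OF u K e'] by blast
    have "\<forall>\<^sub>F n in sequentially. ?h n < d" using LIMSEQ_inverse_real_of_nat d(1) by (rule order_tendstoD)
    then show "\<forall>\<^sub>F n in sequentially. (LINT x|lborel. norm (indicator K x *\<^sub>R (diff_quot j u (?h n) x - u' x))) \<le> e"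
    proof eventually_elim
      case (elim n)
      have "(LINT x|lborel. norm (indicator K x *\<^sub>R (diff_quot j u (?h n) x - u' x))) \<le> (LINT x|lborel. e' * indicator K x)"
      proof (rule integral_mono[OF integrable_norm[OF i]])
        show "norm (indicator K x *\<^sub>R (diff_quot j u (?h n) x - u' x)) \<le> e' * indicator K x" for x
          using d(2)[of "?h n" x] elim by (cases "x \<in> K") auto
      qed (use iK in auto)
      also have "\<dots> = e' * measure lborel K" by simp
      also have "\<dots> \<le> e' * (measure lborel K + 1)" using e' by (intro mult_left_mono) auto
      also have "\<dots> = e" using mp by (simp add: e'_def)
      finally show ?case .
    qed
  qed (auto intro: integral_nonneg_AE)
  then show "\<exists>h. diff_quot_conv K j u u' h" by blast
qed

lemma continuous_mult_integrable:
  fixes c f :: "R3 \<Rightarrow> complex"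
  assumes c: "continuous_on UNIV c" and K: "compact K" and f: "integrable lborel (\<lambda>x. indicator K x *\<^sub>R f x)"
  shows "integrable lborel (\<lambda>x. indicator K x *\<^sub>R (c x * f x))"
proof -
  have "compact (c ` K)" using c K by (intro compact_continuous_image) (auto intro: continuous_on_subset)
  from compact_imp_bounded[OF this] obtain B where B: "\<And>x. x \<in> K \<Longrightarrow> norm (c x) \<le> B"
    unfolding bounded_iff by auto
  have cm: "c \<in> borel_measurable borel" using c by (rule borel_measurable_continuous_onI)
  have eq: "(\<lambda>x. indicator K x *\<^sub>R (c x * f x)) = (\<lambda>x. c x * (indicator K x *\<^sub>R f x))" by (auto simp: fun_eq_iff)
  show ?thesis unfolding eq
  proof (rule Bochner_Integration.integrable_bound[where f="\<lambda>x. B * norm (indicator K x *\<^sub>R f x)"])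
    show "AE x in lborel. norm (c x * (indicator K x *\<^sub>R f x)) \<le> norm (B * norm (indicator K x *\<^sub>R f x))"
    proof (intro AE_I2)
      fix x
      show "norm (c x * (indicator K x *\<^sub>R f x)) \<le> norm (B * norm (indicator K x *\<^sub>R f x))"
      proof (cases "x \<in> K")
        case True
        have "norm (c x) * norm (f x) \<le> \<bar>B\<bar> * norm (f x)" using B[OF True] by (intro mult_right_mono) auto
        then show ?thesis using True by (simp add: norm_mult abs_mult)
      qed simp
    qed
    show "integrable lborel (\<lambda>x. B * norm (indicator K x *\<^sub>R f x))"
      by (intro integrable_mult_right integrable_norm f)
    show "(\<lambda>x. c x * (indicator K x *\<^sub>R f x)) \<in> borel_measurable lborel"
      using cm borel_measurable_integrable[OF f] by (intro borel_measurable_times) auto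
  qed
qed

lemma C1_dir_mult:
  fixes u v :: "R3 \<Rightarrow> complex"
  assumes "C1_dir j u u'" "C1_dir j v v'"
  shows "C1_dir j (\<lambda>x. u x * v x) (\<lambda>x. u x * v' x + u' x * v x)"
  unfolding C1_dir_def
proof (intro conjI allI)
  fix x
  show "((\<lambda>t. u (x + t *\<^sub>R ax j) * v (x + t *\<^sub>R ax j)) has_vector_derivative u x * v' x + u' x * v x) (at 0)"
    using has_vector_derivative_mult[OF C1_dir_line[OF assms(1), of x 0] C1_dir_line[OF assms(2), of x 0]] by simp
qed (use assms in \<open>auto simp: C1_dir_def intro!: continuous_intros\<close>)

text \<open>Leibniz rule for difference quotients with v taken at the shifted point. The increment
  of v and the error of its quotient are uniformly small on K and multiply fixed integrable
  functions; the error of the quotient of w is small in L1 and multiplies a bounded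
  function.\<close>

lemma weak_partial_mult_C1:
  fixes w g :: "R3 \<Rightarrow> complex"
  assumes wp: "weak_partial U j w g" and v: "C1_dir j v v'" and U: "open U"
  shows "weak_partial U j (\<lambda>x. v x * w x) (\<lambda>x. v x * g x + v' x * w x)"
proof (rule weak_partialI_diff_quot[OF U])
  have l: "loc_int U w" "loc_int U g" using wp by (auto simp: weak_partial_def)
  have c: "continuous_on UNIV v" "continuous_on UNIV v'" using v by (auto simp: C1_dir_def)
  have lm: "loc_int U (\<lambda>x. a x * b x)" if "continuous_on UNIV a" "loc_int U b" for a b :: "R3 \<Rightarrow> complex"
    using that continuous_mult_integrable unfolding loc_int_def set_integrable_def by blast
  show "loc_int U (\<lambda>x. v x * w x)" "loc_int U (\<lambda>x. v x * g x + v' x * w x)"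
    using c l by (auto intro!: lm loc_int_add)
  fix K assume K: "compact K" "K \<subseteq> U"
  obtain h where h: "\<And>n. h n > 0" "h \<longlonglongrightarrow> 0"
    "\<And>n. integrable lborel (\<lambda>x. indicator K x *\<^sub>R (diff_quot j w (h n) x - g x))"
    "(\<lambda>n. LINT x|lborel. norm (indicator K x *\<^sub>R (diff_quot j w (h n) x - g x))) \<longlonglongrightarrow> 0"
    using weak_partial_diff_quot_conv[OF wp U K] unfolding diff_quot_conv_def by blast
  have wi: "integrable lborel (\<lambda>x. indicator K x *\<^sub>R w x)" and gi: "integrable lborel (\<lambda>x. indicator K x *\<^sub>R g x)"
    using loc_int_restrict K l by auto
  have cs: "continuous_on UNIV (\<lambda>x. v (x + h n *\<^sub>R ax j))" for n
    by (rule continuous_on_compose2[OF c(1)]) (auto intro!: continuous_intros)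
  let ?v = "\<lambda>n x. v (x + h n *\<^sub>R ax j)"
  let ?Q = "\<lambda>n x. diff_quot j (\<lambda>x. v x * w x) (h n) x - (v x * g x + v' x * w x)"
  have eq: "?Q n x = ?v n x * (diff_quot j w (h n) x - g x) + (?v n x - v x) * g x + (diff_quot j v (h n) x - v' x) * w x" for n x
    by (simp add: diff_quot_def algebra_simps)
  have i1: "integrable lborel (\<lambda>x. indicator K x *\<^sub>R (?v n x * (diff_quot j w (h n) x - g x)))" for n
    by (rule continuous_mult_integrable[OF cs K(1) h(3)])
  have i2: "integrable lborel (\<lambda>x. indicator K x *\<^sub>R ((?v n x - v x) * g x))" for n
    by (rule continuous_mult_integrable[OF continuous_on_diff[OF cs c(1)] K(1) gi])
  have i3: "integrable lborel (\<lambda>x. indicator K x *\<^sub>R ((diff_quot j v (h n) x - v' x) * w x))" for n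
    by (rule continuous_mult_integrable[OF continuous_on_diff[OF continuous_diff_quot[OF c(1)] c(2)] K(1) wi])
  have i: "integrable lborel (\<lambda>x. indicator K x *\<^sub>R ?Q n x)" for n
    unfolding eq scaleR_add_right by (intro Bochner_Integration.integrable_add i1 i2 i3)
  have "compact (v ` K)" using c K by (intro compact_continuous_image) (auto intro: continuous_on_subset)
  from compact_imp_bounded[OF this] obtain B where B: "B > 0" "\<And>x. x \<in> K \<Longrightarrow> norm (v x) \<le> B"
    unfolding bounded_pos by auto
  define I where "I = (LINT x|lborel. norm (indicator K x *\<^sub>R g x)) + (LINT x|lborel. norm (indicator K x *\<^sub>R w x)) + 1"
  have I: "I > 0" unfolding I_def by (intro add_nonneg_pos add_nonneg_nonneg integral_nonneg_AE) auto
  have "diff_quot_conv K j (\<lambda>x. v x * w x) (\<lambda>x. v x * g x + v' x * w x) h"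
    unfolding diff_quot_conv_def
  proof (intro conjI allI i h tendsto_zeroI_le)
    fix e :: real assume e: "e > 0"
    \<comment> \<open>The minimum with 1 keeps the shifted values of v below B + 1.\<close>
    define e' where "e' = min 1 (e / (2 * I))"
    have e': "e' > 0" "e' \<le> 1" "e' * I \<le> e/2" using e I by (auto simp: e'_def min_def field_simps)
    obtain d where d: "d > 0" "\<And>h x. 0 < h \<and> h < d \<and> x \<in> K \<Longrightarrow> norm (diff_quot j v h x - v' x) \<le> e' \<and> norm (v (x + h *\<^sub>R ax j) - v x) \<le> e'"
      using C1_dir_uniform[OF v K(1) e'(1)] by blast
    have ev1: "\<forall>\<^sub>F n in sequentially. h n < d" using h(2) d(1) by (rule order_tendstoD)
    have ev2: "\<forall>\<^sub>F n in sequentially. (LINT x|lborel. norm (indicator K x *\<^sub>R (diff_quot j w (h n) x - g x))) < e / (2 * (B + 1))"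
      using h(4) e B by (intro order_tendstoD(2)[where y=0]) auto
    show "\<forall>\<^sub>F n in sequentially. (LINT x|lborel. norm (indicator K x *\<^sub>R ?Q n x)) \<le> e"
      using ev1 ev2
    proof eventually_elim
      case (elim n)
      let ?d = "\<lambda>x. diff_quot j w (h n) x - g x"
      have pt: "norm (indicator K x *\<^sub>R ?Q n x) \<le> (B + 1) * norm (indicator K x *\<^sub>R ?d x) + (e' * norm (indicator K x *\<^sub>R g x) + e' * norm (indicator K x *\<^sub>R w x))" for x
      proof (cases "x \<in> K")
        case True
        note D = d(2)[of "h n" x]
        have n1: "norm (diff_quot j v (h n) x - v' x) \<le> e'" "norm (?v n x - v x) \<le> e'"
          using D True elim h(1) by auto
        have "norm (?v n x) \<le> norm (v x) + norm (?v n x - v x)" by (metis add.commute diff_add_cancel norm_triangle_ineq)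
        then have n2: "norm (?v n x) \<le> B + 1" using n1(2) e'(2) B(2)[OF True] by linarith
        have "norm (?Q n x) \<le> norm (?v n x * ?d x) + norm ((?v n x - v x) * g x) + norm ((diff_quot j v (h n) x - v' x) * w x)"
          unfolding eq by (intro norm_triangle_le add_mono norm_triangle_ineq order_refl)
        also have "\<dots> \<le> (B + 1) * norm (?d x) + e' * norm (g x) + e' * norm (w x)"
          unfolding norm_mult using n1 n2 by (intro add_mono mult_right_mono) auto
        finally show ?thesis using True by simp
      qed simp
      have "(LINT x|lborel. norm (indicator K x *\<^sub>R ?Q n x)) \<le>
          (LINT x|lborel. (B + 1) * norm (indicator K x *\<^sub>R ?d x) + (e' * norm (indicator K x *\<^sub>R g x) + e' * norm (indicator K x *\<^sub>R w x)))"
        by (rule integral_mono[OF integrable_norm[OF i] _ pt])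
          (intro Bochner_Integration.integrable_add integrable_mult_right integrable_norm h(3) gi wi)
      also have "\<dots> = (B + 1) * (LINT x|lborel. norm (indicator K x *\<^sub>R ?d x)) +
          (e' * (LINT x|lborel. norm (indicator K x *\<^sub>R g x)) + e' * (LINT x|lborel. norm (indicator K x *\<^sub>R w x)))"
        by (subst Bochner_Integration.integral_add; (subst Bochner_Integration.integral_add)?;
          (intro Bochner_Integration.integrable_add integrable_mult_right integrable_norm h(3) gi wi)?)
          (simp_all only: integral_mult_right_zero)
      also have "\<dots> \<le> (B + 1) * (e / (2 * (B + 1))) + e' * I"
      proof (rule add_mono)
        show "(B + 1) * (LINT x|lborel. norm (indicator K x *\<^sub>R ?d x)) \<le> (B + 1) * (e / (2 * (B + 1)))"
          using elim(2) B(1) by (intro mult_left_mono) auto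
        show "e' * (LINT x|lborel. norm (indicator K x *\<^sub>R g x)) + e' * (LINT x|lborel. norm (indicator K x *\<^sub>R w x)) \<le> e' * I"
          using e'(1) by (simp add: I_def distrib_left)
      qed
      also have "(B + 1) * (e / (2 * (B + 1))) = e/2" using B(1) by (simp add: field_simps)
      finally show ?case using e'(3) by linarith
    qed
  qed (auto intro: integral_nonneg_AE)
  then show "\<exists>h. diff_quot_conv K j (\<lambda>x. v x * w x) (\<lambda>x. v x * g x + v' x * w x) h" by blast
qed

text \<open>Along a subsequence the difference quotients of u converge almost everywhere, hence so
  do those of T(u), by differentiability of T. As T is a contraction, the latter are dominated by
  the quotients of u, which are not dominated by a fixed function but converge in L1; this is
  enough.\<close>

lemma weak_partial_chain:
  fixes u g :: "R3 \<Rightarrow> complex" and T :: "complex \<Rightarrow> complex"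
  assumes wp: "weak_partial U j u g" and U: "open U"
    and T: "\<And>z. (T has_derivative DT z) (at z)" and L: "\<And>z w. norm (T z - T w) \<le> norm (z - w)"
    and DTm: "(\<lambda>(z, w). DT z w) \<in> borel_measurable (borel \<Otimes>\<^sub>M borel)" and DTb: "\<And>z w. norm (DT z w) \<le> norm w"
  shows "weak_partial U j (\<lambda>x. T (u x)) (\<lambda>x. DT (u x) (g x))"
proof (rule weak_partialI_diff_quot[OF U])
  have l: "loc_int U u" "loc_int U g" using wp by (auto simp: weak_partial_def)
  have Tc: "continuous_on UNIV T"
    using T by (meson continuous_at_imp_continuous_on has_derivative_continuous)
  have Tm [measurable]: "T \<in> borel_measurable borel" using Tc by (rule borel_measurable_continuous_onI)
  have DTl: "DT z (0) = 0" "DT z (r *\<^sub>R w) = r *\<^sub>R DT z w" for z w r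
    using has_derivative_linear[OF T[of z]] by (auto simp: linear_0 linear_scale)
  have Km: "(\<lambda>x. indicator K x *\<^sub>R a x) \<in> borel_measurable borel" if "compact K" "K \<subseteq> U" "loc_int U a" for K and a :: "R3 \<Rightarrow> complex"
    using loc_int_restrict[OF that(3,1,2)] borel_measurable_integrable by auto
  have iDT: "integrable lborel (\<lambda>x. indicator K x *\<^sub>R DT (u x) (g x))" if K: "compact K" "K \<subseteq> U" for K
  proof -
    have [measurable]: "K \<in> sets borel" using K by (auto intro: borel_compact)
    note [measurable] = Km[OF K l(1)] Km[OF K l(2)]
    have "(\<lambda>x. (\<lambda>(z, w). DT z w) (indicator K x *\<^sub>R u x, indicator K x *\<^sub>R g x)) \<in> borel_measurable borel"
      by (rule measurable_compose[OF _ DTm]) measurable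
    moreover have "(\<lambda>x. (\<lambda>(z, w). DT z w) (indicator K x *\<^sub>R u x, indicator K x *\<^sub>R g x)) = (\<lambda>x. indicator K x *\<^sub>R DT (u x) (g x))"
      by (auto simp: fun_eq_iff indicator_def DTl)
    ultimately have m: "(\<lambda>x. indicator K x *\<^sub>R DT (u x) (g x)) \<in> borel_measurable borel" by simp
    show ?thesis
      by (rule Bochner_Integration.integrable_bound[OF loc_int_restrict[OF l(2) K]])
        (use m DTb in \<open>auto simp: indicator_def\<close>)
  qed
  have iT: "integrable lborel (\<lambda>x. indicator K x *\<^sub>R T (u x))" if K: "compact K" "K \<subseteq> U" for K
  proof -
    have Kb [measurable]: "K \<in> sets borel" using K by (auto intro: borel_compact)
    note [measurable] = Km[OF K l(1)]
    have "(\<lambda>x. indicator K x *\<^sub>R T (indicator K x *\<^sub>R u x)) \<in> borel_measurable borel" by measurable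
    moreover have "(\<lambda>x. indicator K x *\<^sub>R T (indicator K x *\<^sub>R u x)) = (\<lambda>x. indicator K x *\<^sub>R T (u x))"
      by (auto simp: fun_eq_iff indicator_def)
    ultimately have m: "(\<lambda>x. indicator K x *\<^sub>R T (u x)) \<in> borel_measurable borel" by simp
    have i1: "integrable lborel (\<lambda>x. norm (indicator K x *\<^sub>R u x) + norm (T 0) * indicator K x)"
      using K Kb by (intro Bochner_Integration.integrable_add integrable_norm[OF loc_int_restrict[OF l(1) K]] integrable_mult_right integrable_real_indicator emeasure_bounded_finite compact_imp_bounded)
        auto
    show ?thesis
    proof (rule Bochner_Integration.integrable_bound[OF i1])
      show "AE x in lborel. norm (indicator K x *\<^sub>R T (u x)) \<le> norm (norm (indicator K x *\<^sub>R u x) + norm (T 0) * indicator K x)"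
      proof (intro AE_I2)
        fix x
        have "norm (T (u x)) \<le> norm (T (u x) - T 0) + norm (T 0)" by (metis diff_add_cancel norm_triangle_ineq)
        then show "norm (indicator K x *\<^sub>R T (u x)) \<le> norm (norm (indicator K x *\<^sub>R u x) + norm (T 0) * indicator K x)"
          using L[of "u x" 0] by (auto simp: indicator_def)
      qed
    qed (use m in auto)
  qed
  show "loc_int U (\<lambda>x. T (u x))" "loc_int U (\<lambda>x. DT (u x) (g x))"
    unfolding loc_int_def set_integrable_def using iT iDT by auto
  fix K assume K: "compact K" "K \<subseteq> U"
  have Kb [measurable]: "K \<in> sets borel" using K by (auto intro: borel_compact)
  obtain h where h: "\<And>n. h n > 0" "h \<longlonglongrightarrow> 0"
    "\<And>n. integrable lborel (\<lambda>x. indicator K x *\<^sub>R (diff_quot j u (h n) x - g x))"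
    "(\<lambda>n. LINT x|lborel. norm (indicator K x *\<^sub>R (diff_quot j u (h n) x - g x))) \<longlonglongrightarrow> 0"
    using weak_partial_diff_quot_conv[OF wp U K] unfolding diff_quot_conv_def by blast
  obtain r where r: "strict_mono r"
    "AE x in lborel. (\<lambda>n. indicator K x *\<^sub>R (diff_quot j u (h (r n)) x - g x)) \<longlonglongrightarrow> 0"
    using tendsto_L1_AE_subseq[OF h(3,4)] by auto
  define k where "k n = h (r n)" for n
  have k: "\<And>n. k n > 0" "k \<longlonglongrightarrow> 0"
    "\<And>n. integrable lborel (\<lambda>x. indicator K x *\<^sub>R (diff_quot j u (k n) x - g x))"
    "(\<lambda>n. LINT x|lborel. norm (indicator K x *\<^sub>R (diff_quot j u (k n) x - g x))) \<longlonglongrightarrow> 0"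
    "AE x in lborel. (\<lambda>n. indicator K x *\<^sub>R (diff_quot j u (k n) x - g x)) \<longlonglongrightarrow> 0"
    using h r LIMSEQ_subseq_LIMSEQ[OF h(2) r(1)] LIMSEQ_subseq_LIMSEQ[OF h(4) r(1)] unfolding k_def by (auto simp: o_def)
  let ?d = "\<lambda>n x. indicator K x *\<^sub>R (diff_quot j u (k n) x - g x)"
  let ?D = "\<lambda>n x. indicator K x *\<^sub>R (diff_quot j (\<lambda>x. T (u x)) (k n) x - DT (u x) (g x))"
  have gi: "integrable lborel (\<lambda>x. indicator K x *\<^sub>R g x)" by (rule loc_int_restrict[OF l(2) K])
  have dT: "norm (diff_quot j (\<lambda>x. T (u x)) s x) \<le> norm (diff_quot j u s x)" for s x
    unfolding diff_quot_def using L by (auto intro: divide_right_mono)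
  have Db: "norm (?D n x) \<le> norm (?d n x) + 2 * norm (indicator K x *\<^sub>R g x)" for n x
  proof (cases "x \<in> K")
    case True
    have "norm (diff_quot j (\<lambda>x. T (u x)) (k n) x - DT (u x) (g x)) \<le> norm (diff_quot j u (k n) x) + norm (g x)"
      by (rule order_trans[OF norm_triangle_ineq4 add_mono[OF dT DTb]])
    also have "norm (diff_quot j u (k n) x) \<le> norm (diff_quot j u (k n) x - g x) + norm (g x)"
      by (metis diff_add_cancel norm_triangle_ineq)
    finally show ?thesis using True by simp
  qed simp
  \<comment> \<open>Since u is measurable only on compact subsets of U, measurability of its
    translate on K is read off from the integrable difference quotient.\<close>
  have Dm: "?D n \<in> borel_measurable borel" for n
  proof -
    have 1: "(\<lambda>x. indicator K x *\<^sub>R u x) \<in> borel_measurable borel" by (rule Km[OF K l(1)])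
    have "?d n \<in> borel_measurable borel" "(\<lambda>x. indicator K x *\<^sub>R g x) \<in> borel_measurable borel"
      using k(3)[of n] gi borel_measurable_integrable by auto
    then have "(\<lambda>x. indicator K x *\<^sub>R u x + k n *\<^sub>R (?d n x + indicator K x *\<^sub>R g x)) \<in> borel_measurable borel"
      using 1 by measurable
    moreover have "(\<lambda>x. indicator K x *\<^sub>R u x + k n *\<^sub>R (?d n x + indicator K x *\<^sub>R g x)) = (\<lambda>x. indicator K x *\<^sub>R u (x + k n *\<^sub>R ax j))"
      using k(1)[of n] by (auto simp: fun_eq_iff indicator_def diff_quot_def)
    ultimately have 2 [measurable]: "(\<lambda>x. indicator K x *\<^sub>R u (x + k n *\<^sub>R ax j)) \<in> borel_measurable borel" by simp
    note [measurable] = 1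
    have 3 [measurable]: "(\<lambda>x. indicator K x *\<^sub>R DT (u x) (g x)) \<in> borel_measurable borel"
      using iDT[OF K] borel_measurable_integrable by auto
    have "(\<lambda>x. indicator K x *\<^sub>R ((1 / k n) *\<^sub>R (T (indicator K x *\<^sub>R u (x + k n *\<^sub>R ax j)) - T (indicator K x *\<^sub>R u x)) - indicator K x *\<^sub>R DT (u x) (g x))) \<in> borel_measurable borel"
      by measurable
    moreover have "(\<lambda>x. indicator K x *\<^sub>R ((1 / k n) *\<^sub>R (T (indicator K x *\<^sub>R u (x + k n *\<^sub>R ax j)) - T (indicator K x *\<^sub>R u x)) - indicator K x *\<^sub>R DT (u x) (g x))) = ?D n"
      by (auto simp: fun_eq_iff indicator_def diff_quot_def)
    ultimately show ?thesis by simp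
  qed
  have Di: "integrable lborel (?D n)" for n
  proof (rule Bochner_Integration.integrable_bound[where f="\<lambda>x. norm (?d n x) + 2 * norm (indicator K x *\<^sub>R g x)"])
    show "integrable lborel (\<lambda>x. norm (?d n x) + 2 * norm (indicator K x *\<^sub>R g x))"
      by (intro Bochner_Integration.integrable_add integrable_norm integrable_mult_right k(3) gi)
  qed (use Dm in \<open>auto intro!: AE_I2 order_trans[OF Db] simp del: norm_scaleR\<close>)
  \<comment> \<open>The excess of the new error over the old one is dominated by 2 |g| and tends to
    zero almost everywhere, so dominated convergence applies to the excess rather than to the error
    itself.\<close>
  define m where "m n x = max 0 (norm (?D n x) - norm (?d n x))" for n x
  have mlim: "(\<lambda>n. LINT x|lborel. m n x) \<longlonglongrightarrow> (LINT (x::R3)|lborel. 0)"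
  proof (rule integral_dominated_convergence[where w="\<lambda>x. 2 * norm (indicator K x *\<^sub>R g x)"])
    show "m n \<in> borel_measurable lborel" for n
      using borel_measurable_integrable[OF k(3)[of n]] Dm[of n] unfolding m_def[abs_def] by measurable
    show "integrable lborel (\<lambda>x. 2 * norm (indicator K x *\<^sub>R g x))" by (intro integrable_mult_right integrable_norm gi)
    show "AE x in lborel. norm (m n x) \<le> 2 * norm (indicator K x *\<^sub>R g x)" for n
    proof (intro AE_I2)
      fix x
      show "norm (m n x) \<le> 2 * norm (indicator K x *\<^sub>R g x)" using Db[where n=n and x=x] unfolding m_def by (auto simp del: norm_scaleR)
    qed
    show "AE x in lborel. (\<lambda>n. m n x) \<longlonglongrightarrow> 0"
      using k(5)
    proof eventually_elim
      case (elim x)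
      show ?case
      proof (cases "x \<in> K")
        case True
        have q: "(\<lambda>n. diff_quot j u (k n) x) \<longlonglongrightarrow> g x"
          using elim True by (simp add: LIM_zero_iff)
        define c where "c n = k n *\<^sub>R diff_quot j u (k n) x" for n
        have c: "c \<longlonglongrightarrow> 0" using tendsto_scaleR[OF k(2) q] by (simp add: c_def[abs_def])
        have ux: "u (x + k n *\<^sub>R ax j) = u x + c n" for n using k(1)[of n] by (simp add: c_def diff_quot_def)
        obtain E where E: "(\<lambda>y. T (u x + y)) = (\<lambda>y. T (u x) + DT (u x) y + E y)" and E0: "((\<lambda>y. norm (E y) / norm y) \<longlongrightarrow> 0) (at 0)"
        proof
          show "(\<lambda>y. T (u x + y)) = (\<lambda>y. T (u x) + DT (u x) y + (T (u x + y) - T (u x) - DT (u x) y))" by (simp add: fun_eq_iff)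
          show "((\<lambda>y. norm (T (u x + y) - T (u x) - DT (u x) y) / norm y) \<longlongrightarrow> 0) (at 0)"
            using T[of "u x"] unfolding has_derivative_at by auto
        qed
        have E00: "E 0 = 0" using fun_cong[OF E, of 0] DTl by simp
        define \<eta> where "\<eta> y = norm (E y) / norm y" for y
        have "(\<eta> \<longlongrightarrow> \<eta> 0) (at 0)" using E0 by (simp add: \<eta>_def[abs_def])
        then have "isCont \<eta> 0" by (simp add: isCont_def)
        then have \<eta>l: "(\<lambda>n. \<eta> (c n)) \<longlonglongrightarrow> 0"
          using isCont_tendsto_compose[OF _ c, of \<eta>] by (simp add: \<eta>_def)
        have "norm (diff_quot j (\<lambda>x. T (u x)) (k n) x - DT (u x) (diff_quot j u (k n) x)) = \<eta> (c n) * norm (diff_quot j u (k n) x)" for n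
        proof -
          have "diff_quot j (\<lambda>x. T (u x)) (k n) x = (1 / k n) *\<^sub>R (DT (u x) (c n) + E (c n))"
            using fun_cong[OF E, of "c n"] by (simp add: diff_quot_def ux)
          also have "\<dots> = DT (u x) (diff_quot j u (k n) x) + (1 / k n) *\<^sub>R E (c n)"
            using k(1)[of n] by (simp add: c_def DTl scaleR_add_right)
          finally have "norm (diff_quot j (\<lambda>x. T (u x)) (k n) x - DT (u x) (diff_quot j u (k n) x)) = norm (E (c n)) / k n"
            using k(1)[of n] by simp
          also have "\<dots> = \<eta> (c n) * norm (diff_quot j u (k n) x)"
          proof (cases "c n = 0")
            case False
            then show ?thesis using k(1)[of n] by (simp add: \<eta>_def c_def field_simps)
          qed (simp add: E00 \<eta>_def)
          finally show ?thesis .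
        qed
        then have "(\<lambda>n. norm (diff_quot j (\<lambda>x. T (u x)) (k n) x - DT (u x) (diff_quot j u (k n) x))) \<longlonglongrightarrow> 0"
          using tendsto_mult[OF \<eta>l tendsto_norm[OF q]] by simp
        then have a: "(\<lambda>n. diff_quot j (\<lambda>x. T (u x)) (k n) x - DT (u x) (diff_quot j u (k n) x)) \<longlonglongrightarrow> 0"
          by (rule tendsto_norm_zero_cancel)
        have b: "(\<lambda>n. DT (u x) (diff_quot j u (k n) x)) \<longlonglongrightarrow> DT (u x) (g x)"
          using bounded_linear.tendsto[OF has_derivative_bounded_linear[OF T] q] .
        have "(\<lambda>n. diff_quot j (\<lambda>x. T (u x)) (k n) x) \<longlonglongrightarrow> DT (u x) (g x)"
          using tendsto_add[OF a b] by simp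
        then have 1: "(\<lambda>n. ?D n x) \<longlonglongrightarrow> 0" using True by (simp add: LIM_zero_iff)
        have "(\<lambda>n. m n x) \<longlonglongrightarrow> max 0 (norm (0::complex) - norm (0::complex))"
          unfolding m_def by (intro tendsto_intros 1 elim)
        then show ?thesis by simp
      qed (simp add: m_def)
    qed
  qed auto
  have mi: "integrable lborel (m n)" for n
    unfolding m_def[abs_def] by (intro integrable_max Bochner_Integration.integrable_diff integrable_norm Di k(3)) auto
  have "diff_quot_conv K j (\<lambda>x. T (u x)) (\<lambda>x. DT (u x) (g x)) k"
    unfolding diff_quot_conv_def
  proof (intro conjI allI k Di)
    show "(\<lambda>n. LINT x|lborel. norm (?D n x)) \<longlonglongrightarrow> 0"
    proof (rule tendsto_sandwich[OF _ _ tendsto_const])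
      show "\<forall>\<^sub>F n in sequentially. 0 \<le> (LINT x|lborel. norm (?D n x))" by (auto intro: integral_nonneg_AE)
      show "\<forall>\<^sub>F n in sequentially. (LINT x|lborel. norm (?D n x)) \<le> (LINT x|lborel. m n x) + (LINT x|lborel. norm (?d n x))"
      proof (rule always_eventually, rule allI)
        fix n
        have "(LINT x|lborel. norm (?D n x)) \<le> (LINT x|lborel. m n x + norm (?d n x))"
          by (intro integral_mono integrable_norm Di Bochner_Integration.integrable_add mi k(3)) (auto simp: m_def)
        also have "\<dots> = (LINT x|lborel. m n x) + (LINT x|lborel. norm (?d n x))"
          by (intro Bochner_Integration.integral_add mi integrable_norm k(3))
        finally show "(LINT x|lborel. norm (?D n x)) \<le> (LINT x|lborel. m n x) + (LINT x|lborel. norm (?d n x))" .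
      qed
      show "(\<lambda>n. (LINT x|lborel. m n x) + (LINT x|lborel. norm (?d n x))) \<longlonglongrightarrow> 0"
        using tendsto_add[OF mlim k(4)] by simp
    qed
  qed
  then show "\<exists>h. diff_quot_conv K j (\<lambda>x. T (u x)) (\<lambda>x. DT (u x) (g x)) h" by blast
qed

lemma weak_partial_add:
  fixes u u' :: "R3 \<Rightarrow> 'b::{banach,second_countable_topology}"
  assumes "weak_partial U j u g" "weak_partial U j u' g'"
  shows "weak_partial U j (\<lambda>x. u x + u' x) (\<lambda>x. g x + g' x)"
  unfolding weak_partial_iff
proof (intro conjI allI impI)
  have l: "loc_int U u" "loc_int U g" "loc_int U u'" "loc_int U g'" using assms by (auto simp: weak_partial_def)
  then show "loc_int U (\<lambda>x. u x + u' x)" "loc_int U (\<lambda>x. g x + g' x)" by (auto intro: loc_int_add)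
  fix \<phi> assume t: "test_fun U \<phi>"
  show "(LINT x|lborel. partial j \<phi> x *\<^sub>R (u x + u' x)) = - (LINT x|lborel. \<phi> x *\<^sub>R (g x + g' x))"
    using assms t test_fun_mult_integrable(2)[OF l(1) t, of j] test_fun_mult_integrable(1)[OF l(2) t] test_fun_mult_integrable(2)[OF l(3) t, of j] test_fun_mult_integrable(1)[OF l(4) t]
    by (simp add: weak_partial_iff scaleR_add_right)
qed

section \<open>Smooth truncation\<close>

text \<open>A contractive \<open>C\<^sup>1\<close> substitute for the radial projection onto the unit disc, in terms of \<open>w = |z|\<^sup>2\<close>: the factor
  \<open>(2 * w - 1) / w\<^sup>2\<close> joins \<open>1\<close> to first order at \<open>w = 1\<close>. Since \<open>trunc\<close> commutes with rotations, its derivative commutes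
  with covariant differentiation.\<close>

definition trunc_fac :: "real \<Rightarrow> real" where
  "trunc_fac w = (if w \<le> 1 then 1 else (2 * w - 1) / w\<^sup>2)"

definition trunc_fac' :: "real \<Rightarrow> real" where
  "trunc_fac' w = (if w \<le> 1 then 0 else (2 - 2 * w) / w ^ 3)"

lemma trunc_fac_deriv: "(trunc_fac has_real_derivative trunc_fac' w) (at w)"
proof -
  consider "w < 1" | "w > 1" | "w = 1" by linarith
  then show ?thesis
  proof cases
    case 1
    have "((\<lambda>w. 1) has_real_derivative trunc_fac' w) (at w)"
      using 1 by (auto simp: trunc_fac'_def)
    then show ?thesis
      by (rule has_field_derivative_transform_within_open[where S="{..<1}"]) (use 1 in \<open>auto simp: trunc_fac_def\<close>)
  next
    case 2
    have "((\<lambda>w. (2 * w - 1) / w\<^sup>2) has_real_derivative trunc_fac' w) (at w)"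
      using 2 by (auto intro!: derivative_eq_intros simp: trunc_fac'_def field_simps power2_eq_square power3_eq_cube)
    then show ?thesis
      by (rule has_field_derivative_transform_within_open[where S="{1<..}"]) (use 2 in \<open>auto simp: trunc_fac_def\<close>)
  next
    case 3
    have "((\<lambda>h. (trunc_fac (1 + h) - trunc_fac 1) / h) \<longlongrightarrow> 0) (at 0)"
    proof (rule Lim_null_comparison)
      show "\<forall>\<^sub>F h in at 0. norm ((trunc_fac (1 + h) - trunc_fac 1) / h) \<le> \<bar>h\<bar>"
      proof (rule always_eventually, rule allI)
        fix h :: real
        show "norm ((trunc_fac (1 + h) - trunc_fac 1) / h) \<le> \<bar>h\<bar>"
        proof (cases "h > 0")
          case True
          \<comment> \<open>The two branches have contact of second order at 1, so the increment is
            quadratic in h.\<close>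
          have "trunc_fac (1 + h) - trunc_fac 1 = - (h * h / (1 + h)\<^sup>2)"
          proof -
            have "(1 + h)\<^sup>2 \<noteq> 0" using True by simp
            then have "(2 * (1 + h) - 1) / (1 + h)\<^sup>2 - 1 = ((2 * (1 + h) - 1) - (1 + h)\<^sup>2) / (1 + h)\<^sup>2"
              by (simp only: diff_divide_distrib) simp
            also have "(2 * (1 + h) - 1) - (1 + h)\<^sup>2 = - (h * h)" by (simp add: power2_eq_square algebra_simps)
            finally show ?thesis using True by (simp add: trunc_fac_def)
          qed
          then have "(trunc_fac (1 + h) - trunc_fac 1) / h = - (h / (1 + h)\<^sup>2)"
            using True by simp
          moreover have "h / (1 + h)\<^sup>2 \<le> h / 1" using True one_le_power[of "1 + h" 2] by (intro divide_left_mono) auto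
          ultimately show ?thesis using True by simp
        next
          case False
          then show ?thesis by (simp add: trunc_fac_def)
        qed
      qed
    qed (auto intro!: tendsto_eq_intros)
    then show ?thesis using 3 by (simp add: DERIV_def trunc_fac'_def)
  qed
qed

definition trunc :: "complex \<Rightarrow> complex" where
  "trunc z = trunc_fac ((norm z)\<^sup>2) *\<^sub>R z"

definition dtrunc :: "complex \<Rightarrow> complex \<Rightarrow> complex" where
  "dtrunc z w = trunc_fac ((norm z)\<^sup>2) *\<^sub>R w + (2 * trunc_fac' ((norm z)\<^sup>2) * (z \<bullet> w)) *\<^sub>R z"

lemma trunc_has_derivative: "(trunc has_derivative dtrunc z) (at z)"
proof -
  have 1: "((\<lambda>z::complex. (norm z)\<^sup>2) has_derivative (\<lambda>w. 2 * (z \<bullet> w))) (at z)"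
    unfolding power2_norm_eq_inner by (auto intro!: derivative_eq_intros simp: inner_commute)
  have "((\<lambda>z::complex. trunc_fac ((norm z)\<^sup>2)) has_derivative (\<lambda>w. trunc_fac' ((norm z)\<^sup>2) * (2 * (z \<bullet> w)))) (at z)"
    using has_derivative_compose[OF 1 trunc_fac_deriv[unfolded has_field_derivative_def]] .
  from has_derivative_scaleR[OF this has_derivative_ident]
  show ?thesis unfolding trunc_def[abs_def] dtrunc_def[abs_def] by (simp add: mult_ac)
qed

text \<open>Let |z| > 1 and let k, k' be the values of \<open>trunc_fac\<close> and
  \<open>trunc_fac'\<close> at W = |z|^2. The squared norm is k^2 |w|^2 plus a nonnegative multiple
  of k' (k + k' W). Here k' <= 0 and k + k' W = 1 / W^2 > 0, so the extra term only helps, and 0 <=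
  k <= 1.\<close>

lemma dtrunc_le: "norm (dtrunc z w) \<le> norm w"
proof (cases "(norm z)\<^sup>2 \<le> 1")
  case False
  define W where "W = (norm z)\<^sup>2"
  define k where "k = trunc_fac W"
  define k' where "k' = trunc_fac' W"
  have W: "W > 1" using False by (simp add: W_def)
  have k: "k = (2 * W - 1) / W\<^sup>2" "k' = (2 - 2 * W) / W ^ 3" using W by (auto simp: k_def k'_def trunc_fac_def trunc_fac'_def)
  have kk: "k + k' * W = 1 / W\<^sup>2" using W by (simp add: k field_simps power2_eq_square power3_eq_cube)
  have k1: "0 \<le> k" "k \<le> 1"
  proof -
    show "0 \<le> k" using W by (simp add: k)
    have "0 \<le> (W - 1)\<^sup>2" by simp
    then have "2 * W - 1 \<le> W\<^sup>2" by (simp add: power2_eq_square algebra_simps)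
    then show "k \<le> 1" using W by (simp add: k divide_le_eq)
  qed
  have k'0: "k' \<le> 0" using W by (simp add: k divide_le_0_iff)
  have "(norm (dtrunc z w))\<^sup>2 = k\<^sup>2 * (norm w)\<^sup>2 + 4 * k' * (z \<bullet> w)\<^sup>2 * (k + k' * W)"
    unfolding dtrunc_def W_def[symmetric] k_def[symmetric] k'_def[symmetric]
    unfolding power2_norm_eq_inner W_def
    by (simp add: inner_add_left inner_add_right inner_commute power2_eq_square algebra_simps)
  also have "\<dots> \<le> k\<^sup>2 * (norm w)\<^sup>2"
    unfolding kk using k'0 by (simp add: mult_nonpos_nonneg divide_nonpos_nonneg)
  also have "\<dots> \<le> 1 * (norm w)\<^sup>2" by (rule mult_right_mono[OF power_le_one[OF k1]]) simp
  finally have "(norm (dtrunc z w))\<^sup>2 \<le> (norm w)\<^sup>2" by simp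
  then show ?thesis by (rule power2_le_imp_le) simp
qed (auto simp: dtrunc_def trunc_fac_def trunc_fac'_def)

lemma trunc_lipschitz: "norm (trunc z - trunc w) \<le> norm (z - w)"
proof -
  have "norm (trunc z - trunc w) \<le> 1 * norm (z - w)"
    by (rule differentiable_bound[where S=UNIV and f'=dtrunc])
      (auto simp: trunc_has_derivative onorm_bound dtrunc_le)
  then show ?thesis by simp
qed

lemma dtrunc_measurable: "(\<lambda>(z, w). dtrunc z w) \<in> borel_measurable (borel \<Otimes>\<^sub>M borel)"
  unfolding dtrunc_def trunc_fac_def trunc_fac'_def by measurable

text \<open>The vector i c z is orthogonal to z in the real inner product, so only the complex
  linear part of \<open>dtrunc\<close> sees the correction.\<close>

lemma dtrunc_gauge: "dtrunc z (w - \<i> * of_real c * z) = dtrunc z w - \<i> * of_real c * trunc z"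
proof -
  have "z \<bullet> (w - \<i> * of_real c * z) = z \<bullet> w"
    by (simp add: inner_complex_def algebra_simps)
  then show ?thesis by (simp add: dtrunc_def trunc_def scaleR_conv_of_real algebra_simps)
qed

lemma trunc_norm_sq: "(norm (trunc z))\<^sup>2 = (trunc_fac ((norm z)\<^sup>2))\<^sup>2 * (norm z)\<^sup>2"
  by (simp add: trunc_def power_mult_distrib)

text \<open>For W = |z|^2 > 1 the squared modulus of the truncation is X = (2 W - 1)^2 / W^3, and 2
  - W <= X <= W. Hence X is at least as close to 1 as W, so truncation does not raise the potential
  energy.\<close>

lemma trunc_bounds: "norm (trunc z) \<le> 2" "(1 - (norm (trunc z))\<^sup>2)\<^sup>2 \<le> (1 - (norm z)\<^sup>2)\<^sup>2"
proof -
  define W where "W = (norm z)\<^sup>2"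
  have *: "(norm (trunc z))\<^sup>2 \<le> 4 \<and> (1 - (norm (trunc z))\<^sup>2)\<^sup>2 \<le> (1 - W)\<^sup>2"
  proof (cases "W \<le> 1")
    case True
    then show ?thesis by (simp add: trunc_norm_sq W_def trunc_fac_def)
  next
    case False
    define X where "X = (norm (trunc z))\<^sup>2"
    have W: "W > 1" using False by simp
    have "X = ((2 * W - 1) / W\<^sup>2)\<^sup>2 * W" using False by (simp add: X_def trunc_norm_sq W_def[symmetric] trunc_fac_def)
    also have "\<dots> = (2 * W - 1)\<^sup>2 / W ^ 3" using W by (simp add: power_divide field_simps power2_eq_square power3_eq_cube)
    finally have X: "X * W ^ 3 = (2 * W - 1)\<^sup>2" using W by simp
    have W3: "W ^ 3 > 0" "W ^ 3 \<ge> W\<^sup>2" using W by (auto intro: power_increasing)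
    have "(2 * W - 1)\<^sup>2 \<le> 4 * W\<^sup>2" using W by (simp add: power2_eq_square algebra_simps)
    also have "\<dots> \<le> 4 * W ^ 3" using W3 by simp
    finally have X4: "X \<le> 4" using X W3 by (metis mult_le_cancel_right_pos)
    have "(2 * W - 1)\<^sup>2 \<le> (W\<^sup>2)\<^sup>2"
    proof (rule power_mono)
      have "0 \<le> (W - 1)\<^sup>2" by simp
      then show "2 * W - 1 \<le> W\<^sup>2" by (simp add: power2_eq_square algebra_simps)
    qed (use W in auto)
    also have "(W\<^sup>2)\<^sup>2 = W * W ^ 3" by (simp add: power2_eq_square power3_eq_cube)
    finally have XW: "X \<le> W" using X W3 by (metis mult_le_cancel_right_pos)
    \<comment> \<open>Both summands are nonnegative for W >= 1, and together they equal W^3 (X - (2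
      - W)).\<close>
    have "0 \<le> (W\<^sup>2 - W)\<^sup>2 + (3 * W - 1) * (W - 1)" using W by (intro add_nonneg_nonneg mult_nonneg_nonneg) auto
    also have "\<dots> = (2 * W - 1)\<^sup>2 - (2 - W) * W ^ 3" by (simp add: power2_eq_square power3_eq_cube algebra_simps)
    finally have "2 - W \<le> X" using X W3 by (metis diff_ge_0_iff_ge mult_le_cancel_right_pos)
    then have "\<bar>1 - X\<bar> \<le> \<bar>1 - W\<bar>" using XW W by linarith
    then show ?thesis using X4 by (simp add: X_def abs_le_square_iff)
  qed
  then have "(norm (trunc z))\<^sup>2 \<le> 2\<^sup>2" by simp
  then show "norm (trunc z) \<le> 2" by (rule power2_le_imp_le) simp
  show "(1 - (norm (trunc z))\<^sup>2)\<^sup>2 \<le> (1 - (norm z)\<^sup>2)\<^sup>2" using * by (simp add: W_def)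
qed

lemma weak_partial_trunc:
  assumes "weak_partial U j u g" "open U"
  shows "weak_partial U j (\<lambda>x. trunc (u x)) (\<lambda>x. dtrunc (u x) (g x))"
  by (rule weak_partial_chain[OF assms trunc_has_derivative trunc_lipschitz dtrunc_measurable dtrunc_le])

section \<open>Quasi-periodic sums and their derivatives\<close>

text \<open>For \<open>c\<close> supported in \<open>[-1, 1]\<close>, \<open>win c s t\<close> is the full series over all integers \<open>n\<close>. The function \<open>win tent\<close> is
  quasi-periodic with \<open>|win tent|\<^sup>2 = zden\<close>, so it has exactly one zero per unit cell.\<close>

definition win :: "(real \<Rightarrow> real) \<Rightarrow> real \<Rightarrow> real \<Rightarrow> complex" where
  "win c s t = (\<Sum>n\<in>{\<lfloor>s\<rfloor>..\<lfloor>s\<rfloor> + 1}. c (s - of_int n) *\<^sub>R cis (2 * pi * of_int n * t))"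

lemma win_eq_sum:
  assumes c: "\<And>x. \<bar>x\<bar> \<ge> 1 \<Longrightarrow> c x = 0" and S: "finite S" "\<lfloor>s\<rfloor> \<in> S" "\<lfloor>s\<rfloor> + 1 \<in> S"
  shows "win c s t = (\<Sum>n\<in>S. c (s - of_int n) *\<^sub>R cis (2 * pi * of_int n * t))"
  unfolding win_def
proof (rule sum.mono_neutral_left[OF S(1)])
  have "{\<lfloor>s\<rfloor>..\<lfloor>s\<rfloor> + 1} = {\<lfloor>s\<rfloor>, \<lfloor>s\<rfloor> + 1}" by auto
  then show "{\<lfloor>s\<rfloor>..\<lfloor>s\<rfloor> + 1} \<subseteq> S" using S by simp
  show "\<forall>n\<in>S - {\<lfloor>s\<rfloor>..\<lfloor>s\<rfloor> + 1}. c (s - of_int n) *\<^sub>R cis (2 * pi * of_int n * t) = 0"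
  proof
    fix n assume "n \<in> S - {\<lfloor>s\<rfloor>..\<lfloor>s\<rfloor> + 1}"
    then have "n \<le> \<lfloor>s\<rfloor> - 1 \<or> n \<ge> \<lfloor>s\<rfloor> + 2" by auto
    then have "\<bar>s - of_int n\<bar> \<ge> 1" by linarith
    then show "c (s - of_int n) *\<^sub>R cis (2 * pi * of_int n * t) = 0" using c by simp
  qed
qed

text \<open>The index set in the definition jumps with the floor of s. A fixed finite set that
  serves a whole interval around s0 permits limits and derivatives term by term.\<close>

lemma win_local:
  assumes c: "\<And>x. \<bar>x\<bar> \<ge> 1 \<Longrightarrow> c x = 0" and s: "\<bar>s - s0\<bar> < 1"
  shows "win c s t = (\<Sum>n\<in>{\<lfloor>s0\<rfloor>-2..\<lfloor>s0\<rfloor>+3}. c (s - of_int n) *\<^sub>R cis (2 * pi * of_int n * t))"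
proof -
  have "\<lfloor>s\<rfloor> \<ge> \<lfloor>s0\<rfloor> - 1" "\<lfloor>s\<rfloor> \<le> \<lfloor>s0\<rfloor> + 1" using s by linarith+
  then show ?thesis by (intro win_eq_sum c) auto
qed

lemma tendsto_win:
  assumes c: "\<And>x. \<bar>x\<bar> \<ge> 1 \<Longrightarrow> c x = 0" "continuous_on UNIV c"
    and f: "(f \<longlongrightarrow> s) F" and h: "(h \<longlongrightarrow> t) F"
  shows "((\<lambda>x. win c (f x) (h x)) \<longlongrightarrow> win c s t) F"
proof -
  have ev: "\<forall>\<^sub>F x in F. (\<Sum>n\<in>{\<lfloor>s\<rfloor>-2..\<lfloor>s\<rfloor>+3}. c (f x - of_int n) *\<^sub>R cis (2 * pi * of_int n * h x)) = win c (f x) (h x)"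
    using tendstoD[OF f zero_less_one]
    by eventually_elim (rule win_local[symmetric, OF c(1)], auto simp: dist_real_def)
  have "((\<lambda>x. \<Sum>n\<in>{\<lfloor>s\<rfloor>-2..\<lfloor>s\<rfloor>+3}. c (f x - of_int n) *\<^sub>R cis (2 * pi * of_int n * h x)) \<longlongrightarrow>
     (\<Sum>n\<in>{\<lfloor>s\<rfloor>-2..\<lfloor>s\<rfloor>+3}. c (s - of_int n) *\<^sub>R cis (2 * pi * of_int n * t))) F"
  proof (intro tendsto_sum tendsto_scaleR)
    fix n
    have "isCont c (s - of_int n)" using c(2) by (simp add: continuous_on_eq_continuous_at)
    then show "((\<lambda>x. c (f x - of_int n)) \<longlongrightarrow> c (s - of_int n)) F"
      by (rule isCont_tendsto_compose) (intro tendsto_intros f)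
    show "((\<lambda>x. cis (2 * pi * of_int n * h x)) \<longlongrightarrow> cis (2 * pi * of_int n * t)) F"
      by (intro tendsto_intros h)
  qed
  then have "((\<lambda>x. win c (f x) (h x)) \<longlongrightarrow> (\<Sum>n\<in>{\<lfloor>s\<rfloor>-2..\<lfloor>s\<rfloor>+3}. c (s - of_int n) *\<^sub>R cis (2 * pi * of_int n * t))) F"
    by (rule Lim_transform_eventually[OF _ ev])
  then show ?thesis using win_local[of c s s t, OF c(1)] by simp
qed

text \<open>Differentiating the phases brings down 2 pi i n. Writing n = s - (s - n) splits this
  into a multiplication by s, the future connection term, and a sum with the profile x c(x), which
  again vanishes for |x| >= 1.\<close>

lemma has_vector_derivative_win:
  assumes c: "\<And>x. \<bar>x\<bar> \<ge> 1 \<Longrightarrow> c x = 0" and c': "\<And>x. \<bar>x\<bar> \<ge> 1 \<Longrightarrow> c' x = 0"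
    and d: "\<And>x. (c has_real_derivative c' x) (at x)"
    and f: "(f has_real_derivative f') (at \<tau>)" and h: "(h has_real_derivative h') (at \<tau>)"
  shows "((\<lambda>\<tau>. win c (f \<tau>) (h \<tau>)) has_vector_derivative
     f' *\<^sub>R win c' (f \<tau>) (h \<tau>) + (2 * pi * h') *\<^sub>R (\<i> * (f \<tau> *\<^sub>R win c (f \<tau>) (h \<tau>) - win (\<lambda>x. x * c x) (f \<tau>) (h \<tau>)))) (at \<tau>)"
proof -
  define s where "s = f \<tau>"
  define S where "S = {\<lfloor>s\<rfloor>-2..\<lfloor>s\<rfloor>+3}"
  let ?e = "\<lambda>n. cis (2 * pi * of_int n * h \<tau>)"
  have "isCont f \<tau>" using f DERIV_isCont by blast
  then have "(f \<longlongrightarrow> s) (nhds \<tau>)" unfolding s_def isCont_def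
    by (simp add: tendsto_at_iff_tendsto_nhds)
  then have "\<forall>\<^sub>F x in nhds \<tau>. dist (f x) s < 1" by (rule tendstoD) simp
  then obtain O' where O': "open O'" "\<tau> \<in> O'" "\<And>x. x \<in> O' \<Longrightarrow> \<bar>f x - s\<bar> < 1"
    unfolding eventually_nhds dist_real_def by blast
  have trm: "((\<lambda>\<tau>. c (f \<tau> - of_int n) *\<^sub>R cis (2 * pi * of_int n * h \<tau>)) has_vector_derivative
     (c (s - of_int n) *\<^sub>R ((2 * pi * of_int n * h') *\<^sub>R (\<i> * ?e n)) + (c' (s - of_int n) * f') *\<^sub>R ?e n)) (at \<tau>)" for n
  proof (rule has_vector_derivative_scaleR[THEN has_vector_derivative_eq_rhs])
    show "((\<lambda>\<tau>. c (f \<tau> - of_int n)) has_real_derivative (c' (s - of_int n) * f')) (at \<tau>)"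
      by (rule DERIV_chain2[OF d[of "f \<tau> - of_int n", folded s_def, unfolded s_def]  DERIV_diff[OF f DERIV_const, simplified], folded s_def])
    show "((\<lambda>\<tau>. cis (2 * pi * of_int n * h \<tau>)) has_vector_derivative ((2 * pi * of_int n * h') *\<^sub>R (\<i> * ?e n))) (at \<tau>)"
    proof -
      have 1: "((\<lambda>\<tau>. 2 * pi * of_int n * h \<tau>) has_vector_derivative (2 * pi * of_int n * h')) (at \<tau>)"
        using DERIV_cmult[OF h, of "2 * pi * of_int n"] by (simp add: has_real_derivative_iff_has_vector_derivative)
      have 2: "(cis has_vector_derivative \<i> * cis y) (at y)" for y
        unfolding has_vector_derivative_complex_iff by (auto intro!: derivative_eq_intros)
      show ?thesis using vector_diff_chain_at[OF 1 2] by (simp add: o_def)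
    qed
  qed (simp add: s_def)
  have "((\<lambda>\<tau>. \<Sum>n\<in>S. c (f \<tau> - of_int n) *\<^sub>R cis (2 * pi * of_int n * h \<tau>)) has_vector_derivative
     (\<Sum>n\<in>S. (c (s - of_int n) *\<^sub>R ((2 * pi * of_int n * h') *\<^sub>R (\<i> * ?e n)) + (c' (s - of_int n) * f') *\<^sub>R ?e n))) (at \<tau>)"
    by (intro has_vector_derivative_sum trm)
  then have "((\<lambda>\<tau>. win c (f \<tau>) (h \<tau>)) has_vector_derivative
     (\<Sum>n\<in>S. (c (s - of_int n) *\<^sub>R ((2 * pi * of_int n * h') *\<^sub>R (\<i> * ?e n)) + (c' (s - of_int n) * f') *\<^sub>R ?e n))) (at \<tau>)"
    by (rule has_vector_derivative_transform_within_open[OF _ O'(1,2)]) (use win_local[OF c O'(3)] in \<open>simp add: S_def\<close>)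
  moreover have "(\<Sum>n\<in>S. (c (s - of_int n) *\<^sub>R ((2 * pi * of_int n * h') *\<^sub>R (\<i> * ?e n)) + (c' (s - of_int n) * f') *\<^sub>R ?e n))
     = f' *\<^sub>R (\<Sum>n\<in>S. c' (s - of_int n) *\<^sub>R ?e n) + (2 * pi * h') *\<^sub>R (\<i> * (s *\<^sub>R (\<Sum>n\<in>S. c (s - of_int n) *\<^sub>R ?e n) - (\<Sum>n\<in>S. ((s - of_int n) * c (s - of_int n)) *\<^sub>R ?e n)))"
    unfolding scaleR_sum_right sum_subtractf[symmetric] sum_distrib_left sum.distrib[symmetric]
    by (rule sum.cong[OF refl]) (simp add: scaleR_conv_of_real algebra_simps)
  moreover have "\<lfloor>s\<rfloor> \<in> S" "\<lfloor>s\<rfloor> + 1 \<in> S" "finite S" by (auto simp: S_def)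
  ultimately show ?thesis
    using win_eq_sum[of c' S s "h \<tau>", OF c'] win_eq_sum[of c S s "h \<tau>", OF c] win_eq_sum[of "\<lambda>x. x * c x" S s "h \<tau>"] c
    by (simp add: s_def)
qed

section \<open>The vortex lattice\<close>

text \<open>On [-1, 1] this is cos^2 (pi x / 2). Its integer translates sum to 1, it is continuously
  differentiable, and it is the profile for which the squared modulus of the sum is the simple
  product formula \<open>zden\<close>.\<close>

definition tent :: "real \<Rightarrow> real" where
  "tent x = (if \<bar>x\<bar> < 1 then (1 + cos (pi * x)) / 2 else 0)"

definition tent' :: "real \<Rightarrow> real" where
  "tent' x = (if \<bar>x\<bar> < 1 then - (pi / 2) * sin (pi * x) else 0)"

lemma tent_deriv: "(tent has_real_derivative tent' x) (at x)"
proof -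
  have p: "((\<lambda>x. (1 + cos (pi * x)) / 2) has_real_derivative - (pi / 2) * sin (pi * x)) (at x)" for x
    by (auto intro!: derivative_eq_intros)
  consider "\<bar>x\<bar> < 1" | "\<bar>x\<bar> > 1" | "\<bar>x\<bar> = 1" by linarith
  then show ?thesis
  proof cases
    case 1
    have "((\<lambda>x. (1 + cos (pi * x)) / 2) has_real_derivative tent' x) (at x)"
      using p[of x] 1 by (simp add: tent'_def)
    then show ?thesis
      by (rule has_field_derivative_transform_within_open[where S="{-1<..<1}"]) (use 1 in \<open>auto simp: tent_def\<close>)
  next
    case 2
    have "((\<lambda>x. 0) has_real_derivative tent' x) (at x)"
      using 2 by (simp add: tent'_def)
    then show ?thesis
      by (rule has_field_derivative_transform_within_open[where S="{x. \<bar>x\<bar> > 1}"])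
        (use 2 in \<open>auto simp: tent_def intro!: open_Collect_less continuous_intros\<close>)
  next
    \<comment> \<open>At |x| = 1 the cosine branch vanishes to first order. Nearby,
      \<open>tent\<close> equals this branch or 0, so comparison gives the derivative 0.\<close>
    case 3
    have x: "cos (pi * x) = -1" "sin (pi * x) = 0" using 3 by (auto simp: abs_if split: if_splits)
    have "((\<lambda>h. (((1 + cos (pi * (x + h))) / 2) - ((1 + cos (pi * x)) / 2)) / h) \<longlongrightarrow> 0) (at 0)"
      using p[of x] x by (simp add: DERIV_def)
    then have "((\<lambda>h. ((1 + cos (pi * (x + h))) / 2) / h) \<longlongrightarrow> 0) (at 0)" using x by simp
    then have "((\<lambda>h. norm (((1 + cos (pi * (x + h))) / 2) / h)) \<longlongrightarrow> 0) (at 0)" by (rule tendsto_norm_zero)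
    then have "((\<lambda>h. (tent (x + h) - tent x) / h) \<longlongrightarrow> 0) (at 0)"
      by (rule Lim_null_comparison[rotated]) (use 3 in \<open>auto simp: tent_def intro!: always_eventually\<close>)
    then show ?thesis using 3 by (simp add: DERIV_def tent'_def)
  qed
qed

lemma tent_zero: "\<bar>x\<bar> \<ge> 1 \<Longrightarrow> tent x = 0" "\<bar>x\<bar> \<ge> 1 \<Longrightarrow> tent' x = 0"
  by (auto simp: tent_def tent'_def)

lemma tent_continuous: "continuous_on UNIV tent"
  by (meson DERIV_isCont continuous_at_imp_continuous_on tent_deriv)

text \<open>Clamping the argument to [-1, 1] gives the same function because sin (pi x) vanishes at
  both ends.\<close>

lemma tent'_continuous: "continuous_on UNIV tent'"
proof -
  have "tent' = (\<lambda>x. - (pi / 2) * sin (pi * max (-1) (min 1 x)))"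
    by (rule ext) (auto simp: tent'_def abs_if min_def max_def)
  then show ?thesis by (subst \<open>tent' = _\<close>) (intro continuous_intros)
qed

definition zden :: "real \<Rightarrow> real \<Rightarrow> real" where
  "zden s t = 1 - (sin (pi * s))\<^sup>2 * (sin (pi * t))\<^sup>2"

text \<open>The square of the normalising factor: |lat|^2 = zden / (zden + d^2). Thus d sets the
  size of the vortex core, and the modulus is close to 1 where \<open>zden\<close> is large compared
  with d^2.\<close>

definition gfac :: "real \<Rightarrow> real \<Rightarrow> real \<Rightarrow> real" where
  "gfac d s t = 1 / (zden s t + d\<^sup>2)"

lemma zden_nonneg: "zden s t \<ge> 0"
proof -
  have "(sin (pi * s))\<^sup>2 \<le> 1" "(sin (pi * t))\<^sup>2 \<le> 1" by (simp_all add: abs_square_le_1)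
  then have "(sin (pi * s))\<^sup>2 * (sin (pi * t))\<^sup>2 \<le> 1 * 1" by (intro mult_mono) auto
  then show ?thesis by (simp add: zden_def)
qed

lemma zden_pos: "d > 0 \<Longrightarrow> zden s t + d\<^sup>2 > 0"
  using zden_nonneg[of s t] by (simp add: add_nonneg_pos)

definition lat :: "real \<Rightarrow> real \<Rightarrow> real \<Rightarrow> complex" where
  "lat d s t = sqrt (gfac d s t) *\<^sub>R win tent s t"

text \<open>\<open>lat_s\<close> is the derivative of \<open>lat\<close> in \<open>s\<close>, and \<open>lat_t\<close> is its covariant derivative \<open>\<partial>\<^sub>t - 2\<pi>\<i>s\<close>.\<close>

definition lat_s :: "real \<Rightarrow> real \<Rightarrow> real \<Rightarrow> complex" where
  "lat_s d s t = sqrt (gfac d s t) *\<^sub>R (win tent' s t -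
     (gfac d s t * (- pi * sin (pi * s) * cos (pi * s) * (sin (pi * t))\<^sup>2)) *\<^sub>R win tent s t)"

definition lat_t :: "real \<Rightarrow> real \<Rightarrow> real \<Rightarrow> complex" where
  "lat_t d s t = sqrt (gfac d s t) *\<^sub>R (- (2 * pi) *\<^sub>R (\<i> * win (\<lambda>x. x * tent x) s t) -
     (gfac d s t * (- pi * (sin (pi * s))\<^sup>2 * sin (pi * t) * cos (pi * t))) *\<^sub>R win tent s t)"

section \<open>Exact formulas and the gradient bound in one cell\<close>

lemma win_cell:
  assumes "\<forall>x. \<bar>x\<bar> \<ge> 1 \<longrightarrow> c x = 0"
  shows "win c s t = cis (2 * pi * of_int \<lfloor>s\<rfloor> * t) * (c (frac s) *\<^sub>R 1 + c (frac s - 1) *\<^sub>R cis (2 * pi * t))"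
proof -
  have "{\<lfloor>s\<rfloor>..\<lfloor>s\<rfloor> + 1} = {\<lfloor>s\<rfloor>, \<lfloor>s\<rfloor> + 1}" by auto
  then have "win c s t = c (s - of_int \<lfloor>s\<rfloor>) *\<^sub>R cis (2 * pi * of_int \<lfloor>s\<rfloor> * t) +
       c (s - of_int (\<lfloor>s\<rfloor> + 1)) *\<^sub>R cis (2 * pi * of_int (\<lfloor>s\<rfloor> + 1) * t)"
    by (simp add: win_def)
  also have "cis (2 * pi * of_int (\<lfloor>s\<rfloor> + 1) * t) = cis (2 * pi * of_int \<lfloor>s\<rfloor> * t) * cis (2 * pi * t)"
    by (simp add: cis_mult algebra_simps)
  also have "s - of_int (\<lfloor>s\<rfloor> + 1) = frac s - 1" by (simp add: frac_def)
  finally show ?thesis by (simp add: frac_def scaleR_conv_of_real algebra_simps)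
qed

text \<open>Taking out exp (i pi t), the phase halfway between the two remaining modes, leaves the
  sum of the two coefficients with the cosine and their difference with the sine.\<close>

lemma win_cell':
  assumes "\<forall>x. \<bar>x\<bar> \<ge> 1 \<longrightarrow> c x = 0"
  shows "win c s t = cis (2 * pi * of_int \<lfloor>s\<rfloor> * t + pi * t) *
     Complex ((c (frac s) + c (frac s - 1)) * cos (pi * t)) ((c (frac s - 1) - c (frac s)) * sin (pi * t))"
proof -
  have "c (frac s) *\<^sub>R 1 + c (frac s - 1) *\<^sub>R cis (2 * pi * t)
     = cis (pi * t) * (c (frac s) *\<^sub>R cis (- (pi * t)) + c (frac s - 1) *\<^sub>R cis (pi * t))"
    by (simp add: distrib_left cis_mult mult_scaleR_right mult.assoc)
  also have "c (frac s) *\<^sub>R cis (- (pi * t)) + c (frac s - 1) *\<^sub>R cis (pi * t)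
     = Complex ((c (frac s) + c (frac s - 1)) * cos (pi * t)) ((c (frac s - 1) - c (frac s)) * sin (pi * t))"
    by (simp add: complex_eq_iff algebra_simps)
  finally show ?thesis using win_cell[of c s t, OF assms] by (simp add: cis_mult mult.assoc[symmetric])
qed

lemma cell_values:
  fixes X :: real
  assumes X: "0 \<le> X" "X < 1"
  shows "tent X = (1 + cos (pi * X)) / 2" "tent (X - 1) = (1 - cos (pi * X)) / 2"
    "tent' X = - (pi / 2) * sin (pi * X)" "tent' (X - 1) = (pi / 2) * sin (pi * X)"
proof -
  have c: "cos (pi * (X - 1)) = - cos (pi * X)" "sin (pi * (X - 1)) = - sin (pi * X)"
    by (auto simp: right_diff_distrib cos_diff sin_diff)
  show "tent X = (1 + cos (pi * X)) / 2" "tent' X = - (pi / 2) * sin (pi * X)" using X by (auto simp: tent_def tent'_def)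
  show "tent (X - 1) = (1 - cos (pi * X)) / 2" using X c by (auto simp: tent_def)
  show "tent' (X - 1) = (pi / 2) * sin (pi * X)" using X c by (auto simp: tent'_def)
qed

text \<open>Up to a phase, w = C - i a S is \<open>win tent\<close>, and q = |w|^2. Multiplying a
  derivative of w by the conjugate of w gives a real part, \<open>\<sigma>\<close> or
  \<open>\<tau>\<close>, which is half a derivative of q, and an imaginary part, the current
  \<open>js\<close> or \<open>jt\<close>. Dividing w by sqrt (q + d^2) damps the real part by 1 - g
  q = d^2 g and leaves the direction of the current alone. The currents satisfy js^2 + jt^2 <= pi^2
  q (1 + q). The factor pi^2 in front of g is what the leading constant of the energy rests
  on.\<close>

lemma cell_gradient_estimate:
  fixes a b C S X d :: real
  assumes ab: "a\<^sup>2 + b\<^sup>2 = 1" and CS: "C\<^sup>2 + S\<^sup>2 = 1" and X: "0 \<le> X" "X \<le> 1" "a * (2 * X - 1) \<le> 0" and d: "d > 0"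
  defines "q \<equiv> 1 - b\<^sup>2 * S\<^sup>2"
  defines "g \<equiv> 1 / (q + d\<^sup>2)"
  defines "\<sigma> \<equiv> - pi * a * b * S\<^sup>2" and "\<tau> \<equiv> - pi * b\<^sup>2 * S * C"
  defines "R \<equiv> - pi * (2 * a * X + 1 - a) * S" and "I \<equiv> - pi * (2 * X - 1 + a) * C"
  shows "g * ((- (g * \<sigma> * C))\<^sup>2 + (pi * b * S + g * \<sigma> * (a * S))\<^sup>2) + g * ((R - g * \<tau> * C)\<^sup>2 + (I + g * \<tau> * (a * S))\<^sup>2)
     \<le> pi\<^sup>2 * (g + 1 + d\<^sup>2 * g\<^sup>2)"
proof -
  have q1: "q = C\<^sup>2 + a\<^sup>2 * S\<^sup>2" and q2: "q = a\<^sup>2 + b\<^sup>2 * C\<^sup>2"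
  proof -
    have a: "a\<^sup>2 = 1 - b\<^sup>2" using ab by simp
    have C: "C\<^sup>2 = 1 - S\<^sup>2" using CS by simp
    show "q = C\<^sup>2 + a\<^sup>2 * S\<^sup>2" unfolding q_def a C by (simp add: algebra_simps)
    show "q = a\<^sup>2 + b\<^sup>2 * C\<^sup>2" unfolding q_def a C by (simp add: algebra_simps)
  qed
  have sq: "a\<^sup>2 \<le> 1" "b\<^sup>2 \<le> 1" "C\<^sup>2 \<le> 1" "S\<^sup>2 \<le> 1"
    using ab CS zero_le_power2[of a] zero_le_power2[of b] zero_le_power2[of C] zero_le_power2[of S] by linarith+
  have q0: "q \<ge> 0" unfolding q1 by simp
  have dd: "d\<^sup>2 > 0" using d by simp
  have g0: "g > 0" unfolding g_def using q0 dd by (simp add: add_nonneg_pos)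
  have gq: "g * q + d\<^sup>2 * g = 1" 
  proof -
    have "q + d\<^sup>2 \<noteq> 0" using q0 dd by linarith
    then show ?thesis by (simp add: g_def add_divide_distrib[symmetric])
  qed
  have gq1: "g * q \<le> 1" using gq g0 dd by (smt (verit) mult_pos_pos)
  have gd1: "d\<^sup>2 * g \<le> 1" using gq g0 q0 by (smt (verit) mult_nonneg_nonneg)
  define js where "js = pi * b * S * C"
  define jt where "jt = - pi * (a + (2 * X - 1) * q)"
  define ws where "ws = (pi * b * S)\<^sup>2"
  define wt where "wt = R\<^sup>2 + I\<^sup>2"
  have rs: "(- (a * S)) * (pi * b * S) = \<sigma>" unfolding \<sigma>_def by (simp add: power2_eq_square)
  have rt: "C * R - a * S * I = \<tau>"
  proof -
    have "C * R - a * S * I = - pi * S * C * (1 - a\<^sup>2)"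
      unfolding R_def I_def by (simp add: power2_eq_square algebra_simps)
    also have "1 - a\<^sup>2 = b\<^sup>2" using ab by simp
    finally show ?thesis by (simp add: \<tau>_def)
  qed
  have jt': "C * I + a * S * R = jt"
  proof -
    have "C * I + a * S * R = - pi * (a * (C\<^sup>2 + S\<^sup>2) + (2 * X - 1) * (C\<^sup>2 + a\<^sup>2 * S\<^sup>2))"
      unfolding R_def I_def by (simp add: power2_eq_square algebra_simps)
    then show ?thesis unfolding jt_def q1[symmetric] CS by simp
  qed
  have es: "(- (g * \<sigma> * C))\<^sup>2 + (pi * b * S + g * \<sigma> * (a * S))\<^sup>2 = ws - \<sigma>\<^sup>2 * (2 * g - g\<^sup>2 * q)"
  proof -
    have "(- (g * \<sigma> * C))\<^sup>2 + (pi * b * S + g * \<sigma> * (a * S))\<^sup>2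
       = ws + 2 * g * \<sigma> * ((a * S) * (pi * b * S)) + g\<^sup>2 * \<sigma>\<^sup>2 * (C\<^sup>2 + a\<^sup>2 * S\<^sup>2)"
      unfolding ws_def by (simp add: power2_eq_square algebra_simps)
    also have "(a * S) * (pi * b * S) = - \<sigma>" using rs by simp
    finally show ?thesis unfolding q1[symmetric] by (simp add: power2_eq_square algebra_simps)
  qed
  have et: "(R - g * \<tau> * C)\<^sup>2 + (I + g * \<tau> * (a * S))\<^sup>2 = wt - \<tau>\<^sup>2 * (2 * g - g\<^sup>2 * q)"
  proof -
    have "(R - g * \<tau> * C)\<^sup>2 + (I + g * \<tau> * (a * S))\<^sup>2
       = wt - 2 * g * \<tau> * (C * R - a * S * I) + g\<^sup>2 * \<tau>\<^sup>2 * (C\<^sup>2 + a\<^sup>2 * S\<^sup>2)"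
      unfolding wt_def by (simp add: power2_eq_square algebra_simps)
    then show ?thesis unfolding q1[symmetric] rt by (simp add: power2_eq_square algebra_simps)
  qed
  have ps: "ws * q = \<sigma>\<^sup>2 + js\<^sup>2"
    unfolding q1 ws_def \<sigma>_def js_def by (simp add: power2_eq_square algebra_simps)
  have pt: "wt * q = \<tau>\<^sup>2 + jt\<^sup>2"
  proof -
    have "wt * q = (C * R - a * S * I)\<^sup>2 + (C * I + a * S * R)\<^sup>2"
      unfolding wt_def q1 by (simp add: power2_eq_square algebra_simps)
    then show ?thesis unfolding rt jt' .
  qed
  have jb: "js\<^sup>2 + jt\<^sup>2 \<le> pi\<^sup>2 * (q * (1 + q))"
  proof -
    have "b\<^sup>2 * S\<^sup>2 * C\<^sup>2 \<le> b\<^sup>2 * 1 * C\<^sup>2" using sq by (intro mult_right_mono mult_left_mono) auto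
    then have 1: "b\<^sup>2 * S\<^sup>2 * C\<^sup>2 + a\<^sup>2 \<le> q" unfolding q2 by simp
    \<comment> \<open>The sign hypothesis discards the cross term in the square of
      \<open>jt\<close>.\<close>
    have 2: "2 * (a * (2 * X - 1)) * q \<le> 0" using X(3) q0 by (simp add: mult_nonpos_nonneg)
    have "\<bar>2 * X - 1\<bar> \<le> 1" using X by auto
    then have "(2 * X - 1)\<^sup>2 \<le> 1" by (simp add: abs_square_le_1)
    then have 3: "(2 * X - 1)\<^sup>2 * q\<^sup>2 \<le> 1 * q\<^sup>2" by (intro mult_right_mono) auto
    have "js\<^sup>2 + jt\<^sup>2 = pi\<^sup>2 * (b\<^sup>2 * S\<^sup>2 * C\<^sup>2 + a\<^sup>2 + 2 * (a * (2 * X - 1)) * q + (2 * X - 1)\<^sup>2 * q\<^sup>2)"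
      unfolding js_def jt_def by (simp add: power2_eq_square algebra_simps)
    also have "\<dots> \<le> pi\<^sup>2 * (q + q\<^sup>2)" by (rule mult_left_mono) (use 1 2 3 in linarith, simp)
    finally show ?thesis by (simp add: power2_eq_square algebra_simps)
  qed
  have rb: "\<sigma>\<^sup>2 + \<tau>\<^sup>2 \<le> pi\<^sup>2 * q"
  proof -
    have "b\<^sup>2 * S\<^sup>2 * (a\<^sup>2 * S\<^sup>2 + b\<^sup>2 * C\<^sup>2) \<le> 1 * (a\<^sup>2 * 1 + b\<^sup>2 * C\<^sup>2)"
      using sq by (intro mult_mono add_mono mult_left_mono order_refl mult_le_one) auto
    then have 1: "b\<^sup>2 * S\<^sup>2 * (a\<^sup>2 * S\<^sup>2 + b\<^sup>2 * C\<^sup>2) \<le> q" unfolding q2 by simp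
    have "\<sigma>\<^sup>2 + \<tau>\<^sup>2 = pi\<^sup>2 * (b\<^sup>2 * S\<^sup>2 * (a\<^sup>2 * S\<^sup>2 + b\<^sup>2 * C\<^sup>2))"
      unfolding \<sigma>_def \<tau>_def by (simp add: power2_eq_square algebra_simps)
    then show ?thesis using 1 by (simp add: mult_left_mono)
  qed
  have main: "ws - \<sigma>\<^sup>2 * (2 * g - g\<^sup>2 * q) + (wt - \<tau>\<^sup>2 * (2 * g - g\<^sup>2 * q)) \<le> pi\<^sup>2 * (1 + q + (d\<^sup>2 * g)\<^sup>2)" (is "?L \<le> _") if "q > 0"
  proof -
    have "?L * q = (js\<^sup>2 + jt\<^sup>2) + (\<sigma>\<^sup>2 + \<tau>\<^sup>2) * (1 - g * q)\<^sup>2"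
    proof -
      have "?L * q = ws * q + wt * q - (\<sigma>\<^sup>2 + \<tau>\<^sup>2) * (2 * g - g\<^sup>2 * q) * q" by (simp add: algebra_simps)
      also have "\<dots> = (js\<^sup>2 + jt\<^sup>2) + (\<sigma>\<^sup>2 + \<tau>\<^sup>2) * (1 - g * q)\<^sup>2"
        unfolding ps pt by (simp add: power2_eq_square algebra_simps)
      finally show ?thesis .
    qed
    also have "1 - g * q = d\<^sup>2 * g" using gq by simp
    also have "(js\<^sup>2 + jt\<^sup>2) + (\<sigma>\<^sup>2 + \<tau>\<^sup>2) * (d\<^sup>2 * g)\<^sup>2 \<le> pi\<^sup>2 * (q * (1 + q)) + pi\<^sup>2 * q * (d\<^sup>2 * g)\<^sup>2"
      using jb rb by (intro add_mono mult_right_mono) auto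
    also have "\<dots> = pi\<^sup>2 * (1 + q + (d\<^sup>2 * g)\<^sup>2) * q" by (simp add: algebra_simps)
    finally show ?thesis using that by simp
  qed
  \<comment> \<open>At the vortex centre q = 0 and one cannot divide by q. There both derivatives of
    w have modulus pi and the two sides coincide.\<close>
  have main2: "?L \<le> pi\<^sup>2 * (1 + q + (d\<^sup>2 * g)\<^sup>2)"
  proof (cases "q > 0")
    case False
    then have "q = 0" using q0 by simp
    then have C0: "C = 0" and aS: "a * S = 0"
      using q1 by (simp_all add: add_nonneg_eq_0_iff)
    then have "S\<^sup>2 = 1" "a = 0" using CS by auto
    then have "wt = pi\<^sup>2" "ws = pi\<^sup>2 * b\<^sup>2" "\<sigma> = 0" "\<tau> = 0" "b\<^sup>2 = 1" using C0 ab
      unfolding wt_def ws_def R_def I_def \<sigma>_def \<tau>_def by (auto simp: power_mult_distrib)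
    moreover have "d\<^sup>2 * g = 1" using gq \<open>q = 0\<close> by simp
    ultimately show ?thesis using \<open>q = 0\<close> by simp
  qed (use main in simp)
  have "g * ?L \<le> g * (pi\<^sup>2 * (1 + q + (d\<^sup>2 * g)\<^sup>2))" using main2 g0 by (intro mult_left_mono) auto
  also have "\<dots> = pi\<^sup>2 * (g + g * q + d\<^sup>2 * g\<^sup>2 * (d\<^sup>2 * g))" by (simp add: power2_eq_square algebra_simps)
  also have "\<dots> \<le> pi\<^sup>2 * (g + 1 + d\<^sup>2 * g\<^sup>2 * 1)"
    using gq1 gd1 by (intro mult_left_mono add_mono order_refl) auto
  finally show ?thesis unfolding es et by (simp add: distrib_left)
qed

text \<open>A shift of s by 1 changes the sign of both sin (pi s) and cos (pi s), so expressions of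
  degree two are periodic.\<close>

lemma frac_trig:
  "(sin (pi * s))\<^sup>2 = (sin (pi * frac s))\<^sup>2" "sin (pi * s) * cos (pi * s) = sin (pi * frac s) * cos (pi * frac s)"
proof -
  have s: "pi * s = pi * frac s + pi * of_int \<lfloor>s\<rfloor>" by (simp add: frac_def algebra_simps)
  have z: "sin (pi * of_int \<lfloor>s\<rfloor>) = 0" by (simp add: sin_integer_2pi sin_zero_iff_int2 mult.commute)
  have c: "(cos (pi * of_int \<lfloor>s\<rfloor>))\<^sup>2 = 1" using z sin_cos_squared_add[of "pi * of_int \<lfloor>s\<rfloor>"] by simp
  have e: "sin (pi * s) = sin (pi * frac s) * cos (pi * of_int \<lfloor>s\<rfloor>)" "cos (pi * s) = cos (pi * frac s) * cos (pi * of_int \<lfloor>s\<rfloor>)"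
    unfolding s sin_add cos_add z by auto
  show "(sin (pi * s))\<^sup>2 = (sin (pi * frac s))\<^sup>2" unfolding e power_mult_distrib c by simp
  show "sin (pi * s) * cos (pi * s) = sin (pi * frac s) * cos (pi * frac s)"
    unfolding e using c by (simp add: power2_eq_square mult.assoc mult.left_commute)
qed

text \<open>Brings the sum and its two derivatives over the common phase E and into the real
  coordinates a, b, C, S, R, I of the gradient estimate.\<close>

lemma win_formulas:
  defines "E \<equiv> \<lambda>s t. cis (2 * pi * of_int \<lfloor>s\<rfloor> * t + pi * t)"
  shows "win tent s t = E s t * Complex (cos (pi * t)) (- (cos (pi * frac s) * sin (pi * t)))"
    "win tent' s t = E s t * Complex 0 (pi * sin (pi * frac s) * sin (pi * t))"
    "- (2 * pi) *\<^sub>R (\<i> * win (\<lambda>x. x * tent x) s t) = E s t *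
       Complex (- pi * (2 * cos (pi * frac s) * frac s + 1 - cos (pi * frac s)) * sin (pi * t))
               (- pi * (2 * frac s - 1 + cos (pi * frac s)) * cos (pi * t))"
proof -
  have X: "0 \<le> frac s" "frac s < 1" by (auto simp: frac_lt_1)
  note cv = cell_values[OF X]
  have z: "\<forall>x. \<bar>x\<bar> \<ge> 1 \<longrightarrow> tent x = 0" "\<forall>x. \<bar>x\<bar> \<ge> 1 \<longrightarrow> tent' x = 0"
    "\<forall>x. \<bar>x\<bar> \<ge> 1 \<longrightarrow> x * tent x = 0" using tent_zero by auto
  define e where "e = cis (2 * pi * of_int \<lfloor>s\<rfloor> * t + pi * t)"
  show "win tent s t = E s t * Complex (cos (pi * t)) (- (cos (pi * frac s) * sin (pi * t)))"
    unfolding win_cell'[OF z(1)] cv E_def e_def[symmetric] by (simp add: complex_eq_iff field_simps)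
  show "win tent' s t = E s t * Complex 0 (pi * sin (pi * frac s) * sin (pi * t))"
    unfolding win_cell'[OF z(2)] cv E_def e_def[symmetric] by (simp add: complex_eq_iff)
  show "- (2 * pi) *\<^sub>R (\<i> * win (\<lambda>x. x * tent x) s t) = E s t *
       Complex (- pi * (2 * cos (pi * frac s) * frac s + 1 - cos (pi * frac s)) * sin (pi * t))
               (- pi * (2 * frac s - 1 + cos (pi * frac s)) * cos (pi * t))"
    unfolding win_cell'[OF z(3)] cv E_def e_def[symmetric]
    by (simp add: complex_eq_iff field_simps)
qed

lemma norm_win_tent: "(norm (win tent s t))\<^sup>2 = zden s t"
proof -
  have c: "(cos x)\<^sup>2 = 1 - (sin x)\<^sup>2" for x :: real using sin_cos_squared_add[of x] by linarith
  have "(norm (win tent s t))\<^sup>2 = (cos (pi * t))\<^sup>2 + (cos (pi * frac s))\<^sup>2 * (sin (pi * t))\<^sup>2"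
    unfolding win_formulas(1) by (simp add: norm_mult power_mult_distrib cmod_power2)
  then show ?thesis unfolding zden_def frac_trig(1)[of s] c by (simp add: algebra_simps)
qed

lemma norm_lat: assumes "d > 0" shows "1 - (norm (lat d s t))\<^sup>2 = d\<^sup>2 * gfac d s t" "norm (lat d s t) \<le> 1"
proof -
  have z: "zden s t + d\<^sup>2 > 0" by (rule zden_pos[OF assms])
  have "(norm (lat d s t))\<^sup>2 = gfac d s t * zden s t"
    using z by (simp add: lat_def power_mult_distrib norm_win_tent gfac_def)
  then show 1: "1 - (norm (lat d s t))\<^sup>2 = d\<^sup>2 * gfac d s t"
    using z by (simp add: gfac_def field_simps)
  have "d\<^sup>2 * gfac d s t \<ge> 0" using z by (simp add: gfac_def)
  then have "(norm (lat d s t))\<^sup>2 \<le> 1\<^sup>2" using 1 by simp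
  then show "norm (lat d s t) \<le> 1" by (rule power2_le_imp_le) simp
qed

lemma norm_dlat:
  assumes d: "d > 0"
  shows "(norm (lat_s d s t))\<^sup>2 + (norm (lat_t d s t))\<^sup>2 \<le> pi\<^sup>2 * (gfac d s t + 1 + d\<^sup>2 * (gfac d s t)\<^sup>2)"
proof -
  define X where "X = frac s"
  define a b C S where "a = cos (pi * X)" and "b = sin (pi * X)" and "C = cos (pi * t)" and "S = sin (pi * t)"
  define E where "E = cis (2 * pi * of_int \<lfloor>s\<rfloor> * t + pi * t)"
  have X: "0 \<le> X" "X < 1" by (auto simp: X_def frac_lt_1)
  \<comment> \<open>Both cos (pi X) and 2 X - 1 change sign at X = 1/2, in opposite
    directions.\<close>
  have aX: "a * (2 * X - 1) \<le> 0"
  proof (cases "X \<le> 1/2")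
    case True
    have "pi * X \<le> pi * (1/2)" using True by (intro mult_left_mono) auto
    moreover have "0 \<le> pi * X" using X by simp
    ultimately have "a \<ge> 0" unfolding a_def using pi_ge_zero by (intro cos_ge_zero) linarith+
    then show ?thesis using True by (simp add: mult_nonneg_nonpos)
  next
    case False
    have "pi * X \<ge> pi * (1/2)" using False by (intro mult_left_mono) auto
    moreover have "pi * X \<le> pi * 1" using X by (intro mult_left_mono) auto
    ultimately have "cos (pi * X) \<le> cos (pi/2)" by (intro cos_monotone_0_pi_le) auto
    then have "a \<le> 0" unfolding a_def by simp
    then show ?thesis using False by (simp add: mult_nonpos_nonneg)
  qed
  have ab: "a\<^sup>2 + b\<^sup>2 = 1" "C\<^sup>2 + S\<^sup>2 = 1" unfolding a_def b_def C_def S_def by auto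
  define g where "g = gfac d s t"
  have gz: "g = 1 / (1 - b\<^sup>2 * S\<^sup>2 + d\<^sup>2)" unfolding g_def gfac_def zden_def frac_trig(1)[of s] b_def S_def X_def ..
  have g0: "g \<ge> 0" unfolding g_def gfac_def using zden_pos[OF d, of s t] by simp
  define \<sigma> \<tau> R I where "\<sigma> = - pi * a * b * S\<^sup>2" and "\<tau> = - pi * b\<^sup>2 * S * C" and
    "R = - pi * (2 * a * X + 1 - a) * S" and "I = - pi * (2 * X - 1 + a) * C"
  have s1: "- pi * sin (pi * s) * cos (pi * s) * (sin (pi * t))\<^sup>2 = \<sigma>"
    using frac_trig(2)[of s] by (simp add: \<sigma>_def a_def b_def S_def X_def mult_ac)
  have t1: "- pi * (sin (pi * s))\<^sup>2 * sin (pi * t) * cos (pi * t) = \<tau>"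
    unfolding frac_trig(1)[of s] by (simp add: \<tau>_def b_def C_def S_def X_def)
  have ls: "lat_s d s t = sqrt g *\<^sub>R (E * Complex (- (g * \<sigma> * C)) (pi * b * S + g * \<sigma> * (a * S)))"
    unfolding lat_s_def s1 g_def[symmetric] win_formulas E_def[symmetric]
    by (simp add: X_def[symmetric] a_def[symmetric] b_def[symmetric] C_def[symmetric] S_def[symmetric] complex_eq_iff algebra_simps)
  have lt: "lat_t d s t = sqrt g *\<^sub>R (E * Complex (R - g * \<tau> * C) (I + g * \<tau> * (a * S)))"
    unfolding lat_t_def t1 g_def[symmetric] win_formulas E_def[symmetric] R_def I_def
    by (simp add: X_def[symmetric] a_def[symmetric] C_def[symmetric] S_def[symmetric] complex_eq_iff algebra_simps)
  have nE: "norm E = 1" by (simp add: E_def)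
  have "(norm (lat_s d s t))\<^sup>2 + (norm (lat_t d s t))\<^sup>2 =
     g * ((- (g * \<sigma> * C))\<^sup>2 + (pi * b * S + g * \<sigma> * (a * S))\<^sup>2) + g * ((R - g * \<tau> * C)\<^sup>2 + (I + g * \<tau> * (a * S))\<^sup>2)"
    unfolding ls lt using g0 by (simp add: norm_mult nE power_mult_distrib cmod_power2)
  also have "\<dots> \<le> pi\<^sup>2 * (g + 1 + d\<^sup>2 * g\<^sup>2)"
    using cell_gradient_estimate[OF ab X(1) less_imp_le[OF X(2)] aX d] unfolding gz[symmetric] \<sigma>_def \<tau>_def R_def I_def .
  finally show ?thesis unfolding g_def .
qed

lemma gfac_pos: "d > 0 \<Longrightarrow> gfac d s t > 0"
  using zden_pos[of d s t] by (simp add: gfac_def)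

lemma has_vector_derivative_lat:
  assumes d: "d > 0" and f: "(f has_real_derivative f') (at \<tau>)" and h: "(h has_real_derivative h') (at \<tau>)"
  shows "((\<lambda>\<tau>. lat d (f \<tau>) (h \<tau>)) has_vector_derivative
     f' *\<^sub>R lat_s d (f \<tau>) (h \<tau>) + h' *\<^sub>R lat_t d (f \<tau>) (h \<tau>) + (2 * pi * h' * f \<tau>) *\<^sub>R (\<i> * lat d (f \<tau>) (h \<tau>))) (at \<tau>)"
proof -
  define s t where "s = f \<tau>" and "t = h \<tau>"
  \<comment> \<open>\<open>\<sigma>\<close> and \<open>\<rho>\<close> are half the partial
    derivatives of \<open>zden\<close> in s and t, so the derivative of sqrt g is - g sqrt g times
    their combination.\<close>
  define \<sigma> where "\<sigma> = - pi * sin (pi * s) * cos (pi * s) * (sin (pi * t))\<^sup>2"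
  define \<rho> where "\<rho> = - pi * (sin (pi * s))\<^sup>2 * sin (pi * t) * cos (pi * t)"
  define g where "g = gfac d s t"
  have z: "zden s t + d\<^sup>2 > 0" by (rule zden_pos[OF d])
  have g: "g > 0" unfolding g_def by (rule gfac_pos[OF d])
  have zd: "((\<lambda>\<tau>. zden (f \<tau>) (h \<tau>) + d\<^sup>2) has_real_derivative 2 * (f' * \<sigma> + h' * \<rho>)) (at \<tau>)"
    unfolding zden_def
    by (auto intro!: derivative_eq_intros f h simp: s_def[symmetric] t_def[symmetric])
      (simp add: \<sigma>_def \<rho>_def power2_eq_square algebra_simps)
  have gd: "((\<lambda>\<tau>. gfac d (f \<tau>) (h \<tau>)) has_real_derivative - (2 * (f' * \<sigma> + h' * \<rho>)) * g\<^sup>2) (at \<tau>)"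
    unfolding gfac_def
    by (rule DERIV_cong[OF DERIV_divide[OF DERIV_const zd]])
      (use z in \<open>simp_all add: s_def[symmetric] t_def[symmetric] g_def gfac_def power2_eq_square\<close>)
  have sd: "((\<lambda>\<tau>. sqrt (gfac d (f \<tau>) (h \<tau>))) has_real_derivative - (sqrt g * g) * (f' * \<sigma> + h' * \<rho>)) (at \<tau>)"
  proof (rule DERIV_cong[OF DERIV_chain2[OF DERIV_real_sqrt gd]])
    show "0 < gfac d (f \<tau>) (h \<tau>)" by (rule gfac_pos[OF d])
    define r where "r = sqrt g"
    have r: "r > 0" "g\<^sup>2 = r * r * g" using g by (simp_all add: r_def power2_eq_square)
    show "inverse (sqrt (gfac d (f \<tau>) (h \<tau>))) / 2 * (- (2 * (f' * \<sigma> + h' * \<rho>)) * g\<^sup>2) = - (sqrt g * g) * (f' * \<sigma> + h' * \<rho>)"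
      unfolding s_def[symmetric] t_def[symmetric] g_def[symmetric] r_def[symmetric] r(2) using r(1) by (simp add: field_simps)
  qed
  note wd = has_vector_derivative_win[of tent tent', OF tent_zero tent_deriv f h]
  have ls: "lat_s d s t = sqrt g *\<^sub>R (win tent' s t - (g * \<sigma>) *\<^sub>R win tent s t)"
    by (simp only: lat_s_def g_def \<sigma>_def)
  have lt: "lat_t d s t = sqrt g *\<^sub>R (- (2 * pi) *\<^sub>R (\<i> * win (\<lambda>x. x * tent x) s t) - (g * \<rho>) *\<^sub>R win tent s t)"
    by (simp only: lat_t_def g_def \<rho>_def)
  have l: "lat d s t = sqrt g *\<^sub>R win tent s t" by (simp only: lat_def g_def)
  show ?thesis
    unfolding lat_def[of d "f _"]
    by (rule has_vector_derivative_eq_rhs[OF has_vector_derivative_scaleR[OF sd wd]])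
      (simp_all add: tent_zero s_def[symmetric] t_def[symmetric] g_def[symmetric] ls lt l scaleR_conv_of_real algebra_simps)
qed

lemma continuous_win:
  assumes "\<And>x. \<bar>x\<bar> \<ge> 1 \<Longrightarrow> c x = 0" "continuous_on UNIV c" "continuous_on UNIV f" "continuous_on UNIV h"
  shows "continuous_on UNIV (\<lambda>x::'a::t2_space. win c (f x) (h x))"
  using assms(3,4) unfolding continuous_on_def
  by (intro ballI tendsto_win assms(1,2)) auto

lemma continuous_gfac:
  assumes "d > 0" "continuous_on UNIV f" "continuous_on UNIV h"
  shows "continuous_on UNIV (\<lambda>x::'a::t2_space. gfac d (f x) (h x))"
  unfolding gfac_def zden_def using zden_pos[OF assms(1), unfolded zden_def]
  by (intro continuous_intros assms) (metis less_irrefl)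

lemma continuous_lat:
  assumes d: "d > 0" and c: "continuous_on UNIV f" "continuous_on UNIV h"
  shows "continuous_on UNIV (\<lambda>x::'a::t2_space. lat d (f x) (h x))"
    "continuous_on UNIV (\<lambda>x. lat_s d (f x) (h x))" "continuous_on UNIV (\<lambda>x. lat_t d (f x) (h x))"
  unfolding lat_def lat_s_def lat_t_def
  by (intro continuous_intros continuous_gfac continuous_win tent_zero tent_continuous tent'_continuous d c; simp add: tent_zero)+

text \<open>The phase makes the connection form \<open>2\<pi> f dh\<close> of the translated lattice \<open>latv\<close> independent of \<open>\<alpha>\<close> and \<open>\<beta>\<close>, and
  \<open>latc\<close> is the corresponding covariant derivative.\<close>

definition latv :: "real \<Rightarrow> (R3 \<Rightarrow> real) \<Rightarrow> (R3 \<Rightarrow> real) \<Rightarrow> real \<Rightarrow> real \<Rightarrow> R3 \<Rightarrow> complex" where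
  "latv d f h \<alpha> \<beta> x = lat d (f x + \<alpha>) (h x + \<beta>) * cis (- (2 * pi * \<alpha> * (h x + \<beta>)))"

definition latc :: "real \<Rightarrow> (R3 \<Rightarrow> real) \<Rightarrow> (R3 \<Rightarrow> real) \<Rightarrow> (R3 \<Rightarrow> real) \<Rightarrow> (R3 \<Rightarrow> real) \<Rightarrow> real \<Rightarrow> real \<Rightarrow> R3 \<Rightarrow> complex" where
  "latc d f h f' h' \<alpha> \<beta> x = cis (- (2 * pi * \<alpha> * (h x + \<beta>))) *
     (f' x *\<^sub>R lat_s d (f x + \<alpha>) (h x + \<beta>) + h' x *\<^sub>R lat_t d (f x + \<alpha>) (h x + \<beta>))"

lemma cis_line:
  assumes "(h has_real_derivative h') (at \<tau>)"
  shows "((\<lambda>\<tau>. cis (h \<tau>)) has_vector_derivative h' *\<^sub>R (\<i> * cis (h \<tau>))) (at \<tau>)"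
proof -
  have 2: "(cis has_vector_derivative \<i> * cis y) (at y)" for y
    unfolding has_vector_derivative_complex_iff by (auto intro!: derivative_eq_intros)
  show ?thesis
    using vector_diff_chain_at[OF assms[unfolded has_real_derivative_iff_has_vector_derivative] 2] by (simp add: o_def)
qed

lemma C1_dir_cis:
  assumes "C1_dir j h h'"
  shows "C1_dir j (\<lambda>x. cis (h x)) (\<lambda>x. h' x *\<^sub>R (\<i> * cis (h x)))"
proof -
  have "((\<lambda>\<tau>. cis (h (x + \<tau> *\<^sub>R ax j))) has_vector_derivative h' x *\<^sub>R (\<i> * cis (h x))) (at 0)" for x
    using cis_line[of "\<lambda>\<tau>. h (x + \<tau> *\<^sub>R ax j)" "h' x" 0] assms
    by (auto simp: C1_dir_def has_real_derivative_iff_has_vector_derivative)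
  then show ?thesis using assms by (auto simp: C1_dir_def intro!: continuous_intros)
qed

lemma C1_dir_latv:
  assumes d: "d > 0" and f: "C1_dir j f f'" and h: "C1_dir j h h'"
  shows "C1_dir j (latv d f h \<alpha> \<beta>) (\<lambda>x. latc d f h f' h' \<alpha> \<beta> x + (2 * pi * f x * h' x) *\<^sub>R (\<i> * latv d f h \<alpha> \<beta> x))"
proof -
  have c: "continuous_on UNIV f" "continuous_on UNIV h" "continuous_on UNIV f'" "continuous_on UNIV h'"
    using f h by (auto simp: C1_dir_def)
  have c1: "continuous_on UNIV (\<lambda>x. f x + \<alpha>)" "continuous_on UNIV (\<lambda>x. h x + \<beta>)" using c by (auto intro!: continuous_intros)
  note cl = continuous_lat[OF d c1]
  have line: "((\<lambda>\<tau>. latv d f h \<alpha> \<beta> (x + \<tau> *\<^sub>R ax j)) has_vector_derivative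
      latc d f h f' h' \<alpha> \<beta> x + (2 * pi * f x * h' x) *\<^sub>R (\<i> * latv d f h \<alpha> \<beta> x)) (at 0)" for x
  proof -
    have F: "((\<lambda>\<tau>. f (x + \<tau> *\<^sub>R ax j) + \<alpha>) has_real_derivative f' x) (at 0)"
      and Hd: "((\<lambda>\<tau>. h (x + \<tau> *\<^sub>R ax j) + \<beta>) has_real_derivative h' x) (at 0)"
      using f h by (auto simp: C1_dir_def has_real_derivative_iff_has_vector_derivative intro!: derivative_eq_intros)
    have P: "((\<lambda>\<tau>. - (2 * pi * \<alpha> * (h (x + \<tau> *\<^sub>R ax j) + \<beta>))) has_real_derivative - (2 * pi * \<alpha> * h' x)) (at 0)"
      using DERIV_cmult[OF Hd, of "- (2 * pi * \<alpha>)"] by simp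
    show ?thesis
      unfolding latv_def
      by (rule has_vector_derivative_eq_rhs[OF has_vector_derivative_mult[OF has_vector_derivative_lat[OF d F Hd] cis_line[OF P]]])
        (simp add: latc_def scaleR_conv_of_real algebra_simps)
  qed
  have cv: "continuous_on UNIV (latv d f h \<alpha> \<beta>)"
    unfolding latv_def[abs_def] by (intro continuous_intros cl c)
  moreover have "continuous_on UNIV (\<lambda>x. latc d f h f' h' \<alpha> \<beta> x + (2 * pi * f x * h' x) *\<^sub>R (\<i> * latv d f h \<alpha> \<beta> x))"
    unfolding latc_def[abs_def] by (intro continuous_intros cl c cv)
  ultimately show ?thesis using line unfolding C1_dir_def by blast
qed

lemma latv_norm:
  assumes "d > 0"
  shows "norm (latv d f h \<alpha> \<beta> x) \<le> 1" "1 - (norm (latv d f h \<alpha> \<beta> x))\<^sup>2 = d\<^sup>2 * gfac d (f x + \<alpha>) (h x + \<beta>)"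
  using norm_lat[OF assms] by (auto simp: latv_def norm_mult)

text \<open>The factor next to pi^2 in the gradient bound. Only for its first summand does the bound
  on the cell mean grow as d tends to 0.\<close>

definition latP :: "real \<Rightarrow> real \<Rightarrow> real \<Rightarrow> real" where
  "latP d s t = gfac d s t + 1 + d\<^sup>2 * (gfac d s t)\<^sup>2"

text \<open>Cauchy-Schwarz with a spare factor 2, since here f and h may vary in the same direction.
  It serves the lattices that gauge away A - F, for which a constant factor does no harm.\<close>

lemma latc_norm_le:
  assumes d: "d > 0"
  shows "(norm (latc d f h f' h' \<alpha> \<beta> x))\<^sup>2 \<le> 2 * ((f' x)\<^sup>2 + (h' x)\<^sup>2) * (pi\<^sup>2 * latP d (f x + \<alpha>) (h x + \<beta>))"
proof -
  let ?a = "lat_s d (f x + \<alpha>) (h x + \<beta>)" and ?b = "lat_t d (f x + \<alpha>) (h x + \<beta>)"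
  have "norm (latc d f h f' h' \<alpha> \<beta> x) \<le> \<bar>f' x\<bar> * norm ?a + \<bar>h' x\<bar> * norm ?b"
    unfolding latc_def by (simp add: norm_mult) (metis norm_scaleR norm_triangle_ineq)
  then have "(norm (latc d f h f' h' \<alpha> \<beta> x))\<^sup>2 \<le> (\<bar>f' x\<bar> * norm ?a + \<bar>h' x\<bar> * norm ?b)\<^sup>2"
    by (intro power_mono) auto
  also have "\<dots> \<le> 2 * ((f' x)\<^sup>2 + (h' x)\<^sup>2) * ((norm ?a)\<^sup>2 + (norm ?b)\<^sup>2)"
  proof -
    have "(u * p + v * q)\<^sup>2 \<le> 2 * (u\<^sup>2 + v\<^sup>2) * (p\<^sup>2 + q\<^sup>2)" for u v p q :: real
    proof -
      have "2 * (u\<^sup>2 + v\<^sup>2) * (p\<^sup>2 + q\<^sup>2) - (u * p + v * q)\<^sup>2 = (u\<^sup>2 + v\<^sup>2) * (p\<^sup>2 + q\<^sup>2) + (u * q - v * p)\<^sup>2"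
        by (simp add: power2_eq_square algebra_simps)
      moreover have "(u\<^sup>2 + v\<^sup>2) * (p\<^sup>2 + q\<^sup>2) + (u * q - v * p)\<^sup>2 \<ge> 0" by (intro add_nonneg_nonneg mult_nonneg_nonneg) auto
      ultimately show ?thesis by linarith
    qed
    from this[of "\<bar>f' x\<bar>" "norm ?a" "\<bar>h' x\<bar>" "norm ?b"] show ?thesis by simp
  qed
  also have "\<dots> \<le> 2 * ((f' x)\<^sup>2 + (h' x)\<^sup>2) * (pi\<^sup>2 * latP d (f x + \<alpha>) (h x + \<beta>))"
    unfolding latP_def using norm_dlat[OF d] by (intro mult_left_mono) auto
  finally show ?thesis .
qed

section \<open>Averages over a lattice cell\<close>

lemma nn_integral_shift_real:
  fixes f :: "real \<Rightarrow> ennreal"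
  assumes [measurable]: "f \<in> borel_measurable borel"
  shows "(\<integral>\<^sup>+x. indicator {a..<b} x * f x \<partial>lborel) = (\<integral>\<^sup>+x. indicator {a - h..<b - h} x * f (x + h) \<partial>lborel)"
proof -
  have "(\<integral>\<^sup>+x. indicator {a..<b} x * f x \<partial>lborel) = (\<integral>\<^sup>+x. indicator {a..<b} (x + h) * f (x + h) \<partial>lborel)"
    using nn_integral_shift[of "\<lambda>x. indicator {a..<b} x * f x" h] by simp
  also have "\<dots> = (\<integral>\<^sup>+x. indicator {a - h..<b - h} x * f (x + h) \<partial>lborel)"
    by (intro nn_integral_cong) (auto simp: indicator_def)
  finally show ?thesis .
qed

text \<open>Periodicity reduces the starting point to its fractional part r; the piece over [1, r +
  1) is translated back to [0, r).\<close>

lemma nn_integral_periodic: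
  fixes f :: "real \<Rightarrow> ennreal"
  assumes m [measurable]: "f \<in> borel_measurable borel" and per: "\<And>x. f (x + 1) = f x"
  shows "(\<integral>\<^sup>+x. indicator {y..<y + 1} x * f x \<partial>lborel) = (\<integral>\<^sup>+x. indicator {0..<1} x * f x \<partial>lborel)"
proof -
  have pern: "f (x + real n) = f x" for x n
    by (induction n) (auto simp: per add.assoc[symmetric] add.commute[of 1])
  have peri: "f (x + of_int n) = f x" for x n
  proof (cases "n \<ge> 0")
    case True
    then show ?thesis using pern[of x "nat n"] by simp
  next
    case False
    then show ?thesis using pern[of "x + of_int n" "nat (- n)"] by simp
  qed
  define r where "r = frac y"
  have r: "0 \<le> r" "r < 1" by (auto simp: r_def frac_lt_1)
  have "(\<integral>\<^sup>+x. indicator {y..<y + 1} x * f x \<partial>lborel) = (\<integral>\<^sup>+x. indicator {r..<r + 1} x * f x \<partial>lborel)"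
    using nn_integral_shift_real[of f y "y + 1" "of_int \<lfloor>y\<rfloor>"] by (simp add: peri r_def frac_def algebra_simps)
  also have "\<dots> = (\<integral>\<^sup>+x. indicator {r..<1} x * f x + indicator {1..<r + 1} x * f x \<partial>lborel)"
    using r by (intro nn_integral_cong) (auto simp: indicator_def)
  also have "\<dots> = (\<integral>\<^sup>+x. indicator {r..<1} x * f x \<partial>lborel) + (\<integral>\<^sup>+x. indicator {1..<r + 1} x * f x \<partial>lborel)"
    by (intro nn_integral_add) auto
  also have "(\<integral>\<^sup>+x. indicator {1..<r + 1} x * f x \<partial>lborel) = (\<integral>\<^sup>+x. indicator {0..<r} x * f x \<partial>lborel)"
    using nn_integral_shift_real[of f 1 "r + 1" 1] by (simp add: per)
  also have "(\<integral>\<^sup>+x. indicator {r..<1} x * f x \<partial>lborel) + (\<integral>\<^sup>+x. indicator {0..<r} x * f x \<partial>lborel)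
     = (\<integral>\<^sup>+x. indicator {r..<1} x * f x + indicator {0..<r} x * f x \<partial>lborel)"
    by (intro nn_integral_add[symmetric]) auto
  also have "\<dots> = (\<integral>\<^sup>+x. indicator {0..<1} x * f x \<partial>lborel)"
    using r by (intro nn_integral_cong) (auto simp: indicator_def)
  finally show ?thesis .
qed

lemma nn_integral_periodic_center:
  fixes f :: "real \<Rightarrow> ennreal"
  assumes m [measurable]: "f \<in> borel_measurable borel" and per: "\<And>x. f (x + 1) = f x"
  shows "(\<integral>\<^sup>+x. indicator {0..<1} x * f (s + x) \<partial>lborel) = (\<integral>\<^sup>+x. indicator {-1/2..<1/2} x * f (x + 1/2) \<partial>lborel)"
proof -
  have "(\<integral>\<^sup>+x. indicator {0..<1} x * f (s + x) \<partial>lborel) = (\<integral>\<^sup>+x. indicator {s..<s + 1} x * f x \<partial>lborel)"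
    using nn_integral_shift_real[of f s "s + 1" s] by (simp add: add.commute)
  also have "\<dots> = (\<integral>\<^sup>+x. indicator {0..<0 + 1} x * f x \<partial>lborel)"
    using nn_integral_periodic[OF assms] by simp
  also have "\<dots> = (\<integral>\<^sup>+x. indicator {-1/2..<1/2} x * f (x + 1/2) \<partial>lborel)"
    using nn_integral_shift_real[of f 0 "0 + 1" "1/2"] by simp
  finally show ?thesis .
qed

lemma measurable_case_prod_compose:
  assumes "(\<lambda>(x, y). \<Phi> x y) \<in> borel_measurable (borel \<Otimes>\<^sub>M borel)" "f \<in> borel_measurable N" "g \<in> borel_measurable N"
  shows "(\<lambda>z. \<Phi> (f z) (g z)) \<in> borel_measurable N"
  using measurable_compose[OF measurable_Pair[OF assms(2,3)] assms(1)] by simp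

definition cell_mean :: "(real \<Rightarrow> real \<Rightarrow> ennreal) \<Rightarrow> ennreal" where
  "cell_mean \<Phi> = (\<integral>\<^sup>+\<alpha>. indicator {0..<1} \<alpha> * (\<integral>\<^sup>+\<beta>. indicator {0..<1} \<beta> * \<Phi> \<alpha> \<beta> \<partial>lborel) \<partial>lborel)"

text \<open>The mean of a periodic function does not depend on the unit square, so the square
  centred at (1/2, 1/2), a zero of the lattice, may be used for all s and t.\<close>

lemma cell_mean_shift:
  assumes m: "(\<lambda>(x, y). \<Phi> x y) \<in> borel_measurable (borel \<Otimes>\<^sub>M borel)"
    and per: "\<And>x y. \<Phi> (x + 1) y = \<Phi> x y" "\<And>x y. \<Phi> x (y + 1) = \<Phi> x y"
  shows "cell_mean (\<lambda>\<alpha> \<beta>. \<Phi> (s + \<alpha>) (t + \<beta>)) = (\<integral>\<^sup>+x. indicator {-1/2..<1/2} x *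
     (\<integral>\<^sup>+y. indicator {-1/2..<1/2} y * \<Phi> (x + 1/2) (y + 1/2) \<partial>lborel) \<partial>lborel)"
proof -
  note [measurable (raw)] = measurable_case_prod_compose[OF m]
  have m1: "(\<lambda>y. \<Phi> x y) \<in> borel_measurable borel" for x by measurable
  have m2: "(\<lambda>x. \<integral>\<^sup>+y. indicator {-1/2..<1/2} y * \<Phi> x (y + 1/2) \<partial>lborel) \<in> borel_measurable borel"
    by measurable
  have "cell_mean (\<lambda>\<alpha> \<beta>. \<Phi> (s + \<alpha>) (t + \<beta>)) =
     (\<integral>\<^sup>+\<alpha>. indicator {0..<1} \<alpha> * (\<integral>\<^sup>+y. indicator {-1/2..<1/2} y * \<Phi> (s + \<alpha>) (y + 1/2) \<partial>lborel) \<partial>lborel)"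
    unfolding cell_mean_def using nn_integral_periodic_center[OF m1 per(2)] by simp
  also have "\<dots> = (\<integral>\<^sup>+x. indicator {-1/2..<1/2} x *
     (\<integral>\<^sup>+y. indicator {-1/2..<1/2} y * \<Phi> (x + 1/2) (y + 1/2) \<partial>lborel) \<partial>lborel)"
    using nn_integral_periodic_center[OF m2] per(1) by simp
  finally show ?thesis .
qed

text \<open>This amounts to x cos x <= sin x on [0, pi/2], where the difference has the derivative x
  sin x >= 0. It compares \<open>zden\<close> near its zero with a rational function.\<close>

lemma cos_sq_le: fixes \<theta> :: real assumes "\<bar>\<theta>\<bar> \<le> pi/2" shows "(cos \<theta>)\<^sup>2 * (1 + \<theta>\<^sup>2) \<le> 1"
proof -
  define x where "x = \<bar>\<theta>\<bar>"
  have x: "0 \<le> x" "x \<le> pi/2" using assms by (auto simp: x_def)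
  have "(\<lambda>x. sin x - x * cos x) 0 \<le> (\<lambda>x. sin x - x * cos x) x"
  proof (rule DERIV_nonneg_imp_nondecreasing[OF x(1)])
    fix y assume y: "0 \<le> y" "y \<le> x"
    have "((\<lambda>x. sin x - x * cos x) has_real_derivative y * sin y) (at y)"
      by (auto intro!: derivative_eq_intros)
    moreover have "y * sin y \<ge> 0" using y x pi_gt_zero by (intro mult_nonneg_nonneg sin_ge_zero) linarith+
    ultimately show "\<exists>z. ((\<lambda>x. sin x - x * cos x) has_real_derivative z) (at y) \<and> 0 \<le> z" by blast
  qed
  then have 1: "x * cos x \<le> sin x" by simp
  have 2: "x * cos x \<ge> 0" using x by (intro mult_nonneg_nonneg cos_ge_zero) auto
  have "(x * cos x)\<^sup>2 \<le> (sin x)\<^sup>2" using 1 2 by (rule power_mono)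
  moreover have "(cos x)\<^sup>2 * (1 + x\<^sup>2) = (cos x)\<^sup>2 + (x * cos x)\<^sup>2"
    by (simp add: power_mult_distrib algebra_simps)
  ultimately have "(cos x)\<^sup>2 * (1 + x\<^sup>2) \<le> 1" using sin_cos_squared_add[of x] by linarith
  then show ?thesis by (simp add: x_def)
qed

text \<open>Around the vortex one has zden >= Y / (1 + Y). The first bound keeps the coefficient 1
  of the singularity, on which the leading constant of the energy depends; the second has no
  additive constant and can therefore be squared.\<close>

lemma gfac_le:
  assumes d: "d > 0" and x: "\<bar>x\<bar> \<le> 1/2" and y: "\<bar>y\<bar> \<le> 1/2"
  defines "Y \<equiv> pi\<^sup>2 * x\<^sup>2 + pi\<^sup>2 * y\<^sup>2"
  shows "gfac d (x + 1/2) (y + 1/2) \<le> 1 / (Y + d\<^sup>2) + 1" "gfac d (x + 1/2) (y + 1/2) \<le> 7 / (Y + d\<^sup>2)"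
proof -
  have s: "sin (pi * (z + 1/2)) = cos (pi * z)" for z
    using sin_cos_eq[of "- (pi * z)"] by (simp add: distrib_left sin_add)
  have c: "(cos (pi * z))\<^sup>2 \<le> 1 / (1 + pi\<^sup>2 * z\<^sup>2)" if "\<bar>z\<bar> \<le> 1/2" for z
  proof -
    have "pi * \<bar>z\<bar> \<le> pi * (1/2)" using that by (intro mult_left_mono) auto
    then have "\<bar>pi * z\<bar> \<le> pi/2" by (simp add: abs_mult)
    from cos_sq_le[OF this] show ?thesis by (simp add: pos_le_divide_eq add_pos_nonneg power_mult_distrib)
  qed
  have Y0: "Y \<ge> 0" by (simp add: Y_def)
  have dd: "d\<^sup>2 > 0" using d by simp
  have "(cos (pi * x))\<^sup>2 * (cos (pi * y))\<^sup>2 \<le> 1 / (1 + pi\<^sup>2 * x\<^sup>2) * (1 / (1 + pi\<^sup>2 * y\<^sup>2))"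
    using c[OF x] c[OF y] by (intro mult_mono) auto
  also have "\<dots> = 1 / ((1 + pi\<^sup>2 * x\<^sup>2) * (1 + pi\<^sup>2 * y\<^sup>2))" by simp
  also have "\<dots> \<le> 1 / (1 + Y)"
    using Y0 by (intro divide_left_mono) (auto simp: Y_def algebra_simps intro!: mult_pos_pos add_pos_nonneg)
  finally have "zden (x + 1/2) (y + 1/2) \<ge> 1 - 1 / (1 + Y)" unfolding zden_def s by simp
  also have "1 - 1 / (1 + Y) = Y / (1 + Y)" using Y0 by (simp add: field_simps)
  finally have z: "Y / (1 + Y) \<le> zden (x + 1/2) (y + 1/2)" .
  have p: "Y / (1 + Y) + d\<^sup>2 > 0" "Y + d\<^sup>2 > 0" using Y0 dd by (auto intro: add_nonneg_pos)
  have le: "(Y + d\<^sup>2) / (1 + Y) \<le> zden (x + 1/2) (y + 1/2) + d\<^sup>2"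
  proof -
    have "d\<^sup>2 / (1 + Y) \<le> d\<^sup>2 / 1" using Y0 dd by (intro divide_left_mono) auto
    then show ?thesis using z by (simp add: add_divide_distrib)
  qed
  have "gfac d (x + 1/2) (y + 1/2) \<le> 1 / ((Y + d\<^sup>2) / (1 + Y))"
    unfolding gfac_def using le p Y0 zden_pos[OF d] by (intro divide_left_mono mult_pos_pos divide_pos_pos) auto
  then have g: "gfac d (x + 1/2) (y + 1/2) \<le> (1 + Y) / (Y + d\<^sup>2)" by simp
  have "Y / (Y + d\<^sup>2) \<le> 1" using p dd by simp
  then show "gfac d (x + 1/2) (y + 1/2) \<le> 1 / (Y + d\<^sup>2) + 1" using g by (simp add: add_divide_distrib)
  have "x\<^sup>2 \<le> (1/2)\<^sup>2" "y\<^sup>2 \<le> (1/2)\<^sup>2" using power_mono[OF x, of 2] power_mono[OF y, of 2] by auto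
  then have "Y \<le> pi\<^sup>2 * (1/2)\<^sup>2 + pi\<^sup>2 * (1/2)\<^sup>2" unfolding Y_def by (intro add_mono mult_left_mono) auto
  moreover have "pi\<^sup>2 \<le> 3.2\<^sup>2" using pi_approx by (intro power_mono) auto
  \<comment> \<open>Y is at most pi^2 / 2, so 1 + Y is below 6.2 with the rough bound on pi.\<close>
  ultimately have "1 + Y \<le> 7" by (simp add: power2_eq_square)
  then have "(1 + Y) / (Y + d\<^sup>2) \<le> 7 / (Y + d\<^sup>2)" using p by (intro divide_right_mono) auto
  then show "gfac d (x + 1/2) (y + 1/2) \<le> 7 / (Y + d\<^sup>2)" using g by simp
qed

text \<open>The antiderivative arctan (pi y / A) / pi has total increase at most 1, whatever the
  width A.\<close>

lemma nn_integral_lorentz: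
  assumes A: "A > 0"
  shows "(\<integral>\<^sup>+y. indicator {-1/2..<1/2} y * ennreal (A / (pi\<^sup>2 * y\<^sup>2 + A\<^sup>2)) \<partial>lborel) \<le> 1"
proof -
  have p: "pi\<^sup>2 * y\<^sup>2 + A\<^sup>2 > 0" for y using A by (intro add_nonneg_pos) auto
  have "(\<integral>\<^sup>+y. indicator {-1/2..<1/2} y * ennreal (A / (pi\<^sup>2 * y\<^sup>2 + A\<^sup>2)) \<partial>lborel)
     \<le> (\<integral>\<^sup>+y. ennreal (A / (pi\<^sup>2 * y\<^sup>2 + A\<^sup>2)) * indicator {-1/2..1/2} y \<partial>lborel)"
    by (intro nn_integral_mono) (auto simp: indicator_def)
  also have "\<dots> = ennreal (arctan (pi * (1/2) / A) / pi - arctan (pi * (-1/2) / A) / pi)"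
  proof (rule nn_integral_FTC_Icc)
    show "((\<lambda>y. arctan (pi * y / A) / pi) has_real_derivative A / (pi\<^sup>2 * y\<^sup>2 + A\<^sup>2)) (at y)" for y
    proof -
      have "((\<lambda>y. arctan (pi * y / A) / pi) has_real_derivative inverse (1 + (pi * y / A)\<^sup>2) * (pi / A) / pi) (at y)"
        using A by (auto intro!: derivative_eq_intros)
      moreover have "inverse (1 + (pi * y / A)\<^sup>2) * (pi / A) / pi = A / (pi\<^sup>2 * y\<^sup>2 + A\<^sup>2)"
      proof -
        have "1 + (pi * y / A)\<^sup>2 = (pi\<^sup>2 * y\<^sup>2 + A\<^sup>2) / A\<^sup>2" using A by (simp add: power_mult_distrib power_divide field_simps)
        then show ?thesis using A p[of y] by (simp add: power2_eq_square)
      qed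
      ultimately show ?thesis by simp
    qed
    show "0 \<le> A / (pi\<^sup>2 * y\<^sup>2 + A\<^sup>2)" for y using p[of y] A by simp
  qed auto
  also have "\<dots> \<le> ennreal 1"
  proof (rule ennreal_leI)
    have "arctan (pi * (1/2) / A) \<le> pi/2" "arctan (pi * (-1/2) / A) \<ge> - (pi/2)"
      using arctan_bounded less_imp_le by blast+
    then have "arctan (pi * (1/2) / A) - arctan (pi * (-1/2) / A) \<le> pi" by linarith
    then show "arctan (pi * (1/2) / A) / pi - arctan (pi * (-1/2) / A) / pi \<le> 1"
      by (simp add: diff_divide_distrib[symmetric])
  qed
  finally show ?thesis by simp
qed

text \<open>The antiderivative is ln (pi x + sqrt (pi^2 x^2 + d^2)) / pi. Its two endpoint arguments
  have the product d^2, which produces 2 ln (1/d) plus a bounded term.\<close>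

lemma nn_integral_arsinh:
  assumes d: "d > 0" "d \<le> 1"
  shows "(\<integral>\<^sup>+x. indicator {-1/2..<1/2} x * ennreal (1 / sqrt (pi\<^sup>2 * x\<^sup>2 + d\<^sup>2)) \<partial>lborel) \<le> ennreal (2 / pi * (ln (1 / d) + ln 4))"
proof -
  have p: "pi\<^sup>2 * y\<^sup>2 + d\<^sup>2 > 0" for y using d by (intro add_nonneg_pos) auto
  let ?r = "\<lambda>x. sqrt (pi\<^sup>2 * x\<^sup>2 + d\<^sup>2)"
  have r: "?r x > \<bar>pi * x\<bar>" for x
  proof -
    have "sqrt ((pi * x)\<^sup>2) < ?r x" using d by (intro real_sqrt_less_mono) (simp add: power_mult_distrib)
    then show ?thesis by simp
  qed
  have r2: "pi * x + ?r x > 0" for x using r[of x] by linarith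
  have "(\<integral>\<^sup>+x. indicator {-1/2..<1/2} x * ennreal (1 / ?r x) \<partial>lborel)
     \<le> (\<integral>\<^sup>+x. ennreal (1 / ?r x) * indicator {-1/2..1/2} x \<partial>lborel)"
    by (intro nn_integral_mono) (auto simp: indicator_def)
  also have "\<dots> = ennreal (ln (pi * (1/2) + ?r (1/2)) / pi - ln (pi * (-1/2) + ?r (-1/2)) / pi)"
  proof (rule nn_integral_FTC_Icc)
    show "((\<lambda>x. ln (pi * x + ?r x) / pi) has_real_derivative 1 / ?r x) (at x)" for x
    proof -
      have "((\<lambda>x. ln (pi * x + ?r x) / pi) has_real_derivative (pi + pi\<^sup>2 * x / ?r x) / (pi * x + ?r x) / pi) (at x)"
        using p[of x] r2[of x] by (auto intro!: derivative_eq_intros simp: divide_simps)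
      moreover have "(pi + pi\<^sup>2 * x / ?r x) / (pi * x + ?r x) / pi = 1 / ?r x"
      proof -
        define q where "q = ?r x"
        have q: "q > 0" "pi * x + q > 0" using r[of x] abs_ge_zero[of "pi * x"] r2[of x] unfolding q_def by linarith+
        have "pi + pi\<^sup>2 * x / q = pi * (pi * x + q) / q" using q by (simp add: field_simps power2_eq_square)
        then show ?thesis unfolding q_def[symmetric] using q by simp
      qed
      ultimately show ?thesis by simp
    qed
    show "0 \<le> 1 / ?r x" for x using p[of x] by simp
  qed auto
  also have "\<dots> \<le> ennreal (2 / pi * (ln (1 / d) + ln 4))"
  proof (rule ennreal_leI)
    define R where "R = ?r (1/2)"
    have R': "?r (-1/2) = R" by (simp add: R_def)
    have Rp: "R > pi/2" using r[of "1/2"] by (simp add: R_def)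
    have R2: "R\<^sup>2 = (pi/2)\<^sup>2 + d\<^sup>2" unfolding R_def using p[of "1/2"] by (simp add: power_divide)
    have "(pi/2)\<^sup>2 \<le> 1.6\<^sup>2" using pi_approx by (intro power_mono) auto
    moreover have "d\<^sup>2 \<le> 1" using d by (intro power_le_one) auto
    ultimately have "R\<^sup>2 \<le> 2\<^sup>2" unfolding R2 by (simp add: power2_eq_square)
    then have R4: "pi/2 + R \<le> 4" using power2_le_imp_le[of R 2] pi_approx by auto
    have prod: "(R - pi/2) * (pi/2 + R) = d\<^sup>2" using R2 by (simp add: power2_eq_square algebra_simps)
    have pos: "R - pi/2 > 0" "pi/2 + R > 0" using Rp pi_gt_zero by linarith+
    then have "ln (R - pi/2) + ln (pi/2 + R) = ln (d\<^sup>2)" by (simp add: prod[symmetric] ln_mult)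
    also have "ln (d\<^sup>2) = 2 * ln d" using d by (simp add: ln_realpow)
    finally have l: "ln (R - pi/2) = 2 * ln d - ln (pi/2 + R)" by simp
    have "ln (pi/2 + R) \<le> ln 4" using R4 pos by simp
    then have "ln (pi/2 + R) - ln (R - pi/2) \<le> 2 * (ln (1 / d) + ln 4)" unfolding l using d by (simp add: ln_div)
    then have "(ln (pi/2 + R) - ln (R - pi/2)) / pi \<le> 2 * (ln (1 / d) + ln 4) / pi" by (intro divide_right_mono) auto
    then show "ln (pi * (1/2) + ?r (1/2)) / pi - ln (pi * (-1/2) + ?r (-1/2)) / pi \<le> 2 / pi * (ln (1 / d) + ln 4)"
      unfolding R' unfolding R_def[symmetric] by (simp add: diff_divide_distrib)
  qed
  finally show ?thesis .
qed

lemma gfac_periodic: "gfac d (s + 1) t = gfac d s t" "gfac d s (t + 1) = gfac d s t"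
  by (simp_all add: gfac_def zden_def distrib_left sin_add)

lemma gfac_measurable [measurable]: "(\<lambda>(x, y). gfac d x y) \<in> borel_measurable (borel \<Otimes>\<^sub>M borel)"
  unfolding gfac_def zden_def by measurable

text \<open>Integrate first in y: a Lorentz profile of width A = sqrt (pi^2 x^2 + d^2) leaves 1 / A,
  and the integral of 1 / A in x is logarithmic. The additive 1 comes from the bounded part of
  \<open>gfac\<close>.\<close>

lemma cell_mean_gfac:
  assumes d: "d > 0" "d \<le> 1"
  shows "cell_mean (\<lambda>\<alpha> \<beta>. ennreal (gfac d (s + \<alpha>) (t + \<beta>))) \<le> ennreal (1 + 2 / pi * (ln (1 / d) + ln 4))"
proof -
  let ?i = "indicator {-1/2..<1/2} :: real \<Rightarrow> ennreal"
  have p: "pi\<^sup>2 * y\<^sup>2 + d\<^sup>2 > 0" for y using d by (intro add_nonneg_pos) auto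
  have inner: "(\<integral>\<^sup>+y. ?i y * ennreal (gfac d (x + 1/2) (y + 1/2)) \<partial>lborel) \<le> ennreal (1 / sqrt (pi\<^sup>2 * x\<^sup>2 + d\<^sup>2)) + 1"
    if x: "x \<in> {-1/2..<1/2}" for x
  proof -
    define A where "A = sqrt (pi\<^sup>2 * x\<^sup>2 + d\<^sup>2)"
    have A: "A > 0" "A\<^sup>2 = pi\<^sup>2 * x\<^sup>2 + d\<^sup>2" using p[of x] by (auto simp: A_def)
    have "(\<integral>\<^sup>+y. ?i y * ennreal (gfac d (x + 1/2) (y + 1/2)) \<partial>lborel)
       \<le> (\<integral>\<^sup>+y. ennreal (1 / A) * (?i y * ennreal (A / (pi\<^sup>2 * y\<^sup>2 + A\<^sup>2))) + ?i y \<partial>lborel)"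
    proof (rule nn_integral_mono)
      fix y :: real
      show "?i y * ennreal (gfac d (x + 1/2) (y + 1/2)) \<le> ennreal (1 / A) * (?i y * ennreal (A / (pi\<^sup>2 * y\<^sup>2 + A\<^sup>2))) + ?i y"
      proof (cases "y \<in> {-1/2..<1/2}")
        case True
        have "gfac d (x + 1/2) (y + 1/2) \<le> 1 / A * (A / (pi\<^sup>2 * y\<^sup>2 + A\<^sup>2)) + 1"
        proof -
          have "gfac d (x + 1/2) (y + 1/2) \<le> 1 / (pi\<^sup>2 * x\<^sup>2 + pi\<^sup>2 * y\<^sup>2 + d\<^sup>2) + 1"
            by (rule gfac_le(1)[OF d(1)]) (use x True in auto)
          also have "pi\<^sup>2 * x\<^sup>2 + pi\<^sup>2 * y\<^sup>2 + d\<^sup>2 = pi\<^sup>2 * y\<^sup>2 + A\<^sup>2" using A by simp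
          finally show ?thesis using A by simp
        qed
        then have "ennreal (gfac d (x + 1/2) (y + 1/2)) \<le> ennreal (1 / A * (A / (pi\<^sup>2 * y\<^sup>2 + A\<^sup>2)) + 1)"
          by (rule ennreal_leI)
        also have "\<dots> = ennreal (1 / A) * ennreal (A / (pi\<^sup>2 * y\<^sup>2 + A\<^sup>2)) + 1"
          using A by (subst ennreal_plus) (auto simp: ennreal_mult[symmetric] intro!: divide_nonneg_nonneg add_nonneg_nonneg)
        finally show ?thesis using True by simp
      qed simp
    qed
    also have "\<dots> = ennreal (1 / A) * (\<integral>\<^sup>+y. ?i y * ennreal (A / (pi\<^sup>2 * y\<^sup>2 + A\<^sup>2)) \<partial>lborel) + (\<integral>\<^sup>+y. ?i y \<partial>lborel)"
      by (subst nn_integral_add) (auto simp: nn_integral_cmult)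
    also have "\<dots> \<le> ennreal (1 / A) * 1 + 1"
      using nn_integral_lorentz[OF A(1)] by (intro add_mono mult_left_mono) auto
    finally show ?thesis by (simp add: A_def)
  qed
  have m: "(\<lambda>(x, y). ennreal (gfac d x y)) \<in> borel_measurable (borel \<Otimes>\<^sub>M borel)" by measurable
  have "cell_mean (\<lambda>\<alpha> \<beta>. ennreal (gfac d (s + \<alpha>) (t + \<beta>))) =
     (\<integral>\<^sup>+x. ?i x * (\<integral>\<^sup>+y. ?i y * ennreal (gfac d (x + 1/2) (y + 1/2)) \<partial>lborel) \<partial>lborel)"
    by (rule cell_mean_shift[where \<Phi>="\<lambda>x y. ennreal (gfac d x y)"]) (use m in \<open>auto simp: gfac_periodic\<close>)
  also have "\<dots> \<le> (\<integral>\<^sup>+x. ?i x * ennreal (1 / sqrt (pi\<^sup>2 * x\<^sup>2 + d\<^sup>2)) + ?i x \<partial>lborel)"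
    by (intro nn_integral_mono) (use inner in \<open>auto simp: indicator_def\<close>)
  also have "\<dots> = (\<integral>\<^sup>+x. ?i x * ennreal (1 / sqrt (pi\<^sup>2 * x\<^sup>2 + d\<^sup>2)) \<partial>lborel) + (\<integral>\<^sup>+x. ?i x \<partial>lborel)"
    by (intro nn_integral_add) auto
  also have "\<dots> \<le> ennreal (2 / pi * (ln (1 / d) + ln 4)) + 1"
    using nn_integral_arsinh[OF d] by (intro add_mono) auto
  also have "\<dots> = ennreal (1 + 2 / pi * (ln (1 / d) + ln 4))"
  proof -
    have "2 / pi * (ln (1 / d) + ln 4) \<ge> 0" using d by (simp add: ln_div)
    then show ?thesis by (subst ennreal_plus) (auto simp: add.commute)
  qed
  finally show ?thesis .
qed

text \<open>The estimate (a + b + d^2)^2 >= (a + d^2) (b + d^2) separates the variables, and each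
  Lorentz factor integrates to at most 1; 49 is the square of the constant 7. The potential energy
  per vortex therefore stays bounded relative to its scale, without a logarithm.\<close>

lemma cell_mean_gfac_sq:
  assumes d: "d > 0"
  shows "cell_mean (\<lambda>\<alpha> \<beta>. ennreal (d\<^sup>2 * (gfac d (s + \<alpha>) (t + \<beta>))\<^sup>2)) \<le> ennreal 49"
proof -
  let ?i = "indicator {-1/2..<1/2} :: real \<Rightarrow> ennreal"
  let ?l = "\<lambda>y. ennreal (d / (pi\<^sup>2 * y\<^sup>2 + d\<^sup>2))"
  have p: "pi\<^sup>2 * y\<^sup>2 + d\<^sup>2 > 0" for y using d by (intro add_nonneg_pos) auto
  have pt: "d\<^sup>2 * (gfac d (x + 1/2) (y + 1/2))\<^sup>2 \<le> 49 * (d / (pi\<^sup>2 * x\<^sup>2 + d\<^sup>2)) * (d / (pi\<^sup>2 * y\<^sup>2 + d\<^sup>2))"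
    if "\<bar>x\<bar> \<le> 1/2" "\<bar>y\<bar> \<le> 1/2" for x y
  proof -
    define a b where "a = pi\<^sup>2 * x\<^sup>2" and "b = pi\<^sup>2 * y\<^sup>2"
    have ab: "a \<ge> 0" "b \<ge> 0" by (auto simp: a_def b_def)
    have dd: "d\<^sup>2 > 0" using d by simp
    have "(gfac d (x + 1/2) (y + 1/2))\<^sup>2 \<le> (7 / (a + b + d\<^sup>2))\<^sup>2"
      using gfac_le(2)[OF d that] gfac_pos[OF d] by (intro power_mono) (auto simp: a_def b_def less_imp_le)
    also have "\<dots> = 49 / (a + b + d\<^sup>2)\<^sup>2" by (simp add: power_divide)
    also have "\<dots> \<le> 49 / ((a + d\<^sup>2) * (b + d\<^sup>2))"
    proof (rule divide_left_mono)
      have "(a + d\<^sup>2) * (b + d\<^sup>2) \<le> (a + b + d\<^sup>2) * (a + b + d\<^sup>2)" using ab dd by (intro mult_mono) auto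
      then show "(a + d\<^sup>2) * (b + d\<^sup>2) \<le> (a + b + d\<^sup>2)\<^sup>2" by (simp add: power2_eq_square)
      show "0 < (a + b + d\<^sup>2)\<^sup>2 * ((a + d\<^sup>2) * (b + d\<^sup>2))" using ab dd d by (intro mult_pos_pos zero_less_power add_nonneg_pos) auto
    qed auto
    finally have "d\<^sup>2 * (gfac d (x + 1/2) (y + 1/2))\<^sup>2 \<le> d\<^sup>2 * (49 / ((a + d\<^sup>2) * (b + d\<^sup>2)))"
      by (intro mult_left_mono) auto
    also have "\<dots> = 49 * (d / (a + d\<^sup>2)) * (d / (b + d\<^sup>2))" by (simp add: power2_eq_square)
    finally show ?thesis by (simp add: a_def b_def)
  qed
  have m: "(\<lambda>(x, y). ennreal (d\<^sup>2 * (gfac d x y)\<^sup>2)) \<in> borel_measurable (borel \<Otimes>\<^sub>M borel)" by measurable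
  have "cell_mean (\<lambda>\<alpha> \<beta>. ennreal (d\<^sup>2 * (gfac d (s + \<alpha>) (t + \<beta>))\<^sup>2)) =
     (\<integral>\<^sup>+x. ?i x * (\<integral>\<^sup>+y. ?i y * ennreal (d\<^sup>2 * (gfac d (x + 1/2) (y + 1/2))\<^sup>2) \<partial>lborel) \<partial>lborel)"
    by (rule cell_mean_shift[where \<Phi>="\<lambda>x y. ennreal (d\<^sup>2 * (gfac d x y)\<^sup>2)"]) (use m in \<open>auto simp: gfac_periodic\<close>)
  also have "\<dots> \<le> (\<integral>\<^sup>+x. ?i x * (49 * ?l x) \<partial>lborel)"
  proof (rule nn_integral_mono)
    fix x :: real
    show "?i x * (\<integral>\<^sup>+y. ?i y * ennreal (d\<^sup>2 * (gfac d (x + 1/2) (y + 1/2))\<^sup>2) \<partial>lborel) \<le> ?i x * (49 * ?l x)"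
    proof (cases "x \<in> {-1/2..<1/2}")
      case True
      have "(\<integral>\<^sup>+y. ?i y * ennreal (d\<^sup>2 * (gfac d (x + 1/2) (y + 1/2))\<^sup>2) \<partial>lborel) \<le> (\<integral>\<^sup>+y. (49 * ?l x) * (?i y * ?l y) \<partial>lborel)"
      proof (rule nn_integral_mono)
        fix y :: real
        show "?i y * ennreal (d\<^sup>2 * (gfac d (x + 1/2) (y + 1/2))\<^sup>2) \<le> (49 * ?l x) * (?i y * ?l y)"
        proof (cases "y \<in> {-1/2..<1/2}")
          case True
          have "ennreal (d\<^sup>2 * (gfac d (x + 1/2) (y + 1/2))\<^sup>2) \<le> ennreal (49 * (d / (pi\<^sup>2 * x\<^sup>2 + d\<^sup>2)) * (d / (pi\<^sup>2 * y\<^sup>2 + d\<^sup>2)))"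
            using True \<open>x \<in> _\<close> by (intro ennreal_leI pt) auto
          also have "\<dots> = ennreal (49 * (d / (pi\<^sup>2 * x\<^sup>2 + d\<^sup>2))) * ?l y"
            using d p[of x] p[of y] by (intro ennreal_mult) auto
          also have "ennreal (49 * (d / (pi\<^sup>2 * x\<^sup>2 + d\<^sup>2))) = 49 * ?l x"
            using d p[of x] by (subst ennreal_mult) auto
          finally show ?thesis using True by simp
        qed simp
      qed
      also have "\<dots> = (49 * ?l x) * (\<integral>\<^sup>+y. ?i y * ?l y \<partial>lborel)" by (intro nn_integral_cmult) auto
      also have "\<dots> \<le> (49 * ?l x) * 1" using nn_integral_lorentz[OF d] by (intro mult_left_mono) auto
      finally show ?thesis using True by simp
    qed simp
  qed
  also have "\<dots> = 49 * (\<integral>\<^sup>+x. ?i x * ?l x \<partial>lborel)"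
    by (subst nn_integral_cmult[symmetric]) (auto simp: mult_ac)
  also have "\<dots> \<le> 49 * 1" using nn_integral_lorentz[OF d] by (intro mult_left_mono) auto
  finally show ?thesis by simp
qed

lemma cell_mean_add:
  assumes "(\<lambda>(x, y). \<Phi> x y) \<in> borel_measurable (borel \<Otimes>\<^sub>M borel)" "(\<lambda>(x, y). \<Psi> x y) \<in> borel_measurable (borel \<Otimes>\<^sub>M borel)"
  shows "cell_mean (\<lambda>\<alpha> \<beta>. \<Phi> \<alpha> \<beta> + \<Psi> \<alpha> \<beta>) = cell_mean \<Phi> + cell_mean \<Psi>"
proof -
  note [measurable (raw)] = measurable_case_prod_compose[OF assms(1)] measurable_case_prod_compose[OF assms(2)]
  show ?thesis unfolding cell_mean_def
    by (simp add: distrib_left nn_integral_add)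
qed

lemma cell_mean_cmult:
  assumes m: "(\<lambda>(x, y). \<Phi> x y) \<in> borel_measurable (borel \<Otimes>\<^sub>M borel)"
  shows "cell_mean (\<lambda>\<alpha> \<beta>. c * \<Phi> \<alpha> \<beta>) = c * cell_mean \<Phi>"
proof -
  note [measurable (raw)] = measurable_case_prod_compose[OF m]
  show ?thesis unfolding cell_mean_def
    by (simp add: mult.left_commute[of _ c] nn_integral_cmult)
qed

lemma cell_mean_const: "cell_mean (\<lambda>\<alpha> \<beta>. c) = c"
  unfolding cell_mean_def by (simp add: nn_integral_multc)

lemma cell_mean_latP:
  assumes d: "d > 0" "d \<le> 1"
  shows "cell_mean (\<lambda>\<alpha> \<beta>. ennreal (latP d (s + \<alpha>) (t + \<beta>))) \<le> ennreal (2 / pi * ln (1 / d) + 53)"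
proof -
  have g0: "gfac d x y \<ge> 0" for x y using gfac_pos[OF d(1)] less_imp_le by blast
  have "cell_mean (\<lambda>\<alpha> \<beta>. ennreal (latP d (s + \<alpha>) (t + \<beta>))) =
     cell_mean (\<lambda>\<alpha> \<beta>. (ennreal (gfac d (s + \<alpha>) (t + \<beta>)) + 1) + ennreal (d\<^sup>2 * (gfac d (s + \<alpha>) (t + \<beta>))\<^sup>2))"
    unfolding latP_def using g0 by simp
  also have "\<dots> = (cell_mean (\<lambda>\<alpha> \<beta>. ennreal (gfac d (s + \<alpha>) (t + \<beta>))) + cell_mean (\<lambda>\<alpha> \<beta>. 1)) +
      cell_mean (\<lambda>\<alpha> \<beta>. ennreal (d\<^sup>2 * (gfac d (s + \<alpha>) (t + \<beta>))\<^sup>2))"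
    by (subst cell_mean_add, measurable, subst cell_mean_add, measurable)
  also have "\<dots> \<le> (ennreal (1 + 2 / pi * (ln (1 / d) + ln 4)) + ennreal 1) + ennreal 49"
    using cell_mean_gfac[OF d] cell_mean_gfac_sq[OF d(1)] by (intro add_mono) (auto simp: cell_mean_const)
  also have "\<dots> = ennreal ((1 + 2 / pi * (ln (1 / d) + ln 4)) + 1 + 49)"
  proof -
    have "2 / pi * (ln (1 / d) + ln 4) \<ge> 0" using d by (simp add: ln_div)
    then show ?thesis by (simp only: ennreal_plus[symmetric] add_nonneg_nonneg zero_le_one zero_le_numeral)
  qed
  \<comment> \<open>53 = 1 + 1 + 49 + 2, where the last 2 covers the term with ln 4.\<close>
  also have "\<dots> \<le> ennreal (2 / pi * ln (1 / d) + 53)"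
  proof (rule ennreal_leI)
    have "ln (4::real) \<le> 4 / 2" using ln_le_minus_one[of 2] ln_realpow[of 2 2] by simp
    then have "2 / pi * ln 4 \<le> 2 / pi * 2" by (intro mult_left_mono) auto
    also have "\<dots> \<le> 2" using pi_approx by (simp add: field_simps)
    finally show "(1 + 2 / pi * (ln (1 / d) + ln 4)) + 1 + 49 \<le> 2 / pi * ln (1 / d) + 53" by (simp add: distrib_left)
  qed
  finally show ?thesis .
qed

text \<open>If every translate were at least M + \<open>\<eta>\<close>, so would be the mean over
  the unit square; by Tonelli that mean is the integral of the cell means.\<close>

lemma exists_translate_le:
  fixes \<Psi> :: "R3 \<Rightarrow> real \<Rightarrow> real \<Rightarrow> ennreal"
  assumes m: "(\<lambda>(x, \<alpha>, \<beta>). \<Psi> x \<alpha> \<beta>) \<in> borel_measurable (borel \<Otimes>\<^sub>M borel \<Otimes>\<^sub>M borel)"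
    and B: "\<And>x. cell_mean (\<Psi> x) \<le> B x" "(\<integral>\<^sup>+x. B x \<partial>lborel) \<le> ennreal M" and \<eta>: "\<eta> > 0" and M: "M \<ge> 0"
  shows "\<exists>\<alpha> \<beta>. (\<integral>\<^sup>+x. \<Psi> x \<alpha> \<beta> \<partial>lborel) \<le> ennreal (M + \<eta>)"
proof (rule ccontr)
  assume "\<not> ?thesis"
  then have gt: "ennreal (M + \<eta>) \<le> (\<integral>\<^sup>+x. \<Psi> x \<alpha> \<beta> \<partial>lborel)" for \<alpha> \<beta>
    using less_imp_le not_le by blast
  have mc [measurable (raw)]: "(\<lambda>z. \<Psi> (f z) (g z) (h z)) \<in> borel_measurable N"
    if "f \<in> borel_measurable N" "g \<in> borel_measurable N" "h \<in> borel_measurable N" for f g h and N :: "'z measure"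
    using measurable_compose[OF measurable_Pair[OF that(1) measurable_Pair[OF that(2,3)]] m] by simp
  have "ennreal (M + \<eta>) = cell_mean (\<lambda>\<alpha> \<beta>. ennreal (M + \<eta>))" by (simp add: cell_mean_const)
  also have "\<dots> \<le> cell_mean (\<lambda>\<alpha> \<beta>. \<integral>\<^sup>+x. \<Psi> x \<alpha> \<beta> \<partial>lborel)"
    unfolding cell_mean_def by (intro nn_integral_mono mult_left_mono gt) auto
  also have "\<dots> = (\<integral>\<^sup>+\<alpha>. \<integral>\<^sup>+\<beta>. \<integral>\<^sup>+x. indicator {0..<1} \<alpha> * (indicator {0..<1} \<beta> * \<Psi> x \<alpha> \<beta>) \<partial>lborel \<partial>lborel \<partial>lborel)"
    unfolding cell_mean_def by (simp add: nn_integral_cmult)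
  also have "\<dots> = (\<integral>\<^sup>+\<alpha>. \<integral>\<^sup>+x. \<integral>\<^sup>+\<beta>. indicator {0..<1} \<alpha> * (indicator {0..<1} \<beta> * \<Psi> x \<alpha> \<beta>) \<partial>lborel \<partial>lborel \<partial>lborel)"
    by (intro nn_integral_cong lborel_pair.Fubini') measurable
  also have "\<dots> = (\<integral>\<^sup>+x. \<integral>\<^sup>+\<alpha>. \<integral>\<^sup>+\<beta>. indicator {0..<1} \<alpha> * (indicator {0..<1} \<beta> * \<Psi> x \<alpha> \<beta>) \<partial>lborel \<partial>lborel \<partial>lborel)"
    by (intro lborel_pair.Fubini') measurable
  also have "\<dots> = (\<integral>\<^sup>+x. cell_mean (\<Psi> x) \<partial>lborel)"
    unfolding cell_mean_def by (simp add: nn_integral_cmult)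
  also have "\<dots> \<le> ennreal M" using B(1) by (intro order_trans[OF nn_integral_mono B(2)]) auto
  finally show False using \<eta> M by (simp add: ennreal_le_iff)
qed

section \<open>The upper bound for the ground state energy\<close>

lemma C1_dir_coord: "C1_dir j (\<lambda>x. c * x $ k) (\<lambda>x. if j = k then c else 0)"
  unfolding C1_dir_def
proof (intro conjI allI)
  fix x :: R3
  have "(\<lambda>t. c * (x + t *\<^sub>R ax j) $ k) = (\<lambda>t. c * x $ k + t * (if j = k then c else 0))"
    by (auto simp: axis_def fun_eq_iff algebra_simps)
  then show "((\<lambda>t. c * (x + t *\<^sub>R ax j) $ k) has_vector_derivative (if j = k then c else 0)) (at 0)"
    by (auto intro!: derivative_eq_intros simp: has_real_derivative_iff_has_vector_derivative[symmetric])
qed (auto intro!: continuous_intros)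

lemma C1_dir_mult_real:
  fixes u v :: "R3 \<Rightarrow> real"
  assumes "C1_dir j u u'" "C1_dir j v v'"
  shows "C1_dir j (\<lambda>x. u x * v x) (\<lambda>x. u x * v' x + u' x * v x)"
  unfolding C1_dir_def
proof (intro conjI allI)
  fix x
  show "((\<lambda>t. u (x + t *\<^sub>R ax j) * v (x + t *\<^sub>R ax j)) has_vector_derivative u x * v' x + u' x * v x) (at 0)"
    using has_vector_derivative_mult[OF C1_dir_line[OF assms(1), of x 0] C1_dir_line[OF assms(2), of x 0]] by simp
qed (use assms in \<open>auto simp: C1_dir_def intro!: continuous_intros\<close>)

lemma C1_dir_const: "C1_dir j (\<lambda>x. c) (\<lambda>x. 0)"
  by (auto simp: C1_dir_def)

text \<open>The constant derivative of component i of F in direction j; the order of the indices is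
  that of \<open>wcurl\<close>.\<close>

definition dF :: "3 \<Rightarrow> 3 \<Rightarrow> real" where
  "dF j i = (if i = 1 \<and> j = 2 then -1/2 else if i = 2 \<and> j = 1 then 1/2 else 0)"

lemma Fmag_components: "Fmag x $ 1 = (-1/2) * x $ 2" "Fmag x $ 2 = (1/2) * x $ 1" "Fmag x $ 3 = 0"
  by (simp_all add: Fmag_def)

lemma C1_dir_Fmag: "C1_dir j (\<lambda>x. Fmag x $ i) (\<lambda>x. dF j i)"
proof -
  have "i = 1 \<or> i = 2 \<or> i = 3" using exhaust_3 by blast
  then show ?thesis
    using C1_dir_coord[of j "-1/2" 2] C1_dir_coord[of j "1/2" 1] C1_dir_const[of j 0]
    by (elim disjE) (auto simp: Fmag_components dF_def simp del: times_divide_eq_left mult_minus_left divide_minus_left)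
qed

lemma weak_partial_Fmag: "weak_partial UNIV j (\<lambda>x. Fmag x $ i) (\<lambda>x. dF j i)"
  by (rule C1_dir_weak_partial[OF C1_dir_Fmag open_UNIV])

lemma wcurl_AE:
  assumes "\<And>i j. weak_partial UNIV j (\<lambda>y. A y $ i) (g j i)"
  shows "AE x in lborel. wcurl A x = vector [g 2 3 x - g 3 2 x, g 3 1 x - g 1 3 x, g 1 2 x - g 2 1 x]"
proof -
  have "AE x in lborel. wpartial UNIV j (\<lambda>y. A y $ i) x = g j i x" for i j
    using wpartial_eq[OF open_UNIV assms[of j i]] by simp
  note a = this
  show ?thesis
    using a[of 2 3] a[of 3 2] a[of 3 1] a[of 1 3] a[of 1 2] a[of 2 1]
    by eventually_elim (simp add: wcurl_def Let_def)
qed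

lemma beta_eq: "beta = vector [dF 2 3 - dF 3 2, dF 3 1 - dF 1 3, dF 1 2 - dF 2 1]"
  by (simp add: beta_def dF_def)

lemma wcurl_Fmag: "AE x in lborel. wcurl Fmag x = beta"
  using wcurl_AE[of Fmag "\<lambda>j i x. dF j i", OF weak_partial_Fmag] unfolding beta_eq .

text \<open>The zero test functions approximate, but the selected \<open>wpartial\<close> of 0 is
  known to vanish only almost everywhere, so the integrals require an argument.\<close>

lemma Hdot1_zero: "Hdot1 (\<lambda>x. 0)"
  unfolding Hdot1_def
proof (intro conjI allI)
  have w: "weak_partial UNIV j (\<lambda>x::R3. 0::real) (\<lambda>x. 0)" for j
    by (rule C1_dir_weak_partial[OF C1_dir_const open_UNIV])
  show "\<exists>g. weak_partial UNIV j (\<lambda>x::R3. 0::real) g \<and> L2 UNIV g" for j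
    using w by (intro exI[of _ "\<lambda>x. 0"]) (auto simp: L2_def set_borel_measurable_def set_integrable_def)
  have p0: "partial j (\<lambda>x::R3. 0) x = 0" for j x
    using partial_eq[of "\<lambda>x::R3. 0" "\<lambda>x. 0" x j] by simp
  have "(LINT x|lborel. (partial j (\<lambda>x::R3. 0) x - wpartial UNIV j (\<lambda>x::R3. 0::real) x)\<^sup>2) = (LINT (x::R3)|lborel. 0)" for j
  proof (cases "(\<lambda>x. (partial j (\<lambda>x::R3. 0) x - wpartial UNIV j (\<lambda>x::R3. 0::real) x)\<^sup>2) \<in> borel_measurable lborel")
    case True
    then show ?thesis
      by (intro integral_cong_AE) (use wpartial_eq[OF open_UNIV w, of j] p0 in auto)
  next
    case False
    \<comment> \<open>An integrand that is not measurable has the default integral 0.\<close>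
    then show ?thesis using borel_measurable_integrable by (subst not_integrable_integral_eq) auto
  qed
  then show "\<exists>\<phi>::nat \<Rightarrow> R3 \<Rightarrow> real. (\<forall>n. test_fun UNIV (\<phi> n)) \<and>
        (\<forall>j. (\<lambda>n. LINT x|lborel. (partial j (\<phi> n) x - wpartial UNIV j (\<lambda>x. 0) x)\<^sup>2) \<longlonglongrightarrow> 0) \<and>
        (\<forall>r. (\<lambda>n. LINT x:ball 0 r|lborel. \<bar>\<phi> n x - 0\<bar>) \<longlonglongrightarrow> 0)"
    by (intro exI[of _ "\<lambda>n x. 0"]) (auto simp: test_fun_zero)
qed

lemma HdotF_Fmag: "HdotF Fmag"
  unfolding HdotF_def weak_div_free_def
proof (intro conjI allI impI)
  show "Hdot1 (\<lambda>x. (Fmag x - Fmag x) $ i)" for i using Hdot1_zero by simp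
  fix \<phi> :: "R3 \<Rightarrow> real" assume t: "test_fun UNIV \<phi>"
  have l: "loc_int UNIV (\<lambda>x. Fmag x $ i)" for i using weak_partial_Fmag by (auto simp: weak_partial_def)
  have i: "integrable lborel (\<lambda>x. Fmag x $ j * partial j \<phi> x)" for j
    using test_fun_mult_integrable(2)[OF l t, of j j] by (simp add: mult.commute)
  have "(LINT x|lborel. Fmag x $ j * partial j \<phi> x) = 0" for j
  proof -
    have "(LINT x|lborel. partial j \<phi> x *\<^sub>R (Fmag x $ j)) = - (LINT x|lborel. \<phi> x *\<^sub>R dF j j)"
      using weak_partial_Fmag[of j j] t unfolding weak_partial_iff by blast
    moreover have "dF j j = 0" by (auto simp: dF_def)
    ultimately show ?thesis by (simp add: mult.commute)
  qed
  then show "(LINT x|lborel. (\<Sum>j\<in>UNIV. Fmag x $ j * partial j \<phi> x)) = 0"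
    using i by (subst Bochner_Integration.integral_sum) auto
qed

text \<open>The energy integrand with the gradient as a parameter g, so that explicit versions of
  the weak derivatives can replace the selected one.\<close>

definition GL_density :: "real \<Rightarrow> real \<Rightarrow> (3 \<Rightarrow> R3 \<Rightarrow> complex) \<Rightarrow> (R3 \<Rightarrow> complex) \<Rightarrow> (R3 \<Rightarrow> R3) \<Rightarrow> R3 \<Rightarrow> real" where
  "GL_density \<kappa> H g \<psi> A x = (\<Sum>j\<in>UNIV. (cmod (g j x - \<i> * complex_of_real (\<kappa> * H * A x $ j) * \<psi> x))\<^sup>2)
         + \<kappa>\<^sup>2 / 2 * (1 - (cmod (\<psi> x))\<^sup>2)\<^sup>2"

lemma GL_energy_eq:
  assumes "open \<Omega>" "\<And>j. weak_partial \<Omega> j \<psi> (g j)"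
  shows "GL_energy \<Omega> \<kappa> H \<psi> A = (\<integral>\<^sup>+x. indicator \<Omega> x * ennreal (GL_density \<kappa> H g \<psi> A x) \<partial>lborel)
     + ennreal (\<kappa>\<^sup>2 * H\<^sup>2) * (\<integral>\<^sup>+x. ennreal ((norm (wcurl A x - beta))\<^sup>2) \<partial>lborel)"
proof -
  have a: "AE x in lborel. x \<in> \<Omega> \<longrightarrow> wpartial \<Omega> j \<psi> x = g j x" for j
    by (rule wpartial_eq[OF assms])
  have ae: "AE x in lborel. \<forall>j. x \<in> \<Omega> \<longrightarrow> wpartial \<Omega> j \<psi> x = g j x"
    using a by (subst AE_all_countable) auto
  have "(\<integral>\<^sup>+x. indicator \<Omega> x * ennreal
        ((\<Sum>j\<in>UNIV. (cmod (wpartial \<Omega> j \<psi> x - \<i> * complex_of_real (\<kappa> * H * A x $ j) * \<psi> x))\<^sup>2)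
         + \<kappa>\<^sup>2 / 2 * (1 - (cmod (\<psi> x))\<^sup>2)\<^sup>2) \<partial>lborel) = (\<integral>\<^sup>+x. indicator \<Omega> x * ennreal (GL_density \<kappa> H g \<psi> A x) \<partial>lborel)"
  proof (rule nn_integral_cong_AE)
    show "AE x in lborel. indicator \<Omega> x * ennreal
        ((\<Sum>j\<in>UNIV. (cmod (wpartial \<Omega> j \<psi> x - \<i> * complex_of_real (\<kappa> * H * A x $ j) * \<psi> x))\<^sup>2)
         + \<kappa>\<^sup>2 / 2 * (1 - (cmod (\<psi> x))\<^sup>2)\<^sup>2) = indicator \<Omega> x * ennreal (GL_density \<kappa> H g \<psi> A x)"
      using ae by eventually_elim (auto simp: indicator_def GL_density_def)
  qed
  then show ?thesis unfolding GL_energy_def by simp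
qed

lemma GL_energy_Fmag:
  assumes "open \<Omega>" "\<And>j. weak_partial \<Omega> j \<psi> (g j)"
  shows "GL_energy \<Omega> \<kappa> H \<psi> Fmag = (\<integral>\<^sup>+x. indicator \<Omega> x * ennreal (GL_density \<kappa> H g \<psi> Fmag x) \<partial>lborel)"
proof -
  have "(\<integral>\<^sup>+x. ennreal ((norm (wcurl Fmag x - beta))\<^sup>2) \<partial>lborel) = (\<integral>\<^sup>+(x::R3). 0 \<partial>lborel)"
  proof (rule nn_integral_cong_AE)
    show "AE x in lborel. ennreal ((norm (wcurl Fmag x - beta))\<^sup>2) = 0"
      using wcurl_Fmag by eventually_elim simp
  qed
  then show ?thesis using GL_energy_eq[OF assms, where A=Fmag] by simp
qed

lemma L2_bounded_continuous:
  fixes f :: "R3 \<Rightarrow> 'b::{banach,second_countable_topology}"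
  assumes "continuous_on UNIV f" "open \<Omega>" "bounded \<Omega>"
  shows "L2 \<Omega> f"
proof -
  have f: "f \<in> borel_measurable borel" by (rule borel_measurable_continuous_onI[OF assms(1)])
  have O: "\<Omega> \<in> sets borel" using assms(2) by simp
  have "continuous_on UNIV (\<lambda>x. (norm (f x))\<^sup>2)" using assms(1) by (intro continuous_intros)
  then have "set_integrable lborel (closure \<Omega>) (\<lambda>x. (norm (f x))\<^sup>2)"
    unfolding set_integrable_def using assms(3)
    by (intro borel_integrable_compact) (auto intro: continuous_on_subset)
  then have "set_integrable lborel \<Omega> (\<lambda>x. (norm (f x))\<^sup>2)"
    by (rule set_integrable_subset) (use O closure_subset in auto)
  then show ?thesis using f O unfolding L2_def set_borel_measurable_def by auto
qed

section \<open>Energy of the vortex lattice in the field F\<close>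

lemma GL_C0_le:
  assumes "H1 \<Omega> \<psi>" "HdotF A" shows "GL_C0 \<Omega> \<kappa> H \<le> GL_energy \<Omega> \<kappa> H \<psi> A"
  unfolding GL_C0_def using assms by (intro INF_lower2[of "(\<psi>, A)"]) auto

lemma finite_measure_bounded_open:
  assumes "open (\<Omega> :: R3 set)" "bounded \<Omega>"
  shows "emeasure lborel \<Omega> = ennreal (measure lborel \<Omega>)"
  using emeasure_bounded_finite[OF assms(2)] by (intro emeasure_eq_ennreal_measure) auto

text \<open>For f = b x_1 and h = b x_2 the squared covariant gradient is b^2 times that of
  \<open>lat\<close>. Its cell mean is at most b^2 pi^2 (2 / pi) ln (1 / d) = \<kappa> H ln (sqrt
  (\<kappa> / H)) to leading order; everything else is \<kappa> H times a constant.\<close>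

lemma GL_C0_le_lattice:
  assumes O: "open \<Omega>" "bounded \<Omega>" and H: "0 < H" "H \<le> \<kappa>"
  shows "GL_C0 \<Omega> \<kappa> H \<le> ennreal (measure lborel \<Omega> * \<kappa> * H * (ln (sqrt (\<kappa> / H)) + 110))"
proof (rule ennreal_le_epsilon)
  fix \<eta> :: real assume \<eta>: "\<eta> > 0"
  have \<kappa>: "\<kappa> > 0" using H by simp
  \<comment> \<open>With this core size \<kappa>^2 d^2 = \<kappa> H, so the potential term is
    \<kappa> H times a quantity of bounded mean.\<close>
  define d where "d = sqrt (H / \<kappa>)"
  \<comment> \<open>2 pi b^2 = \<kappa> H: each unit cell of (f, h) carries one flux
    quantum.\<close>
  define b where "b = sqrt (\<kappa> * H / (2 * pi))"
  define L where "L = ln (sqrt (\<kappa> / H))"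
  have d: "d > 0" "d \<le> 1" and d2: "d\<^sup>2 = H / \<kappa>" using H \<kappa> by (auto simp: d_def)
  have b2: "b\<^sup>2 = \<kappa> * H / (2 * pi)" using H \<kappa> by (simp add: b_def)
  have ld: "ln (1 / d) = L" unfolding d_def L_def using H \<kappa> by (simp add: real_sqrt_divide)
  define f h :: "R3 \<Rightarrow> real" where "f x = b * x $ 1" and "h x = b * x $ 2" for x
  define f' h' :: "3 \<Rightarrow> R3 \<Rightarrow> real" where "f' j x = (if j = 1 then b else 0)" and "h' j x = (if j = 2 then b else 0)" for j x
  have Cf: "C1_dir j f (f' j)" and Ch: "C1_dir j h (h' j)" for j
    unfolding f_def[abs_def] f'_def[abs_def] h_def[abs_def] h'_def[abs_def] by (rule C1_dir_coord)+
  \<comment> \<open>The connection form 2 pi f dh = \<kappa> H x_1 dx_2 differs from \<kappa> H F by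
    the differential of - \<kappa> H x_1 x_2 / 2.\<close>
  define \<theta> :: "R3 \<Rightarrow> real" where "\<theta> x = ((- \<kappa> * H / 2) * x $ 1) * (1 * x $ 2)" for x
  define \<theta>' :: "3 \<Rightarrow> R3 \<Rightarrow> real" where "\<theta>' j x = ((- \<kappa> * H / 2) * x $ 1) * (if j = 2 then 1 else 0) + (if j = 1 then - \<kappa> * H / 2 else 0) * (1 * x $ 2)" for j x
  have C\<theta>: "C1_dir j \<theta> (\<theta>' j)" for j
    unfolding \<theta>_def[abs_def] \<theta>'_def[abs_def] by (rule C1_dir_mult_real[OF C1_dir_coord C1_dir_coord])
  define \<psi> where "\<psi> \<alpha> \<beta> x = latv d f h \<alpha> \<beta> x * cis (\<theta> x)" for \<alpha> \<beta> x
  define g where "g \<alpha> \<beta> j x = latv d f h \<alpha> \<beta> x * (\<theta>' j x *\<^sub>R (\<i> * cis (\<theta> x))) +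
     (latc d f h (f' j) (h' j) \<alpha> \<beta> x + (2 * pi * f x * h' j x) *\<^sub>R (\<i> * latv d f h \<alpha> \<beta> x)) * cis (\<theta> x)" for \<alpha> \<beta> j x
  have C\<psi>: "C1_dir j (\<psi> \<alpha> \<beta>) (g \<alpha> \<beta> j)" for \<alpha> \<beta> j
    unfolding \<psi>_def[abs_def] g_def[abs_def] by (rule C1_dir_mult[OF C1_dir_latv[OF d(1) Cf Ch] C1_dir_cis[OF C\<theta>]])
  have wp: "weak_partial \<Omega> j (\<psi> \<alpha> \<beta>) (g \<alpha> \<beta> j)" for \<alpha> \<beta> j by (rule C1_dir_weak_partial[OF C\<psi> O(1)])
  have H1: "H1 \<Omega> (\<psi> \<alpha> \<beta>)" for \<alpha> \<beta>
    unfolding H1_def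
  proof (intro conjI allI exI)
    have c: "continuous_on UNIV (\<psi> \<alpha> \<beta>)" "continuous_on UNIV (g \<alpha> \<beta> j)" for j using C\<psi> by (auto simp: C1_dir_def)
    show "L2 \<Omega> (\<psi> \<alpha> \<beta>)" "weak_partial \<Omega> j (\<psi> \<alpha> \<beta>) (g \<alpha> \<beta> j)" "L2 \<Omega> (g \<alpha> \<beta> j)" for j
      using c wp O by (auto intro: L2_bounded_continuous)
  qed
  have cov: "cmod (g \<alpha> \<beta> j x - \<i> * complex_of_real (\<kappa> * H * Fmag x $ j) * \<psi> \<alpha> \<beta> x) = cmod (latc d f h (f' j) (h' j) \<alpha> \<beta> x)" for \<alpha> \<beta> j x
  proof -
    have "\<theta>' j x + 2 * pi * f x * h' j x - \<kappa> * H * Fmag x $ j = 0"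
    proof -
      have bb: "2 * pi * (b * b) = \<kappa> * H" using b2 by (simp add: power2_eq_square)
      have "2 * pi * (b * y) * b = 2 * pi * (b * b) * y" for y by simp
      then have e: "2 * pi * (b * x $ 1) * b = \<kappa> * H * x $ 1" unfolding bb .
      consider "j = 1" | "j = 2" | "j = 3" using exhaust_3 by blast
      then show ?thesis
      proof cases
        case 2
        have "2 * pi * f x * h' j x = \<kappa> * H * x $ 1" using e 2 by (simp only: f_def h'_def if_True simp_thms)
        then show ?thesis using 2 by (simp add: \<theta>'_def Fmag_components)
      qed (simp_all add: \<theta>'_def f_def h'_def Fmag_components)
    qed
    then have s: "complex_of_real (\<theta>' j x) + complex_of_real (2 * pi * f x * h' j x) - complex_of_real (\<kappa> * H * Fmag x $ j) = 0"
      by (metis of_real_0 of_real_add of_real_diff)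
    have "g \<alpha> \<beta> j x - \<i> * complex_of_real (\<kappa> * H * Fmag x $ j) * \<psi> \<alpha> \<beta> x
      = latc d f h (f' j) (h' j) \<alpha> \<beta> x * cis (\<theta> x) + (complex_of_real (\<theta>' j x) + complex_of_real (2 * pi * f x * h' j x) - complex_of_real (\<kappa> * H * Fmag x $ j)) * (\<i> * \<psi> \<alpha> \<beta> x)"
      unfolding g_def \<psi>_def scaleR_conv_of_real by (simp add: algebra_simps del: of_real_mult of_real_divide)
    then show ?thesis unfolding s by (simp add: norm_mult)
  qed
  define \<Psi> :: "R3 \<Rightarrow> real \<Rightarrow> real \<Rightarrow> ennreal" where "\<Psi> x \<alpha> \<beta> = indicator \<Omega> x * (ennreal (b\<^sup>2 * pi\<^sup>2) * ennreal (latP d (f x + \<alpha>) (h x + \<beta>))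
      + ennreal (\<kappa> * H / 2) * ennreal (d\<^sup>2 * (gfac d (f x + \<alpha>) (h x + \<beta>))\<^sup>2))" for x \<alpha> \<beta>
  have g0: "gfac d s t \<ge> 0" for s t using gfac_pos[OF d(1)] less_imp_le by blast
  have P0: "latP d s t \<ge> 0" for s t using g0 by (simp add: latP_def)
  have dens: "indicator \<Omega> x * ennreal (GL_density \<kappa> H (g \<alpha> \<beta>) (\<psi> \<alpha> \<beta>) Fmag x) \<le> \<Psi> x \<alpha> \<beta>" for \<alpha> \<beta> x
  proof -
    let ?s = "f x + \<alpha>" and ?t = "h x + \<beta>"
    have n: "(cmod (\<psi> \<alpha> \<beta> x))\<^sup>2 = 1 - d\<^sup>2 * gfac d ?s ?t"
      using latv_norm(2)[OF d(1), of f h \<alpha> \<beta> x] by (simp add: \<psi>_def norm_mult)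
    \<comment> \<open>f varies only in direction 1 and h only in direction 2, so there are no mixed
      terms and the sharp bound \<open>norm_dlat\<close> is used without loss.\<close>
    have "(\<Sum>j\<in>UNIV. (cmod (latc d f h (f' j) (h' j) \<alpha> \<beta> x))\<^sup>2) = b\<^sup>2 * ((norm (lat_s d ?s ?t))\<^sup>2 + (norm (lat_t d ?s ?t))\<^sup>2)"
      by (simp add: sum_3 latc_def f'_def h'_def norm_mult power_mult_distrib distrib_left)
    also have "\<dots> \<le> b\<^sup>2 * (pi\<^sup>2 * latP d ?s ?t)"
      using norm_dlat[OF d(1), of ?s ?t] unfolding latP_def by (intro mult_left_mono) auto
    finally have 1: "(\<Sum>j\<in>UNIV. (cmod (latc d f h (f' j) (h' j) \<alpha> \<beta> x))\<^sup>2) \<le> b\<^sup>2 * pi\<^sup>2 * latP d ?s ?t" by simp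
    have 2: "\<kappa>\<^sup>2 / 2 * (1 - (cmod (\<psi> \<alpha> \<beta> x))\<^sup>2)\<^sup>2 = \<kappa> * H / 2 * (d\<^sup>2 * (gfac d ?s ?t)\<^sup>2)"
    proof -
      have "\<kappa>\<^sup>2 / 2 * (1 - (cmod (\<psi> \<alpha> \<beta> x))\<^sup>2)\<^sup>2 = (\<kappa>\<^sup>2 * d\<^sup>2) / 2 * (d\<^sup>2 * (gfac d ?s ?t)\<^sup>2)"
        unfolding n by (simp add: power2_eq_square)
      also have "\<kappa>\<^sup>2 * d\<^sup>2 = \<kappa> * H" unfolding d2 using \<kappa> by (simp add: power2_eq_square)
      finally show ?thesis .
    qed
    have "GL_density \<kappa> H (g \<alpha> \<beta>) (\<psi> \<alpha> \<beta>) Fmag x \<le> b\<^sup>2 * pi\<^sup>2 * latP d ?s ?t + \<kappa> * H / 2 * (d\<^sup>2 * (gfac d ?s ?t)\<^sup>2)"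
      unfolding GL_density_def cov using 1 2 by simp
    then have "ennreal (GL_density \<kappa> H (g \<alpha> \<beta>) (\<psi> \<alpha> \<beta>) Fmag x) \<le> ennreal (b\<^sup>2 * pi\<^sup>2 * latP d ?s ?t + \<kappa> * H / 2 * (d\<^sup>2 * (gfac d ?s ?t)\<^sup>2))"
      by (rule ennreal_leI)
    also have "\<dots> = ennreal (b\<^sup>2 * pi\<^sup>2 * latP d ?s ?t) + ennreal (\<kappa> * H / 2 * (d\<^sup>2 * (gfac d ?s ?t)\<^sup>2))"
      using P0 H \<kappa> by (intro ennreal_plus) auto
    also have "\<dots> = ennreal (b\<^sup>2 * pi\<^sup>2) * ennreal (latP d ?s ?t) + ennreal (\<kappa> * H / 2) * ennreal (d\<^sup>2 * (gfac d ?s ?t)\<^sup>2)"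
      using P0 H \<kappa> by (simp only: ennreal_mult[symmetric] mult_nonneg_nonneg zero_le_power2) (simp add: ennreal_mult[symmetric])
    finally show ?thesis unfolding \<Psi>_def by (intro mult_left_mono) auto
  qed
  have Om [measurable]: "\<Omega> \<in> sets borel" using O by simp
  have fm [measurable]: "f \<in> borel_measurable borel" "h \<in> borel_measurable borel"
    using Cf Ch by (auto simp: C1_dir_def intro: borel_measurable_continuous_onI)
  note [measurable (raw)] = measurable_case_prod_compose[OF gfac_measurable]
  have Lm: "(\<lambda>(x, y). latP d x y) \<in> borel_measurable (borel \<Otimes>\<^sub>M borel)" unfolding latP_def by measurable
  note [measurable (raw)] = measurable_case_prod_compose[OF Lm]
  have m\<Psi>: "(\<lambda>(x, \<alpha>, \<beta>). \<Psi> x \<alpha> \<beta>) \<in> borel_measurable (borel \<Otimes>\<^sub>M borel \<Otimes>\<^sub>M borel)"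
    unfolding \<Psi>_def by measurable
  define C where "C = \<kappa> * H * (L + 110)"
  have L0: "L \<ge> 0" unfolding ld[symmetric] using d by simp
  have C0: "C \<ge> 0" using H \<kappa> L0 by (simp add: C_def)
  have mean: "cell_mean (\<Psi> x) \<le> indicator \<Omega> x * ennreal C" for x
  proof -
    have "cell_mean (\<Psi> x) = indicator \<Omega> x * (ennreal (b\<^sup>2 * pi\<^sup>2) * cell_mean (\<lambda>\<alpha> \<beta>. ennreal (latP d (f x + \<alpha>) (h x + \<beta>)))
        + ennreal (\<kappa> * H / 2) * cell_mean (\<lambda>\<alpha> \<beta>. ennreal (d\<^sup>2 * (gfac d (f x + \<alpha>) (h x + \<beta>))\<^sup>2)))"
      unfolding \<Psi>_def[abs_def]
      by (subst cell_mean_cmult, measurable, subst cell_mean_add, measurable, subst cell_mean_cmult, measurable, subst cell_mean_cmult, measurable)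
    also have "\<dots> \<le> indicator \<Omega> x * (ennreal (b\<^sup>2 * pi\<^sup>2) * ennreal (2 / pi * L + 53) + ennreal (\<kappa> * H / 2) * ennreal 49)"
      using cell_mean_latP[OF d] cell_mean_gfac_sq[OF d(1)] unfolding ld by (intro mult_left_mono add_mono) auto
    also have "ennreal (b\<^sup>2 * pi\<^sup>2) * ennreal (2 / pi * L + 53) + ennreal (\<kappa> * H / 2) * ennreal 49
       = ennreal (b\<^sup>2 * pi\<^sup>2 * (2 / pi * L + 53) + \<kappa> * H / 2 * 49)"
      using L0 H \<kappa> by (simp only: ennreal_mult[symmetric] ennreal_plus[symmetric] mult_nonneg_nonneg zero_le_power2 zero_le_numeral add_nonneg_nonneg
          divide_nonneg_nonneg less_imp_le pi_ge_zero)
    also have "\<dots> \<le> ennreal C"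
    proof (rule ennreal_leI)
      have "b\<^sup>2 * pi\<^sup>2 * (2 / pi * L + 53) + \<kappa> * H / 2 * 49 = \<kappa> * H * (L + (53 * pi / 2 + 49 / 2))"
        unfolding b2 by (simp add: field_simps power2_eq_square)
      \<comment> \<open>53 pi / 2 + 49 / 2 is below 110.\<close>
      also have "\<dots> \<le> C" unfolding C_def using H \<kappa> pi_approx by (intro mult_left_mono add_left_mono) auto
      finally show "b\<^sup>2 * pi\<^sup>2 * (2 / pi * L + 53) + \<kappa> * H / 2 * 49 \<le> C" .
    qed
    finally show ?thesis by (simp add: mult_left_mono)
  qed
  have "(\<integral>\<^sup>+x. indicator \<Omega> x * ennreal C \<partial>lborel) \<le> ennreal (measure lborel \<Omega> * C)"
    using finite_measure_bounded_open[OF O] C0 by (simp add: nn_integral_multc ennreal_mult[symmetric])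
  from exists_translate_le[OF m\<Psi> mean this \<eta>] C0 obtain \<alpha> \<beta> where ab: "(\<integral>\<^sup>+x. \<Psi> x \<alpha> \<beta> \<partial>lborel) \<le> ennreal (measure lborel \<Omega> * C + \<eta>)"
    by auto
  have "GL_C0 \<Omega> \<kappa> H \<le> GL_energy \<Omega> \<kappa> H (\<psi> \<alpha> \<beta>) Fmag" by (rule GL_C0_le[OF H1 HdotF_Fmag])
  also have "\<dots> = (\<integral>\<^sup>+x. indicator \<Omega> x * ennreal (GL_density \<kappa> H (g \<alpha> \<beta>) (\<psi> \<alpha> \<beta>) Fmag x) \<partial>lborel)"
    by (rule GL_energy_Fmag[OF O(1) wp])
  also have "\<dots> \<le> (\<integral>\<^sup>+x. \<Psi> x \<alpha> \<beta> \<partial>lborel)" by (intro nn_integral_mono dens)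
  also note ab
  also have "ennreal (measure lborel \<Omega> * C + \<eta>) = ennreal (measure lborel \<Omega> * \<kappa> * H * (L + 110)) + ennreal \<eta>"
    using C0 \<eta> L0 H \<kappa> by (subst ennreal_plus[symmetric]) (auto simp: C_def mult.assoc)
  finally show "GL_C0 \<Omega> \<kappa> H \<le> ennreal (measure lborel \<Omega> * \<kappa> * H * (ln (sqrt (\<kappa> / H)) + 110)) + ennreal \<eta>"
    unfolding L_def .
qed

section \<open>Approximation in the homogeneous Sobolev space\<close>

lemma test_fun_C1_dir: "test_fun U \<phi> \<Longrightarrow> C1_dir j \<phi> (partial j \<phi>)"
  unfolding C1_dir_def
  using test_fun_continuous test_fun_partial_continuous line_derivative[OF test_fun_differentiable, where t=0]
  by (auto simp: has_real_derivative_iff_has_vector_derivative)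

lemma C1_dir_partial_eq:
  assumes "C1_dir j u u'" "u differentiable at x"
  shows "partial j u x = u' x"
proof -
  have "((\<lambda>t. u (x + t *\<^sub>R ax j)) has_real_derivative u' x) (at 0)"
    using assms(1) by (auto simp: C1_dir_def has_real_derivative_iff_has_vector_derivative)
  moreover have "((\<lambda>t. u (x + t *\<^sub>R ax j)) has_real_derivative partial j u x) (at 0)"
    using line_derivative[of u x 0 j] assms(2) by simp
  ultimately show ?thesis by (rule DERIV_unique[symmetric])
qed

lemma test_fun_integrable:
  assumes "test_fun U \<phi>"
  shows "integrable lborel \<phi>" "integrable lborel (partial j \<phi>)"
    "integrable lborel (\<lambda>x. (\<phi> x)\<^sup>2)" "integrable lborel (\<lambda>x. (partial j \<phi> x)\<^sup>2)"
proof -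
  have c: "continuous_on UNIV \<phi>" "continuous_on UNIV (partial j \<phi>)"
    using test_fun_continuous[OF assms] test_fun_partial_continuous[OF assms] by auto
  note t = test_fun_mono[OF assms subset_UNIV]
  have "loc_int UNIV (\<lambda>x::R3. 1::real)" "loc_int UNIV \<phi>" "loc_int UNIV (partial j \<phi>)"
    using c by (auto intro!: continuous_loc_int)
  from test_fun_mult_integrable(1)[OF this(1) t] test_fun_mult_integrable(2)[OF this(1) t, of j] test_fun_mult_integrable(1)[OF this(2) t] test_fun_mult_integrable(2)[OF this(3) t, of j]
  show "integrable lborel \<phi>" "integrable lborel (partial j \<phi>)"
    "integrable lborel (\<lambda>x. (\<phi> x)\<^sup>2)" "integrable lborel (\<lambda>x. (partial j \<phi> x)\<^sup>2)"
    by (simp_all add: power2_eq_square)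
qed

lemma test_fun_mult:
  assumes "test_fun U \<phi>" "test_fun U \<psi>"
  shows "test_fun U (\<lambda>x. \<phi> x * \<psi> x)"
proof -
  obtain S where S: "compact S" "S \<subseteq> U" "\<And>x. x \<notin> S \<Longrightarrow> \<phi> x = 0" using test_fun_support[OF assms(1)] by metis
  show ?thesis
  proof (rule test_funI[OF _ S(1,2)])
    show "smooth_on UNIV (\<lambda>x. \<phi> x * \<psi> x)"
      using assms unfolding test_fun_def smooth_on_def by (auto intro: Ck_on_mult)
  qed (use S in auto)
qed

lemma test_fun_diff:
  assumes "test_fun U \<phi>" "test_fun U \<psi>"
  shows "test_fun U (\<lambda>x. \<phi> x - \<psi> x)"
proof -
  obtain S where S: "compact S" "S \<subseteq> U" "\<And>x. x \<notin> S \<Longrightarrow> \<phi> x = 0" using test_fun_support[OF assms(1)] by metis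
  obtain S' where S': "compact S'" "S' \<subseteq> U" "\<And>x. x \<notin> S' \<Longrightarrow> \<psi> x = 0" using test_fun_support[OF assms(2)] by metis
  show ?thesis
  proof (rule test_funI[where K="S \<union> S'"])
    have "smooth_on UNIV (\<lambda>x. \<phi> x + (-1) * \<psi> x)"
      using assms unfolding test_fun_def smooth_on_def by (intro allI Ck_on_add Ck_on_mult Ck_on_const) auto
    then show "smooth_on UNIV (\<lambda>x. \<phi> x - \<psi> x)" by simp
  qed (use S S' in auto)
qed

lemma partial_diff:
  assumes "\<phi> differentiable at x" "\<psi> differentiable at x"
  shows "partial j (\<lambda>x. \<phi> x - \<psi> x) x = partial j \<phi> x - partial j \<psi> x"
  using partial_eq[OF has_derivative_diff[OF assms[unfolded frechet_derivative_works]]] by (simp add: partial_def)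

lemma C1_dir_radial:
  fixes x :: R3
  shows "C1_dir j (\<lambda>x. 1 / (1 + (norm x)\<^sup>2)) (\<lambda>x. - (2 * x $ j) * (1 / (1 + (norm x)\<^sup>2))\<^sup>2)"
  unfolding C1_dir_def
proof (intro conjI allI)
  have p: "1 + (norm x)\<^sup>2 \<noteq> 0" for x :: R3 by (metis add_pos_nonneg less_irrefl zero_le_power2 zero_less_one)
  then show "continuous_on UNIV (\<lambda>x::R3. 1 / (1 + (norm x)\<^sup>2))" "continuous_on UNIV (\<lambda>x::R3. - (2 * x $ j) * (1 / (1 + (norm x)\<^sup>2))\<^sup>2)"
    by (auto intro!: continuous_intros)
  fix x :: R3
  have e: "(norm (x + t *\<^sub>R ax j))\<^sup>2 = (norm x)\<^sup>2 + 2 * t * x $ j + t\<^sup>2" for t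
    unfolding power2_norm_eq_inner
    by (simp add: inner_add_left inner_add_right inner_commute inner_axis power2_eq_square algebra_simps)
  have "((\<lambda>t. 1 / (1 + (norm (x + t *\<^sub>R ax j))\<^sup>2)) has_real_derivative - (2 * x $ j) * (1 / (1 + (norm x)\<^sup>2))\<^sup>2) (at 0)"
    unfolding e using p[of x] by (auto intro!: derivative_eq_intros simp: power2_eq_square)
  then show "((\<lambda>t. 1 / (1 + (norm (x + t *\<^sub>R ax j))\<^sup>2)) has_vector_derivative - (2 * x $ j) * (1 / (1 + (norm x)\<^sup>2))\<^sup>2) (at 0)"
    by (simp add: has_real_derivative_iff_has_vector_derivative)
qed

lemma norm_sq_3: fixes x :: R3 shows "(norm x)\<^sup>2 = (\<Sum>j\<in>UNIV. (x $ j)\<^sup>2)"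
  unfolding power2_norm_eq_inner by (simp add: inner_vec_def power2_eq_square)

text \<open>Integrate \<open>\<phi>\<^sup>2\<close> against the divergence of \<open>x / (1 + |x|\<^sup>2)\<close>, which is at least \<open>1 / (1 + |x|\<^sup>2)\<close>.\<close>

lemma hardy_inequality:
  assumes t: "test_fun UNIV \<phi>"
  shows "(LINT x|lborel. (\<phi> x)\<^sup>2 / (1 + (norm x)\<^sup>2)) \<le> 4 * (\<Sum>j\<in>UNIV. LINT x|lborel. (partial j \<phi> x)\<^sup>2)"
proof -
  define w :: "R3 \<Rightarrow> real" where "w x = 1 / (1 + (norm x)\<^sup>2)" for x
  define X :: "3 \<Rightarrow> R3 \<Rightarrow> real" where "X j x = (1 * x $ j) * w x" for j x
  define X' :: "3 \<Rightarrow> R3 \<Rightarrow> real" where "X' j x = (1 * x $ j) * (- (2 * x $ j) * (w x)\<^sup>2) + (if j = j then 1 else 0) * w x" for j x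
  have CX: "C1_dir j (X j) (X' j)" for j
    unfolding X_def[abs_def] X'_def[abs_def] w_def by (rule C1_dir_mult_real[OF C1_dir_coord C1_dir_radial])
  have t2: "test_fun UNIV (\<lambda>x. \<phi> x * \<phi> x)" by (rule test_fun_mult[OF t t])
  have p2: "partial j (\<lambda>x. \<phi> x * \<phi> x) x = 2 * \<phi> x * partial j \<phi> x" for j x
    using C1_dir_partial_eq[OF C1_dir_mult_real[OF test_fun_C1_dir[OF t] test_fun_C1_dir[OF t]] test_fun_differentiable[OF t2], of j x] by simp
  have wpX: "weak_partial UNIV j (X j) (X' j)" for j by (rule C1_dir_weak_partial[OF CX open_UNIV])
  have l: "loc_int UNIV (X j)" "loc_int UNIV (X' j)" for j using wpX[of j] by (auto simp: weak_partial_def)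
  have i1: "integrable lborel (\<lambda>x. 2 * \<phi> x * partial j \<phi> x * X j x)" for j
    using test_fun_mult_integrable(2)[OF l(1)[of j] t2, of j] by (simp add: p2)
  have i2: "integrable lborel (\<lambda>x. (\<phi> x)\<^sup>2 * X' j x)" for j
    using test_fun_mult_integrable(1)[OF l(2)[of j] t2] by (simp add: power2_eq_square)
  have ibp: "(LINT x|lborel. (\<phi> x)\<^sup>2 * X' j x) = - (LINT x|lborel. 2 * \<phi> x * partial j \<phi> x * X j x)" for j
    using wpX[of j] t2 unfolding weak_partial_iff by (fastforce simp: p2 power2_eq_square)
  have w0: "w x > 0" for x by (simp add: w_def add_pos_nonneg)
  have nw: "(norm x)\<^sup>2 * w x \<le> 1" for x by (simp add: w_def divide_le_eq add_pos_nonneg)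
  have divX: "(\<Sum>j\<in>UNIV. X' j x) \<ge> w x" for x
  proof -
    have "(\<Sum>j\<in>UNIV. X' j x) = 3 * w x - 2 * ((norm x)\<^sup>2 * w x) * w x"
      unfolding X'_def norm_sq_3 sum_3 by (simp add: power2_eq_square algebra_simps)
    moreover have "2 * ((norm x)\<^sup>2 * w x) * w x \<le> 2 * 1 * w x" using nw[of x] w0[of x] by (intro mult_right_mono mult_left_mono) auto
    ultimately show ?thesis by simp
  qed
  have cw: "continuous_on UNIV w" using C1_dir_radial by (simp add: C1_dir_def w_def[abs_def])
  have iw: "integrable lborel (\<lambda>x. (\<phi> x)\<^sup>2 * w x)"
    using test_fun_mult_integrable(1)[OF continuous_loc_int[OF cw] t2] by (simp add: power2_eq_square)
  have id: "integrable lborel (\<lambda>x. (partial j \<phi> x)\<^sup>2)" for j using test_fun_integrable[OF t] by auto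
  \<comment> \<open>Young's inequality leaves half of the weighted square of \<open>\<phi>\<close>,
    which is absorbed on the left and doubles the factor 2 to 4. The components of the vector field
    sum in square to |x|^2 w^2 <= w.\<close>
  have pt: "- (\<Sum>j\<in>UNIV. 2 * \<phi> x * partial j \<phi> x * X j x) \<le> (1/2) * ((\<phi> x)\<^sup>2 * w x) + 2 * (\<Sum>j\<in>UNIV. (partial j \<phi> x)\<^sup>2)" for x
  proof -
    have a: "- (2 * \<phi> x * partial j \<phi> x * X j x) \<le> (1/2) * ((\<phi> x)\<^sup>2 * (X j x)\<^sup>2) + 2 * (partial j \<phi> x)\<^sup>2" for j
    proof -
      have "0 \<le> (1/2) * (\<phi> x * X j x + 2 * partial j \<phi> x)\<^sup>2" by simp
      then show ?thesis by (simp add: power2_eq_square algebra_simps)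
    qed
    have "- (\<Sum>j\<in>UNIV. 2 * \<phi> x * partial j \<phi> x * X j x) \<le> (\<Sum>j\<in>UNIV. (1/2) * ((\<phi> x)\<^sup>2 * (X j x)\<^sup>2) + 2 * (partial j \<phi> x)\<^sup>2)"
      unfolding sum_negf[symmetric] by (intro sum_mono a)
    also have "\<dots> = (1/2) * ((\<phi> x)\<^sup>2 * (((norm x)\<^sup>2 * w x) * w x)) + 2 * (\<Sum>j\<in>UNIV. (partial j \<phi> x)\<^sup>2)"
      unfolding X_def norm_sq_3 sum_3 by (simp add: power2_eq_square algebra_simps)
    also have "\<dots> \<le> (1/2) * ((\<phi> x)\<^sup>2 * (1 * w x)) + 2 * (\<Sum>j\<in>UNIV. (partial j \<phi> x)\<^sup>2)"
      using nw[of x] w0[of x] by (intro add_right_mono mult_left_mono mult_right_mono) auto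
    finally show ?thesis by simp
  qed
  have "(LINT x|lborel. (\<phi> x)\<^sup>2 * w x) \<le> (LINT x|lborel. (\<Sum>j\<in>UNIV. (\<phi> x)\<^sup>2 * X' j x))"
  proof (rule integral_mono[OF iw])
    show "(\<phi> x)\<^sup>2 * w x \<le> (\<Sum>j\<in>UNIV. (\<phi> x)\<^sup>2 * X' j x)" for x
      unfolding sum_distrib_left[symmetric] using divX by (intro mult_left_mono) auto
  qed (use i2 in auto)
  also have "\<dots> = (\<Sum>j\<in>UNIV. LINT x|lborel. (\<phi> x)\<^sup>2 * X' j x)" by (intro Bochner_Integration.integral_sum i2)
  also have "\<dots> = - (\<Sum>j\<in>UNIV. LINT x|lborel. 2 * \<phi> x * partial j \<phi> x * X j x)" unfolding ibp by (simp add: sum_negf)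
  also have "\<dots> = (LINT x|lborel. - (\<Sum>j\<in>UNIV. 2 * \<phi> x * partial j \<phi> x * X j x))"
    using i1 by simp
  also have "\<dots> \<le> (LINT x|lborel. (1/2) * ((\<phi> x)\<^sup>2 * w x) + 2 * (\<Sum>j\<in>UNIV. (partial j \<phi> x)\<^sup>2))"
    using pt i1 iw id by (intro integral_mono) auto
  also have "\<dots> = (1/2) * (LINT x|lborel. (\<phi> x)\<^sup>2 * w x) + 2 * (\<Sum>j\<in>UNIV. LINT x|lborel. (partial j \<phi> x)\<^sup>2)"
    using iw id by simp
  finally show ?thesis by (simp add: w_def)
qed

lemma sq_diff_le: fixes a b c :: real shows "(a - b)\<^sup>2 \<le> 2 * (a - c)\<^sup>2 + 2 * (b - c)\<^sup>2"
proof -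
  have "0 \<le> (a + b - 2 * c)\<^sup>2" by simp
  then show ?thesis by (simp add: power2_eq_square algebra_simps)
qed

lemma L2_UNIV:
  fixes f :: "R3 \<Rightarrow> real"
  shows "L2 UNIV f \<longleftrightarrow> f \<in> borel_measurable borel \<and> integrable lborel (\<lambda>x. (f x)\<^sup>2)"
  unfolding L2_def set_borel_measurable_def set_integrable_def by simp

lemma L2_diff_integrable:
  fixes f g :: "R3 \<Rightarrow> real"
  assumes "L2 UNIV f" "L2 UNIV g"
  shows "integrable lborel (\<lambda>x. (f x - g x)\<^sup>2)" "integrable lborel (\<lambda>x. f x * g x)"
proof -
  have [measurable]: "f \<in> borel_measurable borel" "g \<in> borel_measurable borel" using assms by (auto simp: L2_UNIV)
  have i: "integrable lborel (\<lambda>x. 2 * (f x)\<^sup>2 + 2 * (g x)\<^sup>2)" using assms by (auto simp: L2_UNIV)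
  show "integrable lborel (\<lambda>x. (f x - g x)\<^sup>2)"
  proof (rule Bochner_Integration.integrable_bound[OF i])
    show "AE x in lborel. norm ((f x - g x)\<^sup>2) \<le> norm (2 * (f x)\<^sup>2 + 2 * (g x)\<^sup>2)"
      using sq_diff_le[of "f _" "g _" 0] by (intro AE_I2) simp
  qed measurable
  show "integrable lborel (\<lambda>x. f x * g x)"
  proof (rule Bochner_Integration.integrable_bound[OF i])
    show "AE x in lborel. norm (f x * g x) \<le> norm (2 * (f x)\<^sup>2 + 2 * (g x)\<^sup>2)"
    proof (intro AE_I2)
      fix x
      have "0 \<le> (\<bar>f x\<bar> - \<bar>g x\<bar>)\<^sup>2" by simp
      then have "2 * (\<bar>f x\<bar> * \<bar>g x\<bar>) \<le> (f x)\<^sup>2 + (g x)\<^sup>2" by (simp add: power2_eq_square algebra_simps)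
      moreover have "\<bar>f x\<bar> * \<bar>g x\<bar> \<ge> 0" "(f x)\<^sup>2 \<ge> 0" "(g x)\<^sup>2 \<ge> 0" by auto
      ultimately have "\<bar>f x\<bar> * \<bar>g x\<bar> \<le> 2 * (f x)\<^sup>2 + 2 * (g x)\<^sup>2" by linarith
      then show "norm (f x * g x) \<le> norm (2 * (f x)\<^sup>2 + 2 * (g x)\<^sup>2)" by (simp add: abs_mult)
    qed
  qed measurable
qed

lemma test_fun_L2:
  assumes "test_fun U \<phi>" shows "L2 UNIV \<phi>" "L2 UNIV (partial j \<phi>)"
  using test_fun_integrable[OF assms] test_fun_continuous[OF assms] test_fun_partial_continuous[OF assms]
  by (auto simp: L2_UNIV intro: borel_measurable_continuous_onI)

text \<open>The selected derivative agrees almost everywhere with a square integrable one. Its Borel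
  measurability comes from local integrability on an exhausting sequence of balls.\<close>

lemma Hdot1_grad:
  assumes "Hdot1 u"
  shows "weak_partial UNIV j u (wpartial UNIV j u)" "L2 UNIV (wpartial UNIV j u)"
proof -
  obtain g where g: "weak_partial UNIV j u g" "L2 UNIV g" using assms unfolding Hdot1_def by blast
  show w: "weak_partial UNIV j u (wpartial UNIV j u)" by (rule wpartial_weak_partial[OF g(1)])
  have ae: "AE x in lborel. wpartial UNIV j u x = g x" using wpartial_eq[OF open_UNIV g(1)] by simp
  have m: "wpartial UNIV j u \<in> borel_measurable borel"
  proof -
    have l: "loc_int UNIV (wpartial UNIV j u)" using w by (auto simp: weak_partial_def)
    have 1: "(\<lambda>x. indicator (cball 0 (real n)) x *\<^sub>R wpartial UNIV j u x) \<in> borel_measurable borel" for n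
      using loc_int_restrict[OF l, of "cball 0 (real n)"] borel_measurable_integrable by auto
    show ?thesis
    proof (rule borel_measurable_LIMSEQ_metric[OF 1])
      fix x :: R3
      obtain N :: nat where N: "norm x \<le> real N" using real_arch_simple by blast
      have "\<forall>\<^sub>F n in sequentially. indicator (cball 0 (real n)) x *\<^sub>R wpartial UNIV j u x = wpartial UNIV j u x"
        using eventually_ge_at_top[of N] by eventually_elim (use N in auto)
      then show "(\<lambda>n. indicator (cball 0 (real n)) x *\<^sub>R wpartial UNIV j u x) \<longlonglongrightarrow> wpartial UNIV j u x"
        by (rule tendsto_eventually)
    qed
  qed
  have "integrable lborel (\<lambda>x. (wpartial UNIV j u x)\<^sup>2)"
  proof (rule integrable_cong_AE_imp[where g="\<lambda>x. (g x)\<^sup>2"])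
    show "AE x in lborel. (g x)\<^sup>2 = (wpartial UNIV j u x)\<^sup>2" using ae by eventually_elim simp
  qed (use g m in \<open>auto simp: L2_UNIV\<close>)
  then show "L2 UNIV (wpartial UNIV j u)" using m by (simp add: L2_UNIV)
qed

text \<open>By definition the approximants converge in the gradient norm and in L1 on balls, whereas
  the competitor requires closeness in L2. Hardy's inequality makes them Cauchy in a weighted L2
  norm, and Fatou along an almost everywhere convergent subsequence passes to u.\<close>

lemma Hdot1_approx:
  assumes u: "Hdot1 u" and e: "e > 0"
  shows "\<exists>\<phi>. test_fun UNIV \<phi> \<and> (\<forall>j. (LINT x|lborel. (partial j \<phi> x - wpartial UNIV j u x)\<^sup>2) \<le> e) \<and>
     (\<integral>\<^sup>+x. indicator (ball 0 R) x * ennreal ((\<phi> x - u x)\<^sup>2) \<partial>lborel) \<le> ennreal e"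
proof -
  obtain \<phi> :: "nat \<Rightarrow> R3 \<Rightarrow> real" where \<phi>: "\<And>n. test_fun UNIV (\<phi> n)"
    "\<And>j. (\<lambda>n. LINT x|lborel. (partial j (\<phi> n) x - wpartial UNIV j u x)\<^sup>2) \<longlonglongrightarrow> 0"
    "\<And>r. (\<lambda>n. LINT x:ball 0 r|lborel. \<bar>\<phi> n x - u x\<bar>) \<longlonglongrightarrow> 0"
    using u unfolding Hdot1_def by blast
  define G where "G j = wpartial UNIV j u" for j
  have GL: "L2 UNIV (G j)" for j using Hdot1_grad[OF u] by (simp add: G_def)
  have lu: "loc_int UNIV u" using Hdot1_grad(1)[OF u] by (auto simp: weak_partial_def)
  have uB: "(\<lambda>x. indicator (ball 0 R) x *\<^sub>R u x) \<in> borel_measurable borel" "integrable lborel (\<lambda>x. indicator (ball 0 R) x *\<^sub>R u x)"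
  proof -
    have "set_integrable lborel (cball 0 R) u" using lu unfolding loc_int_def by auto
    then have "set_integrable lborel (ball 0 R) u" by (rule set_integrable_subset) auto
    then show "integrable lborel (\<lambda>x. indicator (ball 0 R) x *\<^sub>R u x)" unfolding set_integrable_def .
    then show "(\<lambda>x. indicator (ball 0 R) x *\<^sub>R u x) \<in> borel_measurable borel" using borel_measurable_integrable by auto
  qed
  \<comment> \<open>48 = 4 * 3 * 4: Hardy's constant, three directions, and 2 + 2 from splitting the
    square of a difference. The factor 1 + R^2 undoes the weight on the ball.\<close>
  define e' where "e' = min e (e / (48 * (1 + R\<^sup>2)))"
  have R1: "1 + R\<^sup>2 > 0" by (simp add: add_pos_nonneg)
  have e': "e' > 0" "e' \<le> e" using e R1 by (auto simp: e'_def)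
  have e'3: "48 * (1 + R\<^sup>2) * e' \<le> e"
  proof -
    have "48 * (1 + R\<^sup>2) * e' \<le> 48 * (1 + R\<^sup>2) * (e / (48 * (1 + R\<^sup>2)))"
      using R1 by (intro mult_left_mono) (auto simp: e'_def)
    then show ?thesis using R1 by simp
  qed
  have "\<forall>\<^sub>F n in sequentially. \<forall>j. (LINT x|lborel. (partial j (\<phi> n) x - G j x)\<^sup>2) < e'"
    using order_tendstoD(2)[OF \<phi>(2) e'(1)] by (simp add: eventually_all_finite G_def)
  then obtain N where N: "\<And>n j. n \<ge> N \<Longrightarrow> (LINT x|lborel. (partial j (\<phi> n) x - G j x)\<^sup>2) < e'"
    by (auto simp: eventually_sequentially)
  have cauchy: "(LINT x|lborel. (\<phi> N x - \<phi> m x)\<^sup>2 / (1 + (norm x)\<^sup>2)) \<le> 48 * e'" if m: "m \<ge> N" for m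
  proof -
    have t: "test_fun UNIV (\<lambda>x. \<phi> N x - \<phi> m x)" by (rule test_fun_diff[OF \<phi>(1) \<phi>(1)])
    have "(LINT x|lborel. (\<phi> N x - \<phi> m x)\<^sup>2 / (1 + (norm x)\<^sup>2)) \<le> 4 * (\<Sum>j\<in>UNIV. LINT x|lborel. (partial j (\<lambda>x. \<phi> N x - \<phi> m x) x)\<^sup>2)"
      by (rule hardy_inequality[OF t])
    also have "\<dots> \<le> 4 * (\<Sum>j\<in>(UNIV::3 set). 4 * e')"
    proof (intro mult_left_mono sum_mono)
      fix j :: 3
      have i: "integrable lborel (\<lambda>x. (partial j (\<phi> n) x - G j x)\<^sup>2)" for n
        by (rule L2_diff_integrable(1)[OF test_fun_L2(2)[OF \<phi>(1)] GL])
      have "(LINT x|lborel. (partial j (\<lambda>x. \<phi> N x - \<phi> m x) x)\<^sup>2) = (LINT x|lborel. (partial j (\<phi> N) x - partial j (\<phi> m) x)\<^sup>2)"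
        using partial_diff[OF test_fun_differentiable[OF \<phi>(1)] test_fun_differentiable[OF \<phi>(1)]] by simp
      also have "\<dots> \<le> (LINT x|lborel. 2 * (partial j (\<phi> N) x - G j x)\<^sup>2 + 2 * (partial j (\<phi> m) x - G j x)\<^sup>2)"
        by (intro integral_mono L2_diff_integrable(1)[OF test_fun_L2(2)[OF \<phi>(1)] test_fun_L2(2)[OF \<phi>(1)]] sq_diff_le) (use i in auto)
      also have "\<dots> = 2 * (LINT x|lborel. (partial j (\<phi> N) x - G j x)\<^sup>2) + 2 * (LINT x|lborel. (partial j (\<phi> m) x - G j x)\<^sup>2)"
        using i by simp
      also have "\<dots> \<le> 4 * e'" using N[of N j] N[OF m, of j] by simp
      finally show "(LINT x|lborel. (partial j (\<lambda>x. \<phi> N x - \<phi> m x) x)\<^sup>2) \<le> 4 * e'" .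
    qed auto
    also have "\<dots> = 48 * e'" by simp
    finally show ?thesis .
  qed
  define D where "D n x = indicator (ball 0 R) x *\<^sub>R (\<phi> n x - u x)" for n x
  have \<phi>m [measurable]: "\<phi> n \<in> borel_measurable borel" for n using test_fun_L2(1)[OF \<phi>(1)[of n]] by (simp add: L2_UNIV)
  note [measurable] = uB(1)
  have Di: "integrable lborel (D n)" for n
  proof -
    have "integrable lborel (\<lambda>x. indicator (ball 0 R) x *\<^sub>R \<phi> n x)"
      using test_fun_integrable(1)[OF \<phi>(1)] by (intro integrable_mult_indicator) auto
    then show ?thesis using uB(2) unfolding D_def[abs_def] scaleR_diff_right by (intro Bochner_Integration.integrable_diff)
  qed
  have "(\<lambda>n. LINT x|lborel. norm (D n x)) \<longlonglongrightarrow> 0"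
    using \<phi>(3)[of R] unfolding set_lebesgue_integral_def D_def by (simp add: abs_mult)
  from tendsto_L1_AE_subseq[OF Di this] obtain r where r: "strict_mono r" "AE x in lborel. (\<lambda>n. D (r n) x) \<longlonglongrightarrow> 0" by auto
  have "(\<integral>\<^sup>+x. indicator (ball 0 R) x * ennreal ((\<phi> N x - u x)\<^sup>2) \<partial>lborel)
     \<le> (\<integral>\<^sup>+x. liminf (\<lambda>m. ennreal ((1 + R\<^sup>2) * ((\<phi> N x - \<phi> (r m) x)\<^sup>2 / (1 + (norm x)\<^sup>2)))) \<partial>lborel)"
  proof (rule nn_integral_mono_AE)
    show "AE x in lborel. indicator (ball 0 R) x * ennreal ((\<phi> N x - u x)\<^sup>2) \<le> liminf (\<lambda>m. ennreal ((1 + R\<^sup>2) * ((\<phi> N x - \<phi> (r m) x)\<^sup>2 / (1 + (norm x)\<^sup>2))))"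
      using r(2)
    proof eventually_elim
      case (elim x)
      show ?case
      proof (cases "x \<in> ball 0 R")
        case True
        have "(\<lambda>n. \<phi> (r n) x) \<longlonglongrightarrow> u x" using elim True by (simp add: D_def LIM_zero_iff)
        then have "(\<lambda>m. (1 + R\<^sup>2) * ((\<phi> N x - \<phi> (r m) x)\<^sup>2 / (1 + (norm x)\<^sup>2))) \<longlonglongrightarrow> (1 + R\<^sup>2) * ((\<phi> N x - u x)\<^sup>2 / (1 + (norm x)\<^sup>2))"
        proof (intro tendsto_intros)
          have "(norm x)\<^sup>2 \<ge> 0" by simp
          then show "1 + (norm x)\<^sup>2 \<noteq> 0" by linarith
        qed
        then have "(\<lambda>m. ennreal ((1 + R\<^sup>2) * ((\<phi> N x - \<phi> (r m) x)\<^sup>2 / (1 + (norm x)\<^sup>2)))) \<longlonglongrightarrow> ennreal ((1 + R\<^sup>2) * ((\<phi> N x - u x)\<^sup>2 / (1 + (norm x)\<^sup>2)))"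
          by (rule tendsto_ennrealI)
        then have "liminf (\<lambda>m. ennreal ((1 + R\<^sup>2) * ((\<phi> N x - \<phi> (r m) x)\<^sup>2 / (1 + (norm x)\<^sup>2)))) = ennreal ((1 + R\<^sup>2) * ((\<phi> N x - u x)\<^sup>2 / (1 + (norm x)\<^sup>2)))"
          by (intro lim_imp_Liminf) auto
        moreover have "(\<phi> N x - u x)\<^sup>2 \<le> (1 + R\<^sup>2) * ((\<phi> N x - u x)\<^sup>2 / (1 + (norm x)\<^sup>2))"
        proof -
          have "(norm x)\<^sup>2 \<le> R\<^sup>2" using True by (intro power_mono) auto
          then have "1 \<le> (1 + R\<^sup>2) / (1 + (norm x)\<^sup>2)" by (simp add: le_divide_eq add_pos_nonneg)
          then have "1 * (\<phi> N x - u x)\<^sup>2 \<le> (1 + R\<^sup>2) / (1 + (norm x)\<^sup>2) * (\<phi> N x - u x)\<^sup>2" by (intro mult_right_mono) auto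
          then show ?thesis by simp
        qed
        ultimately show ?thesis using True by (simp add: ennreal_leI)
      qed simp
    qed
  qed
  also have "\<dots> \<le> liminf (\<lambda>m. \<integral>\<^sup>+x. ennreal ((1 + R\<^sup>2) * ((\<phi> N x - \<phi> (r m) x)\<^sup>2 / (1 + (norm x)\<^sup>2))) \<partial>lborel)"
    by (intro nn_integral_liminf) measurable
  also have "\<dots> \<le> ennreal e"
  proof (rule Liminf_le)
    have "\<forall>\<^sub>F m in sequentially. N \<le> m" by (rule eventually_ge_at_top)
    then show "\<forall>\<^sub>F m in sequentially. (\<integral>\<^sup>+x. ennreal ((1 + R\<^sup>2) * ((\<phi> N x - \<phi> (r m) x)\<^sup>2 / (1 + (norm x)\<^sup>2))) \<partial>lborel) \<le> ennreal e"
    proof eventually_elim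
      case (elim m)
      then have rm: "r m \<ge> N" using seq_suble[OF r(1), of m] by linarith
      have t2: "test_fun UNIV (\<lambda>x. (\<phi> N x - \<phi> (r m) x) * (\<phi> N x - \<phi> (r m) x))"
        by (intro test_fun_mult test_fun_diff \<phi>)
      have cw: "continuous_on UNIV (\<lambda>x::R3. 1 / (1 + (norm x)\<^sup>2))" using C1_dir_radial by (simp add: C1_dir_def)
      have i: "integrable lborel (\<lambda>x. (\<phi> N x - \<phi> (r m) x)\<^sup>2 / (1 + (norm x)\<^sup>2))"
        using test_fun_mult_integrable(1)[OF continuous_loc_int[OF cw] t2] by (simp add: power2_eq_square)
      have "(\<integral>\<^sup>+x. ennreal ((1 + R\<^sup>2) * ((\<phi> N x - \<phi> (r m) x)\<^sup>2 / (1 + (norm x)\<^sup>2))) \<partial>lborel)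
        = ennreal (LINT x|lborel. (1 + R\<^sup>2) * ((\<phi> N x - \<phi> (r m) x)\<^sup>2 / (1 + (norm x)\<^sup>2)))"
        using R1 by (intro nn_integral_eq_integral integrable_mult_right i) auto
      also have "(LINT x|lborel. (1 + R\<^sup>2) * ((\<phi> N x - \<phi> (r m) x)\<^sup>2 / (1 + (norm x)\<^sup>2))) = (1 + R\<^sup>2) * (LINT x|lborel. (\<phi> N x - \<phi> (r m) x)\<^sup>2 / (1 + (norm x)\<^sup>2))"
        by (rule integral_mult_right_zero)
      also have "\<dots> \<le> (1 + R\<^sup>2) * (48 * e')" using cauchy[OF rm] by (intro mult_left_mono) auto
      also have "\<dots> \<le> e" using e'3 by (simp add: mult_ac)
      finally show ?case by (simp add: ennreal_leI)
    qed
  qed simp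
  finally have 2: "(\<integral>\<^sup>+x. indicator (ball 0 R) x * ennreal ((\<phi> N x - u x)\<^sup>2) \<partial>lborel) \<le> ennreal e" .
  have 1: "(LINT x|lborel. (partial j (\<phi> N) x - wpartial UNIV j u x)\<^sup>2) \<le> e" for j
    using N[of N j] e'(2) by (simp add: G_def)
  show ?thesis using \<phi>(1)[of N] 1 2 by blast
qed

section \<open>The curl controls the gradient\<close>

lemma weak_partialD:
  fixes u :: "R3 \<Rightarrow> 'b::{banach,second_countable_topology}"
  shows "weak_partial U j u g \<Longrightarrow> test_fun U \<phi> \<Longrightarrow> (LINT x|lborel. partial j \<phi> x *\<^sub>R u x) = - (LINT x|lborel. \<phi> x *\<^sub>R g x)"
  unfolding weak_partial_iff by blast

text \<open>Symmetry of mixed derivatives in weak form. The derivative in direction i is replaced by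
  a difference quotient; one integration by parts in direction j and a translation then move both
  operations to the other factor, and no function is differentiated twice.\<close>

lemma test_fun_partial_sym:
  assumes \<phi>: "test_fun UNIV \<phi>" and \<psi>: "test_fun UNIV \<psi>"
  shows "(LINT x|lborel. partial i \<phi> x * partial j \<psi> x) = (LINT x|lborel. partial j \<phi> x * partial i \<psi> x)"
proof -
  define h where "h n = inverse (real (Suc n))" for n
  have h: "h n > 0" "h \<longlonglongrightarrow> 0" for n using LIMSEQ_inverse_real_of_nat by (auto simp: h_def[abs_def])
  have h0: "filterlim h (at 0) sequentially" "filterlim (\<lambda>n. - h n) (at 0) sequentially"
    using h tendsto_minus[OF h(2)] by (auto simp: filterlim_at less_imp_neq[symmetric])
  have c: "continuous_on UNIV \<phi>" "continuous_on UNIV \<psi>" using test_fun_continuous \<phi> \<psi> by auto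
  have cp: "continuous_on UNIV (partial k \<phi>)" "continuous_on UNIV (partial k \<psi>)" for k using test_fun_partial_continuous \<phi> \<psi> by auto
  have m: "\<phi> \<in> borel_measurable borel" "\<psi> \<in> borel_measurable borel" using c by (auto intro: borel_measurable_continuous_onI)
  have mp: "partial k \<phi> \<in> borel_measurable borel" "partial k \<psi> \<in> borel_measurable borel" for k using cp by (auto intro: borel_measurable_continuous_onI)
  note [measurable] = m mp
  have lim: "((\<lambda>t. (\<theta> (x + t *\<^sub>R ax k) - \<theta> x) / t) \<longlongrightarrow> partial k \<theta> x) (at 0)" if "test_fun UNIV \<theta>" for \<theta> k x
    using line_derivative[OF test_fun_differentiable[OF that], where x=x and t=0 and j=k] by (simp add: DERIV_def)
  have id: "(LINT x|lborel. partial j \<phi> x * ((\<psi> (x + h n *\<^sub>R ax i) - \<psi> x) / h n))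
     = (LINT x|lborel. ((\<phi> (x - h n *\<^sub>R ax i) - \<phi> x) / (- h n)) * partial j \<psi> x)" for n
  proof -
    let ?c = "h n *\<^sub>R ax i"
    have wp: "weak_partial UNIV j \<psi> (partial j \<psi>)" by (rule C1_dir_weak_partial[OF test_fun_C1_dir[OF \<psi>] open_UNIV])
    have l: "loc_int UNIV \<psi>" "loc_int UNIV (partial j \<psi>)" using wp by (auto simp: weak_partial_def)
    have t: "test_fun UNIV (\<lambda>x. \<phi> (x - ?c))" by (rule test_fun_shift[OF \<phi>]) auto
    have p: "partial j (\<lambda>x. \<phi> (x - ?c)) x = partial j \<phi> (x - ?c)" for x by (rule partial_shift[OF test_fun_differentiable[OF \<phi>]])
    have i1: "integrable lborel (\<lambda>x. partial j \<phi> (x - ?c) * \<psi> x)" "integrable lborel (\<lambda>x. \<phi> (x - ?c) * partial j \<psi> x)"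
      using test_fun_mult_integrable(2)[OF l(1) t, of j] test_fun_mult_integrable(1)[OF l(2) t] by (simp_all add: p)
    have i2: "integrable lborel (\<lambda>x. partial j \<phi> x * \<psi> x)" "integrable lborel (\<lambda>x. \<phi> x * partial j \<psi> x)"
      using test_fun_mult_integrable(2)[OF l(1) \<phi>, of j] test_fun_mult_integrable(1)[OF l(2) \<phi>] by simp_all
    have i3: "integrable lborel (\<lambda>x. partial j \<phi> x * \<psi> (x + ?c))"
      using integrable_shift[of "\<lambda>x. partial j \<phi> (x - ?c) * \<psi> x" ?c] i1(1) by simp
    have e1: "(LINT x|lborel. partial j \<phi> x * \<psi> (x + ?c)) = - (LINT x|lborel. \<phi> (x - ?c) * partial j \<psi> x)"
    proof -
      have "(LINT x|lborel. partial j \<phi> x * \<psi> (x + ?c)) = (LINT x|lborel. partial j \<phi> (x - ?c) * \<psi> x)"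
        using integral_shift[of "\<lambda>x. partial j \<phi> (x - ?c) * \<psi> x" ?c] by simp
      also have "\<dots> = - (LINT x|lborel. \<phi> (x - ?c) * partial j \<psi> x)"
        using weak_partialD[OF wp t] by (simp add: p)
      finally show ?thesis .
    qed
    have e2: "(LINT x|lborel. partial j \<phi> x * \<psi> x) = - (LINT x|lborel. \<phi> x * partial j \<psi> x)"
      using weak_partialD[OF wp \<phi>] by simp
    have "(LINT x|lborel. partial j \<phi> x * ((\<psi> (x + ?c) - \<psi> x) / h n)) = (LINT x|lborel. (partial j \<phi> x * \<psi> (x + ?c) - partial j \<phi> x * \<psi> x) / h n)"
      by (simp add: right_diff_distrib)
    also have "\<dots> = ((LINT x|lborel. partial j \<phi> x * \<psi> (x + ?c)) - (LINT x|lborel. partial j \<phi> x * \<psi> x)) / h n"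
      using i2 i3 by simp
    also have "\<dots> = ((LINT x|lborel. \<phi> (x - ?c) * partial j \<psi> x) - (LINT x|lborel. \<phi> x * partial j \<psi> x)) / (- h n)"
      unfolding e1 e2 by (simp add: divide_inverse algebra_simps)
    also have "\<dots> = (LINT x|lborel. (\<phi> (x - ?c) * partial j \<psi> x - \<phi> x * partial j \<psi> x) / (- h n))"
      using i1 i2 by simp
    also have "\<dots> = (LINT x|lborel. ((\<phi> (x - ?c) - \<phi> x) / (- h n)) * partial j \<psi> x)"
      by (rule Bochner_Integration.integral_cong) (auto simp: left_diff_distrib)
    finally show ?thesis .
  qed
  obtain B where B: "\<And>x. \<bar>partial i \<psi> x\<bar> \<le> B" "B \<ge> 0" using test_fun_bounded_partial[OF \<psi>] by metis
  obtain B' where B': "\<And>x. \<bar>partial i \<phi> x\<bar> \<le> B'" "B' \<ge> 0" using test_fun_bounded_partial[OF \<phi>] by metis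
  have 1: "(\<lambda>n. LINT x|lborel. partial j \<phi> x * ((\<psi> (x + h n *\<^sub>R ax i) - \<psi> x) / h n)) \<longlonglongrightarrow> (LINT x|lborel. partial j \<phi> x * partial i \<psi> x)"
  proof (rule integral_dominated_convergence[where w="\<lambda>x. B * norm (partial j \<phi> x)"])
    show "AE x in lborel. (\<lambda>n. partial j \<phi> x * ((\<psi> (x + h n *\<^sub>R ax i) - \<psi> x) / h n)) \<longlonglongrightarrow> partial j \<phi> x * partial i \<psi> x"
      by (intro AE_I2 tendsto_mult tendsto_const filterlim_compose[OF lim[OF \<psi>] h0(1)])
    show "AE x in lborel. norm (partial j \<phi> x * ((\<psi> (x + h n *\<^sub>R ax i) - \<psi> x) / h n)) \<le> B * norm (partial j \<phi> x)" for n
    proof (intro AE_I2)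
      fix x
      have "\<bar>(\<psi> (x + h n *\<^sub>R ax i) - \<psi> x) / h n\<bar> \<le> B"
        using test_fun_shift_bound[OF \<psi> B(1), of x "h n"] h(1)[of n] by (simp add: divide_le_eq)
      then have "\<bar>partial j \<phi> x\<bar> * \<bar>(\<psi> (x + h n *\<^sub>R ax i) - \<psi> x) / h n\<bar> \<le> \<bar>partial j \<phi> x\<bar> * B" by (intro mult_left_mono) auto
      then show "norm (partial j \<phi> x * ((\<psi> (x + h n *\<^sub>R ax i) - \<psi> x) / h n)) \<le> B * norm (partial j \<phi> x)"
        by (simp only: real_norm_def abs_mult mult.commute)
    qed
    show "integrable lborel (\<lambda>x. B * norm (partial j \<phi> x))" using test_fun_integrable(2)[OF \<phi>] by auto
  qed measurable
  have 2: "(\<lambda>n. LINT x|lborel. ((\<phi> (x - h n *\<^sub>R ax i) - \<phi> x) / (- h n)) * partial j \<psi> x) \<longlonglongrightarrow> (LINT x|lborel. partial i \<phi> x * partial j \<psi> x)"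
  proof (rule integral_dominated_convergence[where w="\<lambda>x. B' * norm (partial j \<psi> x)"])
    show "AE x in lborel. (\<lambda>n. ((\<phi> (x - h n *\<^sub>R ax i) - \<phi> x) / (- h n)) * partial j \<psi> x) \<longlonglongrightarrow> partial i \<phi> x * partial j \<psi> x"
      using filterlim_compose[OF lim[OF \<phi>] h0(2)] by (intro AE_I2 tendsto_mult tendsto_const) (simp add: scaleR_minus_left)
    show "AE x in lborel. norm (((\<phi> (x - h n *\<^sub>R ax i) - \<phi> x) / (- h n)) * partial j \<psi> x) \<le> B' * norm (partial j \<psi> x)" for n
    proof (intro AE_I2)
      fix x
      have "\<bar>(\<phi> (x - h n *\<^sub>R ax i) - \<phi> x) / (- h n)\<bar> \<le> B'"
        using test_fun_shift_bound[OF \<phi> B'(1), of x "- h n"] h(1)[of n] by (simp add: divide_le_eq)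
      then have "\<bar>(\<phi> (x - h n *\<^sub>R ax i) - \<phi> x) / (- h n)\<bar> * \<bar>partial j \<psi> x\<bar> \<le> B' * \<bar>partial j \<psi> x\<bar>" by (intro mult_right_mono) auto
      then show "norm (((\<phi> (x - h n *\<^sub>R ax i) - \<phi> x) / (- h n)) * partial j \<psi> x) \<le> B' * norm (partial j \<psi> x)"
        by (simp only: real_norm_def abs_mult)
    qed
    show "integrable lborel (\<lambda>x. B' * norm (partial j \<psi> x))" using test_fun_integrable(2)[OF \<psi>] by auto
  qed measurable
  show ?thesis using LIMSEQ_unique[OF 1[unfolded id] 2] by simp
qed

text \<open>Young's inequality with a free parameter takes the place of Cauchy-Schwarz:
  \<open>\<eta>\<close> is fixed first so that the bounded part is at most e / 2, and n is chosen
  afterwards.\<close>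

lemma L2_product_limit:
  fixes f g :: "R3 \<Rightarrow> real"
  assumes f: "L2 UNIV f" "\<And>n. L2 UNIV (F n)" "(\<lambda>n. LINT x|lborel. (F n x - f x)\<^sup>2) \<longlonglongrightarrow> 0"
    and g: "L2 UNIV g" "\<And>n. L2 UNIV (G n)" "(\<lambda>n. LINT x|lborel. (G n x - g x)\<^sup>2) \<longlonglongrightarrow> 0"
  shows "(\<lambda>n. LINT x|lborel. F n x * G n x) \<longlonglongrightarrow> (LINT x|lborel. f x * g x)"
proof -
  define a where "a n = (LINT x|lborel. (F n x - f x)\<^sup>2)" for n
  define b where "b n = (LINT x|lborel. (G n x - g x)\<^sup>2)" for n
  define P where "P = (LINT x|lborel. (f x)\<^sup>2) + (LINT x|lborel. (g x)\<^sup>2)"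
  have P0: "P \<ge> 0" unfolding P_def by (intro add_nonneg_nonneg integral_nonneg_AE) auto
  note df = L2_diff_integrable[OF f(2) f(1)] and dg = L2_diff_integrable[OF g(2) g(1)]
  note fg = L2_diff_integrable(2)[OF f(1) g(1)] and FG = L2_diff_integrable(2)[OF f(2) g(2)]
  have sf: "integrable lborel (\<lambda>x. (f x)\<^sup>2)" "integrable lborel (\<lambda>x. (g x)\<^sup>2)" using f(1) g(1) by (auto simp: L2_UNIV)
  have key: "\<bar>(LINT x|lborel. F n x * G n x) - (LINT x|lborel. f x * g x)\<bar> \<le> \<eta> * P + (1 + 1 / \<eta>) * (a n + b n)" if \<eta>: "\<eta> > 0" for n \<eta>
  proof -
    have pt: "\<bar>F n x * G n x - f x * g x\<bar> \<le> \<eta> * ((f x)\<^sup>2 + (g x)\<^sup>2) + (1 + 1 / \<eta>) * ((F n x - f x)\<^sup>2 + (G n x - g x)\<^sup>2)" for x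
    proof -
      define u v where "u = F n x - f x" and "v = G n x - g x"
      have e: "F n x * G n x - f x * g x = u * v + u * g x + f x * v" by (simp add: u_def v_def algebra_simps)
      have y: "\<bar>p * q\<bar> \<le> \<eta> * q\<^sup>2 + (1 / \<eta>) * p\<^sup>2" for p q :: real
      proof -
        have s: "sqrt \<eta> > 0" "(sqrt \<eta>)\<^sup>2 = \<eta>" using \<eta> by auto
        have "0 \<le> (\<bar>p\<bar> / sqrt \<eta> - sqrt \<eta> * \<bar>q\<bar>)\<^sup>2" by simp
        also have "\<dots> = (1/\<eta>) * p\<^sup>2 + \<eta> * q\<^sup>2 - 2 * \<bar>p * q\<bar>"
          unfolding power2_diff using s by (simp add: power_divide power_mult_distrib abs_mult)
        finally have "2 * \<bar>p * q\<bar> \<le> (1/\<eta>) * p\<^sup>2 + \<eta> * q\<^sup>2" by simp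
        moreover have "\<bar>p * q\<bar> \<ge> 0" by simp
        ultimately show ?thesis by linarith
      qed
      have uv: "\<bar>u * v\<bar> \<le> u\<^sup>2 + v\<^sup>2"
      proof -
        have "0 \<le> (\<bar>u\<bar> - \<bar>v\<bar>)\<^sup>2" by simp
        then have "2 * \<bar>u * v\<bar> \<le> u\<^sup>2 + v\<^sup>2" by (simp add: power2_eq_square abs_mult algebra_simps)
        moreover have "\<bar>u * v\<bar> \<ge> 0" by simp
        ultimately show ?thesis by linarith
      qed
      have "\<bar>F n x * G n x - f x * g x\<bar> \<le> \<bar>u * v\<bar> + \<bar>u * g x\<bar> + \<bar>v * f x\<bar>" unfolding e by (simp add: mult.commute)
      also have "\<dots> \<le> (u\<^sup>2 + v\<^sup>2) + (\<eta> * (g x)\<^sup>2 + (1 / \<eta>) * u\<^sup>2) + (\<eta> * (f x)\<^sup>2 + (1 / \<eta>) * v\<^sup>2)"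
        by (intro add_mono uv y)
      also have "\<dots> = \<eta> * ((f x)\<^sup>2 + (g x)\<^sup>2) + (1 + 1 / \<eta>) * (u\<^sup>2 + v\<^sup>2)" by (simp add: algebra_simps)
      finally show ?thesis by (simp add: u_def v_def)
    qed
    have "\<bar>(LINT x|lborel. F n x * G n x) - (LINT x|lborel. f x * g x)\<bar> = \<bar>LINT x|lborel. F n x * G n x - f x * g x\<bar>"
      using FG fg by simp
    also have "\<dots> \<le> (LINT x|lborel. \<bar>F n x * G n x - f x * g x\<bar>)" by (rule integral_abs_bound)
    also have "\<dots> \<le> (LINT x|lborel. \<eta> * ((f x)\<^sup>2 + (g x)\<^sup>2) + (1 + 1 / \<eta>) * ((F n x - f x)\<^sup>2 + (G n x - g x)\<^sup>2))"
    proof (rule integral_mono[OF _ _ pt])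
      show "integrable lborel (\<lambda>x. \<bar>F n x * G n x - f x * g x\<bar>)" using FG fg by (intro integrable_abs) auto
      show "integrable lborel (\<lambda>x. \<eta> * ((f x)\<^sup>2 + (g x)\<^sup>2) + (1 + 1 / \<eta>) * ((F n x - f x)\<^sup>2 + (G n x - g x)\<^sup>2))"
        using sf df dg by (intro Bochner_Integration.integrable_add integrable_mult_right) auto
    qed
    also have "\<dots> = (LINT x|lborel. \<eta> * ((f x)\<^sup>2 + (g x)\<^sup>2)) + (LINT x|lborel. (1 + 1 / \<eta>) * ((F n x - f x)\<^sup>2 + (G n x - g x)\<^sup>2))"
      using sf df dg by (intro Bochner_Integration.integral_add integrable_mult_right Bochner_Integration.integrable_add) auto
    also have "\<dots> = \<eta> * P + (1 + 1 / \<eta>) * (a n + b n)"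
      unfolding integral_mult_right_zero P_def a_def b_def using sf df(1) dg(1) by simp
    finally show ?thesis .
  qed
  have "(\<lambda>n. \<bar>(LINT x|lborel. F n x * G n x) - (LINT x|lborel. f x * g x)\<bar>) \<longlonglongrightarrow> 0"
  proof (rule tendsto_zeroI_le)
    fix e :: real assume e: "e > 0"
    define \<eta> where "\<eta> = e / (2 * (P + 1))"
    have \<eta>: "\<eta> > 0" using e P0 by (simp add: \<eta>_def)
    have "\<eta> * P \<le> \<eta> * (P + 1)" using \<eta> by (intro mult_left_mono) auto
    also have "\<dots> = e / 2"
    proof -
      have "e / (2 * Q) * Q = e / 2" if "Q \<noteq> 0" for Q :: real using that by simp
      have "P + 1 \<noteq> 0" using P0 by linarith
      then have "e / (2 * (P + 1)) * (P + 1) = e / 2" by (rule \<open>\<And>Q. Q \<noteq> 0 \<Longrightarrow> e / (2 * Q) * Q = e / 2\<close>)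
      then show ?thesis by (simp only: \<eta>_def)
    qed
    finally have \<eta>P: "\<eta> * P \<le> e / 2" .
    have "(\<lambda>n. (1 + 1 / \<eta>) * (a n + b n)) \<longlonglongrightarrow> (1 + 1 / \<eta>) * (0 + 0)"
      using f(3) g(3) unfolding a_def b_def by (intro tendsto_intros)
    then have "\<forall>\<^sub>F n in sequentially. (1 + 1 / \<eta>) * (a n + b n) < e / 2" using e by (intro order_tendstoD(2)) auto
    then show "\<forall>\<^sub>F n in sequentially. \<bar>(LINT x|lborel. F n x * G n x) - (LINT x|lborel. f x * g x)\<bar> \<le> e"
    proof eventually_elim
      case (elim n)
      then show ?case using key[OF \<eta>, of n] \<eta>P by linarith
    qed
  qed auto
  from tendsto_rabs_zero_cancel[OF this] show ?thesis by (rule LIM_zero_cancel)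
qed

text \<open>Both sides are continuous in the gradient norm, so the identity passes from
  approximating test functions to the limit.\<close>

lemma Hdot1_partial_sym:
  assumes u: "Hdot1 u" and v: "Hdot1 v"
  shows "(LINT x|lborel. wpartial UNIV i u x * wpartial UNIV j v x) = (LINT x|lborel. wpartial UNIV j u x * wpartial UNIV i v x)"
proof -
  obtain \<phi> :: "nat \<Rightarrow> R3 \<Rightarrow> real" where \<phi>: "\<And>n. test_fun UNIV (\<phi> n)"
    "\<And>j. (\<lambda>n. LINT x|lborel. (partial j (\<phi> n) x - wpartial UNIV j u x)\<^sup>2) \<longlonglongrightarrow> 0"
    using u unfolding Hdot1_def by blast
  obtain \<psi> :: "nat \<Rightarrow> R3 \<Rightarrow> real" where \<psi>: "\<And>n. test_fun UNIV (\<psi> n)"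
    "\<And>j. (\<lambda>n. LINT x|lborel. (partial j (\<psi> n) x - wpartial UNIV j v x)\<^sup>2) \<longlonglongrightarrow> 0"
    using v unfolding Hdot1_def by blast
  have 1: "(\<lambda>n. LINT x|lborel. partial i (\<phi> n) x * partial j (\<psi> n) x) \<longlonglongrightarrow> (LINT x|lborel. wpartial UNIV i u x * wpartial UNIV j v x)" for i j
    by (rule L2_product_limit[OF Hdot1_grad(2)[OF u] test_fun_L2(2)[OF \<phi>(1)] \<phi>(2) Hdot1_grad(2)[OF v] test_fun_L2(2)[OF \<psi>(1)] \<psi>(2)])
  have s: "(LINT x|lborel. partial i (\<phi> n) x * partial j (\<psi> n) x) = (LINT x|lborel. partial j (\<phi> n) x * partial i (\<psi> n) x)" for n
    by (rule test_fun_partial_sym[OF \<phi>(1) \<psi>(1)])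
  show ?thesis
    by (rule LIMSEQ_unique[OF 1[of i j, unfolded s] 1[of j i]])
qed

lemma HdotF_weak_partial:
  assumes "HdotF A"
  shows "weak_partial UNIV j (\<lambda>x. A x $ i) (\<lambda>x. wpartial UNIV j (\<lambda>x. (A x - Fmag x) $ i) x + dF j i)"
proof -
  have "Hdot1 (\<lambda>x. (A x - Fmag x) $ i)" using assms by (simp add: HdotF_def)
  from weak_partial_add[OF Hdot1_grad(1)[OF this, of j] weak_partial_Fmag[of j i]]
  show ?thesis by simp
qed

text \<open>The selection behind \<open>wpartial\<close> is not additive; uniqueness of weak
  derivatives restores additivity almost everywhere, and the curl of F contributes
  \<open>beta\<close>.\<close>

lemma HdotF_wcurl:
  assumes "HdotF A"
  shows "AE x in lborel. wcurl A x - beta = wcurl (\<lambda>y. A y - Fmag y) x"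
proof -
  define g where "g j i x = wpartial UNIV j (\<lambda>x. (A x - Fmag x) $ i) x" for j i x
  have h: "Hdot1 (\<lambda>x. (A x - Fmag x) $ i)" for i using assms by (simp add: HdotF_def)
  have ae: "AE x in lborel. wcurl A x = vector [(g 2 3 x + dF 2 3) - (g 3 2 x + dF 3 2), (g 3 1 x + dF 3 1) - (g 1 3 x + dF 1 3), (g 1 2 x + dF 1 2) - (g 2 1 x + dF 2 1)]"
    using wcurl_AE[OF HdotF_weak_partial[OF assms]] unfolding g_def .
  have c: "wcurl (\<lambda>y. A y - Fmag y) x = vector [g 2 3 x - g 3 2 x, g 3 1 x - g 1 3 x, g 1 2 x - g 2 1 x]" for x
    by (simp add: wcurl_def Let_def g_def)
  show ?thesis
    using ae unfolding c by eventually_elim (simp add: beta_eq vec_eq_iff forall_3)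
qed

text \<open>Integrating the weak divergence condition by parts in each component tests the sum of
  the diagonal derivatives of A against every \<open>\<phi>\<close>; F contributes nothing because
  \<open>dF j j\<close> = 0.\<close>

lemma HdotF_div_zero:
  assumes A: "HdotF A"
  shows "AE x in lborel. (\<Sum>j\<in>UNIV. wpartial UNIV j (\<lambda>x. (A x - Fmag x) $ j) x) = 0"
proof -
  define g where "g j x = wpartial UNIV j (\<lambda>x. (A x - Fmag x) $ j) x + dF j j" for j x
  have wp: "weak_partial UNIV j (\<lambda>x. A x $ j) (g j)" for j
    using HdotF_weak_partial[OF A, of j j] by (simp add: g_def[abs_def])
  have l: "loc_int UNIV (\<lambda>x. A x $ j)" "loc_int UNIV (g j)" for j using wp[of j] by (auto simp: weak_partial_def)
  have ls: "loc_int UNIV (\<lambda>x. \<Sum>j\<in>UNIV. g j x)"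
    unfolding sum_3 by (intro loc_int_add l)
  have "AE x in lborel. x \<in> UNIV \<longrightarrow> (\<Sum>j\<in>UNIV. g j x) = 0"
  proof (rule fundamental_lemma[OF open_UNIV ls])
    fix \<phi> assume t: "test_fun UNIV \<phi>"
    have i: "integrable lborel (\<lambda>x. \<phi> x * g j x)" "integrable lborel (\<lambda>x. A x $ j * partial j \<phi> x)" for j
      using test_fun_mult_integrable(1)[OF l(2) t, of j] test_fun_mult_integrable(2)[OF l(1) t, of j j] by (simp_all add: mult.commute)
    have e: "(LINT x|lborel. A x $ j * partial j \<phi> x) = - (LINT x|lborel. \<phi> x * g j x)" for j
      using weak_partialD[OF wp[of j] t] by (simp add: mult.commute)
    have "(LINT x|lborel. \<phi> x *\<^sub>R (\<Sum>j\<in>UNIV. g j x)) = (LINT x|lborel. (\<Sum>j\<in>UNIV. \<phi> x * g j x))"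
      by (simp add: sum_distrib_left)
    also have "\<dots> = (\<Sum>j\<in>UNIV. LINT x|lborel. \<phi> x * g j x)" using i by (intro Bochner_Integration.integral_sum) auto
    also have "\<dots> = - (\<Sum>j\<in>UNIV. LINT x|lborel. A x $ j * partial j \<phi> x)" unfolding e by (simp add: sum_negf)
    also have "(\<Sum>j\<in>UNIV. LINT x|lborel. A x $ j * partial j \<phi> x) = (LINT x|lborel. (\<Sum>j\<in>UNIV. A x $ j * partial j \<phi> x))"
      using i by (intro Bochner_Integration.integral_sum[symmetric]) auto
    also have "\<dots> = 0" using A t unfolding HdotF_def weak_div_free_def by blast
    finally show "(LINT x|lborel. \<phi> x *\<^sub>R (\<Sum>j\<in>UNIV. g j x)) = 0" by simp
  qed
  moreover have "dF j j = 0" for j by (auto simp: dF_def)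
  ultimately show ?thesis by (simp add: g_def)
qed

text \<open>Pointwise, |curl a|^2 is the full squared gradient minus the sum of the products of
  transposed derivatives. By the symmetry of mixed products that sum has the same integral as the
  square of the divergence, which is 0. So the magnetic energy controls the whole gradient with
  constant 1.\<close>

lemma curl_grad_identity:
  assumes A: "HdotF A"
  defines "g \<equiv> \<lambda>j i. wpartial UNIV j (\<lambda>x. (A x - Fmag x) $ i)"
  shows "integrable lborel (\<lambda>x. (norm (wcurl (\<lambda>y. A y - Fmag y) x))\<^sup>2)"
    "(LINT x|lborel. (norm (wcurl (\<lambda>y. A y - Fmag y) x))\<^sup>2) = (\<Sum>i\<in>UNIV. \<Sum>j\<in>UNIV. LINT x|lborel. (g j i x)\<^sup>2)"
proof -
  have h: "Hdot1 (\<lambda>x. (A x - Fmag x) $ i)" for i using A by (simp add: HdotF_def)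
  have L: "L2 UNIV (g j i)" for j i using Hdot1_grad(2)[OF h] by (simp add: g_def)
  have ii: "integrable lborel (\<lambda>x. g j i x * g k l x)" for j i k l by (rule L2_diff_integrable(2)[OF L L])
  have n3: "(norm (v::R3))\<^sup>2 = (v$1)\<^sup>2 + (v$2)\<^sup>2 + (v$3)\<^sup>2" for v by (simp add: norm_sq_3 sum_3)
  have pt: "(norm (wcurl (\<lambda>y. A y - Fmag y) x))\<^sup>2 = (\<Sum>i\<in>UNIV. \<Sum>j\<in>UNIV. g j i x * g j i x) - (\<Sum>i\<in>UNIV. \<Sum>j\<in>UNIV. g i j x * g j i x)" for x
    unfolding wcurl_def Let_def n3 sum_3 g_def by (simp add: power2_eq_square algebra_simps)
  show "integrable lborel (\<lambda>x. (norm (wcurl (\<lambda>y. A y - Fmag y) x))\<^sup>2)"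
    unfolding pt using ii by auto
  have sym: "(LINT x|lborel. g i j x * g j i x) = (LINT x|lborel. g i i x * g j j x)" for i j
    using Hdot1_partial_sym[OF h h, of i j j i] by (simp add: g_def mult.commute)
  have "(\<Sum>i\<in>UNIV. \<Sum>j\<in>UNIV. LINT x|lborel. g i j x * g j i x) = (LINT x|lborel. (\<Sum>i\<in>UNIV. g i i x) * (\<Sum>j\<in>UNIV. g j j x))"
    unfolding sym sum_product using ii by simp
  also have "\<dots> = (LINT (x::R3)|lborel. 0)"
  proof (rule integral_cong_AE)
    show "AE x in lborel. (\<Sum>i\<in>UNIV. g i i x) * (\<Sum>j\<in>UNIV. g j j x) = 0"
      using HdotF_div_zero[OF A] unfolding g_def by eventually_elim simp
    have "g j i \<in> borel_measurable borel" for j i using L by (auto simp: L2_UNIV)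
    then show "(\<lambda>x. (\<Sum>i\<in>UNIV. g i i x) * (\<Sum>j\<in>UNIV. g j j x)) \<in> borel_measurable lborel" by measurable
  qed auto
  finally have z: "(\<Sum>i\<in>UNIV. \<Sum>j\<in>UNIV. LINT x|lborel. g i j x * g j i x) = 0" by simp
  have "(LINT x|lborel. (norm (wcurl (\<lambda>y. A y - Fmag y) x))\<^sup>2) = (\<Sum>i\<in>UNIV. \<Sum>j\<in>UNIV. LINT x|lborel. g j i x * g j i x) - (\<Sum>i\<in>UNIV. \<Sum>j\<in>UNIV. LINT x|lborel. g i j x * g j i x)"
    unfolding pt using ii by simp
  then show "(LINT x|lborel. (norm (wcurl (\<lambda>y. A y - Fmag y) x))\<^sup>2) = (\<Sum>i\<in>UNIV. \<Sum>j\<in>UNIV. LINT x|lborel. (g j i x)\<^sup>2)"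
    unfolding z by (simp add: power2_eq_square)
qed

section \<open>The competitor for a minimizer\<close>

lemma loc_int_measurable:
  fixes u :: "R3 \<Rightarrow> 'b::{banach,second_countable_topology}"
  assumes l: "loc_int UNIV u"
  shows "u \<in> borel_measurable borel"
proof -
  have 1: "(\<lambda>x. indicator (cball 0 (real n)) x *\<^sub>R u x) \<in> borel_measurable borel" for n
    using loc_int_restrict[OF l, of "cball 0 (real n)"] borel_measurable_integrable by auto
  show ?thesis
  proof (rule borel_measurable_LIMSEQ_metric[OF 1])
    fix x :: R3
    obtain N :: nat where N: "norm x \<le> real N" using real_arch_simple by blast
    have "\<forall>\<^sub>F n in sequentially. indicator (cball 0 (real n)) x *\<^sub>R u x = u x"
      using eventually_ge_at_top[of N] by eventually_elim (use N in auto)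
    then show "(\<lambda>n. indicator (cball 0 (real n)) x *\<^sub>R u x) \<longlonglongrightarrow> u x"
      by (rule tendsto_eventually)
  qed
qed

section \<open>Pointwise inequalities for the comparison of energies\<close>

lemma young_sq:
  fixes x y \<eta> :: real
  assumes "\<eta> > 0"
  shows "(x + y)\<^sup>2 \<le> (1 + \<eta>) * x\<^sup>2 + (1 + 1 / \<eta>) * y\<^sup>2"
proof -
  have "0 \<le> (\<eta> * x - y)\<^sup>2 / \<eta>" using assms by simp
  also have "\<dots> = \<eta> * x\<^sup>2 + y\<^sup>2 / \<eta> - 2 * x * y"
    using assms by (simp add: power2_diff power_mult_distrib field_simps power2_eq_square)
  finally show ?thesis by (simp add: power2_sum algebra_simps)
qed

text \<open>The coefficient of |D|^2 has to stay 1 + \<open>\<eta>\<close>, since that term is later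
  cancelled against the minimizer's own energy. The constant 16 is 2^2 from the bound on t times 4
  for the number of error terms.\<close>

lemma covariant_sq_le:
  fixes v D D' t l1 l2 l3 p1 p2 p3 r :: complex
  assumes \<eta>: "\<eta> > 0" and "norm v \<le> 1" "norm D' \<le> norm D" "norm t \<le> 2" "norm p1 \<le> 1" "norm p2 \<le> 1" "norm p3 \<le> 1"
  shows "(norm (v * D' + t * (l1 * p1 + l2 * p2 + l3 * p3 + r)))\<^sup>2 \<le>
    (1 + \<eta>) * (norm D)\<^sup>2 + (1 + 1 / \<eta>) * (16 * ((norm l1)\<^sup>2 + (norm l2)\<^sup>2 + (norm l3)\<^sup>2 + (norm r)\<^sup>2))"
proof -
  let ?y = "2 * (norm l1 + norm l2 + norm l3 + norm r)"
  have "norm (l1 * p1) \<le> norm l1" "norm (l2 * p2) \<le> norm l2" "norm (l3 * p3) \<le> norm l3"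
    using assms by (auto simp: norm_mult intro: mult_left_le)
  then have 1: "norm (l1 * p1 + l2 * p2 + l3 * p3 + r) \<le> norm l1 + norm l2 + norm l3 + norm r"
    by (smt (verit) norm_triangle_ineq)
  have "norm (t * (l1 * p1 + l2 * p2 + l3 * p3 + r)) \<le> 2 * (norm l1 + norm l2 + norm l3 + norm r)"
    unfolding norm_mult using 1 assms(4) by (intro mult_mono) auto
  moreover have "norm (v * D') \<le> 1 * norm D" unfolding norm_mult using assms by (intro mult_mono) auto
  ultimately have "norm (v * D' + t * (l1 * p1 + l2 * p2 + l3 * p3 + r)) \<le> norm D + ?y"
    by (intro norm_triangle_le) auto
  then have "(norm (v * D' + t * (l1 * p1 + l2 * p2 + l3 * p3 + r)))\<^sup>2 \<le> (norm D + ?y)\<^sup>2"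
    by (intro power_mono) auto
  also have "\<dots> \<le> (1 + \<eta>) * (norm D)\<^sup>2 + (1 + 1 / \<eta>) * ?y\<^sup>2" by (rule young_sq[OF \<eta>])
  also have "\<dots> \<le> (1 + \<eta>) * (norm D)\<^sup>2 + (1 + 1 / \<eta>) * (16 * ((norm l1)\<^sup>2 + (norm l2)\<^sup>2 + (norm l3)\<^sup>2 + (norm r)\<^sup>2))"
  proof (intro add_left_mono mult_left_mono)
    define a b c e where "a = norm l1" and "b = norm l2" and "c = norm l3" and "e = norm r"
    have "0 \<le> (a - b)\<^sup>2 + (a - c)\<^sup>2 + (a - e)\<^sup>2 + (b - c)\<^sup>2 + (b - e)\<^sup>2 + (c - e)\<^sup>2" by simp
    then have "(2 * (a + b + c + e))\<^sup>2 \<le> 16 * (a\<^sup>2 + b\<^sup>2 + c\<^sup>2 + e\<^sup>2)" by (simp add: power2_eq_square algebra_simps)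
    then show "?y\<^sup>2 \<le> 16 * ((norm l1)\<^sup>2 + (norm l2)\<^sup>2 + (norm l3)\<^sup>2 + (norm r)\<^sup>2)" by (simp add: a_def b_def c_def e_def)
  qed (use \<eta> in auto)
  finally show ?thesis .
qed

text \<open>The defect of a product of numbers in [0, 1] is at most the sum of their defects. The
  constant 48 is 4^2 from T <= 4 times 3 for the number of factors.\<close>

lemma potential_le:
  fixes x1 x2 x3 T :: real
  assumes \<eta>: "\<eta> > 0" and x: "0 \<le> x1" "x1 \<le> 1" "0 \<le> x2" "x2 \<le> 1" "0 \<le> x3" "x3 \<le> 1" and T: "0 \<le> T" "T \<le> 4"
  shows "(1 - x1 * (x2 * x3) * T)\<^sup>2 \<le> (1 + \<eta>) * (1 - T)\<^sup>2 + (1 + 1 / \<eta>) * (48 * ((1 - x1)\<^sup>2 + (1 - x2)\<^sup>2 + (1 - x3)\<^sup>2))"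
proof -
  let ?y = "T * (1 - x1 * (x2 * x3))"
  have "(1 - x1 * (x2 * x3) * T)\<^sup>2 = ((1 - T) + ?y)\<^sup>2" by (simp add: algebra_simps)
  also have "\<dots> \<le> (1 + \<eta>) * (1 - T)\<^sup>2 + (1 + 1 / \<eta>) * ?y\<^sup>2" by (rule young_sq[OF \<eta>])
  also have "\<dots> \<le> (1 + \<eta>) * (1 - T)\<^sup>2 + (1 + 1 / \<eta>) * (48 * ((1 - x1)\<^sup>2 + (1 - x2)\<^sup>2 + (1 - x3)\<^sup>2))"
  proof (intro add_left_mono mult_left_mono)
    define a b c where "a = 1 - x1" and "b = 1 - x2" and "c = 1 - x3"
    have abc: "0 \<le> a" "0 \<le> b" "0 \<le> c" using x by (auto simp: a_def b_def c_def)
    have x23: "0 \<le> x2 * x3" "x2 * x3 \<le> 1" using x by (auto intro: mult_le_one)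
    have "(1 - x2) * (1 - x3) \<ge> 0" "(1 - x1) * (1 - x2 * x3) \<ge> 0" using x x23 by (auto intro!: mult_nonneg_nonneg)
    then have 1: "1 - x1 * (x2 * x3) \<le> a + b + c" unfolding a_def b_def c_def by (simp add: algebra_simps)
    have 2: "x1 * (x2 * x3) \<le> 1" using x x23 by (intro mult_le_one) auto
    have "?y \<le> 4 * (a + b + c)" using T 1 2 by (intro mult_mono) auto
    moreover have "0 \<le> ?y" using T 2 by simp
    ultimately have "?y\<^sup>2 \<le> (4 * (a + b + c))\<^sup>2" by (intro power_mono)
    also have "\<dots> \<le> 48 * (a\<^sup>2 + b\<^sup>2 + c\<^sup>2)"
    proof -
      have "0 \<le> (a - b)\<^sup>2 + (a - c)\<^sup>2 + (b - c)\<^sup>2" by simp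
      then show ?thesis by (simp add: power2_eq_square algebra_simps)
    qed
    finally show "?y\<^sup>2 \<le> 48 * ((1 - x1)\<^sup>2 + (1 - x2)\<^sup>2 + (1 - x3)\<^sup>2)" by (simp add: a_def b_def c_def)
  qed (use \<eta> in auto)
  finally show ?thesis .
qed

text \<open>One of the three factors of the competitor, with the connection form - 2 pi c c'
  \<open>\<phi>\<close> dx_j. The coefficients are kept separate because only their product will be
  prescribed, which leaves their ratio free for balancing c^2 G against c'^2 |\<Omega>|. The final 1
  pays for selecting a translation.\<close>

lemma lattice_average:
  fixes c c' d \<kappa> G :: real and j :: 3 and \<phi> :: "R3 \<Rightarrow> real"
  assumes O: "open \<Omega>" "bounded \<Omega>" and d: "d > 0" "d \<le> 1" and t: "test_fun UNIV \<phi>" and \<kappa>: "\<kappa> > 0"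
    and G: "(\<Sum>k\<in>UNIV. LINT x|lborel. (partial k \<phi> x)\<^sup>2) \<le> G"
  defines "f \<equiv> \<lambda>x. - c * \<phi> x" and "h \<equiv> \<lambda>x::R3. c' * x $ j"
  defines "f' \<equiv> \<lambda>k x. - c * partial k \<phi> x" and "h' \<equiv> \<lambda>k (x::R3). if k = j then c' else 0"
  shows "\<exists>\<alpha> \<beta>. (\<integral>\<^sup>+x. indicator \<Omega> x * ennreal ((\<Sum>k\<in>UNIV. (norm (latc d f h (f' k) (h' k) \<alpha> \<beta> x))\<^sup>2) + \<kappa>\<^sup>2 * (1 - (norm (latv d f h \<alpha> \<beta> x))\<^sup>2)\<^sup>2) \<partial>lborel)
    \<le> ennreal (2 * pi\<^sup>2 * (c\<^sup>2 * G + c'\<^sup>2 * measure lborel \<Omega>) * (2 / pi * ln (1 / d) + 53) + 49 * \<kappa>\<^sup>2 * d\<^sup>2 * measure lborel \<Omega> + 1)"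
proof -
  define S where "S x = (\<Sum>k\<in>UNIV. (partial k \<phi> x)\<^sup>2)" for x
  define w where "w x = 2 * pi\<^sup>2 * (c\<^sup>2 * S x + c'\<^sup>2)" for x
  define \<Lambda> where "\<Lambda> = 2 / pi * ln (1 / d) + 53"
  define \<mu> where "\<mu> = measure lborel \<Omega>"
  have \<Lambda>: "\<Lambda> \<ge> 0" using d by (simp add: \<Lambda>_def)
  have S0: "S x \<ge> 0" for x unfolding S_def by (intro sum_nonneg) auto
  have w0: "w x \<ge> 0" for x unfolding w_def using S0 by (intro mult_nonneg_nonneg add_nonneg_nonneg) auto
  have g0: "gfac d s t \<ge> 0" for s t using gfac_pos[OF d(1)] less_imp_le by blast
  have P0: "latP d s t \<ge> 0" for s t using g0 by (simp add: latP_def)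
  define \<Psi> :: "R3 \<Rightarrow> real \<Rightarrow> real \<Rightarrow> ennreal" where "\<Psi> x \<alpha> \<beta> = indicator \<Omega> x * (ennreal (w x) * ennreal (latP d (f x + \<alpha>) (h x + \<beta>))
      + ennreal (\<kappa>\<^sup>2 * d\<^sup>2) * ennreal (d\<^sup>2 * (gfac d (f x + \<alpha>) (h x + \<beta>))\<^sup>2))" for x \<alpha> \<beta>
  have dens: "indicator \<Omega> x * ennreal ((\<Sum>k\<in>UNIV. (norm (latc d f h (f' k) (h' k) \<alpha> \<beta> x))\<^sup>2) + \<kappa>\<^sup>2 * (1 - (norm (latv d f h \<alpha> \<beta> x))\<^sup>2)\<^sup>2) \<le> \<Psi> x \<alpha> \<beta>" for x \<alpha> \<beta>
  proof -
    let ?s = "f x + \<alpha>" and ?t = "h x + \<beta>"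
    have "(\<Sum>k\<in>UNIV. (norm (latc d f h (f' k) (h' k) \<alpha> \<beta> x))\<^sup>2) \<le> (\<Sum>k\<in>UNIV. 2 * ((f' k x)\<^sup>2 + (h' k x)\<^sup>2) * (pi\<^sup>2 * latP d ?s ?t))"
      by (intro sum_mono latc_norm_le d)
    also have "\<dots> = 2 * (\<Sum>k\<in>UNIV. (f' k x)\<^sup>2 + (h' k x)\<^sup>2) * (pi\<^sup>2 * latP d ?s ?t)"
      by (simp add: sum_distrib_left sum_distrib_right)
    also have "(\<Sum>k\<in>UNIV. (f' k x)\<^sup>2 + (h' k x)\<^sup>2) = c\<^sup>2 * S x + c'\<^sup>2"
    proof -
      have "(\<Sum>k\<in>UNIV. (h' k x)\<^sup>2) = (\<Sum>k\<in>UNIV. if k = j then c'\<^sup>2 else 0)" by (intro sum.cong) (auto simp: h'_def)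
      also have "\<dots> = c'\<^sup>2" by simp
      finally show ?thesis by (simp add: sum.distrib f'_def S_def power_mult_distrib sum_distrib_left)
    qed
    also have "2 * (c\<^sup>2 * S x + c'\<^sup>2) * (pi\<^sup>2 * latP d ?s ?t) = w x * latP d ?s ?t" by (simp add: w_def mult_ac)
    finally have 1: "(\<Sum>k\<in>UNIV. (norm (latc d f h (f' k) (h' k) \<alpha> \<beta> x))\<^sup>2) \<le> w x * latP d ?s ?t" .
    have 2: "\<kappa>\<^sup>2 * (1 - (norm (latv d f h \<alpha> \<beta> x))\<^sup>2)\<^sup>2 = \<kappa>\<^sup>2 * d\<^sup>2 * (d\<^sup>2 * (gfac d ?s ?t)\<^sup>2)"
      unfolding latv_norm(2)[OF d(1)] by (simp add: power2_eq_square)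
    have "ennreal ((\<Sum>k\<in>UNIV. (norm (latc d f h (f' k) (h' k) \<alpha> \<beta> x))\<^sup>2) + \<kappa>\<^sup>2 * (1 - (norm (latv d f h \<alpha> \<beta> x))\<^sup>2)\<^sup>2)
       \<le> ennreal (w x * latP d ?s ?t + \<kappa>\<^sup>2 * d\<^sup>2 * (d\<^sup>2 * (gfac d ?s ?t)\<^sup>2))"
      using add_mono[OF 1 eq_refl[OF 2]] by (rule ennreal_leI)
    also have "\<dots> = ennreal (w x * latP d ?s ?t) + ennreal (\<kappa>\<^sup>2 * d\<^sup>2 * (d\<^sup>2 * (gfac d ?s ?t)\<^sup>2))"
      using P0 w0 by (intro ennreal_plus) auto
    also have "\<dots> = ennreal (w x) * ennreal (latP d ?s ?t) + ennreal (\<kappa>\<^sup>2 * d\<^sup>2) * ennreal (d\<^sup>2 * (gfac d ?s ?t)\<^sup>2)"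
      using P0 w0 by (intro arg_cong2[where f="(+)"] ennreal_mult) auto
    finally show ?thesis unfolding \<Psi>_def by (intro mult_left_mono) auto
  qed
  have Om [measurable]: "\<Omega> \<in> sets borel" using O by simp
  have cph: "continuous_on UNIV \<phi>" "continuous_on UNIV (partial k \<phi>)" for k
    using test_fun_continuous[OF t] test_fun_partial_continuous[OF t] by auto
  have "continuous_on UNIV f" "continuous_on UNIV h" "continuous_on UNIV w"
    unfolding f_def h_def w_def[abs_def] S_def by (intro continuous_intros cph)+
  then have [measurable]: "f \<in> borel_measurable borel" "h \<in> borel_measurable borel" "w \<in> borel_measurable borel"
    by (auto intro: borel_measurable_continuous_onI)
  note [measurable (raw)] = measurable_case_prod_compose[OF gfac_measurable]
  have Lm: "(\<lambda>(x, y). latP d x y) \<in> borel_measurable (borel \<Otimes>\<^sub>M borel)" unfolding latP_def by measurable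
  note [measurable (raw)] = measurable_case_prod_compose[OF Lm]
  have m\<Psi>: "(\<lambda>(x, \<alpha>, \<beta>). \<Psi> x \<alpha> \<beta>) \<in> borel_measurable (borel \<Otimes>\<^sub>M borel \<Otimes>\<^sub>M borel)"
    unfolding \<Psi>_def by measurable
  define C where "C x = w x * \<Lambda> + \<kappa>\<^sup>2 * d\<^sup>2 * 49" for x
  have C0: "C x \<ge> 0" for x using w0 \<Lambda> by (simp add: C_def)
  have mean: "cell_mean (\<Psi> x) \<le> indicator \<Omega> x * ennreal (C x)" for x
  proof -
    have "cell_mean (\<Psi> x) = indicator \<Omega> x * (ennreal (w x) * cell_mean (\<lambda>\<alpha> \<beta>. ennreal (latP d (f x + \<alpha>) (h x + \<beta>)))
        + ennreal (\<kappa>\<^sup>2 * d\<^sup>2) * cell_mean (\<lambda>\<alpha> \<beta>. ennreal (d\<^sup>2 * (gfac d (f x + \<alpha>) (h x + \<beta>))\<^sup>2)))"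
      unfolding \<Psi>_def[abs_def]
      by (subst cell_mean_cmult, measurable, subst cell_mean_add, measurable, subst cell_mean_cmult, measurable, subst cell_mean_cmult, measurable)
    also have "\<dots> \<le> indicator \<Omega> x * (ennreal (w x) * ennreal \<Lambda> + ennreal (\<kappa>\<^sup>2 * d\<^sup>2) * ennreal 49)"
      using cell_mean_latP[OF d] cell_mean_gfac_sq[OF d(1)] unfolding \<Lambda>_def by (intro mult_left_mono add_mono) auto
    also have "ennreal (w x) * ennreal \<Lambda> + ennreal (\<kappa>\<^sup>2 * d\<^sup>2) * ennreal 49 = ennreal (C x)"
      unfolding C_def using w0 \<Lambda> by (subst ennreal_plus) (auto simp: ennreal_mult)
    finally show ?thesis .
  qed
  have iS: "integrable lborel S" unfolding S_def[abs_def] using test_fun_integrable(4)[OF t] by auto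
  have iO: "integrable lborel (indicator \<Omega> :: R3 \<Rightarrow> real)"
    using O by (intro integrable_real_indicator emeasure_bounded_finite) auto
  have LS: "(LINT x|lborel. S x) \<le> G"
    unfolding S_def using G test_fun_integrable(4)[OF t] by (subst Bochner_Integration.integral_sum) auto
  have "(\<integral>\<^sup>+x. indicator \<Omega> x * ennreal (C x) \<partial>lborel) \<le> (\<integral>\<^sup>+x. ennreal ((2 * pi\<^sup>2 * c\<^sup>2 * \<Lambda>) * S x + (2 * pi\<^sup>2 * c'\<^sup>2 * \<Lambda> + \<kappa>\<^sup>2 * d\<^sup>2 * 49) * indicator \<Omega> x) \<partial>lborel)"
  proof (rule nn_integral_mono)
    fix x
    have "C x = (2 * pi\<^sup>2 * c\<^sup>2 * \<Lambda>) * S x + (2 * pi\<^sup>2 * c'\<^sup>2 * \<Lambda> + \<kappa>\<^sup>2 * d\<^sup>2 * 49)"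
      by (simp add: C_def w_def algebra_simps)
    then show "indicator \<Omega> x * ennreal (C x) \<le> ennreal ((2 * pi\<^sup>2 * c\<^sup>2 * \<Lambda>) * S x + (2 * pi\<^sup>2 * c'\<^sup>2 * \<Lambda> + \<kappa>\<^sup>2 * d\<^sup>2 * 49) * indicator \<Omega> x)"
      by (cases "x \<in> \<Omega>") auto
  qed
  also have "\<dots> = ennreal (LINT x|lborel. (2 * pi\<^sup>2 * c\<^sup>2 * \<Lambda>) * S x + (2 * pi\<^sup>2 * c'\<^sup>2 * \<Lambda> + \<kappa>\<^sup>2 * d\<^sup>2 * 49) * indicator \<Omega> x)"
    using iS iO S0 \<Lambda> by (intro nn_integral_eq_integral Bochner_Integration.integrable_add integrable_mult_right AE_I2 add_nonneg_nonneg mult_nonneg_nonneg) auto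
  also have "(LINT x|lborel. (2 * pi\<^sup>2 * c\<^sup>2 * \<Lambda>) * S x + (2 * pi\<^sup>2 * c'\<^sup>2 * \<Lambda> + \<kappa>\<^sup>2 * d\<^sup>2 * 49) * indicator \<Omega> x)
     = (2 * pi\<^sup>2 * c\<^sup>2 * \<Lambda>) * (LINT x|lborel. S x) + (2 * pi\<^sup>2 * c'\<^sup>2 * \<Lambda> + \<kappa>\<^sup>2 * d\<^sup>2 * 49) * \<mu>"
    using iS iO by (subst Bochner_Integration.integral_add) (auto simp: \<mu>_def)
  also have "ennreal \<dots> \<le> ennreal ((2 * pi\<^sup>2 * c\<^sup>2 * \<Lambda>) * G + (2 * pi\<^sup>2 * c'\<^sup>2 * \<Lambda> + \<kappa>\<^sup>2 * d\<^sup>2 * 49) * \<mu>)"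
    using LS \<Lambda> by (intro ennreal_leI add_right_mono mult_left_mono) auto
  also have "(2 * pi\<^sup>2 * c\<^sup>2 * \<Lambda>) * G + (2 * pi\<^sup>2 * c'\<^sup>2 * \<Lambda> + \<kappa>\<^sup>2 * d\<^sup>2 * 49) * \<mu> = 2 * pi\<^sup>2 * (c\<^sup>2 * G + c'\<^sup>2 * \<mu>) * \<Lambda> + 49 * \<kappa>\<^sup>2 * d\<^sup>2 * \<mu>"
    by (simp add: algebra_simps)
  finally have int: "(\<integral>\<^sup>+x. indicator \<Omega> x * ennreal (C x) \<partial>lborel) \<le> ennreal (2 * pi\<^sup>2 * (c\<^sup>2 * G + c'\<^sup>2 * \<mu>) * \<Lambda> + 49 * \<kappa>\<^sup>2 * d\<^sup>2 * \<mu>)" .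
  have G0: "G \<ge> 0" by (rule order_trans[OF _ G]) (intro sum_nonneg integral_nonneg_AE, auto)
  have "2 * pi\<^sup>2 * (c\<^sup>2 * G + c'\<^sup>2 * \<mu>) * \<Lambda> + 49 * \<kappa>\<^sup>2 * d\<^sup>2 * \<mu> \<ge> 0"
    using G0 \<Lambda> by (intro add_nonneg_nonneg mult_nonneg_nonneg) (auto simp: \<mu>_def)
  from exists_translate_le[OF m\<Psi> mean int zero_less_one this]
  obtain \<alpha> \<beta> where ab: "(\<integral>\<^sup>+x. \<Psi> x \<alpha> \<beta> \<partial>lborel) \<le> ennreal (2 * pi\<^sup>2 * (c\<^sup>2 * G + c'\<^sup>2 * \<mu>) * \<Lambda> + 49 * \<kappa>\<^sup>2 * d\<^sup>2 * \<mu> + 1)"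
    by blast
  show ?thesis
    using order_trans[OF nn_integral_mono[OF dens] ab] unfolding \<mu>_def \<Lambda>_def by blast
qed

lemma minimizer_magnetic:
  assumes O: "open \<Omega>" and min: "GL_minimizer \<Omega> \<kappa> H \<psi> A"
    and g: "\<And>j. weak_partial \<Omega> j \<psi> (g j)"
  shows "GL_C0 \<Omega> \<kappa> H = (\<integral>\<^sup>+x. indicator \<Omega> x * ennreal (GL_density \<kappa> H g \<psi> A x) \<partial>lborel)
     + ennreal (\<kappa>\<^sup>2 * H\<^sup>2 * (LINT x|lborel. (norm (wcurl (\<lambda>y. A y - Fmag y) x))\<^sup>2))"
proof -
  have A: "HdotF A" and E: "GL_energy \<Omega> \<kappa> H \<psi> A = GL_C0 \<Omega> \<kappa> H" using min by (auto simp: GL_minimizer_def)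
  have "(\<integral>\<^sup>+x. ennreal ((norm (wcurl A x - beta))\<^sup>2) \<partial>lborel) = (\<integral>\<^sup>+x. ennreal ((norm (wcurl (\<lambda>y. A y - Fmag y) x))\<^sup>2) \<partial>lborel)"
  proof (rule nn_integral_cong_AE)
    show "AE x in lborel. ennreal ((norm (wcurl A x - beta))\<^sup>2) = ennreal ((norm (wcurl (\<lambda>y. A y - Fmag y) x))\<^sup>2)"
      using HdotF_wcurl[OF A] by eventually_elim simp
  qed
  also have "\<dots> = ennreal (LINT x|lborel. (norm (wcurl (\<lambda>y. A y - Fmag y) x))\<^sup>2)"
    by (rule nn_integral_eq_integral[OF curl_grad_identity(1)[OF A]]) simp
  finally have "(\<integral>\<^sup>+x. ennreal ((norm (wcurl A x - beta))\<^sup>2) \<partial>lborel) = \<dots>" .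
  then show ?thesis
    using GL_energy_eq[OF O g, of \<kappa> H A] E by (simp add: ennreal_mult)
qed

text \<open>The rest of the energy is nonnegative, so the magnetic part alone is below the lattice
  bound. This first estimate makes curl (A - F) small enough in L2 for the comparison
  argument.\<close>

lemma minimizer_magnetic_le:
  assumes O: "open \<Omega>" "bounded \<Omega>" and H: "0 < H" "H \<le> \<kappa>" and min: "GL_minimizer \<Omega> \<kappa> H \<psi> A"
  shows "\<kappa>\<^sup>2 * H\<^sup>2 * (LINT x|lborel. (norm (wcurl (\<lambda>y. A y - Fmag y) x))\<^sup>2)
    \<le> measure lborel \<Omega> * \<kappa> * H * (ln (sqrt (\<kappa> / H)) + 110)" (is "?M \<le> ?c")
proof -
  have "\<exists>g. weak_partial \<Omega> j \<psi> g" for j using min by (auto simp: GL_minimizer_def H1_def)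
  then have g: "weak_partial \<Omega> j \<psi> (wpartial \<Omega> j \<psi>)" for j using wpartial_weak_partial by blast
  have "ennreal ?M \<le> GL_C0 \<Omega> \<kappa> H"
    unfolding minimizer_magnetic[OF O(1) min g] by simp
  also have "\<dots> \<le> ennreal ?c" by (rule GL_C0_le_lattice[OF O H])
  finally have le: "ennreal ?M \<le> ennreal ?c" .
  have "1 \<le> \<kappa> / H" using H by simp
  then have "ln (sqrt (\<kappa> / H)) \<ge> 0" by simp
  then have "?c \<ge> 0" using H by (intro mult_nonneg_nonneg) auto
  then show ?thesis using le by (simp add: ennreal_le_iff)
qed

lemma H1_gradient:
  assumes "H1 \<Omega> \<psi>"
  obtains g where "\<And>j. weak_partial \<Omega> j \<psi> (g j)" "\<And>j. L2 \<Omega> (g j)"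
proof -
  have "\<forall>j. \<exists>g. weak_partial \<Omega> j \<psi> g \<and> L2 \<Omega> g" using assms by (simp add: H1_def)
  from choice[OF this] show ?thesis using that by blast
qed

lemma L2_set_measurable: "L2 \<Omega> f \<Longrightarrow> (\<lambda>x. indicator \<Omega> x *\<^sub>R f x) \<in> borel_measurable borel"
  by (simp add: L2_def set_borel_measurable_def)

lemma GL_density_measurable:
  assumes O: "open \<Omega>" and g: "\<And>j. L2 \<Omega> (g j)" and \<psi>: "L2 \<Omega> \<psi>" and A: "\<And>j. (\<lambda>x. A x $ j) \<in> borel_measurable borel"
  shows "(\<lambda>x. indicator \<Omega> x * ennreal (GL_density \<kappa> H g \<psi> A x)) \<in> borel_measurable borel"
proof -
  have [measurable]: "\<Omega> \<in> sets borel" using O by simp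
  note [measurable] = L2_set_measurable[OF g] L2_set_measurable[OF \<psi>] A
  have "(\<lambda>x. indicator \<Omega> x * ennreal (GL_density \<kappa> H (\<lambda>j x. indicator \<Omega> x *\<^sub>R g j x) (\<lambda>x. indicator \<Omega> x *\<^sub>R \<psi> x) A x)) \<in> borel_measurable borel"
    unfolding GL_density_def by measurable
  moreover have "(\<lambda>x. indicator \<Omega> x * ennreal (GL_density \<kappa> H (\<lambda>j x. indicator \<Omega> x *\<^sub>R g j x) (\<lambda>x. indicator \<Omega> x *\<^sub>R \<psi> x) A x))
     = (\<lambda>x. indicator \<Omega> x * ennreal (GL_density \<kappa> H g \<psi> A x))"
    by (auto simp: fun_eq_iff indicator_def GL_density_def)
  ultimately show ?thesis by simp
qed

text \<open>In the Leibniz rule the derivative of v is multiplied by the truncated function, which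
  is bounded, while \<open>dtrunc\<close> does not increase the gradient; on a bounded set both
  terms are square integrable.\<close>

lemma H1_mult_trunc:
  fixes v :: "R3 \<Rightarrow> complex"
  assumes O: "open \<Omega>" "bounded \<Omega>" and g: "\<And>j. weak_partial \<Omega> j \<psi> (g j)" "\<And>j. L2 \<Omega> (g j)" and L2\<psi>: "L2 \<Omega> \<psi>"
    and Cv: "\<And>k. C1_dir k v (v' k)" and v1: "\<And>x. norm (v x) \<le> 1"
  shows "H1 \<Omega> (\<lambda>x. v x * trunc (\<psi> x))"
proof -
  define \<xi> where "\<xi> x = v x * trunc (\<psi> x)" for x
  define g\<xi> where "g\<xi> k x = v x * dtrunc (\<psi> x) (g k x) + v' k x * trunc (\<psi> x)" for k x
  have wp\<xi>: "weak_partial \<Omega> k \<xi> (g\<xi> k)" for k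
    unfolding \<xi>_def[abs_def] g\<xi>_def[abs_def] by (rule weak_partial_mult_C1[OF weak_partial_trunc[OF g(1) O(1)] Cv O(1)])
  have Om [measurable]: "\<Omega> \<in> sets borel" using O by simp
  have cont: "continuous_on UNIV v" "continuous_on UNIV (v' k)" for k using Cv by (auto simp: C1_dir_def)
  note [measurable] = L2_set_measurable[OF L2\<psi>] L2_set_measurable[OF g(2)]
  have [measurable]: "v \<in> borel_measurable borel" "v' k \<in> borel_measurable borel" for k
    using cont by (auto intro: borel_measurable_continuous_onI)
  have trm [measurable]: "trunc \<in> borel_measurable borel"
    by (intro borel_measurable_continuous_onI continuous_at_imp_continuous_on ballI has_derivative_continuous[OF trunc_has_derivative])
  have m1: "(\<lambda>x. indicator \<Omega> x *\<^sub>R \<xi> x) \<in> borel_measurable borel"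
  proof -
    have "(\<lambda>x. v x * (indicator \<Omega> x *\<^sub>R trunc (indicator \<Omega> x *\<^sub>R \<psi> x))) \<in> borel_measurable borel" by measurable
    moreover have "(\<lambda>x. v x * (indicator \<Omega> x *\<^sub>R trunc (indicator \<Omega> x *\<^sub>R \<psi> x))) = (\<lambda>x. indicator \<Omega> x *\<^sub>R \<xi> x)"
      by (auto simp: fun_eq_iff indicator_def \<xi>_def)
    ultimately show ?thesis by (simp only:)
  qed
  have m2: "(\<lambda>x. indicator \<Omega> x *\<^sub>R g\<xi> k x) \<in> borel_measurable borel" for k
  proof -
    have "(\<lambda>x. (\<lambda>(z, w). dtrunc z w) (indicator \<Omega> x *\<^sub>R \<psi> x, indicator \<Omega> x *\<^sub>R g k x)) \<in> borel_measurable borel"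
      by (rule measurable_compose[OF _ dtrunc_measurable]) measurable
    then have [measurable]: "(\<lambda>x. dtrunc (indicator \<Omega> x *\<^sub>R \<psi> x) (indicator \<Omega> x *\<^sub>R g k x)) \<in> borel_measurable borel" by simp
    have "(\<lambda>x. indicator \<Omega> x *\<^sub>R (v x * dtrunc (indicator \<Omega> x *\<^sub>R \<psi> x) (indicator \<Omega> x *\<^sub>R g k x) + v' k x * trunc (indicator \<Omega> x *\<^sub>R \<psi> x))) \<in> borel_measurable borel" by measurable
    moreover have "(\<lambda>x. indicator \<Omega> x *\<^sub>R (v x * dtrunc (indicator \<Omega> x *\<^sub>R \<psi> x) (indicator \<Omega> x *\<^sub>R g k x) + v' k x * trunc (indicator \<Omega> x *\<^sub>R \<psi> x))) = (\<lambda>x. indicator \<Omega> x *\<^sub>R g\<xi> k x)"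
      by (auto simp: fun_eq_iff indicator_def g\<xi>_def)
    ultimately show ?thesis by (simp only:)
  qed
  have iO: "integrable lborel (indicator \<Omega> :: R3 \<Rightarrow> real)"
    using O by (intro integrable_real_indicator emeasure_bounded_finite) auto
  have l1: "L2 \<Omega> \<xi>"
    unfolding L2_def set_borel_measurable_def set_integrable_def
  proof
    show "integrable lborel (\<lambda>x. indicator \<Omega> x *\<^sub>R (norm (\<xi> x))\<^sup>2)"
    proof (rule Bochner_Integration.integrable_bound[where f="\<lambda>x. 4 * indicator \<Omega> x"])
      have "(\<lambda>x. (norm (indicator \<Omega> x *\<^sub>R \<xi> x))\<^sup>2) \<in> borel_measurable borel" using m1 by measurable
      moreover have "(\<lambda>x. (norm (indicator \<Omega> x *\<^sub>R \<xi> x))\<^sup>2) = (\<lambda>x. indicator \<Omega> x *\<^sub>R (norm (\<xi> x))\<^sup>2)"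
        by (auto simp: fun_eq_iff indicator_def)
      ultimately show "(\<lambda>x. indicator \<Omega> x *\<^sub>R (norm (\<xi> x))\<^sup>2) \<in> borel_measurable lborel" by simp
      show "AE x in lborel. norm (indicator \<Omega> x *\<^sub>R (norm (\<xi> x))\<^sup>2) \<le> norm (4 * indicator \<Omega> x :: real)"
      proof (intro AE_I2)
        fix x
        have "norm (\<xi> x) \<le> 1 * 2" unfolding \<xi>_def norm_mult using v1 trunc_bounds(1) by (intro mult_mono) auto
        then have "(norm (\<xi> x))\<^sup>2 \<le> 2\<^sup>2" by (intro power_mono) auto
        then show "norm (indicator \<Omega> x *\<^sub>R (norm (\<xi> x))\<^sup>2) \<le> norm (4 * indicator \<Omega> x :: real)" by (simp add: indicator_def)
      qed
    qed (use iO in auto)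
  qed (use m1 in simp)
  have l2: "L2 \<Omega> (g\<xi> k)" for k
    unfolding L2_def set_borel_measurable_def set_integrable_def
  proof
    have ib: "integrable lborel (\<lambda>x. 2 * (indicator \<Omega> x *\<^sub>R (norm (g k x))\<^sup>2) + 8 * (indicator \<Omega> x *\<^sub>R (norm (v' k x))\<^sup>2))"
      using g(2)[of k] L2_bounded_continuous[OF cont(2)[of k] O] unfolding L2_def set_integrable_def
      by (intro Bochner_Integration.integrable_add integrable_mult_right) auto
    show "integrable lborel (\<lambda>x. indicator \<Omega> x *\<^sub>R (norm (g\<xi> k x))\<^sup>2)"
    proof (rule Bochner_Integration.integrable_bound[OF ib])
      have "(\<lambda>x. (norm (indicator \<Omega> x *\<^sub>R g\<xi> k x))\<^sup>2) \<in> borel_measurable borel" using m2[of k] by measurable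
      moreover have "(\<lambda>x. (norm (indicator \<Omega> x *\<^sub>R g\<xi> k x))\<^sup>2) = (\<lambda>x. indicator \<Omega> x *\<^sub>R (norm (g\<xi> k x))\<^sup>2)"
        by (auto simp: fun_eq_iff indicator_def)
      ultimately show "(\<lambda>x. indicator \<Omega> x *\<^sub>R (norm (g\<xi> k x))\<^sup>2) \<in> borel_measurable lborel" by simp
      show "AE x in lborel. norm (indicator \<Omega> x *\<^sub>R (norm (g\<xi> k x))\<^sup>2) \<le> norm (2 * (indicator \<Omega> x *\<^sub>R (norm (g k x))\<^sup>2) + 8 * (indicator \<Omega> x *\<^sub>R (norm (v' k x))\<^sup>2))"
      proof (intro AE_I2)
        fix x
        have "norm (v x * dtrunc (\<psi> x) (g k x)) \<le> 1 * norm (g k x)" unfolding norm_mult using v1 dtrunc_le by (intro mult_mono) auto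
        moreover have "norm (v' k x * trunc (\<psi> x)) \<le> norm (v' k x) * 2" unfolding norm_mult using trunc_bounds(1) by (intro mult_left_mono) auto
        ultimately have "norm (g\<xi> k x) \<le> norm (g k x) + 2 * norm (v' k x)" unfolding g\<xi>_def by (intro norm_triangle_le) auto
        then have "(norm (g\<xi> k x))\<^sup>2 \<le> (norm (g k x) + 2 * norm (v' k x))\<^sup>2" by (intro power_mono) auto
        also have "\<dots> \<le> 2 * (norm (g k x))\<^sup>2 + 8 * (norm (v' k x))\<^sup>2"
          using young_sq[of 1 "norm (g k x)" "2 * norm (v' k x)"] by simp
        finally show "norm (indicator \<Omega> x *\<^sub>R (norm (g\<xi> k x))\<^sup>2) \<le> norm (2 * (indicator \<Omega> x *\<^sub>R (norm (g k x))\<^sup>2) + 8 * (indicator \<Omega> x *\<^sub>R (norm (v' k x))\<^sup>2))"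
          by (simp add: indicator_def)
      qed
    qed
  qed (use m2 in simp)
  show ?thesis unfolding \<xi>_def[symmetric, abs_def] H1_def using l1 l2 wp\<xi> by blast
qed

text \<open>The competitor is \<open>(trunc \<psi> * v, F)\<close>, where the vortex lattices in \<open>v\<close> make \<open>\<nabla>v\<close> close to
  \<open>- \<i> \<kappa> H (A - F) v\<close>: gauging away \<open>A - F\<close> saves the magnetic energy and costs only \<open>K\<close>.\<close>

lemma competitor_bound:
  assumes O: "open \<Omega>" "bounded \<Omega>" and H: "0 < H" "H \<le> \<kappa>" and min: "GL_minimizer \<Omega> \<kappa> H \<psi> A"
    and \<eta>: "\<eta> > 0" and s: "s > 0"
  defines "X \<equiv> measure lborel \<Omega>" and "L \<equiv> ln (sqrt (\<kappa> / H))"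
    and "m2 \<equiv> LINT x|lborel. (norm (wcurl (\<lambda>y. A y - Fmag y) x))\<^sup>2"
  assumes m2: "m2 \<le> X * s\<^sup>2"
  shows "\<kappa>\<^sup>2 * H\<^sup>2 * m2 \<le> \<eta> * (X * \<kappa> * H * (L + 110)) +
     24 * (1 + 1 / \<eta>) * (3 * (\<kappa> * H) * (s * (3 * X + 6) * (2 * L + 170) + 49 * X) + 6)"
proof -
  have \<kappa>: "\<kappa> > 0" using H by simp
  have "1 \<le> \<kappa> / H" using H by simp
  then have L0: "L \<ge> 0" by (simp add: L_def)
  have X0: "X \<ge> 0" by (simp add: X_def)
  have A: "HdotF A" and H1\<psi>: "H1 \<Omega> \<psi>" using min by (auto simp: GL_minimizer_def)
  obtain g where g: "\<And>j. weak_partial \<Omega> j \<psi> (g j)" "\<And>j. L2 \<Omega> (g j)" using H1_gradient[OF H1\<psi>] by metis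
  define a where "a j x = (A x - Fmag x) $ j" for j x
  have ha: "Hdot1 (a j)" for j using A by (simp add: HdotF_def a_def[abs_def])
  obtain R where R: "\<Omega> \<subseteq> ball 0 R" using O(2) bounded_subset_ballD by blast
  \<comment> \<open>Small enough that replacing A - F by test functions costs only a constant in
    energy, as \<kappa>^2 H^2 e <= 1, and leaves the gradients of order s, as e <= s^2.\<close>
  define e where "e = min (1 / (\<kappa>\<^sup>2 * H\<^sup>2)) (s\<^sup>2)"
  have e: "e > 0" "e \<le> s\<^sup>2" "\<kappa>\<^sup>2 * H\<^sup>2 * e \<le> 1"
  proof -
    show "e > 0" "e \<le> s\<^sup>2" using H \<kappa> s by (auto simp: e_def)
    have "\<kappa>\<^sup>2 * H\<^sup>2 * e \<le> \<kappa>\<^sup>2 * H\<^sup>2 * (1 / (\<kappa>\<^sup>2 * H\<^sup>2))" by (intro mult_left_mono) (auto simp: e_def)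
    then show "\<kappa>\<^sup>2 * H\<^sup>2 * e \<le> 1" using H \<kappa> by simp
  qed
  have "\<forall>j. \<exists>\<phi>. test_fun UNIV \<phi> \<and> (\<forall>k. (LINT x|lborel. (partial k \<phi> x - wpartial UNIV k (a j) x)\<^sup>2) \<le> e) \<and>
     (\<integral>\<^sup>+x. indicator (ball 0 R) x * ennreal ((\<phi> x - a j x)\<^sup>2) \<partial>lborel) \<le> ennreal e"
    using Hdot1_approx[OF ha e(1)] by blast
  from choice[OF this] obtain \<phi> where \<phi>: "\<And>j. test_fun UNIV (\<phi> j)"
    "\<And>j k. (LINT x|lborel. (partial k (\<phi> j) x - wpartial UNIV k (a j) x)\<^sup>2) \<le> e"
    "\<And>j. (\<integral>\<^sup>+x. indicator (ball 0 R) x * ennreal ((\<phi> j x - a j x)\<^sup>2) \<partial>lborel) \<le> ennreal e"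
    by auto
  \<comment> \<open>Twice the squared gradient of A - F, which integrates to m2 by the curl
    identity, plus 2 e for each of the three directions.\<close>
  define G where "G = 2 * m2 + 6 * e"
  have grad: "(\<Sum>k\<in>UNIV. LINT x|lborel. (partial k (\<phi> j) x)\<^sup>2) \<le> G" for j
  proof -
    define p where "p k = wpartial UNIV k (a j)" for k
    have pL: "L2 UNIV (p k)" for k unfolding p_def by (rule Hdot1_grad(2)[OF ha])
    have ip: "integrable lborel (\<lambda>x. (p k x)\<^sup>2)" for k using pL by (auto simp: L2_UNIV)
    have id: "integrable lborel (\<lambda>x. (partial k (\<phi> j) x - p k x)\<^sup>2)" for k
      by (rule L2_diff_integrable(1)[OF test_fun_L2(2)[OF \<phi>(1)] pL])
    have "(\<Sum>k\<in>UNIV. LINT x|lborel. (partial k (\<phi> j) x)\<^sup>2) \<le> (\<Sum>k\<in>UNIV. 2 * e + 2 * (LINT x|lborel. (p k x)\<^sup>2))"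
    proof (rule sum_mono)
      fix k
      have "(LINT x|lborel. (partial k (\<phi> j) x)\<^sup>2) \<le> (LINT x|lborel. 2 * (partial k (\<phi> j) x - p k x)\<^sup>2 + 2 * (p k x)\<^sup>2)"
      proof (rule integral_mono)
        show "(partial k (\<phi> j) x)\<^sup>2 \<le> 2 * (partial k (\<phi> j) x - p k x)\<^sup>2 + 2 * (p k x)\<^sup>2" for x
          using sq_diff_le[of "partial k (\<phi> j) x" 0 "p k x"] by simp
      qed (use test_fun_integrable(4)[OF \<phi>(1)] ip id in auto)
      also have "\<dots> = 2 * (LINT x|lborel. (partial k (\<phi> j) x - p k x)\<^sup>2) + 2 * (LINT x|lborel. (p k x)\<^sup>2)"
        using ip id by simp
      also have "\<dots> \<le> 2 * e + 2 * (LINT x|lborel. (p k x)\<^sup>2)" using \<phi>(2)[of k j] by (simp add: p_def)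
      finally show "(LINT x|lborel. (partial k (\<phi> j) x)\<^sup>2) \<le> 2 * e + 2 * (LINT x|lborel. (p k x)\<^sup>2)" .
    qed
    also have "\<dots> = 6 * e + 2 * (\<Sum>k\<in>UNIV. LINT x|lborel. (p k x)\<^sup>2)" by (simp add: sum.distrib sum_distrib_left)
    also have "(\<Sum>k\<in>UNIV. LINT x|lborel. (p k x)\<^sup>2) \<le> (\<Sum>i\<in>UNIV. \<Sum>k\<in>UNIV. LINT x|lborel. (wpartial UNIV k (a i) x)\<^sup>2)"
      unfolding p_def by (rule member_le_sum[where f="\<lambda>i. \<Sum>k\<in>UNIV. LINT x|lborel. (wpartial UNIV k (a i) x)\<^sup>2"]) (auto intro!: sum_nonneg integral_nonneg_AE)
    also have "\<dots> = m2" using curl_grad_identity(2)[OF A] by (simp add: m2_def a_def[abs_def])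
    finally show ?thesis by (simp add: G_def)
  qed
  define d where "d = sqrt (H / \<kappa>)"
  have d: "d > 0" "d \<le> 1" and d2: "d\<^sup>2 = H / \<kappa>" using H \<kappa> by (auto simp: d_def)
  have ld: "ln (1 / d) = L" unfolding d_def L_def using H \<kappa> by (simp add: real_sqrt_divide)
  \<comment> \<open>The product is fixed by 2 pi c c' = \<kappa> H. The ratio c' / c = s balances
    the costs: G is of order s^2, so c^2 G and c'^2 |\<Omega>| are both of order \<kappa> H
    s.\<close>
  define c where "c = sqrt (\<kappa> * H / (2 * pi * s))"
  define c' where "c' = sqrt (\<kappa> * H * s / (2 * pi))"
  have c2: "c\<^sup>2 = \<kappa> * H / (2 * pi * s)" "c'\<^sup>2 = \<kappa> * H * s / (2 * pi)" using H \<kappa> s by (auto simp: c_def c'_def)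
  have cc: "2 * pi * (c * c') = \<kappa> * H"
  proof -
    have "c * c' = sqrt ((\<kappa> * H / (2 * pi))\<^sup>2)"
      unfolding c_def c'_def real_sqrt_mult[symmetric] using s by (simp add: power2_eq_square)
    then show ?thesis using H \<kappa> by simp
  qed
  define f where "f j = (\<lambda>x. - c * \<phi> j x)" for j
  define h where "h j = (\<lambda>x::R3. c' * x $ j)" for j
  define f' where "f' j = (\<lambda>k x. - c * partial k (\<phi> j) x)" for j
  define h' where "h' j = (\<lambda>k (x::R3). if k = j then c' else 0)" for j :: 3
  define Mb where "Mb = 2 * pi\<^sup>2 * (c\<^sup>2 * G + c'\<^sup>2 * X) * (2 / pi * L + 53) + 49 * \<kappa>\<^sup>2 * d\<^sup>2 * X + 1"
  have "\<forall>j. \<exists>p. (\<integral>\<^sup>+x. indicator \<Omega> x * ennreal ((\<Sum>k\<in>UNIV. (norm (latc d (f j) (h j) (f' j k) (h' j k) (fst p) (snd p) x))\<^sup>2) +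
        \<kappa>\<^sup>2 * (1 - (norm (latv d (f j) (h j) (fst p) (snd p) x))\<^sup>2)\<^sup>2) \<partial>lborel) \<le> ennreal Mb"
  proof
    fix j
    obtain \<alpha> \<beta> where I: "(\<integral>\<^sup>+x. indicator \<Omega> x * ennreal ((\<Sum>k\<in>UNIV. (norm (latc d (f j) (h j) (f' j k) (h' j k) \<alpha> \<beta> x))\<^sup>2) +
        \<kappa>\<^sup>2 * (1 - (norm (latv d (f j) (h j) \<alpha> \<beta> x))\<^sup>2)\<^sup>2) \<partial>lborel) \<le> ennreal Mb"
      using lattice_average[OF O d \<phi>(1)[of j] \<kappa> grad[of j], of c c' j] unfolding f_def h_def f'_def h'_def Mb_def ld X_def by blast
    show "\<exists>p. (\<integral>\<^sup>+x. indicator \<Omega> x * ennreal ((\<Sum>k\<in>UNIV. (norm (latc d (f j) (h j) (f' j k) (h' j k) (fst p) (snd p) x))\<^sup>2) +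
        \<kappa>\<^sup>2 * (1 - (norm (latv d (f j) (h j) (fst p) (snd p) x))\<^sup>2)\<^sup>2) \<partial>lborel) \<le> ennreal Mb"
      by (rule exI[of _ "(\<alpha>, \<beta>)"]) (use I in \<open>simp only: fst_conv snd_conv\<close>)
  qed
  from choice[OF this] obtain p where p: "\<And>j. (\<integral>\<^sup>+x. indicator \<Omega> x * ennreal ((\<Sum>k\<in>UNIV. (norm (latc d (f j) (h j) (f' j k) (h' j k) (fst (p j)) (snd (p j)) x))\<^sup>2) +
        \<kappa>\<^sup>2 * (1 - (norm (latv d (f j) (h j) (fst (p j)) (snd (p j)) x))\<^sup>2)\<^sup>2) \<partial>lborel) \<le> ennreal Mb" by auto
  define V where "V j = latv d (f j) (h j) (fst (p j)) (snd (p j))" for j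
  define W where "W j k = latc d (f j) (h j) (f' j k) (h' j k) (fst (p j)) (snd (p j))" for j k
  have Cf: "C1_dir k (f j) (f' j k)" for j k
    using C1_dir_mult_real[OF C1_dir_const[of k "-c"] test_fun_C1_dir[OF \<phi>(1)[of j]]] by (simp add: f_def f'_def)
  have Ch: "C1_dir k (h j) (h' j k)" for j k
    unfolding h_def h'_def by (rule C1_dir_coord)
  define V' where "V' j k x = W j k x + (2 * pi * f j x * h' j k x) *\<^sub>R (\<i> * V j x)" for j k x
  have CV: "C1_dir k (V j) (V' j k)" for j k
    unfolding V_def V'_def[abs_def] W_def by (rule C1_dir_latv[OF d(1) Cf Ch])
  have V1: "norm (V j x) \<le> 1" for j x unfolding V_def by (rule latv_norm(1)[OF d(1)])
  define v where "v x = V 1 x * (V 2 x * V 3 x)" for x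
  define v' where "v' k x = V 1 x * (V 2 x * V' 3 k x + V' 2 k x * V 3 x) + V' 1 k x * (V 2 x * V 3 x)" for k x
  have Cv: "C1_dir k v (v' k)" for k
    unfolding v_def[abs_def] v'_def[abs_def] by (intro C1_dir_mult CV)
  have v1: "norm (v x) \<le> 1" for x unfolding v_def norm_mult using V1 by (intro mult_le_one mult_nonneg_nonneg) auto
  \<comment> \<open>The connection forms of the three factors add up to - \<kappa> H times the
    approximating field; what remains are the covariant derivatives \<open>W\<close>, each
    multiplied by factors of modulus at most 1.\<close>
  have v'eq: "v' k x = W 1 k x * (V 2 x * V 3 x) + W 2 k x * (V 1 x * V 3 x) + W 3 k x * (V 1 x * V 2 x) - \<i> * complex_of_real (\<kappa> * H * \<phi> k x) * v x" for k x
  proof -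
    have "(\<Sum>j\<in>UNIV. 2 * pi * f j x * h' j k x) = - (\<kappa> * H * \<phi> k x)"
    proof -
      have "(\<Sum>j\<in>UNIV. 2 * pi * f j x * h' j k x) = (\<Sum>j\<in>UNIV. if k = j then 2 * pi * f j x * c' else 0)"
        by (intro sum.cong) (auto simp: h'_def)
      also have "\<dots> = - (2 * pi * (c * c')) * \<phi> k x" by (simp add: f_def)
      finally show ?thesis unfolding cc by simp
    qed
    then have "2 * pi * f 1 x * h' 1 k x + 2 * pi * f 2 x * h' 2 k x + 2 * pi * f 3 x * h' 3 k x = - (\<kappa> * H * \<phi> k x)"
      unfolding sum_3 .
    from arg_cong[OF this, of complex_of_real] have sm: "complex_of_real (2 * pi * f 1 x * h' 1 k x) + complex_of_real (2 * pi * f 2 x * h' 2 k x) + complex_of_real (2 * pi * f 3 x * h' 3 k x) = - complex_of_real (\<kappa> * H * \<phi> k x)"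
      by (simp only: of_real_add of_real_minus)
    have "v' k x = W 1 k x * (V 2 x * V 3 x) + W 2 k x * (V 1 x * V 3 x) + W 3 k x * (V 1 x * V 2 x) +
        (complex_of_real (2 * pi * f 1 x * h' 1 k x) + complex_of_real (2 * pi * f 2 x * h' 2 k x) + complex_of_real (2 * pi * f 3 x * h' 3 k x)) * (\<i> * v x)"
      unfolding v'_def V'_def v_def scaleR_conv_of_real by (simp add: algebra_simps del: of_real_mult)
    then show ?thesis unfolding sm by (simp add: algebra_simps del: of_real_mult)
  qed
  define \<xi> where "\<xi> x = v x * trunc (\<psi> x)" for x
  define g\<xi> where "g\<xi> k x = v x * dtrunc (\<psi> x) (g k x) + v' k x * trunc (\<psi> x)" for k x
  have wp\<xi>: "weak_partial \<Omega> k \<xi> (g\<xi> k)" for k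
    unfolding \<xi>_def[abs_def] g\<xi>_def[abs_def] by (rule weak_partial_mult_C1[OF weak_partial_trunc[OF g(1) O(1)] Cv O(1)])
  have Om [measurable]: "\<Omega> \<in> sets borel" using O by simp
  have L2\<psi>: "L2 \<Omega> \<psi>" using H1\<psi> by (simp add: H1_def)
  have H1\<xi>: "H1 \<Omega> \<xi>"
    unfolding \<xi>_def[abs_def] by (rule H1_mult_trunc[OF O g L2\<psi> Cv v1])
  define T where "T j x = (\<Sum>k\<in>UNIV. (norm (W j k x))\<^sup>2) + \<kappa>\<^sup>2 * (1 - (norm (V j x))\<^sup>2)\<^sup>2" for j x
  define Q where "Q x = (\<Sum>k\<in>UNIV. (\<phi> k x - a k x)\<^sup>2)" for x
  have T0: "T j x \<ge> 0" for j x unfolding T_def by (intro add_nonneg_nonneg sum_nonneg mult_nonneg_nonneg) auto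
  have Q0: "Q x \<ge> 0" for x unfolding Q_def by (intro sum_nonneg) auto
  have D0: "GL_density \<kappa> H g \<psi> A x \<ge> 0" for x unfolding GL_density_def by (intro add_nonneg_nonneg sum_nonneg mult_nonneg_nonneg) auto
  \<comment> \<open>Pointwise comparison of (\<open>\<xi>\<close>, F) with (\<open>\<psi>\<close>,
    A): \<open>T\<close> collects the costs of the three lattices and \<open>Q\<close> the error of
    approximating A - F.\<close>
  have dens: "GL_density \<kappa> H g\<xi> \<xi> Fmag x \<le> (1 + \<eta>) * GL_density \<kappa> H g \<psi> A x + (1 + 1 / \<eta>) * 24 * ((T 1 x + T 2 x + T 3 x) + \<kappa>\<^sup>2 * H\<^sup>2 * Q x)" for x
  proof -
    define t where "t = trunc (\<psi> x)"
    define D where "D k = g k x - \<i> * complex_of_real (\<kappa> * H * A x $ k) * \<psi> x" for k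
    define r where "r k = \<i> * complex_of_real (\<kappa> * H * (a k x - \<phi> k x)) * v x" for k
    have rn: "(norm (r k))\<^sup>2 \<le> \<kappa>\<^sup>2 * H\<^sup>2 * (\<phi> k x - a k x)\<^sup>2" for k
    proof -
      have "norm (r k) \<le> \<bar>\<kappa> * H * (a k x - \<phi> k x)\<bar> * 1"
        unfolding r_def norm_mult norm_of_real using v1 by (intro mult_mono) auto
      then have "(norm (r k))\<^sup>2 \<le> (\<bar>\<kappa> * H * (a k x - \<phi> k x)\<bar> * 1)\<^sup>2" by (intro power_mono) auto
      also have "\<dots> = \<kappa>\<^sup>2 * H\<^sup>2 * (\<phi> k x - a k x)\<^sup>2" by (simp add: power_mult_distrib power2_commute)
      finally show ?thesis .
    qed
    \<comment> \<open>The part \<kappa> H a of the potential inside \<open>D\<close> cancels against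
      the connection of v up to the approximation error \<open>r\<close>;
      \<open>dtrunc_gauge\<close> carries \<open>D\<close> through the truncation.\<close>
    have cov: "g\<xi> k x - \<i> * complex_of_real (\<kappa> * H * Fmag x $ k) * \<xi> x
      = v x * dtrunc (\<psi> x) (D k) + t * (W 1 k x * (V 2 x * V 3 x) + W 2 k x * (V 1 x * V 3 x) + W 3 k x * (V 1 x * V 2 x) + r k)" for k
    proof -
      have Aeq: "\<kappa> * H * A x $ k = \<kappa> * H * Fmag x $ k + \<kappa> * H * a k x" by (simp add: a_def algebra_simps)
      have req: "\<kappa> * H * (a k x - \<phi> k x) = \<kappa> * H * a k x - \<kappa> * H * \<phi> k x" by (simp add: algebra_simps)
      show ?thesis
        unfolding g\<xi>_def \<xi>_def v'eq D_def dtrunc_gauge r_def t_def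
        unfolding Aeq req of_real_add of_real_diff
        by (simp add: algebra_simps del: of_real_mult)
    qed
    have 1: "(cmod (g\<xi> k x - \<i> * complex_of_real (\<kappa> * H * Fmag x $ k) * \<xi> x))\<^sup>2 \<le> (1 + \<eta>) * (cmod (D k))\<^sup>2 +
       (1 + 1 / \<eta>) * (16 * ((norm (W 1 k x))\<^sup>2 + (norm (W 2 k x))\<^sup>2 + (norm (W 3 k x))\<^sup>2 + \<kappa>\<^sup>2 * H\<^sup>2 * (\<phi> k x - a k x)\<^sup>2))" for k
    proof -
      have "(cmod (g\<xi> k x - \<i> * complex_of_real (\<kappa> * H * Fmag x $ k) * \<xi> x))\<^sup>2 \<le> (1 + \<eta>) * (cmod (D k))\<^sup>2 +
       (1 + 1 / \<eta>) * (16 * ((norm (W 1 k x))\<^sup>2 + (norm (W 2 k x))\<^sup>2 + (norm (W 3 k x))\<^sup>2 + (norm (r k))\<^sup>2))"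
        unfolding cov
        by (rule covariant_sq_le[OF \<eta> v1 dtrunc_le]) (use V1 trunc_bounds(1) in \<open>auto simp: t_def norm_mult intro!: mult_le_one\<close>)
      also have "\<dots> \<le> (1 + \<eta>) * (cmod (D k))\<^sup>2 +
       (1 + 1 / \<eta>) * (16 * ((norm (W 1 k x))\<^sup>2 + (norm (W 2 k x))\<^sup>2 + (norm (W 3 k x))\<^sup>2 + \<kappa>\<^sup>2 * H\<^sup>2 * (\<phi> k x - a k x)\<^sup>2))"
        using rn[of k] \<eta> by (intro add_left_mono mult_left_mono) auto
      finally show ?thesis .
    qed
    define w where "w j = (norm (V j x))\<^sup>2" for j
    have w: "0 \<le> w j" "w j \<le> 1" for j using V1[of j x] by (auto simp: w_def power_le_one)
    have tt: "0 \<le> (norm t)\<^sup>2" "(norm t)\<^sup>2 \<le> 4" using power_mono[OF trunc_bounds(1)[of "\<psi> x"], of 2] by (auto simp: t_def)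
    have 2: "(1 - (cmod (\<xi> x))\<^sup>2)\<^sup>2 \<le> (1 + \<eta>) * (1 - (cmod (\<psi> x))\<^sup>2)\<^sup>2 + (1 + 1 / \<eta>) * (48 * ((1 - w 1)\<^sup>2 + (1 - w 2)\<^sup>2 + (1 - w 3)\<^sup>2))"
    proof -
      have "(cmod (\<xi> x))\<^sup>2 = w 1 * (w 2 * w 3) * (norm t)\<^sup>2" by (simp add: \<xi>_def v_def t_def w_def norm_mult power_mult_distrib)
      then have "(1 - (cmod (\<xi> x))\<^sup>2)\<^sup>2 \<le> (1 + \<eta>) * (1 - (norm t)\<^sup>2)\<^sup>2 + (1 + 1 / \<eta>) * (48 * ((1 - w 1)\<^sup>2 + (1 - w 2)\<^sup>2 + (1 - w 3)\<^sup>2))"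
        using potential_le[OF \<eta> w w w tt, of 1 2 3] by simp
      also have "\<dots> \<le> (1 + \<eta>) * (1 - (cmod (\<psi> x))\<^sup>2)\<^sup>2 + (1 + 1 / \<eta>) * (48 * ((1 - w 1)\<^sup>2 + (1 - w 2)\<^sup>2 + (1 - w 3)\<^sup>2))"
        using trunc_bounds(2)[of "\<psi> x"] \<eta> by (intro add_right_mono mult_left_mono) (auto simp: t_def)
      finally show ?thesis .
    qed
    have "GL_density \<kappa> H g\<xi> \<xi> Fmag x \<le> (\<Sum>k\<in>UNIV. (1 + \<eta>) * (cmod (D k))\<^sup>2 +
       (1 + 1 / \<eta>) * (16 * ((norm (W 1 k x))\<^sup>2 + (norm (W 2 k x))\<^sup>2 + (norm (W 3 k x))\<^sup>2 + \<kappa>\<^sup>2 * H\<^sup>2 * (\<phi> k x - a k x)\<^sup>2))) +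
      \<kappa>\<^sup>2 / 2 * ((1 + \<eta>) * (1 - (cmod (\<psi> x))\<^sup>2)\<^sup>2 + (1 + 1 / \<eta>) * (48 * ((1 - w 1)\<^sup>2 + (1 - w 2)\<^sup>2 + (1 - w 3)\<^sup>2)))"
      unfolding GL_density_def by (intro add_mono sum_mono 1 mult_left_mono 2) auto
    also have "\<dots> = (1 + \<eta>) * GL_density \<kappa> H g \<psi> A x + (1 + 1 / \<eta>) * (16 * ((\<Sum>k\<in>UNIV. (norm (W 1 k x))\<^sup>2) + (\<Sum>k\<in>UNIV. (norm (W 2 k x))\<^sup>2) + (\<Sum>k\<in>UNIV. (norm (W 3 k x))\<^sup>2) + \<kappa>\<^sup>2 * H\<^sup>2 * Q x)
        + 24 * (\<kappa>\<^sup>2 * ((1 - w 1)\<^sup>2 + (1 - w 2)\<^sup>2 + (1 - w 3)\<^sup>2)))"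
      unfolding GL_density_def D_def[symmetric] Q_def sum_3 by (simp add: algebra_simps)
    \<comment> \<open>Raising 16 to 24 = 48 / 2 gives the gradient and potential errors a common
      factor, so that they combine to \<open>T\<close>.\<close>
    also have "\<dots> \<le> (1 + \<eta>) * GL_density \<kappa> H g \<psi> A x + (1 + 1 / \<eta>) * (24 * ((\<Sum>k\<in>UNIV. (norm (W 1 k x))\<^sup>2) + (\<Sum>k\<in>UNIV. (norm (W 2 k x))\<^sup>2) + (\<Sum>k\<in>UNIV. (norm (W 3 k x))\<^sup>2) + \<kappa>\<^sup>2 * H\<^sup>2 * Q x)
        + 24 * (\<kappa>\<^sup>2 * ((1 - w 1)\<^sup>2 + (1 - w 2)\<^sup>2 + (1 - w 3)\<^sup>2)))"
      using \<eta> Q0 by (intro add_left_mono mult_left_mono add_right_mono mult_right_mono add_nonneg_nonneg sum_nonneg mult_nonneg_nonneg) auto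
    also have "\<dots> = (1 + \<eta>) * GL_density \<kappa> H g \<psi> A x + (1 + 1 / \<eta>) * 24 * ((T 1 x + T 2 x + T 3 x) + \<kappa>\<^sup>2 * H\<^sup>2 * Q x)"
      unfolding T_def w_def by (simp add: algebra_simps)
    finally show ?thesis .
  qed
  let ?E = "\<integral>\<^sup>+x. indicator \<Omega> x * ennreal (GL_density \<kappa> H g \<psi> A x) \<partial>lborel"
  let ?M = "\<kappa>\<^sup>2 * H\<^sup>2 * m2"
  let ?c = "X * \<kappa> * H * (L + 110)"
  have C0: "GL_C0 \<Omega> \<kappa> H = ?E + ennreal ?M" using minimizer_magnetic[OF O(1) min g(1)] by (simp add: m2_def)
  have ub: "GL_C0 \<Omega> \<kappa> H \<le> ennreal ?c" using GL_C0_le_lattice[OF O H] by (simp add: X_def L_def)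
  have c0: "?c \<ge> 0" using X0 L0 H \<kappa> by (intro mult_nonneg_nonneg) auto
  have Ec: "?E \<le> ennreal ?c" using order_trans[OF _ ub] unfolding C0 by (meson le_iff_add)
  \<comment> \<open>The upper bound makes the energy finite, so that it can be subtracted
    below.\<close>
  then obtain E where E: "?E = ennreal E" "E \<ge> 0" by (cases ?E) (auto simp: top_unique)
  have Ecr: "E \<le> ?c" using Ec c0 E by (simp add: ennreal_le_iff)
  have am: "(\<lambda>x. a k x) \<in> borel_measurable borel" for k
    using Hdot1_grad(1)[OF ha[of k], of 1] by (intro loc_int_measurable) (auto simp: weak_partial_def)
  have Fm: "(\<lambda>x. Fmag x $ k) \<in> borel_measurable borel" for k
    using C1_dir_Fmag[of 1 k] by (auto simp: C1_dir_def intro: borel_measurable_continuous_onI)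
  have Am: "(\<lambda>x. A x $ k) \<in> borel_measurable borel" for k
  proof -
    have "(\<lambda>x. a k x + Fmag x $ k) \<in> borel_measurable borel" using am[of k] Fm[of k] by measurable
    then show ?thesis by (simp add: a_def)
  qed
  note mE = GL_density_measurable[OF O(1) g(2) L2\<psi> Am, of \<kappa> H]
  have \<phi>m: "\<phi> k \<in> borel_measurable borel" for k using test_fun_L2(1)[OF \<phi>(1)] by (simp add: L2_UNIV)
  have Vm: "V j \<in> borel_measurable borel" for j using CV[where j=j] by (auto simp: C1_dir_def intro: borel_measurable_continuous_onI)
  have Wm: "W j k \<in> borel_measurable borel" for j k
  proof -
    have c1: "continuous_on UNIV (f j)" "continuous_on UNIV (h j)" "continuous_on UNIV (f' j k)" "continuous_on UNIV (h' j k)"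
      using Cf Ch by (auto simp: C1_dir_def)
    have c2: "continuous_on UNIV (\<lambda>x. f j x + fst (p j))" "continuous_on UNIV (\<lambda>x. h j x + snd (p j))" using c1 by (auto intro!: continuous_intros)
    have "continuous_on UNIV (W j k)" unfolding W_def latc_def[abs_def] by (intro continuous_intros continuous_lat[OF d(1) c2] c1)
    then show ?thesis by (rule borel_measurable_continuous_onI)
  qed
  note [measurable] = mE \<phi>m Vm Wm am
  have [measurable]: "(\<lambda>x. \<phi> k x - a k x) \<in> borel_measurable borel" for k by (intro borel_measurable_diff \<phi>m am)
  have [measurable]: "ball (0::R3) R \<in> sets borel" by simp
  have Tm [measurable]: "T j \<in> borel_measurable borel" for j unfolding T_def[abs_def] by measurable
  have Qi: "(\<integral>\<^sup>+x. indicator \<Omega> x * ennreal (Q x) \<partial>lborel) \<le> ennreal (3 * e)"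
  proof -
    have "(\<integral>\<^sup>+x. indicator \<Omega> x * ennreal (Q x) \<partial>lborel) \<le> (\<integral>\<^sup>+x. (\<Sum>k\<in>UNIV. indicator (ball 0 R) x * ennreal ((\<phi> k x - a k x)\<^sup>2)) \<partial>lborel)"
    proof (rule nn_integral_mono)
      fix x
      have "ennreal (Q x) = (\<Sum>k\<in>UNIV. ennreal ((\<phi> k x - a k x)\<^sup>2))" unfolding Q_def by (rule sum_ennreal[symmetric]) auto
      then show "indicator \<Omega> x * ennreal (Q x) \<le> (\<Sum>k\<in>UNIV. indicator (ball 0 R) x * ennreal ((\<phi> k x - a k x)\<^sup>2))"
        using R by (cases "x \<in> \<Omega>") (auto simp: sum_distrib_left[symmetric])
    qed
    also have "\<dots> = (\<Sum>k\<in>UNIV. \<integral>\<^sup>+x. indicator (ball 0 R) x * ennreal ((\<phi> k x - a k x)\<^sup>2) \<partial>lborel)"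
      by (rule nn_integral_sum) measurable
    also have "\<dots> \<le> (\<Sum>k\<in>(UNIV::3 set). ennreal e)" by (intro sum_mono \<phi>(3))
    also have "\<dots> = ennreal (3 * e)" using e by (simp add: ennreal_mult)
    finally show ?thesis .
  qed
  have Ti: "(\<integral>\<^sup>+x. indicator \<Omega> x * ennreal (T j x) \<partial>lborel) \<le> ennreal Mb" for j
    using p[of j] unfolding T_def V_def W_def .
  have Mb0: "Mb \<ge> 0"
  proof -
    have "m2 \<ge> 0" unfolding m2_def by (intro integral_nonneg_AE) auto
    then have "G \<ge> 0" using e by (simp add: G_def)
    then show ?thesis unfolding Mb_def using X0 L0 by (intro add_nonneg_nonneg mult_nonneg_nonneg) auto
  qed
  define K where "K = (1 + 1 / \<eta>) * 24 * (3 * Mb + \<kappa>\<^sup>2 * H\<^sup>2 * (3 * e))"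
  define q where "q = (1 + 1 / \<eta>) * 24"
  have q0: "q \<ge> 0" using \<eta> by (simp add: q_def)
  have "GL_C0 \<Omega> \<kappa> H \<le> GL_energy \<Omega> \<kappa> H \<xi> Fmag" by (rule GL_C0_le[OF H1\<xi> HdotF_Fmag])
  also have "\<dots> = (\<integral>\<^sup>+x. indicator \<Omega> x * ennreal (GL_density \<kappa> H g\<xi> \<xi> Fmag x) \<partial>lborel)"
    by (rule GL_energy_Fmag[OF O(1) wp\<xi>])
  also have "\<dots> \<le> (\<integral>\<^sup>+x. ennreal (1 + \<eta>) * (indicator \<Omega> x * ennreal (GL_density \<kappa> H g \<psi> A x)) +
      ennreal q * ((indicator \<Omega> x * ennreal (T 1 x) + indicator \<Omega> x * ennreal (T 2 x) + indicator \<Omega> x * ennreal (T 3 x)) + ennreal (\<kappa>\<^sup>2 * H\<^sup>2) * (indicator \<Omega> x * ennreal (Q x))) \<partial>lborel)"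
  proof (rule nn_integral_mono)
    fix x
    have "ennreal (GL_density \<kappa> H g\<xi> \<xi> Fmag x) \<le> ennreal ((1 + \<eta>) * GL_density \<kappa> H g \<psi> A x + q * ((T 1 x + T 2 x + T 3 x) + \<kappa>\<^sup>2 * H\<^sup>2 * Q x))"
      using dens[of x] unfolding q_def by (rule ennreal_leI)
    also have "\<dots> = ennreal (1 + \<eta>) * ennreal (GL_density \<kappa> H g \<psi> A x) + ennreal q * ((ennreal (T 1 x) + ennreal (T 2 x) + ennreal (T 3 x)) + ennreal (\<kappa>\<^sup>2 * H\<^sup>2) * ennreal (Q x))"
      using \<eta> q0 T0 Q0 D0 by (simp add: ennreal_plus ennreal_mult add_nonneg_nonneg mult_nonneg_nonneg)
    finally have le: "ennreal (GL_density \<kappa> H g\<xi> \<xi> Fmag x) \<le> \<dots>" .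
    show "indicator \<Omega> x * ennreal (GL_density \<kappa> H g\<xi> \<xi> Fmag x) \<le> ennreal (1 + \<eta>) * (indicator \<Omega> x * ennreal (GL_density \<kappa> H g \<psi> A x)) +
      ennreal q * ((indicator \<Omega> x * ennreal (T 1 x) + indicator \<Omega> x * ennreal (T 2 x) + indicator \<Omega> x * ennreal (T 3 x)) + ennreal (\<kappa>\<^sup>2 * H\<^sup>2) * (indicator \<Omega> x * ennreal (Q x)))"
      using le by (cases "x \<in> \<Omega>") auto
  qed
  also have "\<dots> = ennreal (1 + \<eta>) * ?E + ennreal q * (((\<integral>\<^sup>+x. indicator \<Omega> x * ennreal (T 1 x) \<partial>lborel) + (\<integral>\<^sup>+x. indicator \<Omega> x * ennreal (T 2 x) \<partial>lborel) + (\<integral>\<^sup>+x. indicator \<Omega> x * ennreal (T 3 x) \<partial>lborel))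
     + ennreal (\<kappa>\<^sup>2 * H\<^sup>2) * (\<integral>\<^sup>+x. indicator \<Omega> x * ennreal (Q x) \<partial>lborel))"
  proof -
    have [measurable]: "Q \<in> borel_measurable borel" unfolding Q_def[abs_def] by measurable
    show ?thesis by (simp add: nn_integral_add nn_integral_cmult)
  qed
  also have "\<dots> \<le> ennreal (1 + \<eta>) * ennreal E + ennreal q * ((ennreal Mb + ennreal Mb + ennreal Mb) + ennreal (\<kappa>\<^sup>2 * H\<^sup>2) * ennreal (3 * e))"
    unfolding E(1)[symmetric] using Ti Qi by (intro add_mono mult_left_mono order_refl) auto
  also have "\<dots> = ennreal ((1 + \<eta>) * E + q * ((Mb + Mb + Mb) + \<kappa>\<^sup>2 * H\<^sup>2 * (3 * e)))"
    using \<eta> q0 Mb0 e(1) E(2) by (simp add: ennreal_plus[symmetric] ennreal_mult[symmetric] del: ennreal_plus)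
  also have "(1 + \<eta>) * E + q * ((Mb + Mb + Mb) + \<kappa>\<^sup>2 * H\<^sup>2 * (3 * e)) = (1 + \<eta>) * E + K" by (simp add: K_def q_def)
  \<comment> \<open>The competitor has no magnetic energy. Comparing it with the minimum therefore
    bounds M by the Young loss \<open>\<eta>\<close> E and the cost K.\<close>
  finally have "ennreal E + ennreal ?M \<le> ennreal ((1 + \<eta>) * E + K)" unfolding C0 E(1) .
  moreover have "?M \<ge> 0" unfolding m2_def by (intro mult_nonneg_nonneg integral_nonneg_AE) auto
  moreover have "K \<ge> 0" unfolding K_def using \<eta> Mb0 e by (intro mult_nonneg_nonneg add_nonneg_nonneg) auto
  ultimately have "E + ?M \<le> (1 + \<eta>) * E + K"
    using E(2) \<eta> by (simp add: ennreal_plus[symmetric] ennreal_le_iff del: ennreal_plus)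
  then have "?M \<le> \<eta> * E + K" by (simp add: algebra_simps)
  also have "\<eta> * E \<le> \<eta> * ?c" using Ecr \<eta> by (intro mult_left_mono) auto
  finally have fin: "?M \<le> \<eta> * ?c + K" by simp
  \<comment> \<open>Since G <= (2 X + 6) s^2, the two gradient costs together are \<kappa> H s (3 X
    + 6) / (2 pi); the constant 170 replaces 53 pi.\<close>
  have Mble: "Mb \<le> \<kappa> * H * (s * (3 * X + 6) * (2 * L + 170) + 49 * X) + 1"
  proof -
    have "G \<le> (2 * X + 6) * s\<^sup>2" using m2 e(2) by (simp add: G_def algebra_simps)
    then have "c\<^sup>2 * G \<le> \<kappa> * H / (2 * pi * s) * ((2 * X + 6) * s\<^sup>2)"
      unfolding c2 using H \<kappa> s by (intro mult_left_mono) auto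
    also have "\<dots> = \<kappa> * H * s * (2 * X + 6) / (2 * pi)" using s by (simp add: power2_eq_square)
    finally have "c\<^sup>2 * G + c'\<^sup>2 * X \<le> \<kappa> * H * s * (2 * X + 6) / (2 * pi) + \<kappa> * H * s / (2 * pi) * X" unfolding c2 by simp
    also have "\<dots> = \<kappa> * H * s * (3 * X + 6) / (2 * pi)" by (simp add: add_divide_distrib[symmetric] algebra_simps)
    finally have cG: "c\<^sup>2 * G + c'\<^sup>2 * X \<le> \<kappa> * H * s * (3 * X + 6) / (2 * pi)" .
    have "2 * pi\<^sup>2 * (c\<^sup>2 * G + c'\<^sup>2 * X) * (2 / pi * L + 53) \<le> 2 * pi\<^sup>2 * (\<kappa> * H * s * (3 * X + 6) / (2 * pi)) * (2 / pi * L + 53)"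
      using cG L0 by (intro mult_right_mono mult_left_mono) auto
    also have "\<dots> = \<kappa> * H * (s * (3 * X + 6) * (pi * (2 / pi * L + 53)))" by (simp add: power2_eq_square)
    also have "pi * (2 / pi * L + 53) = 2 * L + 53 * pi" by (simp add: distrib_left)
    also have "\<kappa> * H * (s * (3 * X + 6) * (2 * L + 53 * pi)) \<le> \<kappa> * H * (s * (3 * X + 6) * (2 * L + 170))"
      using H \<kappa> s X0 pi_approx by (intro mult_left_mono add_left_mono mult_nonneg_nonneg) auto
    finally have 1: "2 * pi\<^sup>2 * (c\<^sup>2 * G + c'\<^sup>2 * X) * (2 / pi * L + 53) \<le> \<kappa> * H * (s * (3 * X + 6) * (2 * L + 170))" .
    have 2: "49 * \<kappa>\<^sup>2 * d\<^sup>2 * X = \<kappa> * H * (49 * X)" unfolding d2 using \<kappa> by (simp add: power2_eq_square)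
    show ?thesis unfolding Mb_def 2 distrib_left[of "\<kappa> * H"] using 1 by simp
  qed
  have "K \<le> (1 + 1 / \<eta>) * 24 * (3 * (\<kappa> * H * (s * (3 * X + 6) * (2 * L + 170) + 49 * X) + 1) + 3 * 1)"
    unfolding K_def using Mble e(3) \<eta> by (intro mult_left_mono add_mono) auto
  also have "\<dots> = 24 * (1 + 1 / \<eta>) * (3 * (\<kappa> * H) * (s * (3 * X + 6) * (2 * L + 170) + 49 * X) + 6)" by (simp add: algebra_simps)
  finally show ?thesis using fin by linarith
qed

section \<open>Asymptotics\<close>

text \<open>H << \<kappa> makes ln (sqrt (\<kappa> / H)) unbounded, and ln \<kappa> / \<kappa> << H
  makes \<kappa> H grow faster than ln \<kappa>. As soon as \<kappa> H >= 1 one has \<kappa> / H <=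
  \<kappa>^2, so \<kappa> H also outgrows ln (sqrt (\<kappa> / H)).\<close>

lemma field_asymptotics:
  fixes H :: "real \<Rightarrow> real"
  assumes pos: "\<forall>\<kappa>>0. H \<kappa> > 0" and lower: "(\<lambda>\<kappa>. ln \<kappa> / \<kappa>) \<in> o(H)" and upper: "H \<in> o(\<lambda>\<kappa>. \<kappa>)"
  shows "eventually (\<lambda>\<kappa>. 0 < H \<kappa> \<and> H \<kappa> \<le> \<kappa>) at_top"
    and "eventually (\<lambda>\<kappa>. ln (sqrt (\<kappa> / H \<kappa>)) \<ge> B) at_top"
    and "c > 0 \<Longrightarrow> eventually (\<lambda>\<kappa>. 1 \<le> c * (\<kappa> * H \<kappa>) \<and> ln (sqrt (\<kappa> / H \<kappa>)) \<le> c * (\<kappa> * H \<kappa>)) at_top"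
proof -
  have small: "eventually (\<lambda>\<kappa>. H \<kappa> \<le> e * \<kappa>) at_top" if "e > 0" for e
    using landau_o.smallD[OF upper that] eventually_gt_at_top[of 0] by eventually_elim (use pos in auto)
  show "eventually (\<lambda>\<kappa>. 0 < H \<kappa> \<and> H \<kappa> \<le> \<kappa>) at_top"
    using small[of 1, simplified] eventually_gt_at_top[of 0] by eventually_elim (use pos in auto)
  show "eventually (\<lambda>\<kappa>. ln (sqrt (\<kappa> / H \<kappa>)) \<ge> B) at_top"
    using small[of "exp (- 2 * B)", simplified] eventually_gt_at_top[of 0]
  proof eventually_elim
    case (elim \<kappa>)
    then have H: "H \<kappa> > 0" using pos by simp
    have "exp (2 * B) * H \<kappa> \<le> exp (2 * B) * (exp (- (2 * B)) * \<kappa>)" using elim by (intro mult_left_mono) auto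
    then have "exp (2 * B) \<le> \<kappa> / H \<kappa>" using H by (simp add: exp_minus field_simps)
    then have "2 * B \<le> ln (\<kappa> / H \<kappa>)" using H elim by (simp add: ln_ge_iff)
    then show ?case using H elim by (simp add: ln_sqrt)
  qed
  assume c: "c > 0"
  have large: "eventually (\<lambda>\<kappa>. ln \<kappa> \<le> e * (\<kappa> * H \<kappa>)) at_top" if "e > 0" for e
    using landau_o.smallD[OF lower that] eventually_gt_at_top[of 1]
  proof eventually_elim
    case (elim \<kappa>)
    then have "H \<kappa> > 0" using pos by simp
    then have "ln \<kappa> / \<kappa> \<le> e * H \<kappa>" using elim by simp
    then show ?case using elim by (simp add: field_simps)
  qed
  show "eventually (\<lambda>\<kappa>. 1 \<le> c * (\<kappa> * H \<kappa>) \<and> ln (sqrt (\<kappa> / H \<kappa>)) \<le> c * (\<kappa> * H \<kappa>)) at_top"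
    using large[OF c] large[OF zero_less_one] eventually_ge_at_top[of "exp 1"]
  proof eventually_elim
    case (elim \<kappa>)
    then have \<kappa>: "\<kappa> > 0" using exp_gt_zero[of 1] by linarith
    then have H: "H \<kappa> > 0" using pos by simp
    have 1: "1 \<le> ln \<kappa>" using \<kappa> elim(3) by (simp add: ln_ge_iff)
    then have "1 \<le> \<kappa> * H \<kappa>" using elim(2) by linarith
    then have "\<kappa> / H \<kappa> \<le> \<kappa>\<^sup>2" using \<kappa> H by (simp add: field_simps power2_eq_square)
    then have "sqrt (\<kappa> / H \<kappa>) \<le> \<kappa>" using \<kappa> by (intro real_le_lsqrt) auto
    then have "ln (sqrt (\<kappa> / H \<kappa>)) \<le> ln \<kappa>" using \<kappa> H by simp
    then show ?case using elim(1) 1 by linarith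
  qed
qed

text \<open>The budget 4 X^2 q L is split into halves. One half covers the Young loss with weight
  \<open>\<eta>\<close> = X, because L >= 110; \<open>\<epsilon>\<close> is defined so that the
  other half covers the cost of the lattices.\<close>

lemma small_remainder:
  fixes X s L q \<epsilon> :: real
  assumes X: "X > 0" and s: "0 < s" "s \<le> \<epsilon>" and L: "L \<ge> 110" "49 * X \<le> \<epsilon> * L" "6 \<le> \<epsilon> * L" and q: "q \<ge> 1"
    and \<epsilon>: "\<epsilon> = 2 * X\<^sup>2 / (24 * (1 + 1 / X) * (36 * X + 76))"
  shows "X * (X * q * (L + 110)) + 24 * (1 + 1 / X) * (3 * q * (s * (3 * X + 6) * (2 * L + 170) + 49 * X) + 6) \<le> 4 * X\<^sup>2 * q * L"
proof -
  define P where "P = 24 * (1 + 1 / X)"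
  have P: "P > 0" using X by (simp add: P_def add_pos_pos)
  have e0: "\<epsilon> > 0" using s by simp
  have \<epsilon>P: "P * \<epsilon> * (36 * X + 76) = 2 * X\<^sup>2" unfolding \<epsilon> P_def[symmetric] using P X by simp
  have "s * (3 * X + 6) * (2 * L + 170) \<le> \<epsilon> * (3 * X + 6) * (4 * L)"
    using s X L e0 by (intro mult_mono mult_right_mono) auto
  then have "s * (3 * X + 6) * (2 * L + 170) + 49 * X \<le> \<epsilon> * (3 * X + 6) * (4 * L) + \<epsilon> * L" using L by linarith
  then have "3 * q * (s * (3 * X + 6) * (2 * L + 170) + 49 * X) \<le> 3 * q * (\<epsilon> * (3 * X + 6) * (4 * L) + \<epsilon> * L)"
    using q by (intro mult_left_mono) auto
  moreover have "6 \<le> q * (\<epsilon> * L)" using mult_mono[of 1 q 6 "\<epsilon> * L"] q L by simp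
  \<comment> \<open>36 X + 76 = 3 * 4 * (3 X + 6) + 3 + 1.\<close>
  ultimately have "3 * q * (s * (3 * X + 6) * (2 * L + 170) + 49 * X) + 6 \<le> q * L * (\<epsilon> * (36 * X + 76))"
    by (simp add: algebra_simps)
  then have "P * (3 * q * (s * (3 * X + 6) * (2 * L + 170) + 49 * X) + 6) \<le> P * (q * L * (\<epsilon> * (36 * X + 76)))"
    using P by (intro mult_left_mono) auto
  also have "\<dots> = q * L * (P * \<epsilon> * (36 * X + 76))" by (simp add: mult_ac)
  also have "\<dots> = 2 * X\<^sup>2 * q * L" unfolding \<epsilon>P by (simp add: mult_ac)
  finally have 1: "P * (3 * q * (s * (3 * X + 6) * (2 * L + 170) + 49 * X) + 6) \<le> 2 * X\<^sup>2 * q * L" .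
  have "X * (X * q * (L + 110)) \<le> X * (X * q * (2 * L))" using X q L by (intro mult_left_mono) auto
  then show ?thesis using 1 unfolding P_def by (simp add: power2_eq_square mult_ac)
qed

theorem theorem3p1:
  fixes \<Omega> :: "R3 set" and H :: "real \<Rightarrow> real"
  assumes "open \<Omega>" and "bounded \<Omega>" and "smooth_boundary \<Omega>"
    and "\<forall>\<kappa>>0. H \<kappa> > 0"
    and "(\<lambda>\<kappa>. ln \<kappa> / \<kappa>) \<in> o(H)" and "H \<in> o(\<lambda>\<kappa>. \<kappa>)"
  shows "(\<forall>\<epsilon>>0. eventually (\<lambda>\<kappa>. GL_C0 \<Omega> \<kappa> (H \<kappa>)
            \<le> ennreal ((1 + \<epsilon>) * (measure lborel \<Omega> * \<kappa> * H \<kappa> * ln (sqrt (\<kappa> / H \<kappa>))))) at_top)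
       \<and> (\<exists>\<kappa>0. \<forall>\<kappa>\<ge>\<kappa>0. \<forall>\<psi> A. GL_minimizer \<Omega> \<kappa> (H \<kappa>) \<psi> A \<longrightarrow>
            sqrt (LINT x|lborel. (norm (wcurl (\<lambda>y. A y - Fmag y) x))\<^sup>2)
              \<le> 2 * measure lborel \<Omega> / sqrt (\<kappa> * H \<kappa>) * sqrt (ln (sqrt (\<kappa> / H \<kappa>))))"
proof (intro conjI allI impI)
  note asym = field_asymptotics[OF assms(4-6)]
  fix \<epsilon> :: real assume \<epsilon>: "\<epsilon> > 0"
  show "eventually (\<lambda>\<kappa>. GL_C0 \<Omega> \<kappa> (H \<kappa>)
            \<le> ennreal ((1 + \<epsilon>) * (measure lborel \<Omega> * \<kappa> * H \<kappa> * ln (sqrt (\<kappa> / H \<kappa>))))) at_top"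
    \<comment> \<open>Once \<open>\<epsilon>\<close> L >= 110, the additive constant of the lattice
      bound is absorbed.\<close>
    using asym(1) asym(2)[of "110 / \<epsilon>"]
  proof eventually_elim
    case (elim \<kappa>)
    have "ln (sqrt (\<kappa> / H \<kappa>)) + 110 \<le> (1 + \<epsilon>) * ln (sqrt (\<kappa> / H \<kappa>))"
      using elim(2) \<epsilon> by (simp add: field_simps)
    then have "measure lborel \<Omega> * \<kappa> * H \<kappa> * (ln (sqrt (\<kappa> / H \<kappa>)) + 110) \<le> measure lborel \<Omega> * \<kappa> * H \<kappa> * ((1 + \<epsilon>) * ln (sqrt (\<kappa> / H \<kappa>)))"
      using elim by (intro mult_left_mono mult_nonneg_nonneg) auto
    also have "\<dots> = (1 + \<epsilon>) * (measure lborel \<Omega> * \<kappa> * H \<kappa> * ln (sqrt (\<kappa> / H \<kappa>)))" by (simp only: mult_ac)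
    finally show ?case
      using elim by (intro order_trans[OF GL_C0_le_lattice[OF assms(1,2)] ennreal_leI]) auto
  qed
next
  note asym = field_asymptotics[OF assms(4-6)]
  define X where "X = measure lborel \<Omega>"
  \<comment> \<open>The bound on s under which the remainder fits into half of the budget; the value
    1 for X = 0 only keeps \<open>\<epsilon>\<close> positive.\<close>
  define \<epsilon> where "\<epsilon> = (if X = 0 then 1 else 2 * X\<^sup>2 / (24 * (1 + 1 / X) * (36 * X + 76)))"
  have X0: "X \<ge> 0" by (simp add: X_def)
  have \<epsilon>: "\<epsilon> > 0" using X0 by (auto simp: \<epsilon>_def intro!: divide_pos_pos mult_pos_pos add_pos_pos)
  \<comment> \<open>With 220 the sum L + 110 stays below \<open>\<epsilon>\<close> squared times
    \<kappa> H, which gives s <= \<open>\<epsilon>\<close>; the minimum with 1 ensures \<kappa> H >=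
    1.\<close>
  have c: "min 1 (\<epsilon>\<^sup>2 / 220) > 0" using \<epsilon> by simp
  have "eventually (\<lambda>\<kappa>. \<forall>\<psi> A. GL_minimizer \<Omega> \<kappa> (H \<kappa>) \<psi> A \<longrightarrow>
            sqrt (LINT x|lborel. (norm (wcurl (\<lambda>y. A y - Fmag y) x))\<^sup>2)
              \<le> 2 * X / sqrt (\<kappa> * H \<kappa>) * sqrt (ln (sqrt (\<kappa> / H \<kappa>)))) at_top"
    using asym(1) asym(2)[of "max 110 (max (49 * X / \<epsilon>) (6 / \<epsilon>))"] asym(3)[OF c]
  proof eventually_elim
    case (elim \<kappa>)
    define L where "L = ln (sqrt (\<kappa> / H \<kappa>))"
    define q where "q = \<kappa> * H \<kappa>"
    have H: "0 < H \<kappa>" "H \<kappa> \<le> \<kappa>" and \<kappa>: "\<kappa> > 0" using elim by auto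
    have q0: "q > 0" using H \<kappa> by (simp add: q_def)
    have L: "L \<ge> 110" "49 * X \<le> \<epsilon> * L" "6 \<le> \<epsilon> * L" using elim(2) \<epsilon> unfolding L_def[symmetric] by (auto simp: field_simps)
    have q: "1 \<le> q" "220 \<le> \<epsilon>\<^sup>2 * q" "220 * L \<le> \<epsilon>\<^sup>2 * q"
    proof -
      have m: "min 1 (\<epsilon>\<^sup>2 / 220) * q \<le> 1 * q" "min 1 (\<epsilon>\<^sup>2 / 220) * q \<le> \<epsilon>\<^sup>2 / 220 * q"
        using q0 by (intro mult_right_mono; simp)+
      have "1 \<le> min 1 (\<epsilon>\<^sup>2 / 220) * q" "L \<le> min 1 (\<epsilon>\<^sup>2 / 220) * q" using elim(3) unfolding L_def q_def by auto
      then show "1 \<le> q" "220 \<le> \<epsilon>\<^sup>2 * q" "220 * L \<le> \<epsilon>\<^sup>2 * q" using m by linarith+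
    qed
    show ?case
    proof (intro allI impI)
      fix \<psi> A assume min: "GL_minimizer \<Omega> \<kappa> (H \<kappa>) \<psi> A"
      define m2 where "m2 = (LINT x|lborel. (norm (wcurl (\<lambda>y. A y - Fmag y) x))\<^sup>2)"
      have le1: "q\<^sup>2 * m2 \<le> X * q * (L + 110)"
        using minimizer_magnetic_le[OF assms(1,2) H min] by (simp add: q_def m2_def X_def L_def power_mult_distrib mult_ac)
      have "q\<^sup>2 * m2 \<le> 4 * X\<^sup>2 * q * L"
      \<comment> \<open>The weight \<open>\<eta>\<close> = X has to be positive; for X = 0 the first
        magnetic estimate already has the right-hand side 0.\<close>
      proof (cases "X = 0")
        case True
        then show ?thesis using le1 by simp
      next
        case False
        then have Xp: "X > 0" using X0 by simp
        \<comment> \<open>With this s the first magnetic estimate takes the form m2 <= X s^2 that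
          the competitor bound expects.\<close>
        define s where "s = sqrt ((L + 110) / q)"
        have s2: "s\<^sup>2 = (L + 110) / q" and s0: "s > 0" using q0 L by (auto simp: s_def)
        have "(L + 110) / q \<le> \<epsilon>\<^sup>2" using q q0 L by (simp add: field_simps)
        then have s\<epsilon>: "s \<le> \<epsilon>" unfolding s_def using \<epsilon> by (intro real_le_lsqrt) auto
        have "m2 \<le> X * s\<^sup>2"
        proof -
          have "q * (q * m2) \<le> q * (X * (L + 110))" using le1 by (simp add: power2_eq_square mult_ac)
          then have "q * m2 \<le> X * (L + 110)" unfolding mult_le_cancel_left_pos[OF q0] .
          then show ?thesis unfolding s2 using q0 by (simp add: pos_le_divide_eq mult.commute)
        qed
        then have "q\<^sup>2 * m2 \<le> X * (X * q * (L + 110)) + 24 * (1 + 1 / X) * (3 * q * (s * (3 * X + 6) * (2 * L + 170) + 49 * X) + 6)"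
          using competitor_bound[OF assms(1,2) H min Xp s0] by (simp add: q_def m2_def X_def L_def power_mult_distrib mult.assoc)
        also have "\<dots> \<le> 4 * X\<^sup>2 * q * L"
          using Xp by (intro small_remainder[OF Xp s0 s\<epsilon> L q(1)]) (simp add: \<epsilon>_def)
        finally show ?thesis .
      qed
      then have "q * (q * m2) \<le> q * (4 * X\<^sup>2 * L)" by (simp add: power2_eq_square mult_ac)
      then have "q * m2 \<le> 4 * X\<^sup>2 * L" unfolding mult_le_cancel_left_pos[OF q0] .
      then have "m2 \<le> (2 * X)\<^sup>2 * L / q" using q0 by (simp add: pos_le_divide_eq power_mult_distrib mult.commute)
      then have "sqrt m2 \<le> sqrt ((2 * X)\<^sup>2 * L / q)" by simp
      also have "\<dots> = 2 * X / sqrt q * sqrt L" using X0 by (simp add: real_sqrt_mult real_sqrt_divide)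
      finally show "sqrt (LINT x|lborel. (norm (wcurl (\<lambda>y. A y - Fmag y) x))\<^sup>2)
              \<le> 2 * X / sqrt (\<kappa> * H \<kappa>) * sqrt (ln (sqrt (\<kappa> / H \<kappa>)))"
        unfolding m2_def q_def L_def .
    qed
  qed
  then show "\<exists>\<kappa>0. \<forall>\<kappa>\<ge>\<kappa>0. \<forall>\<psi> A. GL_minimizer \<Omega> \<kappa> (H \<kappa>) \<psi> A \<longrightarrow>
            sqrt (LINT x|lborel. (norm (wcurl (\<lambda>y. A y - Fmag y) x))\<^sup>2)
              \<le> 2 * measure lborel \<Omega> / sqrt (\<kappa> * H \<kappa>) * sqrt (ln (sqrt (\<kappa> / H \<kappa>)))"
    unfolding X_def eventually_at_top_linorder .
qed

end
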